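(* If $\sigma\in\mathcal{D}^{3,3,10}$ is a general element, then the Peskine sixfold $X_1^\sigma$ is rational.
   Context: Work over $\mathbb{C}$; $V_i$ and $U_i$ denote vector spaces of dimension $i$, and $\mathbf{P}(V)$ is the projective space of lines in $V$. Let $V_{10}$ be a $10$-dimensional vector space. Define $$\mathcal{D}^{3,3,10}=\{\sigma\in\wedge^3V_{10}^\vee \mid \exists\, V_3\subset V_{10}\text{ such that }\sigma(V_3,V_3,V_{10})=0\},$$ which is a divisor in $\wedge^3V_{10}^\vee$. For $\sigma\in\wedge^3V_{10}^\vee$ put $$X_1^\sigma=\{[U_1]\in\mathbf{P}(V_{10})\mid \operatorname{rank}(\sigma(U_1,V_{10},V_{10}))\le 6\},$$ where $\sigma(U_1,V_{10},V_{10})\in U_1^\vee\otimes\wedge^2(V_{10}/U_1)^\vee$ is viewed as a $9\times 9$ skew-symmetric matrix. "General" means belonging to a suitable dense Zariski-open subset. *)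

theory Defs
  imports "HOL-Analysis.Analysis"
begin

section \<open>Polynomial functions and projective space\<close>

text \<open>The complex algebra of functions generated by \<open>G\<close>. Over the infinite field of complex
  numbers, polynomials may be identified with polynomial functions.\<close>

inductive_set poly_functions :: "('a \<Rightarrow> complex) set \<Rightarrow> ('a \<Rightarrow> complex) set"
  for G :: "('a \<Rightarrow> complex) set" where
  gen: "g \<in> G \<Longrightarrow> g \<in> poly_functions G"
| const: "(\<lambda>_. c) \<in> poly_functions G"
| add: "f \<in> poly_functions G \<Longrightarrow> g \<in> poly_functions G \<Longrightarrow> (\<lambda>x. f x + g x) \<in> poly_functions G"
| mult: "f \<in> poly_functions G \<Longrightarrow> g \<in> poly_functions G \<Longrightarrow> (\<lambda>x. f x * g x) \<in> poly_functions G"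

definition homogeneous_form :: "nat \<Rightarrow> (complex^'n \<Rightarrow> complex) \<Rightarrow> bool" where
  "homogeneous_form d f \<longleftrightarrow>
     f \<in> poly_functions (range (\<lambda>i x. x $ i)) \<and> (\<forall>c x. f (c *s x) = c ^ d * f x)"

text \<open>The points of the projective space of \<open>complex^'n\<close> are the lines through the origin.\<close>

definition projective_space :: "(complex^'n) set set" where
  "projective_space = {L. vec.subspace L \<and> vec.dim L = 1}"

definition zariski :: "(complex^'n) set topology" where
  "zariski = topology_generated_by
     {{L \<in> projective_space. \<exists>x\<in>L. f x \<noteq> 0} | f. \<exists>d. homogeneous_form d f}"

section \<open>Varieties, regular maps, rationality\<close>

definition irreducible_topology :: "'a topology \<Rightarrow> bool" where
  "irreducible_topology T \<longleftrightarrow> topspace T \<noteq> {} \<and>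
     (\<forall>A B. closedin T A \<and> closedin T B \<and> A \<union> B = topspace T \<longrightarrow>
        A = topspace T \<or> B = topspace T)"

definition projective_variety :: "(complex^'n) set set \<Rightarrow> bool" where
  "projective_variety X \<longleftrightarrow> closedin zariski X \<and> irreducible_topology (subtopology zariski X)"

text \<open>Regular maps from a subset of one projective space to another one: locally, the map is
  \<open>[x] \<mapsto> [F\<^sub>1 x : F\<^sub>2 x : \<dots>]\<close> for forms \<open>F\<^sub>j\<close> of the same degree without common zero.\<close>

definition regular_map ::
  "(complex^'n) set set \<Rightarrow> ((complex^'n) set \<Rightarrow> (complex^'m) set) \<Rightarrow> bool" where
  "regular_map X \<phi> \<longleftrightarrow>
     (\<forall>p\<in>X. \<exists>N d (F :: complex^'n \<Rightarrow> complex^'m).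
        openin (subtopology zariski X) N \<and> p \<in> N \<and>
        (\<forall>j. homogeneous_form d (\<lambda>x. F x $ j)) \<and>
        (\<forall>L\<in>N. \<forall>x\<in>L - {0}. F x \<noteq> 0 \<and> \<phi> L = vec.span {F x}))"

definition biregular :: "(complex^'n) set set \<Rightarrow> (complex^'m) set set \<Rightarrow> bool" where
  "biregular U V \<longleftrightarrow>
     (\<exists>\<phi> \<psi>. regular_map U \<phi> \<and> regular_map V \<psi> \<and>
        \<phi> \<in> U \<rightarrow> V \<and> \<psi> \<in> V \<rightarrow> U \<and>
        (\<forall>p\<in>U. \<psi> (\<phi> p) = p) \<and> (\<forall>q\<in>V. \<phi> (\<psi> q) = q))"

text \<open>For irreducible varieties, where nonempty open subsets are dense.\<close>

definition birational :: "(complex^'n) set set \<Rightarrow> (complex^'m) set set \<Rightarrow> bool" where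
  "birational X Y \<longleftrightarrow>
     (\<exists>U V. openin (subtopology zariski X) U \<and> U \<noteq> {} \<and>
            openin (subtopology zariski Y) V \<and> V \<noteq> {} \<and> biregular U V)"

definition rational_sixfold :: "(complex^'n) set set \<Rightarrow> bool" where
  "rational_sixfold X \<longleftrightarrow>
     projective_variety X \<and> birational X (projective_space :: (complex^7) set set)"

section \<open>Trivectors and the Peskine variety\<close>

type_synonym V10 = "complex^10"
type_synonym form3 = "V10 \<Rightarrow> V10 \<Rightarrow> V10 \<Rightarrow> complex"

definition alternating_forms :: "form3 set" where
  "alternating_forms = {\<sigma>.
     (\<forall>y z. Vector_Spaces.linear (*s) (*) (\<lambda>x. \<sigma> x y z)) \<and>
     (\<forall>x z. Vector_Spaces.linear (*s) (*) (\<lambda>y. \<sigma> x y z)) \<and>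
     (\<forall>x y. Vector_Spaces.linear (*s) (*) (\<lambda>z. \<sigma> x y z)) \<and>
     (\<forall>x y. \<sigma> x x y = 0 \<and> \<sigma> x y y = 0 \<and> \<sigma> x y x = 0)}"

text \<open>The Zariski topology of the vector space of alternating trilinear forms: its linear
  functionals are the linear combinations of the evaluations \<open>\<sigma> \<mapsto> \<sigma> x y z\<close>.\<close>

definition zariski_forms :: "form3 topology" where
  "zariski_forms = topology_generated_by
     {{\<sigma> \<in> alternating_forms. f \<sigma> \<noteq> 0} | f.
        f \<in> poly_functions {(\<lambda>\<sigma>. \<sigma> x y z) | x y z. True}}"

definition D_3_3_10 :: "form3 set" where
  "D_3_3_10 = {\<sigma> \<in> alternating_forms.
     \<exists>V3. vec.subspace V3 \<and> vec.dim V3 = 3 \<and> (\<forall>x\<in>V3. \<forall>y\<in>V3. \<forall>z. \<sigma> x y z = 0)}"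

text \<open>If \<open>u\<close> spans the line \<open>U\<close> and \<open>u\<close> together with the nine vectors \<open>w i\<close> spans the whole
  space, then the \<open>w i\<close> form a basis modulo \<open>U\<close>, and the matrix below is the \<open>9 \<times> 9\<close>
  skew-symmetric matrix of \<open>\<sigma>(U,-,-)\<close>. Its rank does not depend on the choice of \<open>u\<close> and \<open>w\<close>.\<close>

definition peskine :: "form3 \<Rightarrow> V10 set set" where
  "peskine \<sigma> = {U \<in> projective_space.
     \<exists>u (w :: 9 \<Rightarrow> V10). vec.span {u} = U \<and> vec.span (insert u (range w)) = UNIV \<and>
        rank ((\<chi> i j. \<sigma> u (w i) (w j)) :: complex^9^9) \<le> 6}"

definition for_general :: "'a topology \<Rightarrow> ('a \<Rightarrow> bool) \<Rightarrow> bool" where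
  "for_general T P \<longleftrightarrow>
     (\<exists>G. openin T G \<and> T closure_of G = topspace T \<and> (\<forall>x\<in>G. P x))"

end

(* Let V be a three-dimensional space with sigma(V,V,-) = 0. For x outside V let K(x) be the set of
   all z with sigma(V,x,z) = 0; in general it has dimension 7, contains V and x, and depends on x
   modulo V only. A skew form sigma(p,-,-) vanishing on a space of dimension 7 has rank at most 6,
   and on K(x) the seven-dimensional restriction is governed by a three-dimensional space of skew
   forms which sigma(V,-,-) fills in general, so that exactly one point p of the class of x modulo V
   satisfies sigma(p,K(x),K(x)) = 0. Hence x |-> p is a rational inverse of the projection
   P(V_10) --> P(V_10 / V) = P^6 restricted to the Peskine variety, whose "good" points are the
   points obtained in this way.

   Irreducibility needs more: every point of the Peskine variety has to be a limit of good points
   (in the classical topology, which is enough because forms are continuous). This is shown by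
   explicit one-parameter deformations at points p with dim K(p) = 7, at those with dim K(p) = 8,
   and at the points of P(V).

   The limits exist only if V satisfies some open conditions. Each forbidden configuration is a
   family of trivectors depending on too few parameters: any 119 coordinates of a trivector of such
   a family are algebraically dependent, while on the divisor 119 suitable coordinates are
   independent. *)

theory Submission
  imports Defs "HOL-Computational_Algebra.Polynomial"
begin

section \<open>Polynomial functions\<close>

text \<open>The constants come from one count. A trivector has 120 coordinates. A member of the
  divisor is given by a three-dimensional space \<open>V\<close>, with 21 parameters, and a form
  vanishing when two arguments lie in \<open>V\<close>, with 98, so the divisor has dimension 119.
  Four of the forbidden configurations have exactly 118 parameters. The fifth, a \<open>V\<close>
  that moves to first order, is governed by a determinant inside the 119-dimensional family; there
  the determinant is adjoined as one more quantity before counting.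

  The obstacle is irreducibility. Birationality with P^6 says nothing about components of the
  Peskine variety without good points, so every point has to be approached. Goodness fails where
  \<open>V\<close> itself contains a solution of the equations meant for \<open>p\<close>, or where
  \<open>K(p)\<close> is too large. The direction of deformation is chosen so that the first order
  term of the equations, or the limit of the spaces \<open>K\<close>, leaves no solution in
  \<open>V\<close>.

  Parity helps: the radical of a skew form has the parity of the ambient dimension, which improves
  several inequalities by one.\<close>

lemma poly_functions_cmult: "f \<in> poly_functions G \<Longrightarrow> (\<lambda>x. c * f x) \<in> poly_functions G"
  by (rule poly_functions.mult[OF poly_functions.const])

lemma poly_functions_uminus: "f \<in> poly_functions G \<Longrightarrow> (\<lambda>x. - f x) \<in> poly_functions G"
  using poly_functions_cmult[of f G "-1"] by simp

lemma poly_functions_diff: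
  "f \<in> poly_functions G \<Longrightarrow> g \<in> poly_functions G \<Longrightarrow> (\<lambda>x. f x - g x) \<in> poly_functions G"
  using poly_functions.add[OF _ poly_functions_uminus, of f G g] by simp

lemma poly_functions_sum:
  "(\<And>i. i \<in> A \<Longrightarrow> f i \<in> poly_functions G) \<Longrightarrow> (\<lambda>x. \<Sum>i\<in>A. f i x) \<in> poly_functions G"
proof (induction A rule: infinite_finite_induct)
  case (insert i A)
  then show ?case
    by (simp add: poly_functions.add)
qed (simp_all add: poly_functions.const)

lemma poly_functions_prod:
  "(\<And>i. i \<in> A \<Longrightarrow> f i \<in> poly_functions G) \<Longrightarrow> (\<lambda>x. \<Prod>i\<in>A. f i x) \<in> poly_functions G"
proof (induction A rule: infinite_finite_induct)
  case (insert i A)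
  then show ?case
    by (simp add: poly_functions.mult)
qed (simp_all add: poly_functions.const)

lemma poly_functions_power: "f \<in> poly_functions G \<Longrightarrow> (\<lambda>x. f x ^ n) \<in> poly_functions G"
  using poly_functions_prod[of "{..<n}" "\<lambda>_. f" G] by simp

lemma poly_functions_det:
  fixes M :: "'a \<Rightarrow> complex^'n^'n"
  assumes "\<And>i j. (\<lambda>x. M x $ i $ j) \<in> poly_functions G"
  shows "(\<lambda>x. det (M x)) \<in> poly_functions G"
  unfolding det_def
  by (intro poly_functions_sum poly_functions_cmult poly_functions_prod assms)

lemmas poly_functions_intros =
  poly_functions.const poly_functions.add poly_functions.mult poly_functions_cmult
  poly_functions_uminus poly_functions_diff poly_functions_sum poly_functions_prod
  poly_functions_power poly_functions_det

lemma poly_functions_compose: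
  assumes "f \<in> poly_functions G" "\<And>g. g \<in> G \<Longrightarrow> (\<lambda>x. g (\<phi> x)) \<in> poly_functions H"
  shows "(\<lambda>x. f (\<phi> x)) \<in> poly_functions H"
  using assms by (induction f) (auto intro: poly_functions.intros)

section \<open>Polynomials in one variable, and restriction of polynomials to lines\<close>

abbreviation upoly :: "(complex \<Rightarrow> complex) set" where
  "upoly \<equiv> poly_functions {\<lambda>t. t}"

lemma upoly_id: "(\<lambda>t. t) \<in> upoly"
  by (rule poly_functions.gen) simp

lemma upoly_poly:
  assumes "f \<in> upoly"
  shows "\<exists>p. \<forall>t. f t = poly p t"
  using assms
proof (induction f)
  case (gen g)
  then show ?case by (intro exI[of _ "[:0,1:]"]) auto
next
  case (const c)
  then show ?case by (intro exI[of _ "[:c:]"]) auto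
next
  case (add f g)
  then show ?case by (metis poly_add)
next
  case (mult f g)
  then show ?case by (metis poly_mult)
qed

lemma upoly_finite_zeros:
  assumes "f \<in> upoly" "f t0 \<noteq> 0"
  shows "finite {t. f t = 0}"
proof -
  obtain p where p: "\<forall>t. f t = poly p t" using upoly_poly[OF assms(1)] by blast
  then have "p \<noteq> 0" using assms(2) by auto
  then show ?thesis using p poly_roots_finite by simp
qed

lemma upoly_zero:
  assumes "f \<in> upoly" "infinite {t. f t = 0}"
  shows "f t = 0"
  using upoly_finite_zeros assms by blast

lemma upoly_common_nonzero:
  assumes "finite F" "\<And>f. f \<in> F \<Longrightarrow> f \<in> upoly" "\<And>f. f \<in> F \<Longrightarrow> \<exists>t. f t \<noteq> 0"
  shows "\<exists>t. \<forall>f\<in>F. f t \<noteq> 0"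
proof -
  have "finite (\<Union>f\<in>F. {t. f t = 0})"
    using assms upoly_finite_zeros by blast
  then obtain t where "t \<notin> (\<Union>f\<in>F. {t. f t = 0})"
    using ex_new_if_finite infinite_UNIV_char_0 by blast
  then show ?thesis by blast
qed

abbreviation coords :: "'v set \<Rightarrow> (('v \<Rightarrow> complex) \<Rightarrow> complex) set" where
  "coords I \<equiv> (\<lambda>i x. x i) ` I"

lemma poly_coord: "i \<in> I \<Longrightarrow> (\<lambda>x. x i) \<in> poly_functions (coords I)"
  by (rule poly_functions.gen) auto

lemma poly_functions_line:
  assumes "f \<in> poly_functions (coords I)"
  shows "(\<lambda>t. f (\<lambda>i. (1 - t) * x i + t * y i)) \<in> upoly"
  by (rule poly_functions_compose[OF assms]) (auto intro!: poly_functions_intros upoly_id)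

text \<open>On the line through \<open>x\<close> and \<open>y\<close> both functions become
  polynomials in \<open>t\<close>, one nonzero at \<open>t = 0\<close> and the other at
  \<open>t = 1\<close>, so each has finitely many zeros. Joining two witnesses by a line is reused
  for the divisor and for the Peskine variety.\<close>

lemma poly_functions_domain:
  assumes "f \<in> poly_functions (coords I)" "g \<in> poly_functions (coords I)" "f x \<noteq> 0" "g y \<noteq> 0"
  shows "\<exists>z. f z \<noteq> 0 \<and> g z \<noteq> 0"
proof -
  let ?z = "\<lambda>t i. (1 - t) * x i + t * y i"
  have "\<exists>t. \<forall>h\<in>{\<lambda>t. f (?z t), \<lambda>t. g (?z t)}. h t \<noteq> 0"
  proof (rule upoly_common_nonzero)
    fix h assume "h \<in> {\<lambda>t. f (?z t), \<lambda>t. g (?z t)}"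
    then show "h \<in> upoly" using assms poly_functions_line by auto
  next
    fix h assume h: "h \<in> {\<lambda>t. f (?z t), \<lambda>t. g (?z t)}"
    have "f (?z 0) \<noteq> 0" "g (?z 1) \<noteq> 0" using assms by auto
    with h show "\<exists>t. h t \<noteq> 0" by blast
  qed simp
  then show ?thesis by auto
qed

section \<open>Algebraic dependence by counting monomials\<close>

text \<open>Elimination, by induction on the number of equations: an unknown \<open>a0\<close> with
  nonzero coefficient is solved for, and \<open>m'\<close> is the system after substitution.\<close>

lemma homogeneous_system:
  fixes m :: "'a \<Rightarrow> 'b \<Rightarrow> 'c::field"
  assumes "finite B" "finite A" "card B < card A"
  shows "\<exists>c. (\<exists>a\<in>A. c a \<noteq> 0) \<and> (\<forall>b\<in>B. (\<Sum>a\<in>A. c a * m a b) = 0)"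
  using assms
proof (induction B arbitrary: A m rule: finite_induct)
  case empty
  then show ?case by (intro exI[of _ "\<lambda>_. 1"]) (auto simp: card_gt_0_iff)
next
  case (insert b B)
  show ?case
  proof (cases "\<forall>a\<in>A. m a b = 0")
    case True
    have "\<exists>c. (\<exists>a\<in>A. c a \<noteq> 0) \<and> (\<forall>b\<in>B. (\<Sum>a\<in>A. c a * m a b) = 0)"
      using insert by (intro insert.IH) auto
    then show ?thesis using True by auto
  next
    case False
    then obtain a0 where a0: "a0 \<in> A" "m a0 b \<noteq> 0" by blast
    define m' where "m' a b' = m a b' - m a b / m a0 b * m a0 b'" for a b'
    have "card B < card (A - {a0})" using insert a0 by simp
    from insert.IH[OF _ this, of m'] insert.prems obtain c where
      c: "\<exists>a\<in>A - {a0}. c a \<noteq> 0" "\<forall>b\<in>B. (\<Sum>a\<in>A - {a0}. c a * m' a b) = 0" by auto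
    define s where "s = (\<Sum>a\<in>A - {a0}. c a * m a b)"
    define c' where "c' a = (if a = a0 then - s / m a0 b else c a)" for a
    have split: "(\<Sum>a\<in>A. c' a * m a b') = - s / m a0 b * m a0 b' + (\<Sum>a\<in>A - {a0}. c a * m a b')" for b'
      using insert.prems a0 by (simp add: sum.remove[of A a0] c'_def cong: sum.cong_simp)
    have "(\<Sum>a\<in>A. c' a * m a b) = 0"
      using a0 by (simp add: split s_def[symmetric])
    moreover have "(\<Sum>a\<in>A. c' a * m a b') = 0" if "b' \<in> B" for b'
    proof -
      have "0 = (\<Sum>a\<in>A - {a0}. c a * m' a b')" using c that by simp
      also have "\<dots> = (\<Sum>a\<in>A - {a0}. c a * m a b') - (\<Sum>a\<in>A - {a0}. c a * m a b) / m a0 b * m a0 b'"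
        by (simp add: m'_def algebra_simps sum_subtractf sum_distrib_left sum_divide_distrib)
      finally show ?thesis by (simp add: split s_def)
    qed
    moreover have "\<exists>a\<in>A. c' a \<noteq> 0" using c(1) by (auto simp: c'_def)
    ultimately show ?thesis by (intro exI[of _ c']) auto
  qed
qed

definition monom_fun :: "'v set \<Rightarrow> ('v \<Rightarrow> nat) \<Rightarrow> ('v \<Rightarrow> complex) \<Rightarrow> complex" where
  "monom_fun I e x = (\<Prod>i\<in>I. x i ^ e i)"

text \<open>The bound is on each exponent separately rather than on the total degree, so the
  monomials form a box and their number is \<open>(d + 1) ^ card I\<close>.\<close>

definition bounded_poly :: "'v set \<Rightarrow> nat \<Rightarrow> (('v \<Rightarrow> complex) \<Rightarrow> complex) set" where
  "bounded_poly I d = {f. \<exists>c. f = (\<lambda>x. \<Sum>e\<in>PiE I (\<lambda>_. {..d}). c e * monom_fun I e x)}"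

lemma monom_fun_restrict: "monom_fun I (restrict e I) = monom_fun I e"
  by (auto simp: monom_fun_def)

lemma bounded_poly_monom:
  assumes "finite I" "\<And>i. i \<in> I \<Longrightarrow> e i \<le> d"
  shows "monom_fun I e \<in> bounded_poly I d"
proof -
  let ?e = "restrict e I"
  have "?e \<in> PiE I (\<lambda>_. {..d})" using assms by auto
  then have "(\<Sum>e'\<in>PiE I (\<lambda>_. {..d}). (if e' = ?e then 1 else 0) * monom_fun I e' x) = monom_fun I ?e x" for x
    using assms by (subst sum.remove[of _ ?e]) (auto simp: finite_PiE intro!: sum.neutral)
  then show ?thesis unfolding bounded_poly_def monom_fun_restrict
    by (intro CollectI exI[of _ "\<lambda>e'. if e' = ?e then 1 else 0"]) auto
qed

lemma bounded_poly_add: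
  assumes "f \<in> bounded_poly I d" "g \<in> bounded_poly I d"
  shows "(\<lambda>x. f x + g x) \<in> bounded_poly I d"
proof -
  obtain c c' where "f = (\<lambda>x. \<Sum>e\<in>PiE I (\<lambda>_. {..d}). c e * monom_fun I e x)"
    "g = (\<lambda>x. \<Sum>e\<in>PiE I (\<lambda>_. {..d}). c' e * monom_fun I e x)"
    using assms by (auto simp: bounded_poly_def)
  then show ?thesis unfolding bounded_poly_def
    by (intro CollectI exI[of _ "\<lambda>e. c e + c' e"]) (simp add: algebra_simps sum.distrib)
qed

lemma bounded_poly_cmult:
  assumes "f \<in> bounded_poly I d"
  shows "(\<lambda>x. a * f x) \<in> bounded_poly I d"
proof -
  obtain c where "f = (\<lambda>x. \<Sum>e\<in>PiE I (\<lambda>_. {..d}). c e * monom_fun I e x)"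
    using assms by (auto simp: bounded_poly_def)
  then show ?thesis unfolding bounded_poly_def
    by (intro CollectI exI[of _ "\<lambda>e. a * c e"]) (simp add: algebra_simps sum_distrib_left)
qed

lemma bounded_poly_sum:
  "(\<And>j. j \<in> A \<Longrightarrow> f j \<in> bounded_poly I d) \<Longrightarrow> (\<lambda>x. \<Sum>j\<in>A. f j x) \<in> bounded_poly I d"
proof (induction A rule: infinite_finite_induct)
  case (insert i A)
  then show ?case by (simp add: bounded_poly_add)
qed (auto simp: bounded_poly_def intro!: exI[of _ "\<lambda>_. 0"])

lemma bounded_poly_mono:
  assumes "finite I" "f \<in> bounded_poly I d" "d \<le> d'"
  shows "f \<in> bounded_poly I d'"
proof -
  obtain c where f: "f = (\<lambda>x. \<Sum>e\<in>PiE I (\<lambda>_. {..d}). c e * monom_fun I e x)"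
    using assms by (auto simp: bounded_poly_def)
  show ?thesis unfolding f
    using assms
    by (intro bounded_poly_sum bounded_poly_cmult bounded_poly_monom) (auto simp: PiE_iff intro: le_trans)
qed

lemma bounded_poly_mult:
  assumes "finite I" "f \<in> bounded_poly I d" "g \<in> bounded_poly I d'"
  shows "(\<lambda>x. f x * g x) \<in> bounded_poly I (d + d')"
proof -
  obtain c c' where f: "f = (\<lambda>x. \<Sum>e\<in>PiE I (\<lambda>_. {..d}). c e * monom_fun I e x)"
    and g: "g = (\<lambda>x. \<Sum>e\<in>PiE I (\<lambda>_. {..d'}). c' e * monom_fun I e x)"
    using assms by (auto simp: bounded_poly_def)
  have fg: "(\<lambda>x. f x * g x) = (\<lambda>x. \<Sum>e\<in>PiE I (\<lambda>_. {..d}). \<Sum>e'\<in>PiE I (\<lambda>_. {..d'}).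
      (c e * c' e') * monom_fun I (\<lambda>i. e i + e' i) x)"
    unfolding f g sum_product by (simp add: monom_fun_def power_add prod.distrib algebra_simps)
  show ?thesis unfolding fg
    using assms
    by (intro bounded_poly_sum bounded_poly_cmult bounded_poly_monom) (auto simp: PiE_iff intro!: add_mono)
qed

lemma bounded_poly_one: "finite I \<Longrightarrow> (\<lambda>x. 1) \<in> bounded_poly I 0"
  using bounded_poly_monom[of I "\<lambda>_. 0" 0] by (simp add: monom_fun_def[abs_def])

lemma poly_functions_bounded:
  assumes "f \<in> poly_functions (coords I)" "finite I"
  shows "\<exists>d. f \<in> bounded_poly I d"
  using assms(1)
proof (induction f)
  case (gen g)
  then obtain i where i: "i \<in> I" "g = (\<lambda>x. x i)" by auto
  have "monom_fun I (\<lambda>j. if j = i then 1 else 0) = g"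
    using i assms(2) by (auto simp: monom_fun_def fun_eq_iff if_distrib[of "\<lambda>n. _ ^ n"] prod.delta cong: if_cong)
  moreover have "monom_fun I (\<lambda>j. if j = i then 1 else 0) \<in> bounded_poly I 1"
    by (rule bounded_poly_monom[OF assms(2)]) simp
  ultimately show ?case by metis
next
  case (const c)
  show ?case using bounded_poly_cmult[OF bounded_poly_one[OF assms(2)], of c] by auto
next
  case (add f g)
  then obtain d d' where "f \<in> bounded_poly I d" "g \<in> bounded_poly I d'" by blast
  then have "f \<in> bounded_poly I (max d d')" "g \<in> bounded_poly I (max d d')"
    using bounded_poly_mono[OF assms(2)] by (metis max.cobounded1, metis max.cobounded2)
  then show ?case using bounded_poly_add by blast
next
  case (mult f g)
  then show ?case using bounded_poly_mult[OF assms(2)] by blast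
qed

lemma bounded_poly_power:
  assumes "finite I" "f \<in> bounded_poly I d"
  shows "(\<lambda>x. f x ^ n) \<in> bounded_poly I (d * n)"
proof (induction n)
  case (Suc n)
  then show ?case using bounded_poly_mult[OF assms(1) assms(2) Suc] by simp
qed (simp add: bounded_poly_one assms)

lemma bounded_poly_prod:
  assumes "finite I" "finite J" "\<And>j. j \<in> J \<Longrightarrow> f j \<in> bounded_poly I d"
  shows "(\<lambda>x. \<Prod>j\<in>J. f j x) \<in> bounded_poly I (d * card J)"
  using assms(2,3)
proof (induction J rule: finite_induct)
  case (insert j J)
  have "(\<lambda>x. f j x * (\<Prod>j\<in>J. f j x)) \<in> bounded_poly I (d + d * card J)"
    using insert by (intro bounded_poly_mult[OF assms(1)]) auto
  then show ?case using insert by (simp add: algebra_simps)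
qed (simp add: bounded_poly_one assms)

text \<open>Linear independence of monomials, by induction on the variables: regarded as a
  polynomial in the new variable \<open>j\<close>, the sum has a coefficient that is nonzero at some
  \<open>y\<close>.\<close>

lemma monom_sum_nonzero:
  assumes "finite J" "\<exists>e\<in>PiE J (\<lambda>_. {..<k}). c e \<noteq> 0"
  shows "\<exists>y. (\<Sum>e\<in>PiE J (\<lambda>_. {..<k}). c e * monom_fun J e y) \<noteq> 0"
  using assms
proof (induction J arbitrary: c rule: finite_induct)
  case empty
  then show ?case by (simp add: monom_fun_def)
next
  case (insert j J)
  obtain e0 where e0: "e0 \<in> PiE (insert j J) (\<lambda>_. {..<k})" "c e0 \<noteq> 0" using insert.prems by blast
  define b where "b a y = (\<Sum>e\<in>PiE J (\<lambda>_. {..<k}). c (e(j := a)) * monom_fun J e y)" for a y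
  have eq: "(\<Sum>e\<in>PiE (insert j J) (\<lambda>_. {..<k}). c e * monom_fun (insert j J) e (y(j := t)))
      = (\<Sum>a<k. b a y * t ^ a)" for y t
  proof -
    have inj: "inj_on (\<lambda>(a, e). e(j := a)) ({..<k} \<times> PiE J (\<lambda>_. {..<k}))"
      using inj_combinator[OF insert.hyps(2), of "\<lambda>_. {..<k}"] by simp
    have mm: "monom_fun (insert j J) (e(j := a)) (y(j := t)) = t ^ a * monom_fun J e y" for a e
    proof -
      have "(\<Prod>i\<in>J. (y(j := t)) i ^ (e(j := a)) i) = (\<Prod>i\<in>J. y i ^ e i)"
        using insert.hyps by (intro prod.cong) auto
      then show ?thesis using insert.hyps by (simp add: monom_fun_def)
    qed
    have "(\<Sum>e\<in>PiE (insert j J) (\<lambda>_. {..<k}). c e * monom_fun (insert j J) e (y(j := t)))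
      = (\<Sum>(a, e)\<in>{..<k} \<times> PiE J (\<lambda>_. {..<k}). c (e(j := a)) * (t ^ a * monom_fun J e y))"
      unfolding PiE_insert_eq sum.reindex[OF inj] by (simp add: mm case_prod_unfold del: fun_upd_apply)
    also have "\<dots> = (\<Sum>a<k. b a y * t ^ a)"
      by (simp add: sum.cartesian_product[symmetric] b_def sum_distrib_left sum_distrib_right algebra_simps)
    finally show ?thesis .
  qed
  have "\<exists>e\<in>PiE J (\<lambda>_. {..<k}). c (e(j := e0 j)) \<noteq> 0"
    by (rule bexI[of _ "e0(j := undefined)"]) (use e0 insert.hyps in \<open>auto simp: PiE_iff extensional_def\<close>)
  from insert.IH[of "\<lambda>e. c (e(j := e0 j))", OF this] obtain y where y: "b (e0 j) y \<noteq> 0"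
    by (auto simp: b_def)
  have "e0 j < k" using e0 by auto
  define p where "p = (\<Sum>a<k. monom (b a y) a)"
  have "coeff p (e0 j) \<noteq> 0"
    using y \<open>e0 j < k\<close> by (simp add: p_def coeff_sum)
  then have "p \<noteq> 0" by auto
  then obtain t where "poly p t \<noteq> 0" using poly_all_0_iff_0 by blast
  then have "(\<Sum>a<k. b a y * t ^ a) \<noteq> 0"
    by (simp add: p_def poly_sum poly_monom)
  then show ?case using eq by metis
qed

text \<open>There are \<open>k ^ card J\<close> monomials of exponents below \<open>k\<close> in the
  \<open>\<Psi> j\<close>, and they all lie in a space whose dimension grows only like
  \<open>k ^ card I\<close>. For large \<open>k\<close> they are linearly dependent, and a linear
  relation among them is the polynomial relation \<open>R\<close>.\<close>

lemma algebraically_dependent: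
  assumes "finite I" "finite J" "card I < card J"
    and \<Psi>: "\<And>j. j \<in> J \<Longrightarrow> \<Psi> j \<in> poly_functions (coords I)"
  shows "\<exists>R \<in> poly_functions (coords J). (\<exists>y. R y \<noteq> 0) \<and> (\<forall>x. R (\<lambda>j. \<Psi> j x) = 0)"
proof -
  obtain d where d: "\<And>j. j \<in> J \<Longrightarrow> \<Psi> j \<in> bounded_poly I (d j)"
    using poly_functions_bounded[OF \<Psi> assms(1)] by metis
  define D where "D = Max (insert 0 (d ` J))"
  have D: "\<Psi> j \<in> bounded_poly I D" if "j \<in> J" for j
    using d[OF that] by (rule bounded_poly_mono[OF assms(1)]) (use that assms in \<open>auto simp: D_def\<close>)
  \<comment> \<open>The power \<open>(D * card J + 1) ^ card I\<close> is the constant in front of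
    \<open>k ^ card I\<close>; \<open>k\<close> is one more than it, and the additional factor
    \<open>k\<close> in \<open>k ^ card J\<close> wins.\<close>
  define k where "k = (D * card J + 1) ^ card I + 1"
  define E where "E = PiE J (\<lambda>_. {..<k})"
  have "\<forall>e\<in>E. (\<lambda>x. monom_fun J e (\<lambda>j. \<Psi> j x)) \<in> bounded_poly I (D * k * card J)"
    unfolding monom_fun_def
  proof (intro ballI bounded_poly_prod assms)
    fix e j assume "e \<in> E" "j \<in> J"
    then have "e j < k" by (auto simp: E_def)
    then show "(\<lambda>x. \<Psi> j x ^ e j) \<in> bounded_poly I (D * k)"
      by (intro bounded_poly_mono[OF assms(1) bounded_poly_power[OF assms(1) D[OF \<open>j \<in> J\<close>]]]) auto
  qed
  then obtain q where q: "\<And>e x. e \<in> E \<Longrightarrow> monom_fun J e (\<lambda>j. \<Psi> j x) =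
      (\<Sum>e'\<in>PiE I (\<lambda>_. {..D * k * card J}). q e e' * monom_fun I e' x)"
    unfolding bounded_poly_def fun_eq_iff mem_Collect_eq by metis
  have "card (PiE I (\<lambda>_. {..D * k * card J})) = (D * k * card J + 1) ^ card I"
    using assms by (simp add: card_PiE)
  also have "\<dots> \<le> ((D * card J + 1) * k) ^ card I"
    by (intro power_mono) (auto simp: k_def algebra_simps)
  also have "\<dots> = (D * card J + 1) ^ card I * k ^ card I" by (rule power_mult_distrib)
  also have "\<dots> < k * k ^ card I" by (intro mult_strict_right_mono) (auto simp: k_def)
  also have "\<dots> = k ^ Suc (card I)" by simp
  also have "\<dots> \<le> k ^ card J" using assms by (intro power_increasing) (auto simp: k_def)
  also have "\<dots> = card E" using assms by (simp add: E_def card_PiE)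
  finally have "card (PiE I (\<lambda>_. {..D * k * card J})) < card E" .
  from homogeneous_system[OF _ _ this, of q] assms obtain c where
    c: "\<exists>e\<in>E. c e \<noteq> 0" "\<forall>e'\<in>PiE I (\<lambda>_. {..D * k * card J}). (\<Sum>e\<in>E. c e * q e e') = 0"
    by (auto simp: E_def finite_PiE)
  define R where "R y = (\<Sum>e\<in>E. c e * monom_fun J e y)" for y
  have "R \<in> poly_functions (coords J)"
    unfolding R_def[abs_def] monom_fun_def by (intro poly_functions_intros poly_coord)
  moreover have "\<exists>y. R y \<noteq> 0"
    unfolding R_def E_def using c(1) by (intro monom_sum_nonzero assms) (auto simp: E_def)
  moreover have "R (\<lambda>j. \<Psi> j x) = 0" for x
  proof -
    have "R (\<lambda>j. \<Psi> j x) = (\<Sum>e\<in>E. \<Sum>e'\<in>PiE I (\<lambda>_. {..D * k * card J}). c e * q e e' * monom_fun I e' x)"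
      unfolding R_def by (intro sum.cong refl) (simp add: q sum_distrib_left mult.assoc)
    also have "\<dots> = (\<Sum>e'\<in>PiE I (\<lambda>_. {..D * k * card J}). (\<Sum>e\<in>E. c e * q e e') * monom_fun I e' x)"
      by (subst sum.swap) (simp add: sum_distrib_right)
    finally show ?thesis using c(2) by simp
  qed
  ultimately show ?thesis by blast
qed

section \<open>Algebraic dependence on a hypersurface\<close>

lemma poly_functions_insert_expand:
  assumes "f \<in> poly_functions (coords (insert j J))"
  shows "\<exists>n r. (\<forall>i. r i \<in> poly_functions (coords J)) \<and> (\<forall>y. f y = (\<Sum>i<n. r i y * y j ^ i))"
  using assms
proof (induction f)
  case (gen g)
  then consider "g = (\<lambda>x. x j)" | i where "i \<in> J" "g = (\<lambda>x. x i)" by auto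
  then show ?case
  proof cases
    case 1
    then show ?thesis
      by (intro exI[of _ 2] exI[of _ "\<lambda>i _. if i = 1 then 1 else 0"])
        (auto simp: numeral_2_eq_2 poly_functions.const)
  next
    case 2
    then show ?thesis by (intro exI[of _ 1] exI[of _ "\<lambda>_. g"]) (auto intro: poly_coord)
  qed
next
  case (const c)
  show ?case by (intro exI[of _ 1] exI[of _ "\<lambda>_ _. c"]) (auto intro: poly_functions.const)
next
  case (add f g)
  then obtain n r m s where r: "\<forall>i. r i \<in> poly_functions (coords J)" "\<forall>y. f y = (\<Sum>i<n. r i y * y j ^ i)"
    and s: "\<forall>i. s i \<in> poly_functions (coords J)" "\<forall>y. g y = (\<Sum>i<m. s i y * y j ^ i)" by blast
  define r' where "r' i = (if i < n then r i else (\<lambda>_. 0))" for i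
  define s' where "s' i = (if i < m then s i else (\<lambda>_. 0))" for i
  have 1: "f y = (\<Sum>i<max n m. r' i y * y j ^ i)" for y
    using r(2) by (auto simp: r'_def split: if_splits intro!: sum.mono_neutral_cong_left)
  have 2: "g y = (\<Sum>i<max n m. s' i y * y j ^ i)" for y
    using s(2) by (auto simp: s'_def split: if_splits intro!: sum.mono_neutral_cong_left)
  show ?case
    by (rule exI[of _ "max n m"], rule exI[of _ "\<lambda>i y. r' i y + s' i y"])
      (use r s in \<open>auto simp: 1 2 algebra_simps sum.distrib r'_def s'_def intro!: poly_functions_intros\<close>)
next
  case (mult f g)
  then obtain n r m s where r: "\<forall>i. r i \<in> poly_functions (coords J)" "\<forall>y. f y = (\<Sum>i<n. r i y * y j ^ i)"
    and s: "\<forall>i. s i \<in> poly_functions (coords J)" "\<forall>y. g y = (\<Sum>i<m. s i y * y j ^ i)" by blast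
  define q where "q l y = (\<Sum>i<n. \<Sum>k<m. (if i + k = l then 1 else 0) * (r i y * s k y))" for l y
  have "f y * g y = (\<Sum>l<n+m. q l y * y j ^ l)" for y
  proof -
    have "(\<Sum>l<n+m. q l y * y j ^ l) = (\<Sum>l<n+m. \<Sum>i<n. \<Sum>k<m. (if i + k = l then 1 else 0) * (r i y * s k y) * y j ^ l)"
      by (simp add: q_def sum_distrib_right)
    also have "\<dots> = (\<Sum>i<n. \<Sum>l<n+m. \<Sum>k<m. (if i + k = l then 1 else 0) * (r i y * s k y) * y j ^ l)"
      by (rule sum.swap)
    also have "\<dots> = (\<Sum>i<n. \<Sum>k<m. \<Sum>l<n+m. (if i + k = l then 1 else 0) * (r i y * s k y) * y j ^ l)"
      by (intro sum.cong refl sum.swap)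
    also have "\<dots> = (\<Sum>i<n. \<Sum>k<m. r i y * s k y * y j ^ (i + k))"
    proof (intro sum.cong refl)
      fix i k assume "i \<in> {..<n}" "k \<in> {..<m}"
      then have "i + k < n + m" by auto
      then show "(\<Sum>l<n+m. (if i + k = l then 1 else 0) * (r i y * s k y) * y j ^ l) = r i y * s k y * y j ^ (i + k)"
        by (subst sum.remove[of _ "i + k"]) (auto intro!: sum.neutral)
    qed
    also have "\<dots> = f y * g y" using r s by (simp add: sum_product power_add algebra_simps)
    finally show ?thesis by simp
  qed
  moreover have "\<forall>i. q i \<in> poly_functions (coords J)"
    unfolding q_def[abs_def] using r s by (intro allI poly_functions_intros) auto
  ultimately show ?case by blast
qed

text \<open>Adjoining \<open>g\<close> to the \<open>\<Psi> j\<close> gives more quantities than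
  variables, hence a relation. Once the largest possible power of \<open>g\<close> is divided out,
  the part of the relation free of \<open>g\<close> is nontrivial and holds wherever
  \<open>g\<close> vanishes. This is why equality of the two cardinalities suffices here, unlike in
  \<open>algebraically_dependent\<close>.\<close>

lemma divisor_avoidance:
  assumes "finite I" "finite J" "card I \<le> card J"
    and \<Psi>: "\<And>j. j \<in> J \<Longrightarrow> \<Psi> j \<in> poly_functions (coords I)"
    and g: "g \<in> poly_functions (coords I)" "g x0 \<noteq> 0"
  shows "\<exists>R \<in> poly_functions (coords J). (\<exists>y. R y \<noteq> 0) \<and> (\<forall>x. g x = 0 \<longrightarrow> R (\<lambda>j. \<Psi> j x) = 0)"
proof -
  \<comment> \<open>\<open>None\<close> is the label of the additional quantity
    \<open>g\<close>.\<close>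
  let ?J = "insert None (Some ` J)"
  define \<Psi>' where "\<Psi>' j = (case j of None \<Rightarrow> g | Some j \<Rightarrow> \<Psi> j)" for j
  have "card ?J = Suc (card J)" using assms by (subst card_insert_disjoint) (auto simp: card_image)
  then have "\<exists>R \<in> poly_functions (coords ?J). (\<exists>y. R y \<noteq> 0) \<and> (\<forall>x. R (\<lambda>j. \<Psi>' j x) = 0)"
    using assms by (intro algebraically_dependent) (auto simp: \<Psi>'_def)
  then obtain R y0 where R: "R \<in> poly_functions (coords ?J)" "R y0 \<noteq> 0" "\<And>x. R (\<lambda>j. \<Psi>' j x) = 0"
    by blast
  obtain n r where r: "\<And>i. r i \<in> poly_functions (coords (Some ` J))"
    "\<And>y. R y = (\<Sum>i<n. r i y * y None ^ i)"
    using poly_functions_insert_expand[OF R(1)] by blast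
  have "\<exists>i. i < n \<and> (\<exists>y. r i y \<noteq> 0)"
  proof (rule ccontr)
    assume "\<not> ?thesis"
    then have "\<forall>i<n. r i y0 = 0" by auto
    then have "R y0 = 0" by (simp add: r(2))
    then show False using R(2) by simp
  qed
  \<comment> \<open>The lowest power of \<open>g\<close> that occurs in the relation with a nonzero
    coefficient.\<close>
  then obtain i where i: "i < n" "\<exists>y. r i y \<noteq> 0" "\<And>i'. i' < i \<Longrightarrow> \<not> (i' < n \<and> (\<exists>y. r i' y \<noteq> 0))"
    using exists_least_iff[of "\<lambda>i. i < n \<and> (\<exists>y. r i y \<noteq> 0)"] by blast
  define s where "s x = (\<Sum>k<n - i. r (i + k) (\<lambda>j. \<Psi>' j x) * g x ^ k)" for x
  have \<Psi>'poly: "r k \<in> poly_functions (coords (Some ` J)) \<Longrightarrow> (\<lambda>x. r k (\<lambda>j. \<Psi>' j x)) \<in> poly_functions (coords I)" for k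
    by (rule poly_functions_compose[where \<phi> = "\<lambda>x j. \<Psi>' j x"]) (auto simp: \<Psi>'_def \<Psi>)
  have sp: "s \<in> poly_functions (coords I)"
    unfolding s_def[abs_def] using r(1) g(1)
    by (intro poly_functions_sum poly_functions.mult poly_functions_power \<Psi>'poly) auto
  have prod0: "g x ^ i * s x = 0" for x
  proof -
    have "0 = (\<Sum>k<n. r k (\<lambda>j. \<Psi>' j x) * g x ^ k)"
      using R(3)[of x] r(2)[of "\<lambda>j. \<Psi>' j x"] by (simp add: \<Psi>'_def)
    also have "\<dots> = (\<Sum>k\<in>{i..<n}. r k (\<lambda>j. \<Psi>' j x) * g x ^ k)"
      using i(3) by (intro sum.mono_neutral_right) (auto simp: not_le)
    also have "\<dots> = (\<Sum>k\<in>{0..<n-i}. r (i + k) (\<lambda>j. \<Psi>' j x) * g x ^ (i + k))"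
      using i(1) sum.shift_bounds_nat_ivl[of "\<lambda>k. r k (\<lambda>j. \<Psi>' j x) * g x ^ k" 0 i "n - i"]
      by (simp add: add.commute)
    also have "\<dots> = g x ^ i * s x"
      by (simp add: s_def power_add sum_distrib_left algebra_simps atLeast0LessThan)
    finally show ?thesis by simp
  qed
  \<comment> \<open>The factor \<open>g x ^ i\<close> cancels because polynomial functions form an
    integral domain and \<open>g\<close> is nonzero at \<open>x0\<close>.\<close>
  have s0: "s x = 0" for x
  proof (rule ccontr)
    assume "s x \<noteq> 0"
    then obtain z where "g z \<noteq> 0" "s z \<noteq> 0" using poly_functions_domain[OF g(1) sp g(2)] by blast
    then show False using prod0[of z] by simp
  qed
  define R' where "R' y = r i (\<lambda>j. case j of None \<Rightarrow> 0 | Some j \<Rightarrow> y j)" for y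
  have "R' \<in> poly_functions (coords J)"
    unfolding R'_def[abs_def] by (rule poly_functions_compose[OF r(1)]) (auto intro: poly_coord)
  moreover have ri: "r i y = r i y'" if "\<And>j. y (Some j) = y' (Some j)" for y y'
  proof -
    have "f y = f y'" if "f \<in> poly_functions (coords (Some ` J))" for f
      using that by induction (auto simp: \<open>\<And>j. y (Some j) = y' (Some j)\<close>)
    then show ?thesis using r(1) by blast
  qed
  have "\<exists>y. R' y \<noteq> 0"
  proof -
    obtain y where y: "r i y \<noteq> 0" using i(2) by blast
    have "R' (\<lambda>j. y (Some j)) = r i y" unfolding R'_def by (rule ri) simp
    with y show ?thesis by metis
  qed
  moreover have "R' (\<lambda>j. \<Psi> j x) = 0" if "g x = 0" for x
  proof -
    have "s x = r i (\<lambda>j. \<Psi>' j x)"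
      using i(1) that unfolding s_def by (subst sum.remove[of _ 0]) (auto intro!: sum.neutral)
    moreover have "R' (\<lambda>j. \<Psi> j x) = r i (\<lambda>j. \<Psi>' j x)" unfolding R'_def by (rule ri) (simp add: \<Psi>'_def)
    ultimately show ?thesis using s0 by simp
  qed
  ultimately show ?thesis by blast
qed

section \<open>Adjugate matrices\<close>

text \<open>Column \<open>k\<close> is replaced by a unit vector, so the entries are cofactors.
  Adjugates stand in for inverses throughout because their entries are polynomials in those of the
  matrix; the stray factor \<open>det A\<close> is absorbed by the homogeneity of the
  conditions.\<close>

definition adj :: "complex^'n^'n \<Rightarrow> complex^'n^'n" where
  "adj A = (\<chi> k l. det (\<chi> i j. if j = k then (if i = l then 1 else 0) else A $ i $ j))"

lemma matrix_vector_axis: "(A :: 'a::comm_ring_1^'n^'m) *v axis i 1 = (\<chi> r. A $ r $ i)"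
  by (simp add: matrix_vector_mult_def axis_def vec_eq_iff if_distrib[of "(*) _"] cong: if_cong)

lemma axis_nth: "axis l a $ i = (if i = l then a else 0)"
  by (simp add: axis_def)

lemma adj_right:
  fixes A :: "complex^'n^'n"
  assumes "det A \<noteq> 0"
  shows "A ** adj A = mat (det A)"
proof -
  have "A *v (\<chi> k. adj A $ k $ l / det A) = axis l 1" for l
    unfolding cramer[OF assms] by (simp add: adj_def vec_eq_iff axis_nth cong: if_cong)
  then have "(\<Sum>k\<in>UNIV. A $ i $ k * (adj A $ k $ l / det A)) = (if i = l then 1 else 0)" for i l
    by (simp add: vec_eq_iff matrix_vector_mult_def axis_def)
  then have "(\<Sum>k\<in>UNIV. A $ i $ k * adj A $ k $ l) = (if i = l then det A else 0)" for i l
    using assms by (simp add: sum_divide_distrib[symmetric] field_simps split: if_splits)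
  then show ?thesis
    by (simp add: vec_eq_iff matrix_matrix_mult_def mat_def)
qed

lemma mat_vec: "mat (c::complex) *v x = c *s x"
  by (simp add: vec_eq_iff matrix_vector_mult_def mat_def if_distrib[of "\<lambda>a. a * _"] cong: if_cong)

lemma adj_right_vec: "det A \<noteq> 0 \<Longrightarrow> A *v (adj A *v x) = det A *s x"
  by (simp add: matrix_vector_mul_assoc adj_right mat_vec)

lemma adj_left_vec:
  assumes "det A \<noteq> 0"
  shows "adj A *v (A *v x) = det A *s x"
proof -
  have inj: "u = w" if "A *v u = A *v w" for u w
    using that assms invertible_det_nz[of A] by (metis invertible_def matrix_vector_mul_assoc matrix_vector_mul_lid)
  show ?thesis
    by (rule inj) (simp add: adj_right_vec[OF assms] vec.scale)
qed

lemma adj_mat_1 [simp]: "adj (mat 1) = mat 1"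
  using adj_right[of "mat 1"] by (simp add: det_I)

lemma poly_functions_adj:
  fixes M :: "'a \<Rightarrow> complex^'n^'n"
  assumes "\<And>i j. (\<lambda>x. M x $ i $ j) \<in> poly_functions G"
  shows "(\<lambda>x. adj (M x) $ k $ l) \<in> poly_functions G"
proof -
  have "(\<lambda>x. (\<chi> i j. if j = k then (if i = l then 1 else 0) else M x $ i $ j) $ i' $ j') \<in> poly_functions G" for i' j'
    using assms by (cases "j' = k") (auto intro: poly_functions.const)
  then have "(\<lambda>x. det (\<chi> i j. if j = k then (if i = l then 1 else 0) else M x $ i $ j)) \<in> poly_functions G"
    by (rule poly_functions_det)
  then show ?thesis by (simp add: adj_def)
qed

section \<open>Alternating trilinear forms in coordinates\<close>

abbreviation ee :: "'n \<Rightarrow> complex^'n" where "ee i \<equiv> axis i 1"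

lemma linear_functionalI:
  assumes "\<And>x y. f (x + y) = f x + f y" "\<And>c x. f (c *s x) = c * f x"
  shows "Vector_Spaces.linear (*s) (*) (f :: complex^'n \<Rightarrow> complex)"
  using assms by unfold_locales (auto simp: algebra_simps)

lemma linear_functionalD:
  assumes "Vector_Spaces.linear (*s) (*) (f :: complex^'n \<Rightarrow> complex)"
  shows "f (x + y) = f x + f y" "f (c *s x) = c * f x"
  using assms by (auto simp: Vector_Spaces.linear_iff)

locale trivector =
  fixes \<sigma> :: form3
  assumes alternating: "\<sigma> \<in> alternating_forms"
begin

lemma add1: "\<sigma> (x + x') y z = \<sigma> x y z + \<sigma> x' y z"
  and add2: "\<sigma> x (y + y') z = \<sigma> x y z + \<sigma> x y' z"
  and add3: "\<sigma> x y (z + z') = \<sigma> x y z + \<sigma> x y z'"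
  and scale1: "\<sigma> (c *s x) y z = c * \<sigma> x y z"
  and scale2: "\<sigma> x (c *s y) z = c * \<sigma> x y z"
  and scale3: "\<sigma> x y (c *s z) = c * \<sigma> x y z"
proof -
  have "Vector_Spaces.linear (*s) (*) (\<lambda>x. \<sigma> x y z)" "Vector_Spaces.linear (*s) (*) (\<lambda>y. \<sigma> x y z)"
    "Vector_Spaces.linear (*s) (*) (\<lambda>z. \<sigma> x y z)" for x y z
    using alternating by (simp_all add: alternating_forms_def)
  note * = linear_functionalD[OF this(1)] linear_functionalD[OF this(2)] linear_functionalD[OF this(3)]
  show "\<sigma> (x + x') y z = \<sigma> x y z + \<sigma> x' y z" "\<sigma> x (y + y') z = \<sigma> x y z + \<sigma> x y' z"
    "\<sigma> x y (z + z') = \<sigma> x y z + \<sigma> x y z'" "\<sigma> (c *s x) y z = c * \<sigma> x y z"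
    "\<sigma> x (c *s y) z = c * \<sigma> x y z" "\<sigma> x y (c *s z) = c * \<sigma> x y z"
    by (rule *)+
qed

lemma same [simp]: "\<sigma> x x y = 0" "\<sigma> x y y = 0" "\<sigma> x y x = 0"
  using alternating by (simp_all add: alternating_forms_def)

lemma zero [simp]: "\<sigma> 0 y z = 0" "\<sigma> x 0 z = 0" "\<sigma> x y 0 = 0"
  using scale1[of 0 0] scale2[of _ 0 0] scale3[of _ _ 0 0] by simp_all

lemma minus [simp]: "\<sigma> (- x) y z = - \<sigma> x y z" "\<sigma> x (- y) z = - \<sigma> x y z" "\<sigma> x y (- z) = - \<sigma> x y z"
  using scale1[of "-1" x y z] scale2[of x "-1" y z] scale3[of x y "-1" z] by simp_all

lemma diff1: "\<sigma> (x - x') y z = \<sigma> x y z - \<sigma> x' y z"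
  and diff2: "\<sigma> x (y - y') z = \<sigma> x y z - \<sigma> x y' z"
  and diff3: "\<sigma> x y (z - z') = \<sigma> x y z - \<sigma> x y z'"
  using add1[of x "- x'"] add2[of x y "- y'"] add3[of x y z "- z'"] by simp_all

lemma sum1: "\<sigma> (\<Sum>i\<in>A. u i) y z = (\<Sum>i\<in>A. \<sigma> (u i) y z)"
  and sum2: "\<sigma> x (\<Sum>i\<in>A. u i) z = (\<Sum>i\<in>A. \<sigma> x (u i) z)"
  and sum3: "\<sigma> x y (\<Sum>i\<in>A. u i) = (\<Sum>i\<in>A. \<sigma> x y (u i))"
  by (induction A rule: infinite_finite_induct) (auto simp: add1 add2 add3)

lemma swap12: "\<sigma> y x z = - \<sigma> x y z"
proof -
  have "\<sigma> (x + y) (x + y) z = \<sigma> x y z + \<sigma> y x z" by (simp only: add1 add2) simp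
  then show ?thesis using same(1)[of "x + y" z] by (metis add_eq_0_iff)
qed

lemma swap23: "\<sigma> x z y = - \<sigma> x y z"
proof -
  have "\<sigma> x (y + z) (y + z) = \<sigma> x y z + \<sigma> x z y" by (simp only: add2 add3) simp
  then show ?thesis using same(2)[of x "y + z"] by (metis add_eq_0_iff)
qed

lemma swap13: "\<sigma> z y x = - \<sigma> x y z"
  using swap12[of z y x] swap23[of z x y] swap12[of x z y] swap23[of y z x] swap12[of y z x] swap23[of x z y] by simp

lemma rotate: "\<sigma> y z x = \<sigma> x y z"
  using swap23[of y x z] swap12[of x y z] by simp

lemmas linear = add1 add2 add3 scale1 scale2 scale3 diff1 diff2 diff3

lemma expand: "\<sigma> x y z = (\<Sum>i\<in>UNIV. \<Sum>j\<in>UNIV. \<Sum>k\<in>UNIV. x $ i * y $ j * z $ k * \<sigma> (ee i) (ee j) (ee k))"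
proof -
  have "\<sigma> x y z = \<sigma> (\<Sum>i\<in>UNIV. x $ i *s ee i) (\<Sum>j\<in>UNIV. y $ j *s ee j) (\<Sum>k\<in>UNIV. z $ k *s ee k)"
    by (simp add: basis_expansion)
  also have "\<dots> = (\<Sum>i\<in>UNIV. \<Sum>j\<in>UNIV. \<Sum>k\<in>UNIV. x $ i * y $ j * z $ k * \<sigma> (ee i) (ee j) (ee k))"
    by (simp only: sum1 scale1, simp only: sum2 scale2 sum_distrib_left,
        simp only: sum3 scale3 sum_distrib_left mult.assoc)
  finally show ?thesis .
qed

end

lemma alternating_formsI:
  assumes "\<And>x x' y z. \<sigma> (x + x') y z = \<sigma> x y z + \<sigma> x' y z" "\<And>c x y z. \<sigma> (c *s x) y z = c * \<sigma> x y z"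
    and "\<And>x y y' z. \<sigma> x (y + y') z = \<sigma> x y z + \<sigma> x y' z" "\<And>c x y z. \<sigma> x (c *s y) z = c * \<sigma> x y z"
    and "\<And>x y z z'. \<sigma> x y (z + z') = \<sigma> x y z + \<sigma> x y z'" "\<And>c x y z. \<sigma> x y (c *s z) = c * \<sigma> x y z"
    and "\<And>x y. \<sigma> x x y = 0" "\<And>x y. \<sigma> x y y = 0" "\<And>x y. \<sigma> x y x = 0"
  shows "\<sigma> \<in> alternating_forms"
  using assms unfolding alternating_forms_def by (auto intro!: linear_functionalI)

definition pull :: "form3 \<Rightarrow> complex^10^10 \<Rightarrow> form3" where
  "pull \<sigma> A = (\<lambda>x y z. \<sigma> (A *v x) (A *v y) (A *v z))"

lemma pull_alternating: "\<sigma> \<in> alternating_forms \<Longrightarrow> pull \<sigma> A \<in> alternating_forms"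
proof -
  assume "\<sigma> \<in> alternating_forms"
  then interpret trivector \<sigma> by unfold_locales
  show ?thesis unfolding pull_def
    by (rule alternating_formsI) (simp_all add: matrix_vector_right_distrib vec.scale linear)
qed

lemma scale_alternating: "\<sigma> \<in> alternating_forms \<Longrightarrow> (\<lambda>x y z. c * \<sigma> x y z) \<in> alternating_forms"
proof -
  assume "\<sigma> \<in> alternating_forms"
  then interpret trivector \<sigma> by unfold_locales
  show ?thesis by (rule alternating_formsI) (simp_all add: linear algebra_simps)
qed

lemma add_alternating:
  assumes "\<sigma> \<in> alternating_forms" "\<tau> \<in> alternating_forms"
  shows "(\<lambda>x y z. \<sigma> x y z + \<tau> x y z) \<in> alternating_forms"
proof -
  interpret s: trivector \<sigma> by unfold_locales fact
  interpret t: trivector \<tau> by unfold_locales fact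
  show ?thesis by (rule alternating_formsI) (simp_all add: s.linear t.linear algebra_simps)
qed

abbreviation form_polys :: "(form3 \<Rightarrow> complex) set" where
  "form_polys \<equiv> poly_functions {(\<lambda>\<sigma>. \<sigma> x y z) | x y z. True}"

lemma form_polys_path:
  assumes "h \<in> form_polys" "\<And>x y z. (\<lambda>t. s t x y z) \<in> poly_functions G"
  shows "(\<lambda>t. h (s t :: form3)) \<in> poly_functions G"
proof (rule poly_functions_compose[OF assms(1), of s])
  fix g :: "form3 \<Rightarrow> complex"
  assume "g \<in> {(\<lambda>\<sigma>. \<sigma> x y z) | x y z. True}"
  then obtain x y z where "g = (\<lambda>\<sigma>. \<sigma> x y z)" by blast
  then show "(\<lambda>t. g (s t)) \<in> poly_functions G" using assms(2) by simp
qed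

lemma poly_functions_matrix_vector:
  assumes "\<And>i j. (\<lambda>t. A t $ i $ j) \<in> poly_functions G"
  shows "(\<lambda>t. (A t *v x) $ i) \<in> poly_functions G"
  unfolding matrix_vector_mult_def using assms by (simp add: poly_functions_intros)

lemma poly_functions_form:
  assumes "\<And>t. L t \<in> alternating_forms" "\<And>i j k. (\<lambda>t. L t (ee i) (ee j) (ee k)) \<in> poly_functions G"
    and "\<And>i. (\<lambda>t. x t $ i) \<in> poly_functions G" "\<And>i. (\<lambda>t. y t $ i) \<in> poly_functions G" "\<And>i. (\<lambda>t. z t $ i) \<in> poly_functions G"
  shows "(\<lambda>t. L t (x t) (y t) (z t)) \<in> poly_functions G"
proof -
  have "(\<lambda>t. L t (x t) (y t) (z t)) = (\<lambda>t. \<Sum>i\<in>UNIV. \<Sum>j\<in>UNIV. \<Sum>k\<in>UNIV.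
      x t $ i * y t $ j * z t $ k * L t (ee i) (ee j) (ee k))"
    by (intro ext trivector.expand trivector.intro assms)
  then show ?thesis by (simp only:) (intro poly_functions_intros assms)
qed

lemma poly_functions_pull:
  assumes "\<And>t. L t \<in> alternating_forms" "\<And>i j k. (\<lambda>t. L t (ee i) (ee j) (ee k)) \<in> poly_functions G"
    and "\<And>i j. (\<lambda>t. A t $ i $ j) \<in> poly_functions G"
  shows "(\<lambda>t. pull (L t) (A t) x y z) \<in> poly_functions G"
  unfolding pull_def
  by (rule poly_functions_form[where L = L and x = "\<lambda>t. A t *v x" and y = "\<lambda>t. A t *v y" and z = "\<lambda>t. A t *v z"])
    (use assms in \<open>auto intro: poly_functions_matrix_vector\<close>)

section \<open>Moving adapted bases into a chart\<close>

text \<open>\<open>B\<close> is stable under scaling and under the matrices supported on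
  \<open>E\<close>, and \<open>h\<close> is known to vanish on what the matrices
  \<open>mat 1 + N\<close> make of \<open>B\<close>. A given \<open>f\<close> need not factor as
  such a matrix times the inverse of one supported on \<open>E\<close>, but all but finitely many
  points of the line \<open>g\<close> from the identity to \<open>f\<close> do. Along this line
  \<open>h\<close> is a polynomial in \<open>t\<close>, so it vanishes at \<open>t = 1\<close> as
  well.\<close>

lemma chart:
  fixes E :: "10 \<Rightarrow> 10 \<Rightarrow> bool" and B :: "form3 set" and f :: "complex^10^10"
  assumes h: "h \<in> form_polys" and E_refl: "\<And>i. E i i"
    and alt: "B \<subseteq> alternating_forms"
    and cone: "\<And>L c. L \<in> B \<Longrightarrow> (\<lambda>x y z. c * L x y z) \<in> B"
    and inv: "\<And>L q. L \<in> B \<Longrightarrow> (\<And>k j. \<not> E k j \<Longrightarrow> q $ k $ j = 0) \<Longrightarrow> det q \<noteq> 0 \<Longrightarrow> pull L q \<in> B"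
    and h0: "\<And>L N. L \<in> B \<Longrightarrow> (\<And>i j. E i j \<Longrightarrow> N $ i $ j = 0) \<Longrightarrow> h (pull L (adj (mat 1 + N))) = 0"
    and f: "det f \<noteq> 0" "pull \<sigma> f \<in> B" and \<sigma>: "\<sigma> \<in> alternating_forms"
  shows "h \<sigma> = 0"
proof -
  interpret s: trivector \<sigma> by unfold_locales fact
  \<comment> \<open>\<open>adj f\<close> inverts \<open>f\<close> up to the factor
    \<open>det f\<close>, which enters once for each of the three arguments. With this
    normalization, pulling \<open>L\<close> back along \<open>adj f\<close> returns
    \<open>\<sigma>\<close>.\<close>
  define L where "L = (\<lambda>x y z. 1 / det f ^ 3 * pull \<sigma> f x y z)"
  have LB: "L \<in> B" unfolding L_def by (rule cone[OF f(2)])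
  then have Lalt: "L \<in> alternating_forms" using alt by blast
  interpret L: trivector L by unfold_locales fact
  define g :: "complex \<Rightarrow> complex^10^10" where
    "g t = (\<chi> i j. (1 - t) * (if i = j then 1 else 0) + t * f $ i $ j)" for t
  have g0: "g 0 = mat 1" by (simp add: g_def vec_eq_iff mat_def)
  have g1: "g 1 = f" by (simp add: g_def vec_eq_iff)
  have gp: "(\<lambda>t. g t $ i $ j) \<in> upoly" for i j
    by (cases "i = j") (auto simp: g_def intro!: poly_functions.add poly_functions.mult poly_functions_diff
        poly_functions.const upoly_id)
  have "pull L (adj (g 1)) = \<sigma>"
    using f(1) by (simp add: fun_eq_iff g1 pull_def L_def adj_right_vec s.linear power3_eq_cube)
  moreover have "h (pull L (adj (g 1))) = 0"
  proof -
    \<comment> \<open>Column \<open>j\<close> of the wanted \<open>q\<close> solves a linear system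
      whose matrix is the block of \<open>g t\<close> on the indices related to \<open>j\<close>.
      Outside this block \<open>G j t\<close> is the identity, which forces the other entries of the
      column to be zero.\<close>
    define G :: "10 \<Rightarrow> complex \<Rightarrow> complex^10^10" where
      "G j t = (\<chi> i k. if E i j \<and> E k j then g t $ i $ k else if i = k then 1 else 0)" for j t
    have Gp: "(\<lambda>t. G j t $ i $ k) \<in> upoly" for j i k
      by (cases "E i j \<and> E k j") (auto simp: G_def intro!: gp poly_functions.const)
    have G0: "G j 0 = mat 1" for j by (simp add: G_def g0 vec_eq_iff mat_def)
    define q' where "q' t = (\<chi> k j. adj (G j t) $ k $ j)" for t
    have q'p: "(\<lambda>t. q' t $ i $ k) \<in> upoly" for i k
      by (simp add: q'_def poly_functions_adj Gp)
    have q'0: "q' 0 = mat 1" by (simp add: q'_def G0)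
    \<comment> \<open>\<open>F\<close> collects the determinants that must not vanish for the
      factorization to exist.\<close>
    define F where "F t = (\<Prod>j\<in>UNIV. det (G j t)) * det (q' t) * det (g t)" for t
    have "F \<in> upoly" unfolding F_def[abs_def]
      by (intro poly_functions.mult poly_functions_prod poly_functions_det Gp q'p gp)
    moreover have "F 0 \<noteq> 0" by (simp add: F_def G0 q'0 g0)
    ultimately have fin: "finite {t. F t = 0}" by (rule upoly_finite_zeros)
    have good: "h (pull L (adj (g t))) = 0" if Ft: "F t \<noteq> 0" for t
    proof -
      have d: "det (G j t) \<noteq> 0" for j using Ft by (simp add: F_def)
      have dg: "det (g t) \<noteq> 0" using Ft by (simp add: F_def)
      define q :: "complex^10^10" where "q = (\<chi> k j. q' t $ k $ j / det (G j t))"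
      have Gq: "G j t *v (\<chi> k. q $ k $ j) = ee j" for j
      proof -
        have "(\<chi> k. q $ k $ j) = (1 / det (G j t)) *s (adj (G j t) *v ee j)"
          by (simp add: q_def q'_def matrix_vector_axis vec_eq_iff)
        then show ?thesis using adj_right_vec[OF d[of j], of "ee j"] d[of j]
          by (simp add: vec.scale)
      qed
      have Gq': "(\<Sum>k\<in>UNIV. G j t $ i $ k * q $ k $ j) = (if i = j then 1 else 0)" for i j
        using arg_cong[OF Gq[of j], of "\<lambda>v. v $ i"] by (simp add: matrix_vector_mult_def axis_def)
      have q0: "q $ i $ j = 0" if "\<not> E i j" for i j
      proof -
        have "i \<noteq> j" using that E_refl by auto
        have "(\<Sum>k\<in>UNIV. G j t $ i $ k * q $ k $ j) = (\<Sum>k\<in>UNIV. if k = i then q $ k $ j else 0)"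
          using that by (intro sum.cong refl) (auto simp: G_def)
        then show ?thesis using Gq'[where i=i and j=j] \<open>i \<noteq> j\<close> by simp
      qed
      have gq: "(g t ** q) $ i $ j = (if i = j then 1 else 0)" if "E i j" for i j
      proof -
        have "(g t ** q) $ i $ j = (\<Sum>k\<in>UNIV. g t $ i $ k * q $ k $ j)"
          by (simp add: matrix_matrix_mult_def)
        also have "\<dots> = (\<Sum>k\<in>UNIV. G j t $ i $ k * q $ k $ j)"
        proof (intro sum.cong refl)
          fix k show "g t $ i $ k * q $ k $ j = G j t $ i $ k * q $ k $ j"
            using that q0[of k j] by (cases "E k j") (auto simp: G_def)
        qed
        finally show ?thesis using Gq' by simp
      qed
      define f' where "f' = g t ** q"
      define N where "N = f' - mat 1"
      have N: "N $ i $ j = 0" if "E i j" for i j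
        using gq[OF that] by (simp add: N_def f'_def mat_def)
      have "q' t = q ** (\<chi> i j. if i = j then det (G j t) else 0)"
        using d by (simp add: vec_eq_iff matrix_matrix_mult_def q_def if_distrib[of "(*) _"] cong: if_cong)
      moreover have "det (q' t) \<noteq> 0" using Ft by (simp add: F_def)
      ultimately have dq: "det q \<noteq> 0" by (auto simp: det_mul)
      have df': "det f' \<noteq> 0" using dg dq by (simp add: f'_def det_mul)
      \<comment> \<open>Applying \<open>adj f'\<close> and then \<open>q\<close> gives
        \<open>det f' / det (g t)\<close> times \<open>adj (g t)\<close>; \<open>c\<close> cancels
        this factor in all three arguments.\<close>
      define c where "c = (det (g t) / det f') ^ 3"
      define L'' where "L'' = (\<lambda>x y z. c * pull L q x y z)"
      have "L'' \<in> B" unfolding L''_def by (intro cone inv LB dq q0)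
      then have "h (pull L'' (adj (mat 1 + N))) = 0" by (rule h0) (rule N)
      moreover have "mat 1 + N = f'" by (simp add: N_def)
      moreover have "pull L'' (adj f') = pull L (adj (g t))"
      proof -
        have qa: "q *v (adj f' *v x) = (det f' / det (g t)) *s (adj (g t) *v x)" for x
        proof -
          have "g t *v (q *v (adj f' *v x)) = det f' *s x"
            using adj_right_vec[OF df', of x] by (simp add: f'_def matrix_vector_mul_assoc matrix_mul_assoc)
          then have "adj (g t) *v (g t *v (q *v (adj f' *v x))) = det f' *s (adj (g t) *v x)"
            by (simp add: vec.scale)
          then have "det (g t) *s (q *v (adj f' *v x)) = det f' *s (adj (g t) *v x)"
            by (simp add: adj_left_vec[OF dg])
          then show ?thesis using dg by (simp add: vec_eq_iff field_simps)
        qed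
        show ?thesis using dg df'
          by (simp add: fun_eq_iff pull_def L''_def c_def qa L.linear power3_eq_cube)
      qed
      ultimately show ?thesis by simp
    qed
    have "(\<lambda>t. h (pull L (adj (g t)))) \<in> upoly"
      by (rule form_polys_path[OF h], rule poly_functions_pull)
        (auto intro: Lalt poly_functions.const poly_functions_adj gp)
    then show ?thesis
    proof (rule upoly_zero)
      show "infinite {t. h (pull L (adj (g t))) = 0}"
      proof
        assume "finite {t. h (pull L (adj (g t))) = 0}"
        then have "finite ({t. h (pull L (adj (g t))) = 0} \<union> {t. F t = 0})" using fin by blast
        moreover have "{t. h (pull L (adj (g t))) = 0} \<union> {t. F t = 0} = UNIV" using good by blast
        ultimately show False using infinite_UNIV_char_0[where 'a=complex] by simp
      qed
    qed
  qed
  ultimately show ?thesis by simp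
qed

section \<open>Coordinates of alternating forms\<close>

text \<open>Coordinates are numbered by naturals, so that the order of indices and block conditions
  such as \<open>nt i < 3\<close> can be counted by evaluation.\<close>

definition ix :: "nat \<Rightarrow> 10" where "ix = (SOME h. bij_betw h {..<10} UNIV)"

definition nt :: "10 \<Rightarrow> nat" where "nt = inv_into {..<10} ix"

lemma ix_bij: "bij_betw ix {..<10} UNIV"
proof -
  have "\<exists>h. bij_betw h {0..<card (UNIV :: 10 set)} (UNIV :: 10 set)"
    by (rule ex_bij_betw_nat_finite) simp
  then have "\<exists>h. bij_betw h {..<10::nat} (UNIV :: 10 set)" by (simp add: atLeast0LessThan)
  then show ?thesis unfolding ix_def by (rule someI_ex)
qed

lemma nt_ix [simp]: "k < 10 \<Longrightarrow> nt (ix k) = k"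
  unfolding nt_def using ix_bij by (simp add: bij_betw_def inv_into_f_f)

lemma ix_nt [simp]: "ix (nt i) = i"
  unfolding nt_def using ix_bij by (simp add: bij_betw_def f_inv_into_f)

lemma nt_less [simp]: "nt i < 10"
proof -
  have "nt i \<in> {..<10}" unfolding nt_def
    by (rule inv_into_into) (use ix_bij in \<open>simp add: bij_betw_def\<close>)
  then show ?thesis by simp
qed

lemma nt_eq_iff: "nt i = nt j \<longleftrightarrow> i = j"
  by (metis ix_nt)

lemma ix_eq_iff [simp]: "a < 10 \<Longrightarrow> b < 10 \<Longrightarrow> ix a = ix b \<longleftrightarrow> a = b"
  by (metis nt_ix)

lemma sum_UNIV_ix: "(\<Sum>i\<in>UNIV. f i) = (\<Sum>k<10. f (ix k))"
  using sum.reindex_bij_betw[OF ix_bij, of f] by simp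

definition triples :: "(10 \<times> 10 \<times> 10) set" where
  "triples = {(i, j, k). nt i < nt j \<and> nt j < nt k}"

definition minor3 :: "10 \<Rightarrow> 10 \<Rightarrow> 10 \<Rightarrow> form3" where
  "minor3 i j k x y z = x$i * (y$j * z$k - y$k * z$j) - x$j * (y$i * z$k - y$k * z$i)
     + x$k * (y$i * z$j - y$j * z$i)"

definition form_of :: "(10 \<times> 10 \<times> 10 \<Rightarrow> complex) \<Rightarrow> form3" where
  "form_of c x y z = (\<Sum>(i, j, k)\<in>triples. c (i, j, k) * minor3 i j k x y z)"

definition cds :: "form3 \<Rightarrow> 10 \<times> 10 \<times> 10 \<Rightarrow> complex" where
  "cds \<sigma> = (\<lambda>(i, j, k). \<sigma> (ee i) (ee j) (ee k))"

lemma minor3_alternating: "minor3 i j k \<in> alternating_forms"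
  by (rule alternating_formsI) (simp_all add: minor3_def algebra_simps)

lemma form_of_alternating: "form_of c \<in> alternating_forms"
proof -
  interpret m: trivector "minor3 i j k" for i j k by unfold_locales (rule minor3_alternating)
  show ?thesis
    by (rule alternating_formsI)
      (simp_all add: form_of_def m.linear case_prod_unfold sum.distrib sum_distrib_left algebra_simps)
qed

lemma minor3_axis:
  assumes "nt i < nt j" "nt j < nt k" "nt a < nt b" "nt b < nt c"
  shows "minor3 i j k (ee a) (ee b) (ee c) = (if i = a \<and> j = b \<and> k = c then 1 else 0)"
proof -
  have "i \<noteq> j" "j \<noteq> k" "i \<noteq> k" "a \<noteq> b" "b \<noteq> c" "a \<noteq> c" using assms by auto
  then show ?thesis using assms by (auto simp: minor3_def axis_nth)
qed

lemma form_of_axis: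
  assumes "(a, b, c) \<in> triples"
  shows "form_of f (ee a) (ee b) (ee c) = f (a, b, c)"
proof -
  have "form_of f (ee a) (ee b) (ee c) = (\<Sum>t\<in>triples. if t = (a, b, c) then f (a, b, c) else 0)"
    unfolding form_of_def
    by (rule sum.cong) (use assms in \<open>auto simp: triples_def minor3_axis split: if_splits\<close>)
  then show ?thesis using assms by simp
qed

lemma alternating_eqI:
  assumes "\<sigma> \<in> alternating_forms" "\<tau> \<in> alternating_forms" "\<And>t. t \<in> triples \<Longrightarrow> cds \<sigma> t = cds \<tau> t"
  shows "\<sigma> = \<tau>"
proof -
  interpret s: trivector \<sigma> by unfold_locales fact
  interpret t: trivector \<tau> by unfold_locales fact
  define eq where "eq i j k \<longleftrightarrow> \<sigma> (ee i) (ee j) (ee k) = \<tau> (ee i) (ee j) (ee k)" for i j k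
  have sorted: "eq i j k" if "nt i < nt j" "nt j < nt k" for i j k
    using assms(3)[of "(i, j, k)"] that by (simp add: triples_def cds_def eq_def)
  have s12: "eq i j k \<Longrightarrow> eq j i k" and s23: "eq i j k \<Longrightarrow> eq i k j" for i j k
    unfolding eq_def using s.swap12[of "ee j" "ee i" "ee k"] t.swap12[of "ee j" "ee i" "ee k"]
      s.swap23[of "ee i" "ee k" "ee j"] t.swap23[of "ee i" "ee k" "ee j"] by simp_all
  have "eq i j k" for i j k
  proof (cases "i = j \<or> j = k \<or> i = k")
    case True
    then show ?thesis by (auto simp: eq_def)
  next
    case False
    then have "nt i \<noteq> nt j" "nt j \<noteq> nt k" "nt i \<noteq> nt k" by (auto simp: nt_eq_iff)
    then consider "nt i < nt j" "nt j < nt k" | "nt i < nt k" "nt k < nt j" | "nt j < nt i" "nt i < nt k"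
      | "nt j < nt k" "nt k < nt i" | "nt k < nt i" "nt i < nt j" | "nt k < nt j" "nt j < nt i"
      by linarith
    then show ?thesis by cases (blast intro: sorted s12 s23)+
  qed
  then show ?thesis
    by (intro ext) (subst s.expand, subst t.expand, simp add: eq_def)
qed

lemma form_of_cds: "\<sigma> \<in> alternating_forms \<Longrightarrow> form_of (cds \<sigma>) = \<sigma>"
  by (rule alternating_eqI[OF form_of_alternating]) (auto simp: cds_def form_of_axis)

lemma form_of_cong: "(\<And>t. t \<in> triples \<Longrightarrow> c t = d t) \<Longrightarrow> form_of c = form_of d"
  unfolding form_of_def by (intro ext sum.cong) auto

lemma cds_poly:
  assumes "R \<in> poly_functions (coords J)"
  shows "(\<lambda>\<sigma>. R (cds \<sigma>)) \<in> form_polys"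
proof (rule poly_functions_compose[OF assms])
  fix g assume "g \<in> coords J"
  then obtain i j k where g: "g = (\<lambda>x. x (i, j, k))" by auto
  show "(\<lambda>\<sigma>. g (cds \<sigma>)) \<in> form_polys"
    unfolding g by (rule poly_functions.gen) (auto simp: cds_def)
qed

lemma form_of_poly:
  assumes "\<And>t. t \<in> triples \<Longrightarrow> (\<lambda>x. c x t) \<in> poly_functions G"
  shows "(\<lambda>x. form_of (c x) u v w) \<in> poly_functions G"
  unfolding form_of_def case_prod_unfold
  by (intro poly_functions_sum poly_functions.mult poly_functions.const) (use assms in auto)

text \<open>The omitted coordinate is the value on the standard three-dimensional space itself, the
  one that \<open>D_3_3_10_dominant\<close> adjusts. The remaining 119 match the dimension of the
  divisor.\<close>

definition triples' :: "(10 \<times> 10 \<times> 10) set" where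
  "triples' = triples - {(ix 0, ix 1, ix 2)}"

lemma card_triples': "card triples' = 119"
proof -
  have "bij_betw (\<lambda>(i, j, k). (nt i, nt j, nt k)) triples {(i, j, k). i < j \<and> j < k \<and> k < 10}"
    by (rule bij_betw_byWitness[where f' = "\<lambda>(i, j, k). (ix i, ix j, ix k)"])
      (auto simp: triples_def)
  then have "card triples = card {(i, j, k). i < j \<and> j < k \<and> k < (10::nat)}"
    by (rule bij_betw_same_card)
  also have "{(i, j, k). i < j \<and> j < k \<and> k < (10::nat)} =
      set (filter (\<lambda>(i, j, k). i < j \<and> j < k) (List.product [0..<10] (List.product [0..<10] [0..<10])))"
    by auto
  also have "card \<dots> = length (filter (\<lambda>(i, j, k). i < j \<and> j < k) (List.product [0..<10] (List.product [0..<10] [0..<10::nat])))"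
    by (intro distinct_card distinct_filter distinct_product) auto
  also have "\<dots> = 120" by code_simp
  finally have "card triples = 120" .
  moreover have "(ix 0, ix 1, ix 2) \<in> triples" by (simp add: triples_def)
  ultimately show ?thesis by (simp add: triples'_def)
qed

lemma independent_to_matrix:
  fixes w :: "nat \<Rightarrow> V10"
  assumes "inj_on w {..<m}" "vec.independent (w ` {..<m})"
  shows "\<exists>f :: complex^10^10. det f \<noteq> 0 \<and> (\<forall>i. nt i < m \<longrightarrow> f *v ee i = w (nt i))"
proof -
  obtain B where B: "w ` {..<m} \<subseteq> B" "vec.independent B" "UNIV \<subseteq> vec.span B"
    using vec.maximal_independent_subset_extend[OF subset_UNIV assms(2)] by metis
  have cB: "card B = 10"
    using vec.basis_card_eq_dim[OF subset_UNIV B(3) B(2)] by (simp add: card_cart_basis)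
  have fB: "finite B" using cB by (simp add: card_ge_0_finite)
  have cw: "card (w ` {..<m}) = m" using assms(1) by (simp add: card_image)
  then have m: "m \<le> 10" using card_mono[OF fB B(1)] cB by simp
  have "card (B - w ` {..<m}) = card {m..<10}"
    using B(1) cB cw fB by (simp add: card_Diff_subset finite_subset)
  then obtain g where g: "bij_betw g {m..<10} (B - w ` {..<m})"
    using fB finite_same_card_bij by (metis finite_Diff finite_atLeastLessThan)
  define b where "b k = (if k < m then w k else g k)" for k
  have "bij_betw b ({..<m} \<union> {m..<10}) (w ` {..<m} \<union> (B - w ` {..<m}))"
  proof (rule bij_betw_combine)
    show "bij_betw b {..<m} (w ` {..<m})"
      using inj_on_imp_bij_betw[OF assms(1)] by (rule bij_betw_cong[THEN iffD1, rotated]) (simp add: b_def)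
    show "bij_betw b {m..<10} (B - w ` {..<m})"
      using g by (rule bij_betw_cong[THEN iffD1, rotated]) (simp add: b_def)
  qed auto
  moreover have "{..<m} \<union> {m..<10} = {..<10}" using m by auto
  moreover have "w ` {..<m} \<union> (B - w ` {..<m}) = B" using B(1) by auto
  ultimately have b: "bij_betw b {..<10} B" by simp
  define f :: "complex^10^10" where "f = (\<chi> r i. b (nt i) $ r)"
  have fe: "f *v ee i = b (nt i)" for i by (simp add: f_def matrix_vector_axis)
  have "f *v x = 0 \<Longrightarrow> x = 0" for x
  proof -
    assume "f *v x = 0"
    then have "(\<Sum>i\<in>UNIV. x $ i *s b (nt i)) = 0"
      by (simp add: f_def vec_eq_iff matrix_vector_mult_def mult.commute)
    then have "(\<Sum>k<10. x $ ix k *s b k) = 0" by (simp add: sum_UNIV_ix)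
    moreover have "(\<Sum>k<10. x $ ix k *s b k) = (\<Sum>v\<in>B. x $ ix (inv_into {..<10} b v) *s v)"
    proof -
      have "(\<Sum>k<10. x $ ix k *s b k) = (\<Sum>k<10. x $ ix (inv_into {..<10} b (b k)) *s b k)"
        using b by (intro sum.cong refl) (simp add: bij_betw_def inv_into_f_f)
      also have "\<dots> = (\<Sum>v\<in>B. x $ ix (inv_into {..<10} b v) *s v)"
        by (rule sum.reindex_bij_betw[OF b])
      finally show ?thesis .
    qed
    ultimately have z: "x $ ix (inv_into {..<10} b v) = 0" if "v \<in> B" for v
      using B(2)[unfolded vec.independent_explicit, THEN conjunct2, rule_format,
          of "\<lambda>v. x $ ix (inv_into {..<10} b v)"] that by simp
    have "x $ i = 0" for i
      using z[of "b (nt i)"] b by (auto simp: bij_betw_def inv_into_f_f)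
    then show "x = 0" by (simp add: vec_eq_iff)
  qed
  then have "\<exists>C. C ** f = mat 1" using matrix_left_invertible_ker[of f] by blast
  then have "invertible f" unfolding invertible_def using matrix_left_right_inverse by blast
  then have "det f \<noteq> 0" by (simp add: invertible_det_nz)
  then show ?thesis using fe by (intro exI[of _ f]) (simp add: b_def)
qed

section \<open>Hypersurfaces containing special forms\<close>

text \<open>\<open>P\<close> is prescribed for ordered triples only. Forms are alternating, so the
  vanishing spreads to all permutations, and \<open>sym3\<close> marks the coordinates that are
  actually lost.\<close>

definition sym3 :: "(nat \<Rightarrow> nat \<Rightarrow> nat \<Rightarrow> bool) \<Rightarrow> nat \<Rightarrow> nat \<Rightarrow> nat \<Rightarrow> bool" where
  "sym3 P a b c \<longleftrightarrow> P a b c \<or> P a c b \<or> P b a c \<or> P b c a \<or> P c a b \<or> P c b a"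

definition vanishing :: "(nat \<Rightarrow> nat \<Rightarrow> nat \<Rightarrow> bool) \<Rightarrow> form3 set" where
  "vanishing P = {L \<in> alternating_forms. \<forall>a b c. P (nt a) (nt b) (nt c) \<longrightarrow> L (ee a) (ee b) (ee c) = 0}"

lemma vanishing_form_of:
  assumes "L \<in> vanishing P"
  shows "L = form_of (\<lambda>(i, j, k). if sym3 P (nt i) (nt j) (nt k) then 0 else cds L (i, j, k))"
proof -
  have alt: "L \<in> alternating_forms" using assms by (simp add: vanishing_def)
  then interpret trivector L by unfold_locales
  have "cds L (i, j, k) = 0" if "sym3 P (nt i) (nt j) (nt k)" for i j k
    using that assms swap12[of "ee i" "ee j" "ee k"] swap23[of "ee i" "ee j" "ee k"] swap13[of "ee i" "ee j" "ee k"]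
      rotate[of "ee i" "ee j" "ee k"] rotate[of "ee k" "ee i" "ee j"]
    unfolding sym3_def vanishing_def cds_def by fastforce
  then have "form_of (cds L) = form_of (\<lambda>(i, j, k). if sym3 P (nt i) (nt j) (nt k) then 0 else cds L (i, j, k))"
    by (intro form_of_cong) auto
  then show ?thesis using form_of_cds[OF alt] by simp
qed

lemma vanishing_scale: "L \<in> vanishing P \<Longrightarrow> (\<lambda>x y z. c * L x y z) \<in> vanishing P"
  by (simp add: vanishing_def scale_alternating)

lemma vanishing_pull:
  assumes "L \<in> vanishing P" "\<And>k j. \<not> E (nt k) (nt j) \<Longrightarrow> q $ k $ j = 0"
    and closed: "\<And>a b c a' b' c'. P a b c \<Longrightarrow> E a' a \<Longrightarrow> E b' b \<Longrightarrow> E c' c \<Longrightarrow> P a' b' c'"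
  shows "pull L q \<in> vanishing P"
proof -
  have alt: "L \<in> alternating_forms" using assms by (simp add: vanishing_def)
  then interpret trivector L by unfold_locales
  have "pull L q (ee a) (ee b) (ee c) = 0" if "P (nt a) (nt b) (nt c)" for a b c
  proof -
    have "q $ i $ a * q $ j $ b * q $ k $ c * L (ee i) (ee j) (ee k) = 0" for i j k
      using assms(1) assms(2)[of i a] assms(2)[of j b] assms(2)[of k c] closed[OF that, of "nt i" "nt j" "nt k"]
      by (auto simp: vanishing_def)
    then show ?thesis unfolding pull_def
      by (subst expand, intro sum.neutral ballI) (simp add: matrix_vector_axis)
  qed
  then show ?thesis using pull_alternating[OF alt] by (simp add: vanishing_def)
qed

type_synonym chart_var = "10 \<times> 10 + 10 \<times> 10 \<times> 10"

text \<open>The two kinds of parameters of a family member: the free entries of \<open>N\<close>,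
  which move the flag, and the coordinates of the form that are not forced to vanish.\<close>

definition chart_vars :: "(nat \<Rightarrow> nat \<Rightarrow> nat \<Rightarrow> bool) \<Rightarrow> (nat \<Rightarrow> nat \<Rightarrow> bool) \<Rightarrow> chart_var set" where
  "chart_vars P E = Inl ` {(i, j). \<not> E (nt i) (nt j)} \<union>
     Inr ` {(i, j, k). (i, j, k) \<in> triples \<and> \<not> sym3 P (nt i) (nt j) (nt k)}"

definition chart_mat :: "(nat \<Rightarrow> nat \<Rightarrow> bool) \<Rightarrow> (chart_var \<Rightarrow> complex) \<Rightarrow> complex^10^10" where
  "chart_mat E x = (\<chi> i j. if E (nt i) (nt j) then 0 else x (Inl (i, j)))"

definition chart_form :: "(nat \<Rightarrow> nat \<Rightarrow> nat \<Rightarrow> bool) \<Rightarrow> (chart_var \<Rightarrow> complex) \<Rightarrow> form3" where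
  "chart_form P x = form_of (\<lambda>(i, j, k).
     if (i, j, k) \<notin> triples \<or> sym3 P (nt i) (nt j) (nt k) then 0 else x (Inr (i, j, k)))"

lemma card_chart_vars:
  "card (chart_vars P E) \<le> length (filter (\<lambda>(i, j). \<not> E i j) (List.product [0..<10] [0..<10])) +
      length (filter (\<lambda>(i, j, k). i < j \<and> j < k \<and> \<not> sym3 P i j k)
        (List.product [0..<10] (List.product [0..<10] [0..<10])))"
proof -
  define IA where "IA = {(i, j). \<not> E (nt i) (nt j)}"
  define IB where "IB = {(i, j, k). (i, j, k) \<in> triples \<and> \<not> sym3 P (nt i) (nt j) (nt k)}"
  have "card IA \<le> length (filter (\<lambda>(i, j). \<not> E i j) (List.product [0..<10] [0..<10]))"
  proof -
    have "IA \<subseteq> (\<lambda>(i, j). (ix i, ix j)) ` set (filter (\<lambda>(i, j). \<not> E i j) (List.product [0..<10] [0..<10]))"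
      by (force simp: IA_def image_iff intro!: bexI[of _ "(nt _, nt _)"])
    from card_mono[OF _ this] show ?thesis
      using card_image_le card_length by (meson List.finite_set finite_imageI le_trans)
  qed
  moreover have "card IB \<le> length (filter (\<lambda>(i, j, k). i < j \<and> j < k \<and> \<not> sym3 P i j k)
        (List.product [0..<10] (List.product [0..<10] [0..<10])))"
  proof -
    have "IB \<subseteq> (\<lambda>(i, j, k). (ix i, ix j, ix k)) ` set (filter (\<lambda>(i, j, k). i < j \<and> j < k \<and> \<not> sym3 P i j k)
        (List.product [0..<10] (List.product [0..<10] [0..<10])))"
      by (force simp: IB_def triples_def image_iff intro!: bexI[of _ "(nt _, nt _, nt _)"])
    from card_mono[OF _ this] show ?thesis
      using card_image_le card_length by (meson List.finite_set finite_imageI le_trans)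
  qed
  moreover have "card (chart_vars P E) = card IA + card IB"
    unfolding chart_vars_def IA_def IB_def by (subst card_Un_disjoint) (auto simp: card_image)
  ultimately show ?thesis by linarith
qed

lemma chart_mat_poly: "(\<lambda>x. chart_mat E x $ i $ j) \<in> poly_functions (coords (chart_vars P E))"
  by (cases "E (nt i) (nt j)") (auto simp: chart_mat_def chart_vars_def intro!: poly_functions.const poly_coord)

lemma chart_form_poly: "(\<lambda>x. chart_form P x u v w) \<in> poly_functions (coords (chart_vars P E))"
  unfolding chart_form_def
proof (rule form_of_poly)
  fix t :: "10 \<times> 10 \<times> 10"
  show "(\<lambda>x. (case t of (i, j, k) \<Rightarrow> if (i, j, k) \<notin> triples \<or> sym3 P (nt i) (nt j) (nt k) then 0 else x (Inr (i, j, k))))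
    \<in> poly_functions (coords (chart_vars P E))"
  proof (cases t)
    case (fields i j k)
    show ?thesis unfolding fields
      by (cases "(i, j, k) \<notin> triples \<or> sym3 P (nt i) (nt j) (nt k)")
        (auto simp: chart_vars_def intro!: poly_functions.const poly_coord)
  qed
qed

lemma chart_form_alternating: "chart_form P x \<in> alternating_forms"
  by (simp add: chart_form_def form_of_alternating)

lemma chart_pull_poly:
  "(\<lambda>x. cds (pull (chart_form P x) (adj (mat 1 + chart_mat E x))) t) \<in> poly_functions (coords (chart_vars P E))"
proof -
  obtain i j k where t: "t = (i, j, k)" by (cases t)
  have 1: "(\<lambda>x. (mat 1 + chart_mat E x) $ a $ b) \<in> poly_functions (coords (chart_vars P E))" for a b
    by (simp add: poly_functions.add[OF poly_functions.const chart_mat_poly])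
  show ?thesis unfolding t cds_def prod.case
  proof (rule poly_functions_pull[where L = "chart_form P" and A = "\<lambda>x. adj (mat 1 + chart_mat E x)"])
    show "(\<lambda>x. adj (mat 1 + chart_mat E x) $ i $ j) \<in> poly_functions (coords (chart_vars P E))" for i j
      by (rule poly_functions_adj) (rule 1)
  qed (rule chart_form_alternating chart_form_poly)+
qed

lemma chart_surj:
  assumes M: "M \<in> vanishing P" and N: "\<And>i j. E (nt i) (nt j) \<Longrightarrow> N $ i $ j = 0"
  shows "\<exists>x. chart_form P x = M \<and> chart_mat E x = N"
proof -
  define x where "x v = (case v of Inl (i, j) \<Rightarrow> N $ i $ j | Inr t \<Rightarrow> cds M t)" for v
  have "chart_mat E x = N" using N by (simp add: chart_mat_def x_def vec_eq_iff)
  moreover have "chart_form P x = M" unfolding chart_form_def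
    by (rule trans[OF form_of_cong vanishing_form_of[OF M, symmetric]]) (auto simp: x_def)
  ultimately show ?thesis by blast
qed

text \<open>\<open>P\<close> marks coordinates that vanish, \<open>E\<close> the matrix entries of a linear group preserving
  this condition. A generic member of the family is \<open>pull L (adj (mat 1 + N))\<close> with \<open>N\<close> supported
  off \<open>E\<close>, so \<open>count\<close> bounds the dimension of the family by 118.\<close>

lemma special_hypersurface:
  fixes P :: "nat \<Rightarrow> nat \<Rightarrow> nat \<Rightarrow> bool" and E :: "nat \<Rightarrow> nat \<Rightarrow> bool"
  assumes E_refl: "\<And>i. E i i"
    and closed: "\<And>a b c a' b' c'. P a b c \<Longrightarrow> E a' a \<Longrightarrow> E b' b \<Longrightarrow> E c' c \<Longrightarrow> P a' b' c'"
    and count: "length (filter (\<lambda>(i, j). \<not> E i j) (List.product [0..<10] [0..<10])) +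
      length (filter (\<lambda>(i, j, k). i < j \<and> j < k \<and> \<not> sym3 P i j k)
        (List.product [0..<10] (List.product [0..<10] [0..<10]))) < 119"
  shows "\<exists>R\<in>poly_functions (coords triples'). (\<exists>y. R y \<noteq> 0) \<and>
    (\<forall>\<sigma>\<in>alternating_forms. \<forall>f. det f \<noteq> 0 \<longrightarrow> pull \<sigma> f \<in> vanishing P \<longrightarrow> R (cds \<sigma>) = 0)"
proof -
  have cI: "card (chart_vars P E) < card triples'"
    using card_chart_vars[of P E] count unfolding card_triples' by linarith
  define \<Psi> where "\<Psi> t x = cds (pull (chart_form P x) (adj (mat 1 + chart_mat E x))) t" for t x
  have "\<Psi> t \<in> poly_functions (coords (chart_vars P E))" for t
    unfolding \<Psi>_def by (rule chart_pull_poly)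
  then obtain R y where R: "R \<in> poly_functions (coords triples')" "R y \<noteq> 0" "\<And>x. R (\<lambda>t. \<Psi> t x) = 0"
    using algebraically_dependent[of "chart_vars P E" triples' \<Psi>] cI by auto
  have "R (cds \<sigma>) = 0" if \<sigma>: "\<sigma> \<in> alternating_forms" and f: "det f \<noteq> 0" "pull \<sigma> f \<in> vanishing P" for \<sigma> f
  proof (rule chart[where E = "\<lambda>i j. E (nt i) (nt j)" and B = "vanishing P", OF cds_poly[OF R(1)]])
    show "vanishing P \<subseteq> alternating_forms" by (auto simp: vanishing_def)
  next
    fix M and q :: "complex^10^10" assume "M \<in> vanishing P" "\<And>k j. \<not> E (nt k) (nt j) \<Longrightarrow> q $ k $ j = 0"
    then show "pull M q \<in> vanishing P" using closed by (rule vanishing_pull)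
  next
    fix M and N :: "complex^10^10" assume "M \<in> vanishing P" "\<And>i j. E (nt i) (nt j) \<Longrightarrow> N $ i $ j = 0"
    then obtain x where "chart_form P x = M" "chart_mat E x = N" using chart_surj by blast
    then have "(\<lambda>t. \<Psi> t x) = cds (pull M (adj (mat 1 + N)))" by (simp add: \<Psi>_def)
    then show "R (cds (pull M (adj (mat 1 + N)))) = 0" using R(3)[of x] by simp
  qed (use E_refl f \<sigma> vanishing_scale in auto)
  then show ?thesis using R(1,2) by blast
qed

section \<open>Four forbidden configurations, each with 118 parameters\<close>

definition plane3 :: "nat \<Rightarrow> nat \<Rightarrow> nat \<Rightarrow> bool" where
  "plane3 a b c \<longleftrightarrow> a < 3 \<and> b < 3"

text \<open>A vector of the plane whose radical contains a six-dimensional space around the plane,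
  so that its skew form has rank at most 4. The flag of dimensions 1, 3, 6 has 35 parameters and the
  form 83.\<close>

lemma hypersurface_rank4_pencil:
  "\<exists>R\<in>poly_functions (coords triples'). (\<exists>y. R y \<noteq> 0) \<and> (\<forall>\<sigma>\<in>alternating_forms. \<forall>f. det f \<noteq> 0 \<longrightarrow>
     pull \<sigma> f \<in> vanishing (\<lambda>a b c. plane3 a b c \<or> a = 0 \<and> b < 6) \<longrightarrow> R (cds \<sigma>) = 0)"
  by (rule special_hypersurface[where E = "\<lambda>i j. if j = 0 then i = 0 else if j < 3 then i < 3 else if j < 6 then i < 6 else True"])
    (simp, force simp: plane3_def split: if_splits, unfold plane3_def sym3_def, code_simp)

text \<open>Two isotropic planes in direct sum: 42 parameters for the pair and 76 for the
  form.\<close>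

lemma hypersurface_second_plane:
  "\<exists>R\<in>poly_functions (coords triples'). (\<exists>y. R y \<noteq> 0) \<and> (\<forall>\<sigma>\<in>alternating_forms. \<forall>f. det f \<noteq> 0 \<longrightarrow>
     pull \<sigma> f \<in> vanishing (\<lambda>a b c. plane3 a b c \<or> 3 \<le> a \<and> a < 6 \<and> 3 \<le> b \<and> b < 6) \<longrightarrow> R (cds \<sigma>) = 0)"
  by (rule special_hypersurface[where E = "\<lambda>i j. if j < 3 then i < 3 else if j < 6 then 3 \<le> i \<and> i < 6 else True"])
    (simp, force simp: plane3_def split: if_splits, unfold plane3_def sym3_def, code_simp)

text \<open>A flag of dimensions 3, 5, 7 has 37 parameters, and 81 coordinates of the form
  survive.\<close>

lemma hypersurface_isotropic_flag:
  "\<exists>R\<in>poly_functions (coords triples'). (\<exists>y. R y \<noteq> 0) \<and> (\<forall>\<sigma>\<in>alternating_forms. \<forall>f. det f \<noteq> 0 \<longrightarrow>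
     pull \<sigma> f \<in> vanishing (\<lambda>a b c. plane3 a b c \<or> a < 5 \<and> b < 5 \<and> c < 7) \<longrightarrow> R (cds \<sigma>) = 0)"
  by (rule special_hypersurface[where E = "\<lambda>i j. if j < 3 then i < 3 else if j < 5 then i < 5 else if j < 7 then i < 7 else True"])
    (simp, force simp: plane3_def split: if_splits, unfold plane3_def sym3_def, code_simp)

text \<open>The skew form of vector 3 vanishes on an eight-dimensional space, so it has rank at most
  4, and vector 0 of the plane lies in its radical. The configuration has 40 parameters and the form
  78.\<close>

lemma hypersurface_rank4_point:
  "\<exists>R\<in>poly_functions (coords triples'). (\<exists>y. R y \<noteq> 0) \<and> (\<forall>\<sigma>\<in>alternating_forms. \<forall>f. det f \<noteq> 0 \<longrightarrow>
     pull \<sigma> f \<in> vanishing (\<lambda>a b c. plane3 a b c \<or> a = 3 \<and> b = 0 \<or> a = 3 \<and> b < 8 \<and> c < 8) \<longrightarrow> R (cds \<sigma>) = 0)"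
  by (rule special_hypersurface[where E = "\<lambda>i j. if j = 0 then i = 0 else if j < 3 then i < 3 else
      if j = 3 then i = 3 else if j < 8 then i < 8 else True"])
    (simp, force simp: plane3_def split: if_splits, unfold plane3_def sym3_def, code_simp)

section \<open>The divisor in coordinates\<close>

lemma vanishing_plane3I:
  assumes "M \<in> alternating_forms" "\<And>i j k. nt i < nt j \<Longrightarrow> nt j < nt k \<Longrightarrow> nt j < 3 \<Longrightarrow> M (ee i) (ee j) (ee k) = 0"
  shows "M \<in> vanishing plane3"
proof -
  interpret trivector M by unfold_locales fact
  define z where "z i j k \<longleftrightarrow> M (ee i) (ee j) (ee k) = 0" for i j k
  have s12: "z i j k \<Longrightarrow> z j i k" and s23: "z i j k \<Longrightarrow> z i k j" for i j k
    unfolding z_def using swap12[of "ee j" "ee i" "ee k"] swap23[of "ee i" "ee k" "ee j"] by simp_all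
  have sorted: "z i j k" if "nt i < nt j" "nt j < nt k" "nt j < 3" for i j k
    using assms(2) that by (simp add: z_def)
  have "z a b c" if ab: "nt a < 3" "nt b < 3" for a b c
  proof (cases "a = b \<or> b = c \<or> a = c")
    case True
    then show ?thesis by (auto simp: z_def)
  next
    case False
    then have "nt a \<noteq> nt b" "nt b \<noteq> nt c" "nt a \<noteq> nt c" by (auto simp: nt_eq_iff)
    then consider "nt a < nt b" "nt b < nt c" | "nt a < nt c" "nt c < nt b" | "nt b < nt a" "nt a < nt c"
      | "nt b < nt c" "nt c < nt a" | "nt c < nt a" "nt a < nt b" | "nt c < nt b" "nt b < nt a"
      by linarith
    then show ?thesis
    proof cases
      case 1 then show ?thesis using ab by (intro sorted) auto
    next
      case 2 then show ?thesis using ab by (intro s23[of a c b] sorted) auto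
    next
      case 3 then show ?thesis using ab by (intro s12[of b a c] sorted) auto
    next
      case 4 then show ?thesis using ab by (intro s12[of b a c] s23[of b c a] sorted) auto
    next
      case 5 then show ?thesis using ab by (intro s23[of a c b] s12[of c a b] sorted) auto
    next
      case 6 then show ?thesis using ab by (intro s12[of b a c] s23[of b c a] s12[of c b a] sorted) auto
    qed
  qed
  then show ?thesis using assms(1) by (simp add: vanishing_def plane3_def z_def)
qed

lemma plane3_vanish:
  assumes "L \<in> vanishing plane3" "\<And>i. 3 \<le> nt i \<Longrightarrow> x $ i = 0" "\<And>i. 3 \<le> nt i \<Longrightarrow> y $ i = 0"
  shows "L x y z = 0"
proof -
  interpret trivector L using assms(1) by unfold_locales (simp add: vanishing_def)
  have "x $ i * y $ j * z $ k * L (ee i) (ee j) (ee k) = 0" for i j k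
    using assms by (cases "nt i < 3 \<and> nt j < 3") (auto simp: vanishing_def plane3_def not_less)
  then show ?thesis by (subst expand, intro sum.neutral ballI)
qed

lemma card_nt_less: "m \<le> 10 \<Longrightarrow> card {i. nt i < m} = m"
proof -
  assume "m \<le> 10"
  then have "bij_betw nt {i. nt i < m} {..<m}"
    by (intro bij_betw_byWitness[where f' = ix]) auto
  then show ?thesis using bij_betw_same_card by fastforce
qed

lemma D_3_3_10_iff:
  "\<sigma> \<in> D_3_3_10 \<longleftrightarrow> \<sigma> \<in> alternating_forms \<and> (\<exists>f. det f \<noteq> 0 \<and> pull \<sigma> f \<in> vanishing plane3)"
proof (intro iffI conjI)
  assume D: "\<sigma> \<in> D_3_3_10"
  then show alt: "\<sigma> \<in> alternating_forms" by (simp add: D_3_3_10_def)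
  obtain V where V: "vec.subspace V" "vec.dim V = 3" "\<And>x y z. x \<in> V \<Longrightarrow> y \<in> V \<Longrightarrow> \<sigma> x y z = 0"
    using D by (auto simp: D_3_3_10_def)
  obtain B where B: "B \<subseteq> V" "vec.independent B" "card B = 3"
    using vec.basis_exists V(2) by metis
  then obtain w where w: "bij_betw w {..<3::nat} B"
    using ex_bij_betw_nat_finite[of B] by (metis atLeast0LessThan card.infinite zero_neq_numeral)
  then have "inj_on w {..<3}" "w ` {..<3} = B" by (auto simp: bij_betw_def)
  then obtain f where f: "det f \<noteq> 0" "\<And>i. nt i < 3 \<Longrightarrow> f *v ee i = w (nt i)"
    using independent_to_matrix[of w 3] B by metis
  have wV: "w k \<in> V" if "k < 3" for k
    using \<open>w ` {..<3} = B\<close> B(1) that by blast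
  have "pull \<sigma> f (ee a) (ee b) (ee c) = 0" if "nt a < 3" "nt b < 3" for a b c
    using that by (simp add: pull_def f(2) V(3) wV)
  then have "pull \<sigma> f \<in> vanishing plane3"
    using pull_alternating[OF alt] by (simp add: vanishing_def plane3_def)
  then show "\<exists>f. det f \<noteq> 0 \<and> pull \<sigma> f \<in> vanishing plane3" using f(1) by blast
next
  assume "\<sigma> \<in> alternating_forms \<and> (\<exists>f. det f \<noteq> 0 \<and> pull \<sigma> f \<in> vanishing plane3)"
  then obtain f where alt: "\<sigma> \<in> alternating_forms" and f: "det f \<noteq> 0" "pull \<sigma> f \<in> vanishing plane3" by blast
  define C where "C = {x :: V10. \<forall>i. i \<notin> {i. nt i < 3} \<longrightarrow> x $ i = 0}"
  have dC: "vec.dim C = 3" unfolding C_def by (subst dim_substandard_cart) (simp add: card_nt_less)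
  have sC: "vec.subspace C" unfolding C_def vec.subspace_def by auto
  have inj: "inj ((*v) f)"
    using f(1) by (metis adj_left_vec injI vec.scale_left_imp_eq)
  have "\<sigma> x y z = 0" if "x \<in> (*v) f ` C" "y \<in> (*v) f ` C" for x y z
  proof -
    obtain u v where u: "x = f *v u" "u \<in> C" "y = f *v v" "v \<in> C" using \<open>x \<in> _\<close> \<open>y \<in> _\<close> by blast
    have z: "z = f *v ((1 / det f) *s (adj f *v z))"
      using adj_right_vec[OF f(1), of z] f(1) by (simp add: vec.scale)
    have "pull \<sigma> f u v ((1 / det f) *s (adj f *v z)) = 0"
      using u(2,4) by (intro plane3_vanish[OF f(2)]) (auto simp: C_def)
    then show ?thesis using z by (simp add: pull_def u)
  qed
  moreover have "vec.dim ((*v) f ` C) = 3"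
    using vec.dim_image_eq[OF matrix_vector_mul_linear_gen, of f C] inj dC by (simp add: inj_on_subset)
  moreover have "vec.subspace ((*v) f ` C)" by (rule vec.subspace_image[OF sC])
  ultimately show "\<sigma> \<in> D_3_3_10" unfolding D_3_3_10_def using alt by blast
qed

text \<open>Members of the divisor come from pairs of an invertible matrix and a form vanishing on
  the standard plane. Two such pairs are joined by a line, along which \<open>h1\<close>,
  \<open>h2\<close> and the determinant of the matrix are polynomials in \<open>t\<close>.\<close>

lemma D_3_3_10_irreducible:
  assumes h: "h1 \<in> form_polys" "h2 \<in> form_polys"
    and s: "\<sigma>1 \<in> D_3_3_10" "\<sigma>2 \<in> D_3_3_10" "h1 \<sigma>1 \<noteq> 0" "h2 \<sigma>2 \<noteq> 0"
  shows "\<exists>\<sigma>\<in>D_3_3_10. h1 \<sigma> \<noteq> 0 \<and> h2 \<sigma> \<noteq> 0"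
proof -
  have "\<exists>f L. det f \<noteq> 0 \<and> L \<in> vanishing plane3 \<and> \<sigma> = pull L (adj f)" if "\<sigma> \<in> D_3_3_10" for \<sigma>
  proof -
    obtain f where alt: "\<sigma> \<in> alternating_forms" and f: "det f \<noteq> 0" "pull \<sigma> f \<in> vanishing plane3"
      using \<open>\<sigma> \<in> _\<close> by (auto simp: D_3_3_10_iff)
    interpret trivector \<sigma> by unfold_locales fact
    have "\<sigma> = pull (\<lambda>x y z. 1 / det f ^ 3 * pull \<sigma> f x y z) (adj f)"
      using f(1) by (simp add: fun_eq_iff pull_def adj_right_vec linear power3_eq_cube)
    then show ?thesis using f vanishing_scale by blast
  qed
  then obtain f1 L1 f2 L2 where
    1: "det f1 \<noteq> 0" "L1 \<in> vanishing plane3" "\<sigma>1 = pull L1 (adj f1)" and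
    2: "det f2 \<noteq> 0" "L2 \<in> vanishing plane3" "\<sigma>2 = pull L2 (adj f2)" using s by metis
  define g :: "complex \<Rightarrow> complex^10^10" where "g t = (\<chi> i j. (1 - t) * f1 $ i $ j + t * f2 $ i $ j)" for t
  define L where "L t = (\<lambda>x y z. (1 - t) * L1 x y z + t * L2 x y z)" for t
  have LV: "L t \<in> vanishing plane3" for t
    using 1(2) 2(2) by (auto simp: L_def vanishing_def intro!: add_alternating scale_alternating)
  then have La: "L t \<in> alternating_forms" for t by (simp add: vanishing_def)
  have gp: "(\<lambda>t. g t $ i $ j) \<in> upoly" for i j
    by (auto simp: g_def intro!: poly_functions.add poly_functions.mult poly_functions_diff poly_functions.const upoly_id)
  have Lp: "(\<lambda>t. L t x y z) \<in> upoly" for x y z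
    by (auto simp: L_def intro!: poly_functions.add poly_functions.mult poly_functions_diff poly_functions.const upoly_id)
  define s where "s t = pull (L t) (adj (g t))" for t
  have sp: "(\<lambda>t. s t x y z) \<in> upoly" for x y z
    unfolding s_def by (rule poly_functions_pull[OF La Lp]) (rule poly_functions_adj, rule gp)
  have g01: "g 0 = f1" "g 1 = f2" and L01: "L 0 = L1" "L 1 = L2"
    by (simp_all add: g_def L_def vec_eq_iff)
  have "\<exists>t. \<forall>p\<in>{\<lambda>t. det (g t), \<lambda>t. h1 (s t), \<lambda>t. h2 (s t)}. p t \<noteq> 0"
  proof (rule upoly_common_nonzero)
    fix p assume "p \<in> {\<lambda>t. det (g t), \<lambda>t. h1 (s t), \<lambda>t. h2 (s t)}"
    moreover have "(\<lambda>t. h1 (s t)) \<in> upoly" "(\<lambda>t. h2 (s t)) \<in> upoly"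
      by (rule form_polys_path[of _ s], rule h, rule sp)+
    ultimately show "p \<in> upoly" using poly_functions_det[of g, OF gp] by blast
  next
    fix p assume "p \<in> {\<lambda>t. det (g t), \<lambda>t. h1 (s t), \<lambda>t. h2 (s t)}"
    moreover have "det (g 0) \<noteq> 0" "h1 (s 0) \<noteq> 0" "h2 (s 1) \<noteq> 0"
      using 1 2 s(3,4) by (simp_all add: g01 L01 s_def)
    ultimately show "\<exists>t. p t \<noteq> 0" by blast
  qed simp
  then obtain t where t: "det (g t) \<noteq> 0" "h1 (s t) \<noteq> 0" "h2 (s t) \<noteq> 0" by auto
  interpret L: trivector "L t" by unfold_locales (rule La)
  have "pull (s t) (g t) = (\<lambda>x y z. det (g t) ^ 3 * L t x y z)"
    by (simp add: fun_eq_iff s_def pull_def adj_left_vec[OF t(1)] L.linear power3_eq_cube)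
  then have "pull (s t) (g t) \<in> vanishing plane3" using vanishing_scale[OF LV] by simp
  then have "s t \<in> D_3_3_10" unfolding D_3_3_10_iff using t(1) by (auto simp: s_def pull_alternating La)
  then show ?thesis using t by blast
qed

section \<open>The linearized equations of a plane\<close>

text \<open>The cyclic successor on the first three indices: \<open>nx i\<close> and
  \<open>nx (nx i)\<close> are the two other than \<open>i\<close>, so a pair of basis vectors of
  the plane can be labelled by the index that it misses.\<close>

definition nx :: "10 \<Rightarrow> 10" where "nx i = ix ((nt i + 1) mod 3)"

text \<open>The plane spanned by the vectors \<open>ee i + t *s a i\<close> with \<open>nt i < 3\<close> stays isotropic to first order
  in \<open>t\<close> if and only if \<open>L (ee i) (a j) z = L (ee j) (a i) z\<close> for all \<open>z\<close>; \<open>jac L\<close> is the matrix of this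
  linear system, padded by the identity in the remaining components.\<close>

definition jac_entry :: "form3 \<Rightarrow> 10 \<Rightarrow> 10 \<Rightarrow> 10 \<Rightarrow> 10 \<Rightarrow> complex" where
  "jac_entry L i z c w =
    (if nt i < 3 \<and> 3 \<le> nt z then
       (if 3 \<le> nt w then
          (if c = nx (nx i) then L (ee (nx i)) (ee w) (ee z) else 0)
          - (if c = nx i then L (ee (nx (nx i))) (ee w) (ee z) else 0)
        else 0)
     else if i = c \<and> z = w then 1 else 0)"

definition jac :: "form3 \<Rightarrow> complex^(10 \<times> 10)^(10 \<times> 10)" where
  "jac L = (\<chi> r s. jac_entry L (fst r) (snd r) (fst s) (snd s))"

lemma jac_apply:
  "(jac L *v v) $ (i, z) = (if nt i < 3 \<and> 3 \<le> nt z then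
     (\<Sum>w\<in>{w. 3 \<le> nt w}. L (ee (nx i)) (ee w) (ee z) * v $ (nx (nx i), w)
        - L (ee (nx (nx i))) (ee w) (ee z) * v $ (nx i, w)) else v $ (i, z))"
proof -
  have "(jac L *v v) $ (i, z) = (\<Sum>(c, w)\<in>UNIV \<times> UNIV. jac_entry L i z c w * v $ (c, w))"
    by (simp add: jac_def matrix_vector_mult_def case_prod_unfold)
  also have "\<dots> = (\<Sum>w\<in>UNIV. \<Sum>c\<in>UNIV. jac_entry L i z c w * v $ (c, w))"
    by (subst sum.cartesian_product[symmetric]) (rule sum.swap)
  also have "\<dots> = (if nt i < 3 \<and> 3 \<le> nt z then
     (\<Sum>w\<in>{w. 3 \<le> nt w}. L (ee (nx i)) (ee w) (ee z) * v $ (nx (nx i), w)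
        - L (ee (nx (nx i))) (ee w) (ee z) * v $ (nx i, w)) else v $ (i, z))"
  proof (cases "nt i < 3 \<and> 3 \<le> nt z")
    case True
    have "(\<Sum>c\<in>UNIV. jac_entry L i z c w * v $ (c, w)) =
       (if 3 \<le> nt w then L (ee (nx i)) (ee w) (ee z) * v $ (nx (nx i), w)
        - L (ee (nx (nx i))) (ee w) (ee z) * v $ (nx i, w) else 0)" for w
      using True by (auto simp: jac_entry_def left_diff_distrib sum_subtractf if_distrib[of "\<lambda>a. a * _"] cong: if_cong)
    then have "(\<Sum>w\<in>UNIV. \<Sum>c\<in>UNIV. jac_entry L i z c w * v $ (c, w)) =
       (\<Sum>w\<in>UNIV. (if 3 \<le> nt w then L (ee (nx i)) (ee w) (ee z) * v $ (nx (nx i), w)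
        - L (ee (nx (nx i))) (ee w) (ee z) * v $ (nx i, w) else 0))" by simp
    then show ?thesis using True
      by (simp only: if_True) (simp add: sum.inter_filter[symmetric])
  next
    case False
    have "(\<Sum>c\<in>UNIV. jac_entry L i z c w * v $ (c, w)) = (if z = w then v $ (i, w) else 0)" for w
      using False by (auto simp: jac_entry_def if_distrib[of "\<lambda>a. a * _"] cong: if_cong)
    then show ?thesis using False by (simp only: if_False) simp
  qed
  finally show ?thesis .
qed

text \<open>The \<open>a i\<close> stand for a homomorphism from the plane to the quotient by it,
  that is, a tangent vector of the Grassmannian; the last clause says that this tangent vector is
  not zero.\<close>

definition degenerate :: "form3 \<Rightarrow> bool" where
  "degenerate L \<longleftrightarrow> (\<exists>a. (\<forall>i j z. nt i < 3 \<longrightarrow> nt j < 3 \<longrightarrow> L (ee i) (a j) z = L (ee j) (a i) z) \<and>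
     (\<exists>j k. nt j < 3 \<and> 3 \<le> nt k \<and> a j $ k \<noteq> 0))"

lemma nx_less [simp]: "nt (nx i) < 3"
  by (simp add: nx_def)

text \<open>Equations and unknowns are both indexed by one of three vectors of the plane and one of
  the seven remaining basis vectors. The system is thus square of size 21, and a nontrivial
  deformation makes a single determinant vanish.\<close>

lemma degenerate_jac:
  assumes L: "L \<in> vanishing plane3" and "degenerate L"
  shows "det (jac L) = 0"
proof -
  interpret trivector L using L by unfold_locales (simp add: vanishing_def)
  obtain a j0 k0 where a: "\<And>i j z. nt i < 3 \<Longrightarrow> nt j < 3 \<Longrightarrow> L (ee i) (a j) z = L (ee j) (a i) z"
    and jk: "nt j0 < 3" "3 \<le> nt k0" "a j0 $ k0 \<noteq> 0" using assms(2) unfolding degenerate_def by blast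
  define v :: "complex^(10 \<times> 10)" where
    "v = (\<chi> r. if nt (fst r) < 3 \<and> 3 \<le> nt (snd r) then a (fst r) $ snd r else 0)"
  have L0: "L (ee i) x z = (\<Sum>w\<in>{w. 3 \<le> nt w}. x $ w * L (ee i) (ee w) z)" if "nt i < 3" for i x z
  proof -
    have "L (ee i) x z = L (ee i) (\<Sum>w\<in>UNIV. x $ w *s ee w) z" by (simp add: basis_expansion)
    also have "\<dots> = (\<Sum>w\<in>UNIV. x $ w * L (ee i) (ee w) z)" by (simp add: sum2 scale2)
    also have "\<dots> = (\<Sum>w\<in>{w. 3 \<le> nt w}. x $ w * L (ee i) (ee w) z)"
    proof (rule sum.mono_neutral_right)
      show "\<forall>w\<in>UNIV - {w. 3 \<le> nt w}. x $ w * L (ee i) (ee w) z = 0"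
        using that by (auto intro!: plane3_vanish[OF L] simp: axis_nth)
    qed auto
    finally show ?thesis .
  qed
  have "(jac L *v v) $ (i, z) = 0" for i z
  proof (cases "nt i < 3 \<and> 3 \<le> nt z")
    case True
    have "L (ee (nx i)) (a (nx (nx i))) (ee z) = L (ee (nx (nx i))) (a (nx i)) (ee z)" by (intro a) auto
    then show ?thesis using True
      by (simp add: jac_apply v_def L0 sum_subtractf mult.commute)
  qed (auto simp: jac_apply v_def)
  then have "jac L *v v = 0" by (simp add: vec_eq_iff)
  moreover have "v \<noteq> 0" using jk by (auto simp: v_def vec_eq_iff)
  ultimately show ?thesis
    by (metis adj_left_vec matrix_vector_mult_0_right vec.scale_eq_0_iff)
qed

text \<open>Found by a computer search over sums of decomposable forms.\<close>

definition sample_form :: form3 where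
  "sample_form = (\<lambda>x y z. minor3 (ix 0) (ix 4) (ix 9) x y z + minor3 (ix 0) (ix 7) (ix 8) x y z
     + minor3 (ix 1) (ix 3) (ix 9) x y z + minor3 (ix 1) (ix 5) (ix 6) x y z
     + minor3 (ix 2) (ix 3) (ix 4) x y z + minor3 (ix 2) (ix 5) (ix 7) x y z
     + minor3 (ix 2) (ix 6) (ix 8) x y z)"

lemma sample_form_vanishing: "sample_form \<in> vanishing plane3"
proof (rule vanishing_plane3I)
  show "sample_form \<in> alternating_forms"
    unfolding sample_form_def by (intro add_alternating minor3_alternating)
next
  fix i j k assume "nt i < nt j" "nt j < nt k" "nt j < 3"
  then have "ix m \<noteq> i" "ix m \<noteq> j" if "3 \<le> m" "m < 10" for m
    using nt_ix[OF that(2)] that by auto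
  then show "sample_form (ee i) (ee j) (ee k) = 0"
    by (simp add: sample_form_def minor3_def axis_nth)
qed

text \<open>The system is sparse enough to be solved directly: fourteen equations contain a single
  unknown, four more do so after substitution, and the last three unknowns form a cycle.\<close>

lemma sample_form_jac: "det (jac sample_form) \<noteq> 0"
proof -
  have "v = 0" if v: "jac sample_form *v v = 0" for v
  proof -
    have rows: "(jac sample_form *v v) $ (i, z) = 0" for i z using v by simp
    have set: "{w. 3 \<le> nt w} = ix ` {3,4,5,6,7,8,9}"
    proof (intro subset_antisym subsetI)
      fix w assume "w \<in> {w. 3 \<le> nt w}"
      moreover have "m \<in> {3,4,5,6,7,8,9}" if "3 \<le> m" "m < 10" for m :: nat using that by auto
      ultimately have "nt w \<in> {3,4,5,6,7,8,9}" using nt_less[of w] by blast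
      then show "w \<in> ix ` {3,4,5,6,7,8,9}" by (metis image_eqI ix_nt)
    qed auto
    have sumW: "(\<Sum>w\<in>{w. 3 \<le> nt w}. f w) = f (ix 3) + f (ix 4) + f (ix 5) + f (ix 6) + f (ix 7) + f (ix 8) + f (ix 9)"
      for f :: "10 \<Rightarrow> complex"
      unfolding set by (subst sum.reindex) (auto simp: inj_on_def)
    have eq: "k < 3 \<Longrightarrow> 3 \<le> m \<Longrightarrow> m < 10 \<Longrightarrow>
      (\<Sum>w\<in>{w. 3 \<le> nt w}. sample_form (ee (ix ((k + 1) mod 3))) (ee w) (ee (ix m)) * v $ (ix ((k + 2) mod 3), w)
        - sample_form (ee (ix ((k + 2) mod 3))) (ee w) (ee (ix m)) * v $ (ix ((k + 1) mod 3), w)) = 0" for k m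
      using rows[of "ix k" "ix m"] by (simp add: jac_apply nx_def mod_Suc_eq)
    note simps = numeral_2_eq_2 sumW sample_form_def minor3_def axis_nth
    have v0: "v $ (ix k, ix m) = 0" if "k < 3" "3 \<le> m" "m < 10" for k m
    proof -
      have k: "k \<in> {0, 1, 2}" and m: "m \<in> {3,4,5,6,7,8,9}" using that by auto
      have z13: "v $ (ix (Suc 0), ix 3) = 0" using eq[of 0 4] by (simp add: simps)
      have z15: "v $ (ix (Suc 0), ix 5) = 0" using eq[of 0 7] by (simp add: simps)
      have z16: "v $ (ix (Suc 0), ix 6) = 0" using eq[of 0 8] by (simp add: simps)
      have z23: "v $ (ix (Suc (Suc 0)), ix 3) = 0" using eq[of 0 9] by (simp add: simps)
      have z04: "v $ (ix 0, ix 4) = 0" using eq[of 1 3] by (simp add: simps)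
      have z07: "v $ (ix 0, ix 7) = 0" using eq[of 1 5] by (simp add: simps)
      have z08: "v $ (ix 0, ix 8) = 0" using eq[of 1 6] by (simp add: simps)
      have z24: "v $ (ix (Suc (Suc 0)), ix 4) = 0" using eq[of 1 9] by (simp add: simps)
      have z09: "v $ (ix 0, ix 9) = 0" using eq[of 2 3] by (simp add: simps)
      have z19: "v $ (ix (Suc 0), ix 9) = 0" using eq[of 2 4] by (simp add: simps)
      have z06: "v $ (ix 0, ix 6) = 0" using eq[of 2 5] by (simp add: simps)
      have z05: "v $ (ix 0, ix 5) = 0" using eq[of 2 6] by (simp add: simps)
      have z18: "v $ (ix (Suc 0), ix 8) = 0" using eq[of 2 7] by (simp add: simps)
      have z17: "v $ (ix (Suc 0), ix 7) = 0" using eq[of 2 8] by (simp add: simps)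
      have z26: "v $ (ix (Suc (Suc 0)), ix 6) = 0" using eq[of 0 5] by (simp add: simps z13 z15 z16 z23 z04 z07 z08 z24 z09 z19 z06 z05 z18 z17)
      have z25: "v $ (ix (Suc (Suc 0)), ix 5) = 0" using eq[of 0 6] by (simp add: simps z13 z15 z16 z23 z04 z07 z08 z24 z09 z19 z06 z05 z18 z17)
      have z28: "v $ (ix (Suc (Suc 0)), ix 8) = 0" using eq[of 1 7] by (simp add: simps z13 z15 z16 z23 z04 z07 z08 z24 z09 z19 z06 z05 z18 z17)
      have z27: "v $ (ix (Suc (Suc 0)), ix 7) = 0" using eq[of 1 8] by (simp add: simps z13 z15 z16 z23 z04 z07 z08 z24 z09 z19 z06 z05 z18 z17)
      \<comment> \<open>Going once around the cycle of the last three unknowns changes the sign, so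
        all three vanish.\<close>
      have "v $ (ix (Suc 0), ix 4) = v $ (ix (Suc (Suc 0)), ix 9)" using eq[of 0 3] by (simp add: simps)
      moreover have "v $ (ix 0, ix 3) = - v $ (ix (Suc (Suc 0)), ix 9)" using eq[of 1 4] by (simp add: simps eq_neg_iff_add_eq_0)
      moreover have "v $ (ix (Suc 0), ix 4) = v $ (ix 0, ix 3)" using eq[of 2 9] by (simp add: simps)
      ultimately have z29: "v $ (ix (Suc (Suc 0)), ix 9) = 0" "v $ (ix (Suc 0), ix 4) = 0" "v $ (ix 0, ix 3) = 0" by auto
      show ?thesis using k m z13 z15 z16 z23 z04 z07 z08 z24 z09 z19 z06 z05 z18 z17 z26 z25 z28 z27 z29 by (auto simp: numeral_2_eq_2)
    qed
    have "v $ (i, z) = 0" for i z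
    proof (cases "nt i < 3 \<and> 3 \<le> nt z")
      case True
      then show ?thesis using v0[of "nt i" "nt z"] by simp
    next
      case False
      then show ?thesis using rows[of i z] by (simp add: jac_apply split: if_splits)
    qed
    then show ?thesis by (simp add: vec_eq_iff)
  qed
  then have "\<exists>C. C ** jac sample_form = mat 1" using matrix_left_invertible_ker by blast
  then have "invertible (jac sample_form)" unfolding invertible_def using matrix_left_right_inverse by blast
  then show ?thesis by (simp add: invertible_det_nz)
qed

lemma det_nonzero_injD:
  fixes A :: "complex^'n^'n"
  shows "det A \<noteq> 0 \<Longrightarrow> A *v x = A *v y \<Longrightarrow> x = y"
  by (metis adj_left_vec vec.scale_left_imp_eq)

lemma det_nonzeroI:
  fixes A :: "complex^'n^'n"
  assumes "\<And>x. A *v x = 0 \<Longrightarrow> x = 0"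
  shows "det A \<noteq> 0"
proof -
  have "\<exists>C. C ** A = mat 1" using assms matrix_left_invertible_ker by blast
  then have "invertible A" unfolding invertible_def using matrix_left_right_inverse by blast
  then show ?thesis by (simp add: invertible_det_nz)
qed

lemma matrix_vector_columns: "(A :: 'a::comm_ring_1^'n^'m) *v x = (\<Sum>j\<in>UNIV. x $ j *s (\<chi> i. A $ i $ j))"
  by (simp add: vec_eq_iff matrix_vector_mult_def mult.commute)

text \<open>A deformation is transported by conjugation with \<open>q\<close>: restrict
  \<open>q\<close> to the plane, apply \<open>a\<close>, then apply the inverse of \<open>q\<close>.
  It remains nonzero because \<open>q\<close> maps the plane onto itself.\<close>

lemma degenerate_pull:
  assumes L: "L \<in> vanishing plane3" and deg: "degenerate L"
    and q: "\<And>k j. 3 \<le> nt k \<Longrightarrow> nt j < 3 \<Longrightarrow> q $ k $ j = 0" "det q \<noteq> 0"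
  shows "degenerate (pull L q)"
proof -
  interpret trivector L using L by unfold_locales (simp add: vanishing_def)
  obtain a j0 k0 where a: "\<And>i j z. nt i < 3 \<Longrightarrow> nt j < 3 \<Longrightarrow> L (ee i) (a j) z = L (ee j) (a i) z"
    and jk: "nt j0 < 3" "3 \<le> nt k0" "a j0 $ k0 \<noteq> 0" using deg unfolding degenerate_def by blast
  define S where "S = {i. nt i < 3}"
  define b where "b j = (\<Sum>k\<in>S. q $ k $ j *s a k)" for j
  define a' where "a' j = (1 / det q) *s (adj q *v b j)" for j
  have qa': "q *v a' j = b j" for j
    using q(2) by (simp add: a'_def vec.scale adj_right_vec)
  have qe: "q *v ee i = (\<Sum>m\<in>S. q $ m $ i *s ee m)" if "i \<in> S" for i
  proof -
    have "q *v ee i = (\<Sum>m\<in>UNIV. q $ m $ i *s ee m)"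
      using basis_expansion[of "\<chi> m. q $ m $ i"] by (simp add: matrix_vector_axis)
    also have "\<dots> = (\<Sum>m\<in>S. q $ m $ i *s ee m)"
      using that q(1) by (intro sum.mono_neutral_right) (auto simp: S_def)
    finally show ?thesis .
  qed
  have eq: "pull L q (ee i) (a' j) z = pull L q (ee j) (a' i) z" if "i \<in> S" "j \<in> S" for i j z
  proof -
    have "pull L q (ee i) (a' j) z = (\<Sum>m\<in>S. \<Sum>k\<in>S. q $ m $ i * q $ k $ j * L (ee m) (a k) (q *v z))"
      using that by (simp add: pull_def qa' qe b_def sum1 sum2 scale1 scale2 sum_distrib_left mult.assoc)
    also have "\<dots> = (\<Sum>m\<in>S. \<Sum>k\<in>S. q $ m $ i * q $ k $ j * L (ee k) (a m) (q *v z))"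
      by (intro sum.cong refl) (simp add: a S_def)
    also have "\<dots> = (\<Sum>k\<in>S. \<Sum>m\<in>S. q $ k $ j * q $ m $ i * L (ee k) (a m) (q *v z))"
      by (subst sum.swap) (simp add: mult.commute mult.left_commute)
    also have "\<dots> = pull L q (ee j) (a' i) z"
      using that by (simp add: pull_def qa' qe b_def sum1 sum2 scale1 scale2 sum_distrib_left mult.assoc)
    finally show ?thesis .
  qed
  have "\<exists>j k. nt j < 3 \<and> 3 \<le> nt k \<and> a' j $ k \<noteq> 0"
  proof (rule ccontr)
    assume "\<not> ?thesis"
    then have a'0: "a' j $ k = 0" if "nt j < 3" "3 \<le> nt k" for j k using that by blast
    define C where "C = {x :: V10. \<forall>k. 3 \<le> nt k \<longrightarrow> x $ k = 0}"
    have sC: "vec.subspace C" unfolding C_def vec.subspace_def by auto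
    have qC: "q *v x \<in> C" if "x \<in> C" for x
      unfolding C_def
    proof (intro CollectI allI impI)
      fix k assume "3 \<le> nt k"
      then have "q $ k $ j * x $ j = 0" for j
        using that q(1)[of k j] by (cases "nt j < 3") (auto simp: C_def)
      then show "(q *v x) $ k = 0" unfolding matrix_vector_mult_def by (simp only: vec_lambda_beta sum.neutral_const)
    qed
    have "vec.dim ((*v) q ` C) = vec.dim C"
      using det_nonzero_injD[OF q(2)] by (intro vec.dim_image_eq matrix_vector_mul_linear_gen inj_onI) blast
    then have qim: "(*v) q ` C = C"
      using qC by (intro vec.subspace_dim_equal vec.subspace_image sC) auto
    have bC: "b j \<in> C" if "j \<in> S" for j
    proof -
      have "a' j \<in> C" using that a'0 by (simp add: C_def S_def)
      then show ?thesis using qC qa' by metis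
    qed
    have "a k \<in> C" if "k \<in> S" for k
    proof -
      have "ee k \<in> C" using that by (auto simp: C_def S_def axis_nth)
      then obtain c where c: "c \<in> C" "q *v c = ee k" using qim by (metis imageE)
      have cS: "(\<Sum>j\<in>S. q $ m $ j * c $ j) = (if m = k then 1 else 0)" for m
      proof -
        have "(\<Sum>j\<in>S. q $ m $ j * c $ j) = (\<Sum>j\<in>UNIV. q $ m $ j * c $ j)"
          using c(1) by (intro sum.mono_neutral_left) (auto simp: S_def C_def)
        also have "\<dots> = (q *v c) $ m" by (simp add: matrix_vector_mult_def)
        finally show ?thesis by (simp add: c(2) axis_nth)
      qed
      have "(\<Sum>j\<in>S. c $ j *s b j) = (\<Sum>m\<in>S. \<Sum>j\<in>S. (q $ m $ j * c $ j) *s a m)"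
        unfolding b_def by (subst sum.swap) (simp add: vec.scale_sum_right mult.commute)
      also have "\<dots> = (\<Sum>m\<in>S. (\<Sum>j\<in>S. q $ m $ j * c $ j) *s a m)"
        by (simp add: vec.scale_sum_left)
      also have "\<dots> = (\<Sum>m\<in>S. if m = k then a k else 0)"
        unfolding cS by (intro sum.cong refl) auto
      also have "\<dots> = a k" using that by (simp add: sum.delta)
      finally have "a k = (\<Sum>j\<in>S. c $ j *s b j)" by simp
      then show ?thesis using bC by (simp add: vec.subspace_sum[OF sC] vec.subspace_scale[OF sC])
    qed
    then show False using jk by (auto simp: C_def S_def)
  qed
  then show ?thesis unfolding degenerate_def using eq by (intro exI[of _ a']) (auto simp: S_def)
qed

text \<open>Here the chart has 119 parameters, so counting alone cannot separate these forms from
  the whole divisor. They lie where \<open>det (jac L)\<close> vanishes; \<open>sample_form\<close>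
  shows that this determinant is not identically zero, and \<open>divisor_avoidance\<close> supplies
  the missing relation.\<close>

lemma hypersurface_degenerate:
  "\<exists>R\<in>poly_functions (coords triples'). (\<exists>y. R y \<noteq> 0) \<and> (\<forall>\<sigma>\<in>alternating_forms. \<forall>f. det f \<noteq> 0 \<longrightarrow>
     pull \<sigma> f \<in> vanishing plane3 \<longrightarrow> degenerate (pull \<sigma> f) \<longrightarrow> R (cds \<sigma>) = 0)"
proof -
  define E where "E i j \<longleftrightarrow> ((j::nat) < 3 \<longrightarrow> (i::nat) < 3)" for i j
  have "length (filter (\<lambda>(i, j). \<not> E i j) (List.product [0..<10] [0..<10])) +
      length (filter (\<lambda>(i, j, k). i < j \<and> j < k \<and> \<not> sym3 plane3 i j k)
        (List.product [0..<10] (List.product [0..<10] [0..<10]))) \<le> 119"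
    unfolding E_def sym3_def plane3_def by code_simp
  then have card: "card (chart_vars plane3 E) \<le> card triples'"
    using card_chart_vars[of plane3 E] unfolding card_triples' by linarith
  define \<Psi> where "\<Psi> t x = cds (pull (chart_form plane3 x) (adj (mat 1 + chart_mat E x))) t" for t x
  define g where "g x = det (jac (chart_form plane3 x))" for x
  have gp: "g \<in> poly_functions (coords (chart_vars plane3 E))"
    unfolding g_def[abs_def]
  proof (rule poly_functions_det)
    fix r s
    have e: "(\<lambda>x. jac_entry (chart_form plane3 x) i z c w) \<in> poly_functions (coords (chart_vars plane3 E))" for i z c w
      by (cases "nt i < 3 \<and> 3 \<le> nt z"; cases "3 \<le> nt w"; cases "c = nx (nx i)"; cases "c = nx i")
        (auto simp: jac_entry_def intro!: poly_functions.const poly_functions_diff poly_functions_uminus chart_form_poly)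
    show "(\<lambda>x. jac (chart_form plane3 x) $ r $ s) \<in> poly_functions (coords (chart_vars plane3 E))"
      using e by (simp add: jac_def)
  qed
  obtain x0 where "chart_form plane3 x0 = sample_form"
    using chart_surj[OF sample_form_vanishing, of E 0] by auto
  then have gx0: "g x0 \<noteq> 0" by (simp add: g_def sample_form_jac)
  have "finite triples'" using card_triples' by (metis card.infinite zero_neq_numeral)
  then obtain R y where R: "R \<in> poly_functions (coords triples')" "R y \<noteq> 0"
    "\<And>x. g x = 0 \<Longrightarrow> R (\<lambda>t. \<Psi> t x) = 0"
    using divisor_avoidance[of "chart_vars plane3 E" triples' \<Psi> g x0] card gp gx0
    unfolding \<Psi>_def using chart_pull_poly by auto
  define B where "B = {L \<in> vanishing plane3. degenerate L}"
  have "R (cds \<sigma>) = 0" if \<sigma>: "\<sigma> \<in> alternating_forms" and f: "det f \<noteq> 0" "pull \<sigma> f \<in> vanishing plane3" "degenerate (pull \<sigma> f)" for \<sigma> f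
  proof (rule chart[where E = "\<lambda>i j. E (nt i) (nt j)" and B = B, OF cds_poly[OF R(1)]])
    show "B \<subseteq> alternating_forms" by (auto simp: B_def vanishing_def)
  next
    fix M c assume "M \<in> B"
    then obtain a where "M \<in> vanishing plane3"
      "\<forall>i j z. nt i < 3 \<longrightarrow> nt j < 3 \<longrightarrow> M (ee i) (a j) z = M (ee j) (a i) z"
      "\<exists>j k. nt j < 3 \<and> 3 \<le> nt k \<and> a j $ k \<noteq> 0" unfolding B_def degenerate_def by blast
    then show "(\<lambda>x y z. c * M x y z) \<in> B"
      unfolding B_def degenerate_def by (auto intro!: vanishing_scale exI[of _ a])
  next
    fix M and q :: "complex^10^10"
    assume M: "M \<in> B" and q: "\<And>k j. \<not> E (nt k) (nt j) \<Longrightarrow> q $ k $ j = 0" "det q \<noteq> 0"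
    have "pull M q \<in> vanishing plane3"
      using M q(1) by (intro vanishing_pull[where E = E]) (auto simp: B_def E_def plane3_def)
    moreover have "degenerate (pull M q)"
      using M q by (intro degenerate_pull) (auto simp: B_def E_def)
    ultimately show "pull M q \<in> B" by (simp add: B_def)
  next
    fix M and N :: "complex^10^10" assume M: "M \<in> B" and N: "\<And>i j. E (nt i) (nt j) \<Longrightarrow> N $ i $ j = 0"
    then have "M \<in> vanishing plane3" by (simp add: B_def)
    from chart_surj[OF this, of E N] N obtain x where x: "chart_form plane3 x = M" "chart_mat E x = N" by blast
    then have "(\<lambda>t. \<Psi> t x) = cds (pull M (adj (mat 1 + N)))" by (simp add: \<Psi>_def)
    moreover have "g x = 0" using M degenerate_jac by (simp add: g_def x B_def)
    ultimately show "R (cds (pull M (adj (mat 1 + N)))) = 0" using R(3)[of x] by simp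
  qed (use f \<sigma> in \<open>auto simp: E_def B_def\<close>)
  then show ?thesis using R(1,2) by blast
qed

section \<open>Density of the divisor under a coordinate projection\<close>

lemma has_derivative_vec_lambda:
  fixes q :: "'i::finite \<Rightarrow> 'a::real_normed_vector \<Rightarrow> complex"
  assumes "\<And>r. (q r has_derivative q' r) F"
  shows "((\<lambda>a. \<chi> r. q r a) has_derivative (\<lambda>h. \<chi> r. q' r h)) F"
proof -
  have eq: "(\<chi> r. c r) = (\<Sum>r\<in>UNIV. axis r (c r))" for c :: "'i \<Rightarrow> complex"
    by (simp add: vec_eq_iff axis_def)
  have bl: "bounded_linear (axis r :: complex \<Rightarrow> complex^'i)" for r
    unfolding linear_conv_bounded_linear[symmetric]
    by (rule linearI) (simp_all add: vec_eq_iff axis_def)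
  show ?thesis unfolding eq
    by (intro has_derivative_sum bounded_linear.has_derivative[OF bl] assms)
qed

lemma bounded_linear_matrix_vector: "bounded_linear ((*v) (A :: complex^'n^'m))"
  unfolding linear_conv_bounded_linear[symmetric]
  by (rule linearI) (simp_all add: vec_eq_iff matrix_vector_mult_def distrib_left sum.distrib scaleR_sum_right)

text \<open>The derivative of \<open>F\<close> at 0 is the invertible \<open>M\<close>, so
  \<open>F\<close> is open there. Isotropy of a plane near the standard one is of this shape, linear
  plus quadratic in the coordinates of the plane as a graph.\<close>

lemma quadratic_perturbation_open:
  fixes M :: "complex^'n^'n" and c :: "'n \<Rightarrow> 'n \<Rightarrow> 'n \<Rightarrow> complex"
  assumes "det M \<noteq> 0"
  defines "F \<equiv> \<lambda>a. (\<chi> r. (M *v a) $ r + (\<Sum>s\<in>UNIV. \<Sum>t\<in>UNIV. c r s t * (a $ s * a $ t)))"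
  shows "\<exists>e>0. ball 0 e \<subseteq> range F"
proof -
  have der: "(F has_derivative (*v) M) (at 0)"
  proof -
    have nth: "((\<lambda>a::complex^'n. a $ s) has_derivative (\<lambda>h. h $ s)) (at 0)" for s
      by (rule bounded_linear.has_derivative[OF bounded_linear_vec_nth has_derivative_ident])
    have quad: "((\<lambda>a::complex^'n. c r s t * (a $ s * a $ t)) has_derivative (\<lambda>h. 0)) (at 0)" for r s t
      by (rule has_derivative_eq_rhs[OF has_derivative_mult_right[OF has_derivative_mult[OF nth nth]]]) auto
    have "((\<lambda>a. (M *v a) $ r + (\<Sum>s\<in>UNIV. \<Sum>t\<in>UNIV. c r s t * (a $ s * a $ t)))
       has_derivative (\<lambda>h. (M *v h) $ r + (\<Sum>s\<in>(UNIV::'n set). \<Sum>t\<in>(UNIV::'n set). 0))) (at 0)" for r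
      by (intro has_derivative_add has_derivative_sum quad bounded_linear.has_derivative[OF bounded_linear_vec_nth]
          bounded_linear.has_derivative[OF bounded_linear_matrix_vector] has_derivative_ident)
    then have "(F has_derivative (\<lambda>h. \<chi> r. (M *v h) $ r + (\<Sum>s\<in>(UNIV::'n set). \<Sum>t\<in>(UNIV::'n set). 0))) (at 0)"
      unfolding F_def by (rule has_derivative_vec_lambda)
    then show ?thesis by simp
  qed
  have cont: "continuous_on UNIV F"
    unfolding F_def matrix_vector_mult_def by (auto intro!: continuous_intros)
  obtain B where B: "M ** B = mat 1" using assms(1) by (metis invertible_def invertible_det_nz)
  have "F 0 \<in> interior (F ` UNIV)"
  proof (rule sussmann_open_mapping[OF open_UNIV cont UNIV_I der])
    show "bounded_linear ((*v) B)" by (rule bounded_linear_matrix_vector)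
    show "(*v) M \<circ> (*v) B = id" by (simp add: fun_eq_iff matrix_vector_mul_assoc B)
  qed auto
  moreover have "F 0 = 0" by (simp add: F_def vec_eq_iff)
  ultimately show ?thesis by (simp add: mem_interior)
qed

lemma poly_coords_cong:
  assumes "R \<in> poly_functions (coords J)" "\<And>j. j \<in> J \<Longrightarrow> y j = y' j"
  shows "R y = R y'"
  using assms(1) by induction (use assms(2) in auto)

lemma sum_fst_eq:
  fixes h :: "10 \<Rightarrow> complex"
  shows "(\<Sum>s\<in>(UNIV :: (10 \<times> 10) set). if fst s = j then h (snd s) else 0) = (\<Sum>w\<in>UNIV. h w)"
proof -
  have "(\<Sum>s\<in>(UNIV :: (10 \<times> 10) set). if fst s = j then h (snd s) else 0)
      = (\<Sum>(c, w)\<in>(UNIV :: 10 set) \<times> (UNIV :: 10 set). if c = j then h w else 0)"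
    by (simp add: case_prod_unfold)
  also have "\<dots> = (\<Sum>w\<in>UNIV. \<Sum>c\<in>UNIV. if c = j then h w else 0)"
    by (subst sum.cartesian_product[symmetric]) (rule sum.swap)
  finally show ?thesis by simp
qed

text \<open>The 119 coordinates take an open set of values on the divisor near any form with
  nondegenerate Jacobian. A generic \<open>y0\<close> is joined by a polynomial curve to such a
  form; for small \<open>t\<close> the curve is realized by members of the divisor, so if
  \<open>R\<close> vanished on the divisor it would vanish along the whole curve, also at
  \<open>y0\<close>.\<close>

lemma D_3_3_10_dominant:
  assumes R: "R \<in> poly_functions (coords triples')" "R y \<noteq> 0"
  shows "\<exists>\<sigma>\<in>D_3_3_10. R (cds \<sigma>) \<noteq> 0"
proof -
  define lower where "lower y = form_of (\<lambda>(i, j, k). if nt j < 3 then 0 else y (i, j, k))" for y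
  have tri': "t \<in> triples'" if "t \<in> triples" "t = (i, j, k)" "3 \<le> nt j" for t i j k
    using that by (auto simp: triples'_def)
  have lp: "(\<lambda>y. lower y u v w) \<in> poly_functions (coords triples')" for u v w
    unfolding lower_def
  proof (rule form_of_poly)
    fix t assume t: "t \<in> triples"
    obtain i j k where ijk: "t = (i, j, k)" by (cases t)
    show "(\<lambda>x. case t of (i, j, k) \<Rightarrow> if nt j < 3 then 0 else x (i, j, k)) \<in> poly_functions (coords triples')"
      using tri'[OF t ijk] unfolding ijk
      by (cases "nt j < 3") (auto intro: poly_functions.const poly_coord)
  qed
  define g where "g y = det (jac (lower y))" for y
  have gp: "g \<in> poly_functions (coords triples')"
    unfolding g_def[abs_def]
  proof (rule poly_functions_det)
    fix r s
    have e: "(\<lambda>x. jac_entry (lower x) i z c w) \<in> poly_functions (coords triples')" for i z c w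
      by (cases "nt i < 3 \<and> 3 \<le> nt z"; cases "3 \<le> nt w"; cases "c = nx (nx i)"; cases "c = nx i")
        (auto simp: jac_entry_def intro!: poly_functions.const poly_functions_diff poly_functions_uminus lp)
    show "(\<lambda>x. jac (lower x) $ r $ s) \<in> poly_functions (coords triples')"
      using e by (simp add: jac_def)
  qed
  have "lower (cds sample_form) = form_of (cds sample_form)"
    unfolding lower_def
  proof (rule form_of_cong)
    fix t assume "t \<in> triples"
    then show "(case t of (i, j, k) \<Rightarrow> if nt j < 3 then 0 else cds sample_form (i, j, k)) = cds sample_form t"
      using sample_form_vanishing by (auto simp: triples_def cds_def vanishing_def plane3_def)
  qed
  then have "lower (cds sample_form) = sample_form"
    using sample_form_vanishing by (simp add: form_of_cds vanishing_def)
  then have "g (cds sample_form) \<noteq> 0" by (simp add: g_def sample_form_jac)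
  then obtain y0 where y0: "R y0 \<noteq> 0" "g y0 \<noteq> 0"
    using poly_functions_domain[OF R(1) gp R(2)] by blast
  define L where "L = lower y0"
  have Lalt: "L \<in> alternating_forms" by (simp add: L_def lower_def form_of_alternating)
  have LV: "L \<in> vanishing plane3"
    by (rule vanishing_plane3I[OF Lalt]) (simp add: L_def lower_def form_of_axis triples_def)
  have dM: "det (jac L) \<noteq> 0" using y0(2) by (simp add: g_def L_def)
  interpret L: trivector L by unfold_locales fact
  \<comment> \<open>The coordinates with two indices in the plane, which obstruct its isotropy; the
    one with all three indices there is excluded by \<open>triples'\<close>.\<close>
  define Q where "Q = form_of (\<lambda>(i, j, k). if nt j < 3 \<and> (i, j, k) \<in> triples' then y0 (i, j, k) else 0)"
  have Qalt: "Q \<in> alternating_forms" by (simp add: Q_def form_of_alternating)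
  interpret Q: trivector Q by unfold_locales fact
  have Q0: "Q u x y = 0" if "\<And>i. nt i < 3 \<Longrightarrow> x $ i = 0" "\<And>i. nt i < 3 \<Longrightarrow> y $ i = 0" for u x y
    unfolding Q_def form_of_def using that
    by (intro sum.neutral ballI) (auto simp: triples_def minor3_def)
  define T :: "complex^(10 \<times> 10)" where
    "T = (\<chi> r. if nt (fst r) < 3 \<and> 3 \<le> nt (snd r) then - Q (ee (nx (fst r))) (ee (nx (nx (fst r)))) (ee (snd r)) else 0)"
  define H where "H z w w' = (if 3 \<le> nt w \<and> 3 \<le> nt w' then L (ee w) (ee w') (ee z) else 0)" for z w w'
  \<comment> \<open>The quadratic part of the equations: for a plane spanned by vectors
    \<open>ee j + a j\<close> it encodes \<open>L (a j) (a l) (ee k)\<close>.\<close>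
  define c :: "10 \<times> 10 \<Rightarrow> 10 \<times> 10 \<Rightarrow> 10 \<times> 10 \<Rightarrow> complex" where
    "c r s t = (if nt (fst r) < 3 \<and> 3 \<le> nt (snd r) \<and> fst s = nx (fst r) \<and> fst t = nx (nx (fst r))
       then H (snd r) (snd s) (snd t) else 0)" for r s t
  obtain e where e: "e > 0" "ball 0 e \<subseteq> range (\<lambda>a. (\<chi> r. (jac L *v a) $ r + (\<Sum>s\<in>UNIV. \<Sum>t\<in>UNIV. c r s t * (a $ s * a $ t))))"
    using quadratic_perturbation_open[OF dM, of c] by blast
  \<comment> \<open>Only the obstructing coordinates are scaled. At \<open>t = 0\<close> none is
    left, and at \<open>t = 1\<close> the point \<open>y0\<close> returns.\<close>
  define yt where "yt t = (\<lambda>(i, j, k). if nt j < 3 then t * y0 (i, j, k) else y0 (i, j, k))" for t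
  have small: "\<exists>\<sigma>\<in>D_3_3_10. \<forall>\<tau>\<in>triples'. cds \<sigma> \<tau> = yt t \<tau>" if t: "t *s T \<in> ball 0 e" for t
  proof -
    obtain v where v: "\<And>r. (jac L *v v) $ r + (\<Sum>s\<in>UNIV. \<Sum>t\<in>UNIV. c r s t * (v $ s * v $ t)) = t * T $ r"
      using e(2) t by (force simp: vec_eq_iff)
    define a :: "10 \<Rightarrow> V10" where "a j = (\<chi> w. if 3 \<le> nt w then v $ (j, w) else 0)" for j
    define f :: "complex^10^10" where "f = (\<chi> r j. (if r = j then 1 else 0) + (if nt j < 3 then a j $ r else 0))"
    have f1: "f *v ee j = ee j + a j" if "nt j < 3" for j
      using that by (simp add: f_def matrix_vector_axis vec_eq_iff axis_nth)
    have f2: "f *v ee j = ee j" if "3 \<le> nt j" for j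
      using that by (simp add: f_def matrix_vector_axis vec_eq_iff axis_nth)
    have fx: "(f *v x) $ r = x $ r + (\<Sum>j\<in>{j. nt j < 3}. a j $ r * x $ j)" for x r
    proof -
      have "(f *v x) $ r = (\<Sum>j\<in>UNIV. (if j = r then x $ j else 0)) + (\<Sum>j\<in>UNIV. if nt j < 3 then a j $ r * x $ j else 0)"
        unfolding sum.distrib[symmetric] by (auto simp: f_def matrix_vector_mult_def distrib_right intro!: sum.cong)
      then show ?thesis by (simp add: sum.inter_filter[symmetric])
    qed
    have df: "det f \<noteq> 0"
    proof (rule det_nonzeroI)
      fix x assume x: "f *v x = 0"
      have "x $ r = 0" if "nt r < 3" for r
        using arg_cong[OF x, of "\<lambda>u. u $ r"] that by (simp add: fx a_def)
      then show "x = 0" using arg_cong[OF x, of "\<lambda>u. u $ r" for r] by (simp add: fx vec_eq_iff)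
    qed
    define s0 where "s0 = (\<lambda>x y z. L x y z + t * Q x y z)"
    \<comment> \<open>The omitted coordinate is given the value that makes the form vanish on the
      three spanning vectors of the deformed plane.\<close>
    define sv where "sv = - s0 (f *v ee (ix 0)) (f *v ee (ix 1)) (f *v ee (ix 2))"
    define \<sigma> where "\<sigma> = (\<lambda>x y z. s0 x y z + sv * minor3 (ix 0) (ix 1) (ix 2) x y z)"
    have alt: "\<sigma> \<in> alternating_forms"
      unfolding \<sigma>_def s0_def
      by (intro add_alternating scale_alternating[OF minor3_alternating] scale_alternating Lalt Qalt)
    interpret S: trivector \<sigma> by unfold_locales fact
    have key: "\<sigma> (f *v ee (nx m)) (f *v ee (nx (nx m))) (ee k) = 0" if m: "nt m < 3" and k: "3 \<le> nt k" for m k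
    proof -
      let ?j = "nx m" and ?l = "nx (nx m)"
      have aexp: "a j = (\<Sum>w\<in>{w. 3 \<le> nt w}. v $ (j, w) *s ee w)" for j
      proof -
        have "a j = (\<Sum>w\<in>UNIV. a j $ w *s ee w)" by (simp add: basis_expansion)
        also have "\<dots> = (\<Sum>w\<in>{w. 3 \<le> nt w}. a j $ w *s ee w)"
          by (rule sum.mono_neutral_right) (auto simp: a_def)
        finally show ?thesis by (simp add: a_def)
      qed
      have 1: "(jac L *v v) $ (m, k) = L (ee ?j) (a ?l) (ee k) + L (a ?j) (ee ?l) (ee k)"
      proof -
        have "(jac L *v v) $ (m, k) = L (ee ?j) (a ?l) (ee k) - L (ee ?l) (a ?j) (ee k)"
          using m k by (simp add: jac_apply aexp L.sum2 L.scale2 sum_subtractf mult.commute)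
        then show ?thesis using L.swap12[of "ee ?l" "a ?j" "ee k"] by simp
      qed
      have 2: "(\<Sum>s\<in>UNIV. \<Sum>t\<in>UNIV. c (m, k) s t * (v $ s * v $ t)) = L (a ?j) (a ?l) (ee k)"
      proof -
        have "(\<Sum>s\<in>UNIV. \<Sum>t\<in>UNIV. c (m, k) s t * (v $ s * v $ t)) =
          (\<Sum>s\<in>UNIV. if fst s = ?j then (\<Sum>t\<in>UNIV. if fst t = ?l then H k (snd s) (snd t) * (v $ (?j, snd s) * v $ (?l, snd t)) else 0) else 0)"
          using m k by (intro sum.cong refl) (auto simp: c_def intro!: sum.cong sum.neutral)
        also have "\<dots> = (\<Sum>w\<in>UNIV. \<Sum>w'\<in>UNIV. H k w w' * (v $ (?j, w) * v $ (?l, w')))"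
          by (simp only: sum_fst_eq[of ?l "\<lambda>w'. H k w w' * (v $ (?j, w) * v $ (?l, w'))" for w]
              sum_fst_eq[of ?j "\<lambda>w. \<Sum>w'\<in>UNIV. H k w w' * (v $ (?j, w) * v $ (?l, w'))"])
        also have "\<dots> = (\<Sum>w\<in>UNIV. \<Sum>w'\<in>UNIV. a ?j $ w * (a ?l $ w' * L (ee w) (ee w') (ee k)))"
          by (intro sum.cong refl) (simp add: H_def a_def)
        also have "\<dots> = L (\<Sum>w\<in>UNIV. a ?j $ w *s ee w) (\<Sum>w'\<in>UNIV. a ?l $ w' *s ee w') (ee k)"
          by (simp only: L.sum1 L.scale1, simp only: L.sum2 L.scale2 sum_distrib_left)
        finally show ?thesis by (simp add: basis_expansion)
      qed
      have F: "L (ee ?j) (a ?l) (ee k) + L (a ?j) (ee ?l) (ee k) + L (a ?j) (a ?l) (ee k)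
          = - t * Q (ee ?j) (ee ?l) (ee k)"
        using v[of "(m, k)"] m k unfolding 1 2 by (simp add: T_def)
      have L0: "L (ee ?j) (ee ?l) (ee k) = 0"
        using LV by (simp add: vanishing_def plane3_def)
      have kW: "(ee k :: V10) $ i = 0" if "nt i < 3" for i using that k by (auto simp: axis_nth)
      have aW: "a j $ i = 0" if "nt i < 3" for i j using that by (simp add: a_def)
      have Q1: "Q (ee ?j) (a ?l) (ee k) = 0" "Q (a ?j) (a ?l) (ee k) = 0" by (rule Q0; simp add: kW aW)+
      have Q2: "Q (a ?j) (ee ?l) (ee k) = 0"
        using Q0[of "a ?j" "ee k" "ee ?l"] Q.swap12[of "a ?j" "ee ?l" "ee k"] kW aW by simp
      have min: "minor3 (ix 0) (ix 1) (ix 2) x y (ee k) = 0" for x y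
        using k by (auto simp: minor3_def axis_nth)
      have "\<sigma> (f *v ee ?j) (f *v ee ?l) (ee k) =
          L (ee ?j) (a ?l) (ee k) + L (a ?j) (ee ?l) (ee k) + L (a ?j) (a ?l) (ee k) + t * Q (ee ?j) (ee ?l) (ee k)"
        by (simp add: \<sigma>_def s0_def f1 min L.linear Q.linear L0 Q1 Q2 del: One_nat_def)
      then show ?thesis using F by simp
    qed
    have "pull \<sigma> f \<in> vanishing plane3"
    proof (rule vanishing_plane3I[OF pull_alternating[OF alt]])
      fix i j k assume o: "nt i < nt j" "nt j < nt k" "nt j < 3"
      show "pull \<sigma> f (ee i) (ee j) (ee k) = 0"
      proof (cases "nt k < 3")
        case True
        then have "nt i = 0" "nt j = 1" "nt k = 2" using o by auto
        then have ijk: "i = ix 0" "j = ix 1" "k = ix 2" by (metis ix_nt)+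
        have fc: "(f *v ee (ix b)) $ ix c = (if b = c then 1 else 0)" if "b < 3" "c < 3" for b c
          using that by (simp add: f1 a_def axis_nth)
        have "minor3 (ix 0) (ix 1) (ix 2) (f *v ee (ix 0)) (f *v ee (ix 1)) (f *v ee (ix 2)) = 1"
          by (simp add: minor3_def fc del: One_nat_def)
        then show ?thesis by (simp add: ijk pull_def \<sigma>_def sv_def del: One_nat_def)
      next
        case False
        have "\<exists>m. nt m < 3 \<and> (i = nx m \<and> j = nx (nx m) \<or> j = nx m \<and> i = nx (nx m))"
        proof -
          have "nt i = 0 \<and> nt j = 1 \<or> nt i = 0 \<and> nt j = 2 \<or> nt i = 1 \<and> nt j = 2" using o by auto
          then have "i = ix 0 \<and> j = ix 1 \<or> i = ix 0 \<and> j = ix 2 \<or> i = ix 1 \<and> j = ix 2" by (metis ix_nt)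
          moreover have "nx (ix 0) = ix 1" "nx (ix 1) = ix 2" "nx (ix 2) = ix 0" "nt (ix 0) < 3" "nt (ix 1) < 3" "nt (ix 2) < 3"
            by (simp_all add: nx_def numeral_2_eq_2)
          ultimately show ?thesis by metis
        qed
        then obtain m where m: "nt m < 3" "i = nx m \<and> j = nx (nx m) \<or> j = nx m \<and> i = nx (nx m)" by blast
        have "\<sigma> (f *v ee i) (f *v ee j) (ee k) = 0"
          using m(2) key[OF m(1), of k] False S.swap12[of "f *v ee i" "f *v ee j" "ee k"] by auto
        then show ?thesis using False by (simp add: pull_def f2)
      qed
    qed
    then have "\<sigma> \<in> D_3_3_10" using df alt by (auto simp: D_3_3_10_iff)
    moreover have "cds \<sigma> \<tau> = yt t \<tau>" if "\<tau> \<in> triples'" for \<tau>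
    proof -
      obtain i j k where ijk: "\<tau> = (i, j, k)" by (cases \<tau>)
      have tr: "(i, j, k) \<in> triples" "(i, j, k) \<in> triples'" using that by (auto simp: ijk triples'_def)
      have "minor3 (ix 0) (ix 1) (ix 2) (ee i) (ee j) (ee k) = 0"
        using tr by (subst minor3_axis) (auto simp: triples_def triples'_def)
      then show ?thesis
        using tr by (simp add: ijk cds_def \<sigma>_def s0_def L_def lower_def Q_def form_of_axis yt_def)
    qed
    ultimately show ?thesis by blast
  qed
  show ?thesis
  proof (rule ccontr)
    assume neg: "\<not> ?thesis"
    have z: "R (yt t) = 0" if t: "t *s T \<in> ball 0 e" for t
    proof -
      obtain \<sigma> where "\<sigma> \<in> D_3_3_10" "\<forall>\<tau>\<in>triples'. cds \<sigma> \<tau> = yt t \<tau>" using small[OF t] by blast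
      then show ?thesis using neg poly_coords_cong[OF R(1), of "cds \<sigma>" "yt t"] by auto
    qed
    define d where "d = e / (norm T + 1)"
    have d: "d > 0" using e(1) by (simp add: d_def add_nonneg_pos)
    have nT: "norm (t *s T) = norm t * norm T" for t
      by (simp add: norm_vec_def L2_set_def norm_mult power_mult_distrib sum_distrib_left[symmetric] real_sqrt_mult)
    \<comment> \<open>Realizability is known for small \<open>t\<close> only, but a disc contains
      infinitely many points, enough for a polynomial in \<open>t\<close>.\<close>
    have "ball 0 d \<subseteq> {t. R (yt t) = 0}"
    proof
      fix t :: complex assume "t \<in> ball 0 d"
      then have "norm t * (norm T + 1) < e" by (simp add: d_def pos_less_divide_eq add_nonneg_pos)
      moreover have "norm t * norm T \<le> norm t * (norm T + 1)" by (simp add: mult_left_mono)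
      ultimately have "t *s T \<in> ball 0 e" by (simp add: nT)
      then show "t \<in> {t. R (yt t) = 0}" using z by simp
    qed
    then have inf: "infinite {t. R (yt t) = 0}"
      using uncountable_ball[OF d, of "0::complex"] countable_finite finite_subset by blast
    have "(\<lambda>t. R (yt t)) \<in> upoly"
    proof (rule poly_functions_compose[OF R(1), of yt])
      fix h assume "h \<in> coords triples'"
      then obtain i j k where "h = (\<lambda>x. x (i, j, k))" by auto
      then show "(\<lambda>t. h (yt t)) \<in> upoly"
        by (cases "nt j < 3") (auto simp: yt_def intro!: poly_functions.mult poly_functions.const upoly_id)
    qed
    from upoly_zero[OF this inf, of 1] have "R (yt 1) = 0" .
    moreover have "yt 1 = y0" by (auto simp: yt_def)
    ultimately show False using y0(1) by simp
  qed
qed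

text \<open>Each forbidden configuration has an equation that does not vanish identically on the
  divisor; as the divisor is irreducible, the product of the five equations does not either.\<close>

lemma generic_polynomial:
  "\<exists>h\<in>form_polys. (\<exists>\<sigma>\<in>D_3_3_10. h \<sigma> \<noteq> 0) \<and> (\<forall>\<sigma>\<in>D_3_3_10. h \<sigma> \<noteq> 0 \<longrightarrow> (\<forall>f. det f \<noteq> 0 \<longrightarrow>
     pull \<sigma> f \<notin> vanishing (\<lambda>a b c. plane3 a b c \<or> a = 0 \<and> b < 6) \<and>
     pull \<sigma> f \<notin> vanishing (\<lambda>a b c. plane3 a b c \<or> 3 \<le> a \<and> a < 6 \<and> 3 \<le> b \<and> b < 6) \<and>
     pull \<sigma> f \<notin> vanishing (\<lambda>a b c. plane3 a b c \<or> a < 5 \<and> b < 5 \<and> c < 7) \<and>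
     pull \<sigma> f \<notin> vanishing (\<lambda>a b c. plane3 a b c \<or> a = 3 \<and> b = 0 \<or> a = 3 \<and> b < 8 \<and> c < 8) \<and>
     (pull \<sigma> f \<in> vanishing plane3 \<longrightarrow> \<not> degenerate (pull \<sigma> f))))"
proof -
  have dom: "\<exists>h\<in>form_polys. (\<exists>\<sigma>\<in>D_3_3_10. h \<sigma> \<noteq> 0) \<and> (\<forall>\<sigma>\<in>D_3_3_10. P \<sigma> \<longrightarrow> h \<sigma> = 0)"
    if ex: "\<exists>R\<in>poly_functions (coords triples'). (\<exists>y. R y \<noteq> 0) \<and> (\<forall>\<sigma>\<in>alternating_forms. P \<sigma> \<longrightarrow> R (cds \<sigma>) = 0)" for P
  proof -
    obtain R y where R: "R \<in> poly_functions (coords triples')" "R y \<noteq> 0"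
      "\<And>\<sigma>. \<sigma> \<in> alternating_forms \<Longrightarrow> P \<sigma> \<Longrightarrow> R (cds \<sigma>) = 0" using ex by blast
    obtain \<sigma> where "\<sigma> \<in> D_3_3_10" "R (cds \<sigma>) \<noteq> 0" using D_3_3_10_dominant[OF R(1,2)] by blast
    then show ?thesis using R(3) cds_poly[OF R(1)]
      by (intro bexI[of _ "\<lambda>\<sigma>. R (cds \<sigma>)"]) (auto simp: D_3_3_10_def)
  qed
  have comb: "\<exists>h\<in>form_polys. (\<exists>\<sigma>\<in>D_3_3_10. h \<sigma> \<noteq> 0) \<and> (\<forall>\<sigma>\<in>D_3_3_10. P \<sigma> \<or> Q \<sigma> \<longrightarrow> h \<sigma> = 0)"
    if ex: "\<exists>h\<in>form_polys. (\<exists>\<sigma>\<in>D_3_3_10. h \<sigma> \<noteq> 0) \<and> (\<forall>\<sigma>\<in>D_3_3_10. P \<sigma> \<longrightarrow> h \<sigma> = 0)"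
      "\<exists>h\<in>form_polys. (\<exists>\<sigma>\<in>D_3_3_10. h \<sigma> \<noteq> 0) \<and> (\<forall>\<sigma>\<in>D_3_3_10. Q \<sigma> \<longrightarrow> h \<sigma> = 0)" for P Q
  proof -
    obtain h1 s1 where h1: "h1 \<in> form_polys" "s1 \<in> D_3_3_10" "h1 s1 \<noteq> 0" "\<And>\<sigma>. \<sigma> \<in> D_3_3_10 \<Longrightarrow> P \<sigma> \<Longrightarrow> h1 \<sigma> = 0"
      using ex(1) by blast
    obtain h2 s2 where h2: "h2 \<in> form_polys" "s2 \<in> D_3_3_10" "h2 s2 \<noteq> 0" "\<And>\<sigma>. \<sigma> \<in> D_3_3_10 \<Longrightarrow> Q \<sigma> \<Longrightarrow> h2 \<sigma> = 0"
      using ex(2) by blast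
    obtain s where "s \<in> D_3_3_10" "h1 s \<noteq> 0" "h2 s \<noteq> 0" using D_3_3_10_irreducible[OF h1(1) h2(1) h1(2) h2(2) h1(3) h2(3)] by blast
    then show ?thesis using h1 h2 by (intro bexI[of _ "\<lambda>\<sigma>. h1 \<sigma> * h2 \<sigma>"]) (auto intro: poly_functions.mult)
  qed
  define B where "B P \<sigma> \<longleftrightarrow> (\<exists>f. det f \<noteq> 0 \<and> pull \<sigma> f \<in> vanishing P)" for P \<sigma>
  have sp: "\<exists>h\<in>form_polys. (\<exists>\<sigma>\<in>D_3_3_10. h \<sigma> \<noteq> 0) \<and> (\<forall>\<sigma>\<in>D_3_3_10. B P \<sigma> \<longrightarrow> h \<sigma> = 0)"
    if "\<exists>R\<in>poly_functions (coords triples'). (\<exists>y. R y \<noteq> 0) \<and>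
    (\<forall>\<sigma>\<in>alternating_forms. \<forall>f. det f \<noteq> 0 \<longrightarrow> pull \<sigma> f \<in> vanishing P \<longrightarrow> R (cds \<sigma>) = 0)" for P
    by (rule dom) (use that in \<open>unfold B_def, blast\<close>)
  have dg: "\<exists>h\<in>form_polys. (\<exists>\<sigma>\<in>D_3_3_10. h \<sigma> \<noteq> 0) \<and> (\<forall>\<sigma>\<in>D_3_3_10.
      (\<exists>f. det f \<noteq> 0 \<and> pull \<sigma> f \<in> vanishing plane3 \<and> degenerate (pull \<sigma> f)) \<longrightarrow> h \<sigma> = 0)"
    by (rule dom) (use hypersurface_degenerate in blast)
  from comb[OF sp[OF hypersurface_rank4_pencil] comb[OF sp[OF hypersurface_second_plane]
      comb[OF sp[OF hypersurface_isotropic_flag] comb[OF sp[OF hypersurface_rank4_point] dg]]]]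
  obtain h \<sigma> where h: "h \<in> form_polys" "\<sigma> \<in> D_3_3_10" "h \<sigma> \<noteq> 0" and
    bad: "\<And>\<sigma>. \<sigma> \<in> D_3_3_10 \<Longrightarrow>
      B (\<lambda>a b c. plane3 a b c \<or> a = 0 \<and> b < 6) \<sigma> \<or>
      B (\<lambda>a b c. plane3 a b c \<or> 3 \<le> a \<and> a < 6 \<and> 3 \<le> b \<and> b < 6) \<sigma> \<or>
      B (\<lambda>a b c. plane3 a b c \<or> a < 5 \<and> b < 5 \<and> c < 7) \<sigma> \<or>
      B (\<lambda>a b c. plane3 a b c \<or> a = 3 \<and> b = 0 \<or> a = 3 \<and> b < 8 \<and> c < 8) \<sigma> \<or>
      (\<exists>f. det f \<noteq> 0 \<and> pull \<sigma> f \<in> vanishing plane3 \<and> degenerate (pull \<sigma> f)) \<Longrightarrow> h \<sigma> = 0"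
    by blast
  show ?thesis
  proof (rule bexI[OF _ h(1)], intro conjI ballI impI allI)
    show "\<exists>\<sigma>\<in>D_3_3_10. h \<sigma> \<noteq> 0" using h by blast
  qed (use bad in \<open>unfold B_def, blast+\<close>)
qed

section \<open>Dimension counts for pairings\<close>

definition functional :: "(complex^'n \<Rightarrow> complex) \<Rightarrow> bool" where
  "functional f \<longleftrightarrow> (\<forall>x y. f (x + y) = f x + f y) \<and> (\<forall>c x. f (c *s x) = c * f x)"

lemma functional_simps:
  assumes "functional f"
  shows "f (x + y) = f x + f y" "f (c *s x) = c * f x" "f 0 = 0" "f (x - y) = f x - f y"
proof -
  show 1: "f (x + y) = f x + f y" and 2: "f (c *s x) = c * f x" for x y c
    using assms by (auto simp: functional_def)
  show "f 0 = 0" using 2[of 0 0] by simp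
  show "f (x - y) = f x - f y" using 1[of "x - y" y] by simp
qed

lemma functional_span:
  assumes "functional f" "x \<in> vec.span S" "\<And>s. s \<in> S \<Longrightarrow> f s = 0"
  shows "f x = 0"
  using assms(2,3)
proof (induction rule: vec.span_induct_alt)
  case base
  then show ?case by (simp add: functional_simps[OF assms(1)])
next
  case (step c x y)
  then show ?case by (simp add: functional_simps[OF assms(1)])
qed

lemma subspace_kernel:
  assumes "vec.subspace S" "functional f"
  shows "vec.subspace {x \<in> S. f x = 0}"
  using assms(1) by (auto simp: vec.subspace_def functional_simps[OF assms(2)])

lemma subspace_kernels:
  assumes "vec.subspace S" "\<And>b. b \<in> B \<Longrightarrow> functional (\<phi> b)"
  shows "vec.subspace {x \<in> S. \<forall>b\<in>B. \<phi> b x = 0}"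
  using assms(1) by (auto simp: vec.subspace_def functional_simps[OF assms(2)])

lemma dim_kernel:
  assumes "vec.subspace S" "functional f"
  shows "vec.dim S \<le> vec.dim {x \<in> S. f x = 0} + 1"
proof (cases "\<exists>a\<in>S. f a \<noteq> 0")
  case True
  then obtain a where a: "a \<in> S" "f a \<noteq> 0" by blast
  have "S \<subseteq> vec.span (insert a {x \<in> S. f x = 0})"
  proof
    fix x assume x: "x \<in> S"
    have "x - (f x / f a) *s a \<in> {x \<in> S. f x = 0}"
      using x a assms(1) by (auto simp: functional_simps[OF assms(2)] vec.subspace_diff vec.subspace_scale)
    then show "x \<in> vec.span (insert a {x \<in> S. f x = 0})"
      unfolding vec.span_breakdown_eq by (auto intro: vec.span_base)
  qed
  then have "vec.dim S \<le> vec.dim (insert a {x \<in> S. f x = 0})" by (rule vec.dim_mono)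
  also have "\<dots> \<le> vec.dim {x \<in> S. f x = 0} + 1" by (simp add: vec.dim_insert)
  finally show ?thesis .
next
  case False
  then have "{x \<in> S. f x = 0} = S" by auto
  then show ?thesis by simp
qed

lemma dim_kernels:
  assumes "finite B" "vec.subspace S" "\<And>b. b \<in> B \<Longrightarrow> functional (\<phi> b)"
  shows "vec.dim S \<le> vec.dim {x \<in> S. \<forall>b\<in>B. \<phi> b x = 0} + card B"
  using assms(1,3)
proof (induction B rule: finite_induct)
  case (insert b B)
  let ?S = "{x \<in> S. \<forall>b\<in>B. \<phi> b x = 0}"
  have "vec.subspace ?S" using insert.prems assms(2) by (intro subspace_kernels) auto
  then have "vec.dim ?S \<le> vec.dim {x \<in> ?S. \<phi> b x = 0} + 1" using insert.prems by (intro dim_kernel) auto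
  moreover have "{x \<in> ?S. \<phi> b x = 0} = {x \<in> S. \<forall>b\<in>insert b B. \<phi> b x = 0}" by auto
  ultimately show ?case using insert by simp
qed simp

definition bilinear_form :: "(complex^'n \<Rightarrow> complex^'m \<Rightarrow> complex) \<Rightarrow> bool" where
  "bilinear_form \<beta> \<longleftrightarrow> (\<forall>x. functional (\<beta> x)) \<and> (\<forall>y. functional (\<lambda>x. \<beta> x y))"

text \<open>Take a basis of \<open>S\<close> that extends one of its left kernel. The kernel part
  imposes no condition on \<open>T\<close>, so \<open>T\<close> is cut out by the remaining basis
  vectors only. Exchanging the two sides gives the equality \<open>pairing\<close>, the source of
  most dimension counts below.\<close>

lemma pairing_le:
  assumes "bilinear_form \<beta>" "vec.subspace S" "vec.subspace T"
  shows "vec.dim T + vec.dim {s \<in> S. \<forall>t\<in>T. \<beta> s t = 0} \<le> vec.dim {t \<in> T. \<forall>s\<in>S. \<beta> s t = 0} + vec.dim S"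
proof -
  let ?S0 = "{s \<in> S. \<forall>t\<in>T. \<beta> s t = 0}"
  have fb: "functional (\<beta> x)" "functional (\<lambda>x. \<beta> x y)" for x y using assms(1) by (auto simp: bilinear_form_def)
  obtain B0 where B0: "B0 \<subseteq> ?S0" "vec.independent B0" "?S0 \<subseteq> vec.span B0" "card B0 = vec.dim ?S0"
    by (rule vec.basis_exists[of ?S0])
  then have "B0 \<subseteq> S" by auto
  then obtain B where B: "B0 \<subseteq> B" "B \<subseteq> S" "vec.independent B" "S \<subseteq> vec.span B"
    using vec.maximal_independent_subset_extend[OF _ B0(2)] by blast
  have fB: "finite B" using B(3) vec.finiteI_independent by blast
  have cB: "card B = vec.dim S" using vec.basis_card_eq_dim[OF B(2) B(4) B(3)] .
  have "{t \<in> T. \<forall>s\<in>S. \<beta> s t = 0} = {t \<in> T. \<forall>s\<in>B - B0. \<beta> s t = 0}"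
  proof (intro subset_antisym subsetI)
    fix t assume t: "t \<in> {t \<in> T. \<forall>s\<in>B - B0. \<beta> s t = 0}"
    have "\<beta> s t = 0" if "s \<in> S" for s
    proof (rule functional_span[OF fb(2)])
      show "s \<in> vec.span B" using that B(4) by blast
      show "\<beta> b t = 0" if "b \<in> B" for b using that t B0(1) by (cases "b \<in> B0") auto
    qed
    then show "t \<in> {t \<in> T. \<forall>s\<in>S. \<beta> s t = 0}" using t by auto
  qed (use B(2) in auto)
  moreover have "vec.dim T \<le> vec.dim {t \<in> T. \<forall>s\<in>B - B0. \<beta> s t = 0} + card (B - B0)"
    using fB assms(3) fb by (intro dim_kernels) auto
  moreover have "card (B - B0) = card B - card B0"
    using B(1) fB by (intro card_Diff_subset) (auto intro: finite_subset)
  moreover have "card B0 \<le> card B" using B(1) fB by (rule card_mono[rotated])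
  ultimately show ?thesis using B0(4) cB by simp
qed

lemma pairing:
  assumes "bilinear_form \<beta>" "vec.subspace S" "vec.subspace T"
  shows "vec.dim {t \<in> T. \<forall>s\<in>S. \<beta> s t = 0} + vec.dim S = vec.dim T + vec.dim {s \<in> S. \<forall>t\<in>T. \<beta> s t = 0}"
proof -
  have "bilinear_form (\<lambda>y x. \<beta> x y)" using assms(1) by (auto simp: bilinear_form_def)
  from pairing_le[OF this assms(3,2)] pairing_le[OF assms] show ?thesis by simp
qed

text \<open>The orthogonal of a hyperbolic plane \<open>?P\<close> inside \<open>S\<close> has
  dimension two less and the same radical.\<close>

lemma alternating_parity:
  fixes \<beta> :: "complex^'n \<Rightarrow> complex^'n \<Rightarrow> complex"
  assumes \<beta>: "bilinear_form \<beta>" "\<And>x. \<beta> x x = 0" and "vec.subspace S"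
  shows "even (vec.dim S + vec.dim {s \<in> S. \<forall>t\<in>S. \<beta> s t = 0})"
  using assms(3)
proof (induction "vec.dim S" arbitrary: S rule: less_induct)
  case less
  have fb: "functional (\<beta> x)" "functional (\<lambda>x. \<beta> x y)" for x y using \<beta>(1) by (auto simp: bilinear_form_def)
  note lin = functional_simps[OF fb(1)] functional_simps[OF fb(2)]
  have skew: "\<beta> y x = - \<beta> x y" for x y
  proof -
    have "\<beta> (x + y) (x + y) = \<beta> x y + \<beta> y x" by (simp only: lin) (simp add: \<beta>(2))
    then have "\<beta> x y + \<beta> y x = 0" using \<beta>(2)[of "x + y"] by simp
    then show ?thesis by (metis add_eq_0_iff)
  qed
  show ?case
  proof (cases "\<exists>x\<in>S. \<exists>y\<in>S. \<beta> x y \<noteq> 0")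
    case False
    then have "{s \<in> S. \<forall>t\<in>S. \<beta> s t = 0} = S" by auto
    then show ?thesis by simp
  next
    case True
    then obtain x y where xy: "x \<in> S" "y \<in> S" "\<beta> x y \<noteq> 0" by blast
    let ?P = "vec.span {x, y}"
    let ?S' = "{z \<in> S. \<forall>s\<in>?P. \<beta> s z = 0}"
    have S'_iff: "z \<in> ?S' \<longleftrightarrow> z \<in> S \<and> \<beta> x z = 0 \<and> \<beta> y z = 0" for z
      using functional_span[OF fb(2), of _ "{x, y}"] by (auto intro: vec.span_base)
    have PS: "?P \<subseteq> S" using xy less.prems by (intro vec.span_minimal) auto
    have P0: "{s \<in> ?P. \<forall>t\<in>S. \<beta> s t = 0} = {0}"
    proof (intro subset_antisym subsetI)
      fix s assume s: "s \<in> {s \<in> ?P. \<forall>t\<in>S. \<beta> s t = 0}"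
      then obtain a where "s - a *s x \<in> vec.span {y}" by (auto simp: vec.span_breakdown_eq)
      then obtain b where "s - a *s x = b *s y" by (auto simp: vec.span_singleton)
      then have sab: "s = a *s x + b *s y" by (simp add: algebra_simps)
      have "\<beta> s x = 0" "\<beta> s y = 0" using s xy by auto
      then have "a = 0" "b = 0" using xy(3) skew[of x y] by (auto simp: sab lin \<beta>(2))
      then show "s \<in> {0}" using sab by simp
    qed (auto simp: lin vec.span_zero)
    have ind: "x \<notin> vec.span {y}"
    proof
      assume "x \<in> vec.span {y}"
      then obtain b where "x = b *s y" by (auto simp: vec.span_singleton)
      then show False using xy(3) by (simp add: lin \<beta>(2))
    qed
    have "y \<noteq> 0" using xy(3) by (auto simp: lin)
    then have dP: "vec.dim ?P = 2" using ind by (simp add: vec.dim_insert)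
    have sS': "vec.subspace ?S'" by (rule subspace_kernels[OF less.prems fb(1)])
    have d: "vec.dim ?S' + 2 = vec.dim S"
      using pairing[OF \<beta>(1) vec.subspace_span less.prems, of "{x, y}"] unfolding P0 dP by simp
    have rad: "{s \<in> ?S'. \<forall>t\<in>?S'. \<beta> s t = 0} = {s \<in> S. \<forall>t\<in>S. \<beta> s t = 0}"
    proof (intro subset_antisym subsetI)
      fix s assume s: "s \<in> {s \<in> ?S'. \<forall>t\<in>?S'. \<beta> s t = 0}"
      have sx: "s \<in> S" "\<beta> x s = 0" "\<beta> y s = 0" using s S'_iff by blast+
      have "\<beta> s t = 0" if "t \<in> S" for t
      proof -
        let ?t = "t - (\<beta> x t / \<beta> x y) *s y - (\<beta> y t / \<beta> y x) *s x"
        have yx: "\<beta> y x \<noteq> 0" using xy skew[of x y] by simp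
        have "?t \<in> S" using that xy less.prems by (intro vec.subspace_diff vec.subspace_scale) auto
        then have "?t \<in> ?S'" unfolding S'_iff using xy yx by (simp add: lin \<beta>(2))
        then have "\<beta> s ?t = 0" using s by blast
        then show ?thesis using sx skew[of x s] skew[of y s] by (simp add: lin)
      qed
      then show "s \<in> {s \<in> S. \<forall>t\<in>S. \<beta> s t = 0}" using sx by auto
    next
      fix s assume s: "s \<in> {s \<in> S. \<forall>t\<in>S. \<beta> s t = 0}"
      then have "s \<in> ?S'" unfolding S'_iff using xy skew[of s x] skew[of s y] by auto
      then show "s \<in> {s \<in> ?S'. \<forall>t\<in>?S'. \<beta> s t = 0}" using s by blast
    qed
    have "even (vec.dim ?S' + vec.dim {s \<in> ?S'. \<forall>t\<in>?S'. \<beta> s t = 0})"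
      using d by (intro less.hyps sS') simp
    then show ?thesis unfolding rad by (simp add: d[symmetric])
  qed
qed

text \<open>Bases are grown as sequences, so that a flag of subspaces corresponds to initial
  segments and vanishing on the flag to conditions on indices.\<close>

lemma extend_independent:
  fixes w :: "nat \<Rightarrow> complex^'n"
  assumes "inj_on w {..<m}" "vec.independent (w ` {..<m})" "m \<le> m'" "m' \<le> vec.dim (w ` {..<m} \<union> X)"
  shows "\<exists>w'. (\<forall>k<m. w' k = w k) \<and> (\<forall>k. m \<le> k \<longrightarrow> k < m' \<longrightarrow> w' k \<in> X) \<and>
    inj_on w' {..<m'} \<and> vec.independent (w' ` {..<m'})"
  using assms(3,4)
proof (induction m' rule: dec_induct)
  case base
  show ?case using assms by (intro exI[of _ w]) auto
next
  case (step n)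
  then obtain w' :: "nat \<Rightarrow> complex^'n" where w': "\<forall>k<m. w' k = w k" "\<forall>k. m \<le> k \<longrightarrow> k < n \<longrightarrow> w' k \<in> X"
    "inj_on w' {..<n}" "vec.independent (w' ` {..<n})" by auto
  have "\<not> X \<subseteq> vec.span (w' ` {..<n})"
  proof
    assume X: "X \<subseteq> vec.span (w' ` {..<n})"
    have "w ` {..<m} = w' ` {..<m}" using w'(1) by (intro image_cong) auto
    also have "\<dots> \<subseteq> w' ` {..<n}" using step(1) by (intro image_mono) auto
    finally have "w ` {..<m} \<subseteq> w' ` {..<n}" .
    then have "w ` {..<m} \<union> X \<subseteq> vec.span (w' ` {..<n})" using X vec.span_superset by blast
    then have "vec.dim (w ` {..<m} \<union> X) \<le> card (w' ` {..<n})" by (rule vec.dim_le_card) simp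
    also have "\<dots> \<le> n" using card_image_le[of "{..<n}" w'] by simp
    finally show False using step by simp
  qed
  then obtain x where x: "x \<in> X" "x \<notin> vec.span (w' ` {..<n})" by blast
  define w'' where "w'' = w'(n := x)"
  have w''n: "w'' k = w' k" if "k \<in> {..<n}" for k using that by (simp add: w''_def)
  have im0: "w'' ` {..<n} = w' ` {..<n}" by (intro image_cong refl w''n)
  have im: "w'' ` {..<Suc n} = insert x (w' ` {..<n})"
    unfolding lessThan_Suc image_insert im0 by (simp add: w''_def)
  have xn: "x \<notin> w' ` {..<n}" by (rule contrapos_nn[OF x(2) vec.span_base])
  have "inj_on w'' {..<Suc n}"
    unfolding lessThan_Suc inj_on_insert
  proof
    show "inj_on w'' {..<n}" using inj_on_cong[of "{..<n}" w'' w'] w''n w'(3) by blast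
    have "w'' n = x" by (simp add: w''_def)
    moreover have "w'' ` ({..<n} - {n}) \<subseteq> w' ` {..<n}" using im0 by blast
    ultimately show "w'' n \<notin> w'' ` ({..<n} - {n})" using xn by blast
  qed
  moreover have "vec.independent (w'' ` {..<Suc n})"
    unfolding im using x(2) w'(4) by (rule vec.independent_insertI)
  moreover have "\<forall>k<m. w'' k = w k" "\<forall>k. m \<le> k \<longrightarrow> k < Suc n \<longrightarrow> w'' k \<in> X"
    using w' x(1) step(1) by (auto simp: w''_def less_Suc_eq)
  ultimately show ?case by blast
qed

section \<open>Sufficiently general elements of the divisor\<close>

text \<open>The conditions hold on a nonempty open subset of the divisor: \<open>nondegenerate\<close> says that the plane
  \<open>V\<close> is infinitesimally rigid, the others exclude configurations of too small a dimension.\<close>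

locale general_trivector = trivector +
  fixes V :: "V10 set"
  assumes V: "vec.subspace V" "vec.dim V = 3" and V_iso: "\<And>x y z. x \<in> V \<Longrightarrow> y \<in> V \<Longrightarrow> \<sigma> x y z = 0"
    and no_rank4: "\<And>v N. v \<in> V \<Longrightarrow> v \<noteq> 0 \<Longrightarrow> vec.subspace N \<Longrightarrow> V \<subseteq> N \<Longrightarrow> (\<And>z w. z \<in> N \<Longrightarrow> \<sigma> v z w = 0)
      \<Longrightarrow> vec.dim N \<le> 5"
    and nondegenerate: "\<And>v1 v2 v3 a1 a2 a3. V = vec.span {v1, v2, v3} \<Longrightarrow> (\<And>z. \<sigma> v1 a2 z = \<sigma> v2 a1 z) \<Longrightarrow>
      (\<And>z. \<sigma> v1 a3 z = \<sigma> v3 a1 z) \<Longrightarrow> (\<And>z. \<sigma> v2 a3 z = \<sigma> v3 a2 z) \<Longrightarrow> a1 \<in> V \<and> a2 \<in> V \<and> a3 \<in> V"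
    and no_second_plane: "\<And>S. vec.subspace S \<Longrightarrow> vec.dim S = 3 \<Longrightarrow> S \<inter> V = {0} \<Longrightarrow>
      (\<And>x y z. x \<in> S \<Longrightarrow> y \<in> S \<Longrightarrow> \<sigma> x y z = 0) \<Longrightarrow> False"
    and no_flag: "\<And>S T. vec.subspace S \<Longrightarrow> vec.subspace T \<Longrightarrow> V \<subseteq> S \<Longrightarrow> S \<subseteq> T \<Longrightarrow> vec.dim S = 5 \<Longrightarrow> vec.dim T = 7 \<Longrightarrow>
      (\<And>x y z. x \<in> S \<Longrightarrow> y \<in> S \<Longrightarrow> z \<in> T \<Longrightarrow> \<sigma> x y z = 0) \<Longrightarrow> False"
    and no_rank4_point: "\<And>c p T. c \<in> V \<Longrightarrow> c \<noteq> 0 \<Longrightarrow> p \<notin> V \<Longrightarrow> vec.subspace T \<Longrightarrow> V \<subseteq> T \<Longrightarrow> p \<in> T \<Longrightarrow>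
      vec.dim T = 8 \<Longrightarrow> (\<And>z. \<sigma> p c z = 0) \<Longrightarrow> (\<And>x y. x \<in> T \<Longrightarrow> y \<in> T \<Longrightarrow> \<sigma> p x y = 0) \<Longrightarrow> False"

lemma vanishing_pullI:
  fixes w :: "nat \<Rightarrow> V10"
  assumes "\<sigma> \<in> alternating_forms" "\<And>i. nt i < m \<Longrightarrow> f *v ee i = w (nt i)"
    and "\<And>a b c z. P a b c \<Longrightarrow> c < 10 \<Longrightarrow> a < m \<and> b < m \<and> (c < m \<and> \<sigma> (w a) (w b) (w c) = 0 \<or> (\<forall>z. \<sigma> (w a) (w b) z = 0))"
  shows "pull \<sigma> f \<in> vanishing P"
proof -
  have "pull \<sigma> f (ee a) (ee b) (ee c) = 0" if P: "P (nt a) (nt b) (nt c)" for a b c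
    using assms(3)[OF P nt_less] assms(2)[of a] assms(2)[of b] assms(2)[of c] by (auto simp: pull_def)
  then show ?thesis using pull_alternating[OF assms(1)] by (simp add: vanishing_def)
qed

text \<open>A violated condition supplies a flag or a deformation. A basis adapted to it, beginning
  with three vectors of \<open>V\<close>, is a matrix \<open>f\<close> that brings
  \<open>\<sigma>\<close> into one of the excluded patterns.\<close>

lemma general_trivectorI:
  assumes \<sigma>: "\<sigma> \<in> D_3_3_10"
    and gen: "\<And>f. det f \<noteq> 0 \<Longrightarrow>
     pull \<sigma> f \<notin> vanishing (\<lambda>a b c. plane3 a b c \<or> a = 0 \<and> b < 6) \<and>
     pull \<sigma> f \<notin> vanishing (\<lambda>a b c. plane3 a b c \<or> 3 \<le> a \<and> a < 6 \<and> 3 \<le> b \<and> b < 6) \<and>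
     pull \<sigma> f \<notin> vanishing (\<lambda>a b c. plane3 a b c \<or> a < 5 \<and> b < 5 \<and> c < 7) \<and>
     pull \<sigma> f \<notin> vanishing (\<lambda>a b c. plane3 a b c \<or> a = 3 \<and> b = 0 \<or> a = 3 \<and> b < 8 \<and> c < 8) \<and>
     (pull \<sigma> f \<in> vanishing plane3 \<longrightarrow> \<not> degenerate (pull \<sigma> f))"
  shows "\<exists>V. general_trivector \<sigma> V"
proof -
  have alt: "\<sigma> \<in> alternating_forms" using \<sigma> by (simp add: D_3_3_10_def)
  interpret trivector \<sigma> by unfold_locales fact
  obtain V where V: "vec.subspace V" "vec.dim V = 3" and V_iso: "\<And>x y z. x \<in> V \<Longrightarrow> y \<in> V \<Longrightarrow> \<sigma> x y z = 0"
    using \<sigma> by (auto simp: D_3_3_10_def)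
  have V0: "0 \<in> V" using V(1) by (rule vec.subspace_0)
  have dimU: "vec.dim (w ` {..<m} \<union> T) = vec.dim T" if "w ` {..<m::nat} \<subseteq> T" for w :: "nat \<Rightarrow> V10" and m T
    using that by (simp add: Un_absorb1)
  have listV: "\<exists>w :: nat \<Rightarrow> V10. (\<forall>k<3. w k \<in> V) \<and> (v \<noteq> 0 \<longrightarrow> w 0 = v) \<and> inj_on w {..<3} \<and> vec.independent (w ` {..<3})"
    if v: "v \<in> V" for v
  proof (cases "v = 0")
    case True
    show ?thesis
      using extend_independent[of "\<lambda>_. v" 0 3 V] V(2) True vec.independent_empty by auto
  next
    case False
    have "vec.independent {v}" using False by simp
    then show ?thesis
      using extend_independent[of "\<lambda>_. v" 1 3 V] dimU[of "\<lambda>_. v" 1 V] V(2) v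
      by (auto simp: lessThan_Suc less_Suc_eq numeral_3_eq_3)
  qed
  have "general_trivector \<sigma> V"
  proof unfold_locales
    show "vec.subspace V" "vec.dim V = 3" "\<And>x y z. x \<in> V \<Longrightarrow> y \<in> V \<Longrightarrow> \<sigma> x y z = 0" by fact+
  next
    fix v N assume v: "v \<in> V" "v \<noteq> 0" and N: "vec.subspace N" "V \<subseteq> N" "\<And>z w. z \<in> N \<Longrightarrow> \<sigma> v z w = 0"
    show "vec.dim N \<le> 5"
    proof (rule ccontr)
      assume "\<not> ?thesis"
      then have d: "6 \<le> vec.dim N" by simp
      obtain w :: "nat \<Rightarrow> V10" where w: "\<forall>k<3. w k \<in> V" "w 0 = v" "inj_on w {..<3}" "vec.independent (w ` {..<3})"
        using listV[OF v(1)] v(2) by blast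
      have "w ` {..<3} \<subseteq> N" using w(1) N(2) by auto
      then obtain w' :: "nat \<Rightarrow> V10" where w': "\<forall>k<3. w' k = w k" "\<forall>k. 3 \<le> k \<longrightarrow> k < 6 \<longrightarrow> w' k \<in> N"
        "inj_on w' {..<6}" "vec.independent (w' ` {..<6})"
        using extend_independent[OF w(3,4), of 6 N] d by (auto simp: dimU)
      have wN: "w' k \<in> N" if "k < 6" for k using w' w(1) N(2) that by (metis linorder_not_less subsetD)
      obtain f where f: "det f \<noteq> 0" "\<And>i. nt i < 6 \<Longrightarrow> f *v ee i = w' (nt i)"
        using independent_to_matrix[OF w'(3,4)] by blast
      have "pull \<sigma> f \<in> vanishing (\<lambda>a b c. plane3 a b c \<or> a = 0 \<and> b < 6)"
        by (rule vanishing_pullI[OF alt f(2)]) (use w w' wN N(3) V_iso in \<open>auto simp: plane3_def\<close>)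
      then show False using gen[OF f(1)] by blast
    qed
  next
    fix v1 v2 v3 a1 a2 a3
    assume Vs: "V = vec.span {v1, v2, v3}" and a: "\<And>z. \<sigma> v1 a2 z = \<sigma> v2 a1 z" "\<And>z. \<sigma> v1 a3 z = \<sigma> v3 a1 z"
      "\<And>z. \<sigma> v2 a3 z = \<sigma> v3 a2 z"
    define w where "w k = (if k = 0 then v1 else if k = 1 then v2 else v3)" for k :: nat
    have wim: "w ` {..<3} = {v1, v2, v3}" by (auto simp: w_def numeral_3_eq_3 lessThan_Suc)
    have d3: "vec.dim {v1, v2, v3} = 3" using V(2) Vs by simp
    have c3: "card {v1, v2, v3} = 3"
    proof -
      have "3 \<le> card {v1, v2, v3}" using vec.dim_le_card[OF vec.span_superset, of "{v1, v2, v3}"] d3 by simp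
      moreover have "card {v1, v2, v3} \<le> 3" by (simp add: card_insert_if)
      ultimately show ?thesis by simp
    qed
    have ind: "vec.independent (w ` {..<3})"
      unfolding wim
      by (rule vec.card_eq_dim[OF subset_refl, THEN iffD2]) (use c3 d3 in simp, simp, rule vec.span_superset)
    have inj: "inj_on w {..<3}" using c3 by (intro eq_card_imp_inj_on) (auto simp: wim)
    obtain f where f: "det f \<noteq> 0" "\<And>i. nt i < 3 \<Longrightarrow> f *v ee i = w (nt i)"
      using independent_to_matrix[OF inj ind] by blast
    have wV: "w k \<in> V" for k using Vs by (auto simp: w_def intro: vec.span_base)
    have "pull \<sigma> f \<in> vanishing plane3"
      by (rule vanishing_pullI[OF alt f(2)]) (use wV V_iso in \<open>auto simp: plane3_def\<close>)
    then have ndeg: "\<not> degenerate (pull \<sigma> f)" using gen[OF f(1)] by blast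
    define a where "a k = (if k = 0 then a1 else if k = 1 then a2 else a3)" for k :: nat
    define a' where "a' j = (1 / det f) *s (adj f *v a (nt j))" for j
    have fa': "f *v a' j = a (nt j)" for j
      using f(1) by (simp add: a'_def vec.scale adj_right_vec)
    have "\<sigma> (w i) (a j) z = \<sigma> (w j) (a i) z" if "i < 3" "j < 3" for i j z
    proof -
      have "i = 0 \<or> i = 1 \<or> i = 2" "j = 0 \<or> j = 1 \<or> j = 2" using that by auto
      then show ?thesis using \<open>\<And>z. \<sigma> v1 a2 z = \<sigma> v2 a1 z\<close> \<open>\<And>z. \<sigma> v1 a3 z = \<sigma> v3 a1 z\<close> \<open>\<And>z. \<sigma> v2 a3 z = \<sigma> v3 a2 z\<close>
        by (elim disjE) (simp_all add: w_def a_def)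
    qed
    then have "\<forall>i j z. nt i < 3 \<longrightarrow> nt j < 3 \<longrightarrow> pull \<sigma> f (ee i) (a' j) z = pull \<sigma> f (ee j) (a' i) z"
      by (simp add: pull_def f(2) fa')
    then have z: "a' j $ k = 0" if "nt j < 3" "3 \<le> nt k" for j k using ndeg that unfolding degenerate_def by blast
    have aV: "a m \<in> V" if "m < 3" for m
    proof -
      have "a m = f *v a' (ix m)" using that by (simp add: fa')
      also have "\<dots> = (\<Sum>j\<in>UNIV. a' (ix m) $ j *s (f *v ee j))"
        using matrix_vector_columns[of f "a' (ix m)"] by (simp add: matrix_vector_axis)
      also have "\<dots> \<in> V"
      proof (rule vec.subspace_sum[OF V(1)])
        fix j show "a' (ix m) $ j *s (f *v ee j) \<in> V"
          using z[of "ix m" j] that f(2)[of j] wV V(1) V0 by (cases "nt j < 3") (auto intro: vec.subspace_scale)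
      qed
      finally show ?thesis .
    qed
    show "a1 \<in> V \<and> a2 \<in> V \<and> a3 \<in> V"
      using aV[of 0] aV[of 1] aV[of 2] by (simp add: a_def)
  next
    fix S assume S: "vec.subspace S" "vec.dim S = 3" "S \<inter> V = {0}" "\<And>x y z. x \<in> S \<Longrightarrow> y \<in> S \<Longrightarrow> \<sigma> x y z = 0"
    obtain w :: "nat \<Rightarrow> V10" where w: "\<forall>k<3. w k \<in> V" "inj_on w {..<3}" "vec.independent (w ` {..<3})"
      using listV[OF V0] by blast
    have wV: "w ` {..<3} \<subseteq> V" using w(1) by auto
    have "card (w ` {..<3}) = 3" using w(2) by (simp add: card_image)
    then have sp: "vec.span (w ` {..<3}) = V"
      using vec.card_eq_dim[OF wV] w(3) V vec.span_minimal[OF wV V(1)] by auto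
    have "6 \<le> vec.dim (w ` {..<3} \<union> S)"
    proof -
      have "{x + y |x y. x \<in> V \<and> y \<in> S} \<subseteq> vec.span (w ` {..<3} \<union> S)"
      proof
        fix z assume "z \<in> {x + y |x y. x \<in> V \<and> y \<in> S}"
        then obtain x y where z: "z = x + y" "x \<in> V" "y \<in> S" by blast
        have "x \<in> vec.span (w ` {..<3} \<union> S)"
          using z(2) sp vec.span_mono[of "w ` {..<3}" "w ` {..<3} \<union> S"] by auto
        then show "z \<in> vec.span (w ` {..<3} \<union> S)" using z by (auto intro: vec.span_add vec.span_base)
      qed
      then have "vec.dim {x + y |x y. x \<in> V \<and> y \<in> S} \<le> vec.dim (w ` {..<3} \<union> S)" by (rule vec.dim_mono)
      moreover have "vec.dim {x + y |x y. x \<in> V \<and> y \<in> S} + vec.dim (V \<inter> S) = 6"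
        using vec.dim_sums_Int[OF V(1) S(1)] V(2) S(2) by simp
      moreover have "vec.dim (V \<inter> S) = 0" using S(3) by (simp add: Int_commute)
      ultimately show ?thesis by simp
    qed
    then obtain w' :: "nat \<Rightarrow> V10" where w': "\<forall>k<3. w' k = w k" "\<forall>k. 3 \<le> k \<longrightarrow> k < 6 \<longrightarrow> w' k \<in> S"
        "inj_on w' {..<6}" "vec.independent (w' ` {..<6})"
      using extend_independent[OF w(2,3), of 6 S] by auto
    obtain f where f: "det f \<noteq> 0" "\<And>i. nt i < 6 \<Longrightarrow> f *v ee i = w' (nt i)"
      using independent_to_matrix[OF w'(3,4)] by blast
    have "pull \<sigma> f \<in> vanishing (\<lambda>a b c. plane3 a b c \<or> 3 \<le> a \<and> a < 6 \<and> 3 \<le> b \<and> b < 6)"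
      by (rule vanishing_pullI[OF alt f(2)]) (use w w' S(4) V_iso in \<open>auto simp: plane3_def\<close>)
    then show False using gen[OF f(1)] by blast
  next
    fix S T assume S: "vec.subspace S" "vec.subspace T" "V \<subseteq> S" "S \<subseteq> T" "vec.dim S = 5" "vec.dim T = 7"
      "\<And>x y z. x \<in> S \<Longrightarrow> y \<in> S \<Longrightarrow> z \<in> T \<Longrightarrow> \<sigma> x y z = 0"
    obtain w :: "nat \<Rightarrow> V10" where w: "\<forall>k<3. w k \<in> V" "inj_on w {..<3}" "vec.independent (w ` {..<3})"
      using listV[OF V0] by blast
    have "w ` {..<3} \<subseteq> S" using w(1) S by auto
    then obtain w' :: "nat \<Rightarrow> V10" where w': "\<forall>k<3. w' k = w k" "\<forall>k. 3 \<le> k \<longrightarrow> k < 5 \<longrightarrow> w' k \<in> S"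
        "inj_on w' {..<5}" "vec.independent (w' ` {..<5})"
      using extend_independent[OF w(2,3), of 5 S] S by (auto simp: dimU)
    have wS: "w' k \<in> S" if "k < 5" for k using w' w(1) S(3) that by (metis linorder_not_less subsetD)
    have "w' ` {..<5} \<subseteq> T" using wS S by auto
    then obtain w'' :: "nat \<Rightarrow> V10" where w'': "\<forall>k<5. w'' k = w' k" "\<forall>k. 5 \<le> k \<longrightarrow> k < 7 \<longrightarrow> w'' k \<in> T"
        "inj_on w'' {..<7}" "vec.independent (w'' ` {..<7})"
      using extend_independent[OF w'(3,4), of 7 T] S by (auto simp: dimU)
    have wV: "w'' k \<in> V" if "k < 3" for k using w''(1) w'(1) w(1) that by auto
    have wS': "w'' k \<in> S" if "k < 5" for k using w''(1) wS that by auto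
    have wT: "w'' k \<in> T" if "k < 7" for k using w''(2) wS' S(4) that by (metis linorder_not_less subsetD)
    obtain f where f: "det f \<noteq> 0" "\<And>i. nt i < 7 \<Longrightarrow> f *v ee i = w'' (nt i)"
      using independent_to_matrix[OF w''(3,4)] by blast
    have "pull \<sigma> f \<in> vanishing (\<lambda>a b c. plane3 a b c \<or> a < 5 \<and> b < 5 \<and> c < 7)"
      by (rule vanishing_pullI[OF alt f(2)]) (use wV wS' wT S(7) V_iso in \<open>auto simp: plane3_def\<close>)
    then show False using gen[OF f(1)] by blast
  next
    fix c p T assume c: "c \<in> V" "c \<noteq> 0" and p: "p \<notin> V" and T: "vec.subspace T" "V \<subseteq> T" "p \<in> T" "vec.dim T = 8"
      and z: "\<And>z. \<sigma> p c z = 0" "\<And>x y. x \<in> T \<Longrightarrow> y \<in> T \<Longrightarrow> \<sigma> p x y = 0"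
    obtain w :: "nat \<Rightarrow> V10" where w: "\<forall>k<3. w k \<in> V" "w 0 = c" "inj_on w {..<3}" "vec.independent (w ` {..<3})"
      using listV[OF c(1)] c(2) by blast
    have wV: "w ` {..<3} \<subseteq> V" using w(1) by auto
    have "vec.span (w ` {..<3}) \<subseteq> V" using wV V(1) by (rule vec.span_minimal)
    then have pn: "p \<notin> vec.span (w ` {..<3})" using p by blast
    have "card (w ` {..<3}) = 3" using w(3) by (simp add: card_image)
    then have "vec.dim (w ` {..<3}) = 3" using w(4) vec.dim_eq_card_independent by metis
    then have "4 \<le> vec.dim (w ` {..<3} \<union> {p})" using pn by (simp add: vec.dim_insert)
    then obtain w' :: "nat \<Rightarrow> V10" where w': "\<forall>k<3. w' k = w k" "\<forall>k. 3 \<le> k \<longrightarrow> k < 4 \<longrightarrow> w' k \<in> {p}"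
        "inj_on w' {..<4}" "vec.independent (w' ` {..<4})"
      using extend_independent[OF w(3,4), of 4 "{p}"] by auto
    have w3: "w' 3 = p" using w'(2) by simp
    have wT: "w' k \<in> T" if "k < 4" for k
    proof (cases "k < 3")
      case True
      then show ?thesis using w'(1) w(1) T(2) by auto
    next
      case False
      then have "k = 3" using that by simp
      then show ?thesis using w3 T(3) by simp
    qed
    then have "w' ` {..<4} \<subseteq> T" by auto
    then obtain w'' :: "nat \<Rightarrow> V10" where w'': "\<forall>k<4. w'' k = w' k" "\<forall>k. 4 \<le> k \<longrightarrow> k < 8 \<longrightarrow> w'' k \<in> T"
        "inj_on w'' {..<8}" "vec.independent (w'' ` {..<8})"
      using extend_independent[OF w'(3,4), of 8 T] T by (auto simp: dimU)
    have wV': "w'' k \<in> V" if "k < 3" for k using w''(1) w'(1) w(1) that by auto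
    have w0: "w'' 0 = c" "w'' 3 = p" using w''(1) w'(1) w(2) w3 by auto
    have wT': "w'' k \<in> T" if "k < 8" for k using w'' wT that by (metis linorder_not_less)
    obtain f where f: "det f \<noteq> 0" "\<And>i. nt i < 8 \<Longrightarrow> f *v ee i = w'' (nt i)"
      using independent_to_matrix[OF w''(3,4)] by blast
    have "pull \<sigma> f \<in> vanishing (\<lambda>a b c. plane3 a b c \<or> a = 3 \<and> b = 0 \<or> a = 3 \<and> b < 8 \<and> c < 8)"
      by (rule vanishing_pullI[OF alt f(2)]) (use wV' w0 wT' z V_iso in \<open>auto simp: plane3_def\<close>)
    then show False using gen[OF f(1)] by blast
  qed
  then show ?thesis by blast
qed

section \<open>Linear algebra: chains of subspaces, functionals, dual bases\<close>

lemma subspace_exists_outside: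
  assumes "vec.subspace S" "vec.dim S < vec.dim T"
  shows "\<exists>z\<in>T. z \<notin> S"
  using assms vec.dim_subset[of T S] by (meson linorder_not_less subsetI)

lemma subspace_nontrivial:
  assumes "0 < vec.dim T"
  shows "\<exists>z\<in>T. z \<noteq> 0"
  using assms by (metis insertI1 subsetI vec.dim_eq_0 not_gr_zero singletonI)

lemma subspace_eq_span_insert:
  assumes "vec.subspace S" "vec.subspace T" "S \<subseteq> T" "z \<in> T" "z \<notin> S" "vec.dim T = vec.dim S + 1"
  shows "T = vec.span (insert z S)"
proof -
  have "vec.span (insert z S) \<subseteq> T" using assms by (intro vec.span_minimal) auto
  moreover have "vec.dim (vec.span (insert z S)) = vec.dim T"
    using assms by (simp add: vec.dim_insert vec.span_eq_iff[THEN iffD2])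
  ultimately show ?thesis using vec.subspace_dim_equal[OF vec.subspace_span assms(2)] by (metis order_refl)
qed

lemma span_insert_span [simp]: "vec.span (insert z (vec.span S)) = vec.span (insert z S)"
proof (rule vec.span_eq[THEN iffD2], intro conjI)
  show "insert z (vec.span S) \<subseteq> vec.span (insert z S)"
    using vec.span_mono[OF subset_insertI, of S z] vec.span_base[of z "insert z S"] by blast
  show "insert z S \<subseteq> vec.span (insert z (vec.span S))"
    using vec.span_superset[of "insert z (vec.span S)"] vec.span_superset[of S] by blast
qed

lemma extend_by_one:
  assumes "vec.subspace S" "vec.subspace T" "S \<subseteq> T" "vec.dim S < vec.dim T"
  shows "\<exists>z\<in>T. z \<notin> S \<and> vec.span (insert z S) \<subseteq> T \<and> vec.dim (vec.span (insert z S)) = vec.dim S + 1"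
proof -
  obtain z where z: "z \<in> T" "z \<notin> S" using subspace_exists_outside[OF assms(1,4)] by blast
  have "vec.span (insert z S) \<subseteq> T" using assms z by (intro vec.span_minimal) auto
  moreover have "vec.dim (vec.span (insert z S)) = vec.dim S + 1"
    using z(2) assms(1) by (simp add: vec.dim_insert vec.span_eq_iff[THEN iffD2])
  ultimately show ?thesis using z by blast
qed

lemma extend_by_two:
  assumes "vec.subspace S" "vec.subspace T" "S \<subseteq> T" "vec.dim T = vec.dim S + 2"
  shows "\<exists>y\<in>T. \<exists>z\<in>T. T = vec.span (insert z (insert y S)) \<and> (\<forall>a b. a *s y + b *s z \<in> S \<longrightarrow> a = 0 \<and> b = 0)"
proof -
  obtain y where y: "y \<in> T" "y \<notin> S" "vec.span (insert y S) \<subseteq> T" "vec.dim (vec.span (insert y S)) = vec.dim S + 1"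
    using extend_by_one[OF assms(1-3)] assms(4) by auto
  obtain z where z: "z \<in> T" "z \<notin> vec.span (insert y S)"
    using extend_by_one[OF vec.subspace_span assms(2) y(3)] y(4) assms(4) by auto
  have T: "T = vec.span (insert z (insert y S))"
    using subspace_eq_span_insert[OF vec.subspace_span assms(2) y(3) z] y(4) assms(4) by simp
  have "a = 0 \<and> b = 0" if ab: "a *s y + b *s z \<in> S" for a b
  proof -
    have "b = 0"
    proof (rule ccontr)
      assume b: "b \<noteq> 0"
      have "(1 / b) *s ((a *s y + b *s z) - a *s y) \<in> vec.span (insert y S)"
        using ab by (intro vec.span_scale vec.span_diff) (auto intro: vec.span_base)
      then show False using z(2) b by simp
    qed
    moreover have "a = 0"
    proof (rule ccontr)
      assume a: "a \<noteq> 0"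
      have "a *s y \<in> S" using ab \<open>b = 0\<close> by simp
      then have "(1 / a) *s (a *s y) \<in> S" by (rule vec.subspace_scale[OF assms(1)])
      then show False using y(2) a by simp
    qed
    ultimately show ?thesis by simp
  qed
  then show ?thesis using y(1) z(1) T by blast
qed

lemma in_span_insert: "x \<in> vec.span (insert a S) \<longleftrightarrow> (\<exists>k. \<exists>s\<in>vec.span S. x = k *s a + s)"
  unfolding vec.span_breakdown_eq by (metis add.commute add_diff_cancel_left' diff_add_cancel)

lemma in_span_insert_subspace:
  "vec.subspace S \<Longrightarrow> x \<in> vec.span (insert a S) \<longleftrightarrow> (\<exists>k. \<exists>s\<in>S. x = k *s a + s)"
  by (simp add: in_span_insert vec.span_eq_iff[THEN iffD2])

lemma subspace_between:
  assumes "vec.subspace S" "vec.subspace T" "S \<subseteq> T" "vec.dim S \<le> m" "m \<le> vec.dim T"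
  shows "\<exists>C. vec.subspace C \<and> S \<subseteq> C \<and> C \<subseteq> T \<and> vec.dim C = m"
  using assms(4,5)
proof (induction m rule: dec_induct)
  case base
  then show ?case using assms by blast
next
  case (step n)
  then obtain C where C: "vec.subspace C" "S \<subseteq> C" "C \<subseteq> T" "vec.dim C = n" by auto
  obtain z where "z \<in> T" "vec.span (insert z C) \<subseteq> T" "vec.dim (vec.span (insert z C)) = Suc n"
    using extend_by_one[OF C(1) assms(2) C(3)] C(4) step by auto
  moreover have "S \<subseteq> vec.span (insert z C)" using C(2) vec.span_superset[of "insert z C"] by blast
  ultimately show ?case using vec.subspace_span by blast
qed

lemma functional_multiple:
  assumes "functional f" "functional g" "\<And>y. f y = 0 \<Longrightarrow> g y = 0"
  shows "\<exists>\<alpha>. \<forall>y. g y = \<alpha> * f y"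
proof (cases "\<exists>y. f y \<noteq> 0")
  case True
  then obtain y0 where y0: "f y0 \<noteq> 0" by blast
  have "g y = g y0 / f y0 * f y" for y
  proof -
    have "f (y - (f y / f y0) *s y0) = 0" using y0 by (simp add: functional_simps[OF assms(1)])
    then have "g (y - (f y / f y0) *s y0) = 0" by (rule assms(3))
    then show ?thesis by (simp add: functional_simps[OF assms(2)])
  qed
  then show ?thesis by blast
next
  case False
  then show ?thesis using assms(3) by (intro exI[of _ 0]) auto
qed

lemma functional_expand:
  assumes "functional f"
  shows "f x = (\<Sum>i\<in>UNIV. x $ i * f (ee i))"
proof -
  have s: "f (\<Sum>i\<in>A. g i) = (\<Sum>i\<in>A. f (g i))" for A and g :: "'b \<Rightarrow> _"
    by (induction A rule: infinite_finite_induct) (auto simp: functional_simps[OF assms])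
  have "f x = f (\<Sum>i\<in>UNIV. x $ i *s ee i)" by (simp add: basis_expansion)
  then show ?thesis by (simp only: s functional_simps[OF assms])
qed

lemma functional_sum:
  assumes "functional f"
  shows "f (\<Sum>i\<in>A. c i *s g i) = (\<Sum>i\<in>A. c i * f (g i))"
  by (induction A rule: infinite_finite_induct) (auto simp: functional_simps[OF assms])

lemma kernel3_pairing:
  fixes \<phi> :: "3 \<Rightarrow> V10 \<Rightarrow> complex"
  assumes "\<And>i. functional (\<phi> i)"
  shows "vec.dim {z. \<forall>i. \<phi> i z = 0} = 7 + vec.dim {c :: complex^3. \<forall>z. (\<Sum>i\<in>UNIV. c $ i * \<phi> i z) = 0}"
proof -
  define \<beta> where "\<beta> c z = (\<Sum>i\<in>UNIV. c $ i * \<phi> i z)" for c :: "complex^3" and z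
  have "bilinear_form \<beta>"
    unfolding bilinear_form_def functional_def \<beta>_def
    by (auto simp: functional_simps[OF assms] algebra_simps sum.distrib sum_distrib_left)
  from pairing[OF this vec.subspace_UNIV vec.subspace_UNIV]
  have "vec.dim {t. \<forall>s. \<beta> s t = 0} + 3 = 10 + vec.dim {s. \<forall>t. \<beta> s t = 0}"
    by (simp add: card_cart_basis)
  moreover have "{t. \<forall>s. \<beta> s t = 0} = {z. \<forall>i. \<phi> i z = 0}"
  proof (intro subset_antisym subsetI CollectI allI)
    fix t i assume "t \<in> {t. \<forall>s. \<beta> s t = 0}"
    then have "\<beta> (ee i) t = 0" by blast
    then show "\<phi> i t = 0" by (simp add: \<beta>_def axis_nth if_distrib[of "\<lambda>a. a * _"] cong: if_cong)
  qed (simp add: \<beta>_def)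
  ultimately show ?thesis by (simp add: \<beta>_def)
qed

lemma dual_basis3:
  fixes \<phi> :: "3 \<Rightarrow> V10 \<Rightarrow> complex"
  assumes \<phi>: "\<And>i. functional (\<phi> i)" and "vec.dim {z. \<forall>i. \<phi> i z = 0} = 7"
  shows "\<exists>a. \<forall>i k. \<phi> i (a k) = (if i = k then 1 else 0)"
proof -
  define A :: "complex^10^3" where "A = (\<chi> i j. \<phi> i (ee j))"
  have Az: "(A *v z) $ i = \<phi> i z" for z i
    by (simp add: A_def matrix_vector_mult_def functional_expand[OF \<phi>, of i z] mult.commute)
  have "vec.dim {c :: complex^3. \<forall>z. (\<Sum>i\<in>UNIV. c $ i * \<phi> i z) = 0} = 0"
    using kernel3_pairing[of \<phi>, OF \<phi>] assms(2) by simp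
  then have c0: "c = 0" if "\<forall>z. (\<Sum>i\<in>UNIV. c $ i * \<phi> i z) = 0" for c :: "complex^3"
    using that by auto
  have "\<forall>c. (\<Sum>i\<in>UNIV. c i *s row i A) = 0 \<longrightarrow> (\<forall>i. c i = 0)"
  proof (intro allI impI)
    fix c i assume c: "(\<Sum>i\<in>UNIV. c i *s row i A) = 0"
    have "(\<Sum>i\<in>UNIV. c i * \<phi> i z) = 0" for z
    proof -
      have "(\<Sum>i\<in>UNIV. c i * \<phi> i z) = (\<Sum>i\<in>UNIV. \<Sum>j\<in>UNIV. z $ j * (c i * A $ i $ j))"
        by (simp add: Az[symmetric] matrix_vector_mult_def sum_distrib_left algebra_simps)
      also have "\<dots> = (\<Sum>j\<in>UNIV. z $ j * (\<Sum>i\<in>UNIV. c i *s row i A) $ j)"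
        by (subst sum.swap) (simp add: sum_distrib_left row_def)
      finally show ?thesis by (simp add: c)
    qed
    then have "(\<chi> i. c i) = 0" by (intro c0) simp
    then show "c i = 0" by (simp add: vec_eq_iff)
  qed
  then obtain B where B: "A ** B = mat 1" using matrix_right_invertible_independent_rows[of A] by blast
  have "\<phi> i (B *v ee k) = (if i = k then 1 else 0)" for i k
    unfolding Az[symmetric] by (simp add: matrix_vector_mul_assoc B axis_nth)
  then show ?thesis by (intro exI[of _ "\<lambda>k. B *v ee k"]) simp
qed

text \<open>A converse to \<open>dual_basis3\<close>: the determinant certifies dimension 7 by a
  condition that is open and polynomial. This is used both for limits and for the charts of the
  rational inverse.\<close>

lemma det_dual3:
  fixes \<phi> :: "3 \<Rightarrow> V10 \<Rightarrow> complex"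
  assumes \<phi>: "\<And>i. functional (\<phi> i)" and D: "det (\<chi> i k. \<phi> i (a k)) \<noteq> 0"
  shows "vec.dim {z. \<forall>i. \<phi> i z = 0} = 7"
proof -
  have "c = 0" if c: "\<forall>z. (\<Sum>i\<in>UNIV. c $ i * \<phi> i z) = 0" for c :: "complex^3"
  proof (rule det_nonzero_injD)
    show "det (transpose (\<chi> i k. \<phi> i (a k))) \<noteq> 0" using D by (simp add: det_transpose)
    show "transpose (\<chi> i k. \<phi> i (a k)) *v c = transpose (\<chi> i k. \<phi> i (a k)) *v 0"
      using c by (simp add: vec_eq_iff matrix_vector_mult_def transpose_def mult.commute)
  qed
  then have "{c :: complex^3. \<forall>z. (\<Sum>i\<in>UNIV. c $ i * \<phi> i z) = 0} \<subseteq> {0}" by blast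
  then have "vec.dim {c :: complex^3. \<forall>z. (\<Sum>i\<in>UNIV. c $ i * \<phi> i z) = 0} = 0"
    by (simp only: vec.dim_eq_0)
  then show ?thesis using kernel3_pairing[of \<phi>, OF \<phi>] by simp
qed

lemma tendsto_scale_vec:
  assumes "(f \<longlongrightarrow> a) F" "(g \<longlongrightarrow> (b :: complex^'n)) F"
  shows "((\<lambda>n. f n *s g n) \<longlongrightarrow> a *s b) F"
  by (rule vec_tendstoI) (auto intro!: tendsto_intros assms)

section \<open>Geometry of the Peskine variety\<close>

context trivector
begin

lemma functional_first: "functional (\<lambda>x. \<sigma> x y z)" and functional_second: "functional (\<lambda>y. \<sigma> x y z)"
  and functional_third: "functional (\<sigma> x y)"
  by (auto simp: functional_def linear)

lemma bilinear_form_first: "bilinear_form (\<sigma> p)"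
  by (auto simp: bilinear_form_def functional_second functional_third)

lemma bilinear_form_second: "bilinear_form (\<lambda>v z. \<sigma> v x z)"
  by (auto simp: bilinear_form_def functional_first functional_third)

definition rad :: "V10 \<Rightarrow> V10 set" where "rad p = {z. \<forall>w. \<sigma> p z w = 0}"

lemma rad_subspace: "vec.subspace (rad p)"
  by (auto simp: vec.subspace_def rad_def linear)

lemma rad_self: "p \<in> rad p"
  by (simp add: rad_def)

lemma rad_even: "even (vec.dim (rad p))"
  using alternating_parity[OF bilinear_form_first same(2) vec.subspace_UNIV, of p]
  by (simp add: rad_def card_cart_basis)

text \<open>The orthogonal of \<open>S\<close> has dimension 3 plus that of
  \<open>S \<inter> rad p\<close>, and it contains \<open>S\<close>, whose dimension is 7.\<close>

lemma isotropic_rad: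
  assumes "vec.subspace S" "vec.dim S = 7" "\<And>x y. x \<in> S \<Longrightarrow> y \<in> S \<Longrightarrow> \<sigma> p x y = 0"
  shows "4 \<le> vec.dim (rad p)"
proof -
  have "vec.dim {t. \<forall>s\<in>S. \<sigma> p s t = 0} + 7 = 10 + vec.dim {s \<in> S. \<forall>t. \<sigma> p s t = 0}"
    using pairing[OF bilinear_form_first assms(1) vec.subspace_UNIV, of p] assms(2) by (simp add: card_cart_basis)
  moreover have "7 \<le> vec.dim {t. \<forall>s\<in>S. \<sigma> p s t = 0}"
    unfolding assms(2)[symmetric] using assms(3) by (intro vec.dim_subset) auto
  moreover have "vec.dim {s \<in> S. \<forall>t. \<sigma> p s t = 0} \<le> vec.dim (rad p)"
    by (intro vec.dim_subset) (auto simp: rad_def)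
  ultimately show ?thesis by linarith
qed

lemma tendsto_form:
  assumes "(x \<longlongrightarrow> x0) F" "(y \<longlongrightarrow> y0) F" "(z \<longlongrightarrow> z0) F"
  shows "((\<lambda>n. \<sigma> (x n) (y n) (z n)) \<longlongrightarrow> \<sigma> x0 y0 z0) F"
proof -
  have "((\<lambda>n. \<Sum>i\<in>UNIV. \<Sum>j\<in>UNIV. \<Sum>k\<in>UNIV. x n $ i * y n $ j * z n $ k * \<sigma> (ee i) (ee j) (ee k))
    \<longlongrightarrow> (\<Sum>i\<in>UNIV. \<Sum>j\<in>UNIV. \<Sum>k\<in>UNIV. x0 $ i * y0 $ j * z0 $ k * \<sigma> (ee i) (ee j) (ee k))) F"
    by (intro tendsto_intros assms)
  then show ?thesis by (simp only: expand[symmetric])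
qed

end

section \<open>The spaces \<open>K x\<close> and \<open>W4 x\<close>, and good points\<close>

context general_trivector
begin

definition K :: "V10 \<Rightarrow> V10 set" where "K x = {z. \<forall>v\<in>V. \<sigma> v x z = 0}"

lemma K_subspace: "vec.subspace (K x)"
  by (auto simp: vec.subspace_def K_def linear)

lemma V_K: "V \<subseteq> K x" and self_K: "x \<in> K x"
  using V_iso by (auto simp: K_def swap23[of _ x])

lemma V_zero: "0 \<in> V" and V_add: "u \<in> V \<Longrightarrow> v \<in> V \<Longrightarrow> u + v \<in> V" and V_scale: "v \<in> V \<Longrightarrow> c *s v \<in> V"
  and V_diff: "u \<in> V \<Longrightarrow> v \<in> V \<Longrightarrow> u - v \<in> V"
  using V(1) by (auto simp: vec.subspace_0 vec.subspace_add vec.subspace_scale vec.subspace_diff)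

lemma V_scale_iff: "c \<noteq> 0 \<Longrightarrow> c *s x \<in> V \<longleftrightarrow> x \<in> V"
  using V_scale[of x c] V_scale[of "c *s x" "1 / c"] by auto

lemma V_span: "vec.span V = V"
  using V(1) by (simp add: vec.span_eq_iff)

lemma K_shift: "v \<in> V \<Longrightarrow> c \<noteq> 0 \<Longrightarrow> K (c *s x + v) = K x"
  by (auto simp: K_def linear V_iso)

text \<open>The codimension of \<open>K x\<close> is the rank of the pairing
  \<open>\<sigma> v x z\<close> between \<open>v\<close> in \<open>V\<close> and all
  \<open>z\<close>. This rank, three or two, separates the two kinds of points outside
  \<open>V\<close> that are treated below.\<close>

lemma dim_K: "vec.dim (K x) = 7 + vec.dim {v \<in> V. \<forall>z. \<sigma> v x z = 0}"
  using pairing[OF bilinear_form_second V(1) vec.subspace_UNIV, of x] V(2)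
  by (simp add: K_def card_cart_basis)

lemma span_singleton_V: "c \<in> V \<Longrightarrow> vec.span {c} \<subseteq> V"
  using V(1) by (intro vec.span_minimal) auto

lemma V_basis:
  assumes "c \<in> V" "c' \<in> V" "c \<noteq> 0" "c' \<notin> vec.span {c}"
  shows "\<exists>d\<in>V. V = vec.span {c, c', d}"
proof -
  have d2: "vec.dim (vec.span {c', c}) = 2" using assms by (simp add: vec.dim_insert)
  have sub: "vec.span {c', c} \<subseteq> V" using assms V(1) by (intro vec.span_minimal) auto
  have "vec.dim (vec.span {c', c}) < vec.dim V" using d2 V(2) by simp
  from subspace_exists_outside[OF vec.subspace_span this]
  obtain d where d: "d \<in> V" "d \<notin> vec.span {c', c}" by blast
  have "V = vec.span (insert d (vec.span {c', c}))"
    using d2 V by (intro subspace_eq_span_insert vec.subspace_span sub d) auto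
  also have "\<dots> = vec.span {c, c', d}" by (simp add: insert_commute)
  finally show ?thesis using d by blast
qed

lemma V_second:
  assumes "c \<in> V"
  shows "\<exists>c'\<in>V. c' \<notin> vec.span {c}"
proof -
  have "vec.dim (vec.span {c}) \<le> 1" by simp
  then show ?thesis using subspace_exists_outside[OF vec.subspace_span, of "{c}" V] V(2) by simp
qed

text \<open>Sending \<open>c\<close> and \<open>c'\<close> to 0 and a third basis vector of
  \<open>V\<close> to \<open>x\<close> satisfies the linearized equations, so the rigidity of
  \<open>V\<close> applies.\<close>

lemma common_kernel:
  assumes "c \<in> V" "c' \<in> V" "c \<noteq> 0" "c' \<notin> vec.span {c}" "\<And>z. \<sigma> c x z = 0" "\<And>z. \<sigma> c' x z = 0"
  shows "x \<in> V"
proof -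
  obtain d where d: "d \<in> V" "V = vec.span {c, c', d}" using V_basis[OF assms(1-4)] by blast
  from nondegenerate[OF d(2), of 0 0 x] assms(5,6) show ?thesis by simp
qed

lemma dim_N:
  assumes "x \<notin> V"
  shows "vec.dim {v \<in> V. \<forall>z. \<sigma> v x z = 0} \<le> 1"
proof (rule ccontr)
  let ?N = "{v \<in> V. \<forall>z. \<sigma> v x z = 0}"
  assume "\<not> ?thesis"
  then have d: "2 \<le> vec.dim ?N" by simp
  then obtain c where c: "c \<in> ?N" "c \<noteq> 0" using subspace_nontrivial[of ?N] by auto
  have "vec.dim (vec.span {c}) \<le> 1" by simp
  then obtain c' where "c' \<in> ?N" "c' \<notin> vec.span {c}"
    using subspace_exists_outside[OF vec.subspace_span, of "{c}" ?N] d by auto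
  then show False using common_kernel[of c c' x] c assms by blast
qed

lemma dim_K_cases:
  assumes "x \<notin> V"
  obtains "vec.dim (K x) = 7" "\<And>v. v \<in> V \<Longrightarrow> (\<And>z. \<sigma> v x z = 0) \<Longrightarrow> v = 0"
  | c where "vec.dim (K x) = 8" "c \<in> V" "c \<noteq> 0" "\<And>z. \<sigma> c x z = 0"
proof (cases "vec.dim {v \<in> V. \<forall>z. \<sigma> v x z = 0} = 0")
  case True
  then have "{v \<in> V. \<forall>z. \<sigma> v x z = 0} \<subseteq> {0}" by simp
  then show ?thesis using True dim_K[of x] by (intro that(1)) auto
next
  case False
  then have "vec.dim {v \<in> V. \<forall>z. \<sigma> v x z = 0} = 1" using dim_N[OF assms] by linarith
  moreover obtain c where "c \<in> {v \<in> V. \<forall>z. \<sigma> v x z = 0}" "c \<noteq> 0"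
    using subspace_nontrivial[of "{v \<in> V. \<forall>z. \<sigma> v x z = 0}"] False by blast
  ultimately show ?thesis using dim_K[of x] by (intro that(2)) auto
qed

lemma dim_K_eight:
  assumes "x \<notin> V" "c \<in> V" "c \<noteq> 0" "\<And>z. \<sigma> c x z = 0"
  shows "vec.dim (K x) = 8"
  using dim_K_cases[OF assms(1)] assms by metis

lemma V_rad: "v \<in> V \<Longrightarrow> V \<subseteq> rad v"
  using V_iso by (auto simp: rad_def)

text \<open>The dimension lies between 3 and 5 and is even. In particular all of P(V) belongs to the
  Peskine variety.\<close>

lemma dim_rad_V:
  assumes "v \<in> V" "v \<noteq> 0"
  shows "vec.dim (rad v) = 4"
proof -
  have "3 \<le> vec.dim (rad v)" using vec.dim_subset[OF V_rad[OF assms(1)]] V(2) by simp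
  moreover have "vec.dim (rad v) \<le> 5"
    by (rule no_rank4[OF assms rad_subspace V_rad[OF assms(1)]]) (simp add: rad_def)
  ultimately have "vec.dim (rad v) = 3 \<or> vec.dim (rad v) = 4 \<or> vec.dim (rad v) = 5" by linarith
  then show ?thesis using rad_even[of v] by auto
qed

definition inX :: "V10 \<Rightarrow> bool" where "inX p \<longleftrightarrow> p \<noteq> 0 \<and> 4 \<le> vec.dim (rad p)"

text \<open>By the last condition \<open>p\<close> is determined, up to a factor, by its class modulo \<open>V\<close>.\<close>

definition good :: "V10 \<Rightarrow> bool" where
  "good p \<longleftrightarrow> p \<notin> V \<and> vec.dim (K p) = 7 \<and> (\<forall>x\<in>K p. \<forall>y\<in>K p. \<sigma> p x y = 0) \<and>
     (\<forall>v\<in>V. (\<forall>x\<in>K p. \<forall>y\<in>K p. \<sigma> v x y = 0) \<longrightarrow> v = 0)"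

lemma good_inX: "good p \<Longrightarrow> inX p"
  using isotropic_rad[OF K_subspace, of p p] V_zero by (auto simp: good_def inX_def)

lemma rad_K: "rad p \<subseteq> K p"
proof
  fix z assume "z \<in> rad p"
  then have "\<sigma> p z v = 0" for v by (simp add: rad_def)
  then show "z \<in> K p" unfolding K_def using rotate[of p z] by simp
qed

text \<open>Rank three means that no nonzero vector of \<open>V\<close> lies in the radical. Both
  spaces lie in the seven-dimensional \<open>K p\<close>, which is therefore their direct sum. On it
  \<open>\<sigma> p\<close> vanishes: \<open>V\<close> pairs trivially with \<open>K p\<close> by
  definition, and the radical with everything.\<close>

lemma rank3_point:
  assumes "inX p" "p \<notin> V" "vec.dim (K p) = 7"
  shows "rad p \<inter> V = {0}" "vec.dim (rad p) = 4" "\<And>z. z \<in> K p \<Longrightarrow> \<exists>v\<in>V. \<exists>r\<in>rad p. z = v + r"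
    "\<And>x y. x \<in> K p \<Longrightarrow> y \<in> K p \<Longrightarrow> \<sigma> p x y = 0"
proof -
  have "vec.dim {v \<in> V. \<forall>z. \<sigma> v p z = 0} = 0" using dim_K[of p] assms(3) by simp
  then have N0: "{v \<in> V. \<forall>z. \<sigma> v p z = 0} \<subseteq> {0}" by (simp only: vec.dim_eq_0)
  show i: "rad p \<inter> V = {0}"
  proof (intro subset_antisym subsetI)
    fix v assume "v \<in> rad p \<inter> V"
    then have "v \<in> {v \<in> V. \<forall>z. \<sigma> v p z = 0}" using swap12[of p v] by (auto simp: rad_def)
    then show "v \<in> {0}" using N0 by blast
  qed (use V_zero in \<open>auto simp: rad_def\<close>)
  let ?S = "{x + y |x y. x \<in> V \<and> y \<in> rad p}"
  have d: "vec.dim ?S = 3 + vec.dim (rad p)"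
    using vec.dim_sums_Int[OF V(1) rad_subspace, of p] i V(2) by (simp add: Int_commute)
  have sub: "?S \<subseteq> K p" using V_K rad_K K_subspace by (auto intro!: vec.subspace_add)
  have "vec.dim ?S \<le> 7" using vec.dim_subset[OF sub] assms(3) by simp
  then show d4: "vec.dim (rad p) = 4" using d assms(1) by (simp add: inX_def)
  have "vec.subspace ?S" by (rule vec.subspace_sums[OF V(1) rad_subspace])
  then have eq: "?S = K p"
    using vec.subspace_dim_equal[OF _ K_subspace sub] d d4 assms(3) by simp
  then show dec: "\<exists>v\<in>V. \<exists>r\<in>rad p. z = v + r" if "z \<in> K p" for z using that by blast
  show "\<sigma> p x y = 0" if xy: "x \<in> K p" "y \<in> K p" for x y
  proof -
    obtain v r where x: "x = v + r" "v \<in> V" "r \<in> rad p" using dec[OF xy(1)] by blast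
    have "\<sigma> p v y = 0" using xy(2) x(2) swap12[of p v y] by (simp add: K_def)
    moreover have "\<sigma> p r y = 0" using x(3) by (simp add: rad_def)
    ultimately show ?thesis by (simp add: x linear)
  qed
qed

definition W4 :: "V10 \<Rightarrow> V10 set" where "W4 x = vec.span (insert x V)"

lemma W4_subspace: "vec.subspace (W4 x)" and W4_V: "V \<subseteq> W4 x" and W4_self: "x \<in> W4 x"
  using vec.span_superset[of "insert x V"] by (auto simp: W4_def)

lemma W4_iff: "w \<in> W4 x \<longleftrightarrow> (\<exists>s. \<exists>v\<in>V. w = s *s x + v)"
  unfolding W4_def by (rule in_span_insert_subspace[OF V(1)])

lemma W4_dim: "x \<notin> V \<Longrightarrow> vec.dim (W4 x) = 4"
  unfolding W4_def using V by (simp add: vec.dim_insert V_span)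

lemma W4_K: "W4 x \<subseteq> K x"
  unfolding W4_def using V_K self_K K_subspace by (intro vec.span_minimal) auto

text \<open>Consequently each form \<open>\<sigma> w\<close> with \<open>w\<close> in
  \<open>W4 x\<close> descends to the quotient \<open>K x / W4 x\<close>. For \<open>x\<close>
  outside \<open>V\<close> this quotient has dimension 3 or 4, and the arguments below take place on
  it.\<close>

lemma W4_iso: "w \<in> W4 x \<Longrightarrow> w' \<in> W4 x \<Longrightarrow> z \<in> K x \<Longrightarrow> \<sigma> w w' z = 0"
  by (auto simp: W4_iff K_def linear V_iso swap12[of x])

lemma span_isotropic:
  assumes "\<And>a b. a \<in> G \<Longrightarrow> b \<in> G \<Longrightarrow> \<sigma> u a b = 0" "x \<in> vec.span G" "y \<in> vec.span G"
  shows "\<sigma> u x y = 0"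
proof (rule functional_span[OF functional_second assms(2)])
  fix a assume a: "a \<in> G"
  show "\<sigma> u a y = 0" by (rule functional_span[OF functional_third assms(3)]) (rule assms(1)[OF a])
qed

text \<open>The quotient \<open>K x / W4 x\<close> has dimension 3 and carries only a
  three-dimensional space of skew forms, while \<open>W4 x\<close> has dimension 4. So some nonzero
  element of \<open>W4 x\<close> induces the zero form.\<close>

lemma kernel_exists:
  assumes x: "x \<notin> V" and d: "vec.dim (K x) = 7"
  shows "\<exists>s v. v \<in> V \<and> (s, v) \<noteq> (0, 0) \<and> (\<forall>a\<in>K x. \<forall>b\<in>K x. \<sigma> (s *s x + v) a b = 0)"
proof -
  have "vec.dim (W4 x) < vec.dim (K x)" using d W4_dim[OF x] by simp
  from extend_by_one[OF W4_subspace K_subspace W4_K this]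
  obtain z1 where z1: "z1 \<in> K x" "vec.span (insert z1 (W4 x)) \<subseteq> K x"
    "vec.dim (vec.span (insert z1 (W4 x))) = vec.dim (W4 x) + 1" by blast
  obtain z2 z3 where z: "z2 \<in> K x" "z3 \<in> K x" "K x = vec.span (insert z3 (insert z2 (vec.span (insert z1 (W4 x)))))"
    using extend_by_two[OF vec.subspace_span K_subspace z1(2)] d z1(3) W4_dim[OF x] by auto
  have Kx: "K x = vec.span (insert z3 (insert z2 (insert z1 (W4 x))))"
    using z(3) span_insert_span[of z3 "insert z2 (vec.span (insert z1 (W4 x)))"] span_insert_span[of z2 "insert z1 (W4 x)"]
      span_insert_span[of z3 "insert z2 (insert z1 (W4 x))"] by simp
  define \<phi> where "\<phi> i = (if i = 0 then (\<lambda>u. \<sigma> u z1 z2) else if i = 1 then (\<lambda>u. \<sigma> u z1 z3) else (\<lambda>u. \<sigma> u z2 z3))"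
    for i :: nat
  have "vec.dim (W4 x) \<le> vec.dim {u \<in> W4 x. \<forall>i\<in>{..<3}. \<phi> i u = 0} + card {..<3::nat}"
  proof (rule dim_kernels[OF _ W4_subspace])
    fix i show "functional (\<phi> i)"
      using functional_first by (cases "i = 0"; cases "i = 1") (simp_all add: \<phi>_def)
  qed simp
  then have "0 < vec.dim {u \<in> W4 x. \<forall>i\<in>{..<3}. \<phi> i u = 0}" using W4_dim[OF x] by simp
  from subspace_nontrivial[OF this] obtain u where "u \<in> {u \<in> W4 x. \<forall>i\<in>{..<3}. \<phi> i u = 0}" "u \<noteq> 0" by blast
  then have u: "u \<in> W4 x" "u \<noteq> 0" "\<And>i. i < 3 \<Longrightarrow> \<phi> i u = 0" by auto
  have uz: "\<sigma> u z1 z2 = 0" "\<sigma> u z1 z3 = 0" "\<sigma> u z2 z3 = 0" using u(3)[of 0] u(3)[of 1] u(3)[of 2] by (simp_all add: \<phi>_def)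
  have "\<sigma> u a b = 0" if "a \<in> K x" "b \<in> K x" for a b
  proof (rule span_isotropic[where G = "insert z3 (insert z2 (insert z1 (W4 x)))"])
    fix a b assume ab: "a \<in> insert z3 (insert z2 (insert z1 (W4 x)))" "b \<in> insert z3 (insert z2 (insert z1 (W4 x)))"
    have K: "a \<in> K x" "b \<in> K x" using ab z z1 W4_K by blast+
    show "\<sigma> u a b = 0"
    proof (cases "a \<in> W4 x \<or> b \<in> W4 x")
      case True
      then show ?thesis using W4_iso[OF u(1)] K swap23[of u a b] by auto
    next
      case False
      then show ?thesis using ab uz swap23[of u z1 z2] swap23[of u z1 z3] swap23[of u z2 z3] by auto
    qed
  qed (use that Kx in auto)
  moreover obtain s v where "v \<in> V" "u = s *s x + v" using u(1) by (auto simp: W4_iff)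
  ultimately show ?thesis using u(2) by (intro exI[of _ s] exI[of _ v]) auto
qed

section \<open>The compactness argument for limits of good points\<close>

lemma V_closed: "closed V"
proof -
  have "subspace V"
  proof (unfold subspace_def, intro conjI ballI allI)
    fix c :: real and x assume "x \<in> V"
    then have "complex_of_real c *s x \<in> V" by (rule V_scale)
    moreover have "complex_of_real c *s x = c *\<^sub>R x" by (auto simp: vec_eq_iff scaleR_conv_of_real[where 'a = complex])
    ultimately show "c *\<^sub>R x \<in> V" by simp
  qed (use V_zero V_add in auto)
  then show ?thesis by (rule closed_subspace)
qed

text \<open>By \<open>kernel_exists\<close> each \<open>X n\<close> is congruent, modulo \<open>V\<close>, to a solution of the equations of good
  points. The normalized solutions have a limit by compactness, and \<open>uniq\<close> forces it to be \<open>x0\<close>.\<close>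

lemma limit_core:
  assumes x0: "x0 \<notin> V" and X: "X \<longlonglongrightarrow> x0" "\<And>n. X n \<notin> V" "\<And>n. vec.dim (K (X n)) = 7"
    and uniq: "\<And>r u v u0 v0. strict_mono (r :: nat \<Rightarrow> nat) \<Longrightarrow> (\<And>n. v n \<in> V) \<Longrightarrow>
      (\<And>n a b. a \<in> K (X (r n)) \<Longrightarrow> b \<in> K (X (r n)) \<Longrightarrow> \<sigma> (u n *s X (r n) + v n) a b = 0) \<Longrightarrow>
      u \<longlonglongrightarrow> u0 \<Longrightarrow> v \<longlonglongrightarrow> v0 \<Longrightarrow> v0 = 0"
  shows "x0 \<in> closure (Collect good)"
proof (rule ccontr)
  assume "\<not> ?thesis"
  then obtain e where e: "e > 0" "\<And>y. good y \<Longrightarrow> e \<le> dist y x0"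
    unfolding closure_approachable by (auto simp: not_less)
  have "\<exists>sv. norm sv = 1 \<and> snd sv \<in> V \<and> (\<forall>a\<in>K (X n). \<forall>b\<in>K (X n). \<sigma> (fst sv *s X n + snd sv) a b = 0) \<and>
    (fst sv \<noteq> 0 \<longrightarrow> good (X n + (1 / fst sv) *s snd sv))" for n
  proof -
    have sc: "complex_of_real c *s x = c *\<^sub>R x" for c and x :: V10
      by (auto simp: vec_eq_iff scaleR_conv_of_real[where 'a = complex])
    show ?thesis
    proof (cases "\<exists>v\<in>V. v \<noteq> 0 \<and> (\<forall>a\<in>K (X n). \<forall>b\<in>K (X n). \<sigma> v a b = 0)")
      \<comment> \<open>A solution inside \<open>V\<close> yields no good point, but its normalized
        pair with first component 0 is kept. In the limit, norm one and a vanishing second component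
        force the first component to be nonzero.\<close>
      case True
      then obtain v where v: "v \<in> V" "v \<noteq> 0" "\<And>a b. a \<in> K (X n) \<Longrightarrow> b \<in> K (X n) \<Longrightarrow> \<sigma> v a b = 0" by blast
      let ?v = "complex_of_real (1 / norm v) *s v"
      have "norm ?v = 1" using v(2) by (simp only: sc) simp
      then have "norm (0 :: complex, ?v) = 1" by (simp add: norm_Pair)
      then show ?thesis using v V_scale[OF v(1)] by (intro exI[of _ "(0, ?v)"]) (simp add: linear)
    next
      case False
      obtain s v where sv: "v \<in> V" "(s, v) \<noteq> (0, 0)" "\<forall>a\<in>K (X n). \<forall>b\<in>K (X n). \<sigma> (s *s X n + v) a b = 0"
        using kernel_exists[OF X(2,3)] by blast
      have s: "s \<noteq> 0" using False sv by auto
      have g: "good (X n + (1 / s) *s v)"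
      proof -
        have K: "K (X n + (1 / s) *s v) = K (X n)" using K_shift[of "(1 / s) *s v" 1 "X n"] V_scale[OF sv(1)] by simp
        have eq: "X n + (1 / s) *s v = (1 / s) *s (s *s X n + v)" using s by (simp add: vec.scale_right_distrib)
        have "X n + (1 / s) *s v \<notin> V"
        proof
          assume "X n + (1 / s) *s v \<in> V"
          then have "X n + (1 / s) *s v - (1 / s) *s v \<in> V" by (rule V_diff) (rule V_scale[OF sv(1)])
          then show False using X(2) by simp
        qed
        moreover have "\<forall>x\<in>K (X n). \<forall>y\<in>K (X n). \<sigma> (X n + (1 / s) *s v) x y = 0"
          unfolding eq scale1 using sv(3) by simp
        ultimately show ?thesis using False X(3) unfolding good_def K by blast
      qed
      define m where "m = norm (s, v)"
      have m: "m > 0" unfolding m_def using sv(2) by (simp only: zero_less_norm_iff zero_prod_def not_False_eq_True)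
      let ?s = "complex_of_real (1 / m) * s" and ?v = "complex_of_real (1 / m) *s v"
      have "(?s, ?v) = (1 / m) *\<^sub>R (s, v)" by (simp only: sc) (simp add: scaleR_conv_of_real)
      then have "norm (?s, ?v) = \<bar>1 / m\<bar> * m" by (simp only: norm_scaleR m_def)
      then have 1: "norm (?s, ?v) = 1" using m by simp
      have "(1 / ?s) *s ?v = (1 / s) *s v" using m s by (simp add: vec_eq_iff)
      then have 2: "good (X n + (1 / ?s) *s ?v)" using g by (simp only:)
      have "?s *s X n + ?v = complex_of_real (1 / m) *s (s *s X n + v)"
        by (simp add: vec.scale_right_distrib)
      then have 3: "\<forall>a\<in>K (X n). \<forall>b\<in>K (X n). \<sigma> (?s *s X n + ?v) a b = 0"
        using sv(3) by (simp only: scale1) simp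
      show ?thesis using 1 2 3 V_scale[OF sv(1)]
        by (intro exI[of _ "(?s, ?v)"]) (simp only: fst_conv snd_conv, blast)
    qed
  qed
  then obtain sv :: "nat \<Rightarrow> complex \<times> V10" where sv: "\<And>n. norm (sv n) = 1" "\<And>n. snd (sv n) \<in> V"
    "\<And>n a b. a \<in> K (X n) \<Longrightarrow> b \<in> K (X n) \<Longrightarrow> \<sigma> (fst (sv n) *s X n + snd (sv n)) a b = 0"
    "\<And>n. fst (sv n) \<noteq> 0 \<Longrightarrow> good (X n + (1 / fst (sv n)) *s snd (sv n))" by metis
  have "bounded (range sv)" using sv(1) by (intro boundedI[of _ 1]) auto
  then obtain l r where r: "strict_mono (r :: nat \<Rightarrow> nat)" "(sv \<circ> r) \<longlonglongrightarrow> l"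
    using bounded_imp_convergent_subsequence by blast
  have lf: "(\<lambda>n. fst (sv (r n))) \<longlonglongrightarrow> fst l" and ls: "(\<lambda>n. snd (sv (r n))) \<longlonglongrightarrow> snd l"
    using tendsto_fst[OF r(2)] tendsto_snd[OF r(2)] by (simp_all add: o_def)
  have s0: "snd l = 0"
    by (rule uniq[OF r(1) _ _ lf ls]) (use sv in auto)
  have "(\<lambda>n. norm (sv (r n))) \<longlonglongrightarrow> norm l" using tendsto_norm[OF r(2)] by (simp add: o_def)
  then have "norm l = 1" using sv(1) by (simp add: LIMSEQ_const_iff)
  then have f0: "fst l \<noteq> 0" using s0 by (metis norm_eq_zero prod.collapse zero_neq_one zero_prod_def)
  have "(\<lambda>n. X (r n) + (1 / fst (sv (r n))) *s snd (sv (r n))) \<longlonglongrightarrow> x0 + (1 / fst l) *s snd l"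
    using LIMSEQ_subseq_LIMSEQ[OF X(1) r(1)]
    by (intro tendsto_add tendsto_scale_vec tendsto_divide tendsto_const lf ls f0) (simp add: o_def)
  then have "(\<lambda>n. X (r n) + (1 / fst (sv (r n))) *s snd (sv (r n))) \<longlonglongrightarrow> x0" by (simp add: s0)
  then have "\<forall>\<^sub>F n in sequentially. dist (X (r n) + (1 / fst (sv (r n))) *s snd (sv (r n))) x0 < e"
    using e(1) by (rule tendstoD)
  moreover have "\<forall>\<^sub>F n in sequentially. fst (sv (r n)) \<noteq> 0" by (rule tendsto_imp_eventually_ne[OF lf f0])
  ultimately have "\<forall>\<^sub>F n in sequentially. False"
    by eventually_elim (use e(2) sv(4) in \<open>auto simp: not_less[symmetric]\<close>)
  then show False by simp
qed

end

section \<open>Perturbation of dual bases\<close>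

lemma tendsto_det:
  fixes M :: "'a \<Rightarrow> complex^'n^'n"
  assumes "\<And>i j. ((\<lambda>t. M t $ i $ j) \<longlongrightarrow> M0 $ i $ j) F"
  shows "((\<lambda>t. det (M t)) \<longlongrightarrow> det M0) F"
  unfolding det_def by (intro tendsto_intros assms)

lemma tendsto_adj:
  fixes M :: "'a \<Rightarrow> complex^'n^'n"
  assumes "\<And>i j. ((\<lambda>t. M t $ i $ j) \<longlongrightarrow> M0 $ i $ j) F"
  shows "((\<lambda>t. adj (M t) $ k $ l) \<longlongrightarrow> adj M0 $ k $ l) F"
proof -
  have "((\<lambda>t. (\<chi> i j. if j = k then (if i = l then 1 else 0) else M t $ i $ j) $ i' $ j') \<longlongrightarrow>
      (\<chi> i j. if j = k then (if i = l then 1 else 0) else M0 $ i $ j) $ i' $ j') F" for i' j'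
    using assms by (cases "j' = k") auto
  from tendsto_det[OF this] show ?thesis by (simp add: adj_def)
qed

definition dual_mat :: "(3 \<Rightarrow> V10 \<Rightarrow> complex) \<Rightarrow> (3 \<Rightarrow> V10) \<Rightarrow> complex^3^3" where
  "dual_mat \<phi> a = (\<chi> i k. \<phi> i (a k))"

text \<open>Cramer's rule for a vector in the span of the \<open>a k\<close> with prescribed values
  of the three functionals. The \<open>a k\<close> stay fixed while the functionals vary, so the
  solutions converge together with the functionals.\<close>

definition dual_sol :: "(3 \<Rightarrow> V10 \<Rightarrow> complex) \<Rightarrow> (3 \<Rightarrow> V10) \<Rightarrow> complex^3 \<Rightarrow> V10" where
  "dual_sol \<phi> a w = (\<Sum>k\<in>UNIV. ((adj (dual_mat \<phi> a) *v w) $ k / det (dual_mat \<phi> a)) *s a k)"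

lemma dual_sol_works:
  assumes "\<And>i. functional (\<phi> i)" "det (dual_mat \<phi> a) \<noteq> 0"
  shows "\<phi> i (dual_sol \<phi> a w) = w $ i"
proof -
  have "\<phi> i (dual_sol \<phi> a w) = (\<Sum>k\<in>UNIV. dual_mat \<phi> a $ i $ k * (adj (dual_mat \<phi> a) *v w) $ k) / det (dual_mat \<phi> a)"
    unfolding dual_sol_def functional_sum[OF assms(1)]
    by (simp add: dual_mat_def sum_divide_distrib mult.commute)
  also have "\<dots> = (dual_mat \<phi> a *v (adj (dual_mat \<phi> a) *v w)) $ i / det (dual_mat \<phi> a)"
    by (simp add: matrix_vector_mult_def[of "dual_mat \<phi> a"])
  finally show ?thesis using assms(2) by (simp only: adj_right_vec[OF assms(2)]) simp
qed

lemma dual_mat_dim: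
  "(\<And>i. functional (\<phi> i)) \<Longrightarrow> det (dual_mat \<phi> a) \<noteq> 0 \<Longrightarrow> vec.dim {z. \<forall>i. \<phi> i z = 0} = 7"
  unfolding dual_mat_def by (rule det_dual3)

lemma dual_mat_tendsto:
  assumes "\<And>i k. \<theta> i (a k) = (if i = k then 1 else 0)" "\<And>i z. ((\<lambda>n. \<phi> n i z) \<longlongrightarrow> \<theta> i z) F"
  shows "((\<lambda>n. dual_mat (\<phi> n) a $ i $ k) \<longlongrightarrow> (mat 1 :: complex^3^3) $ i $ k) F"
  using assms(2)[of i "a k"] unfolding assms(1) by (simp add: dual_mat_def mat_def)

lemma dual_mat_eventually:
  assumes "\<And>i k. \<theta> i (a k) = (if i = k then 1 else 0)" "\<And>i z. ((\<lambda>n. \<phi> n i z) \<longlongrightarrow> \<theta> i z) F"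
  shows "\<forall>\<^sub>F n in F. det (dual_mat (\<phi> n) a) \<noteq> 0"
  using tendsto_det[OF dual_mat_tendsto, OF assms] by (rule tendsto_imp_eventually_ne) simp

lemma dual_sol_tendsto:
  assumes "\<And>i k. \<theta> i (a k) = (if i = k then 1 else 0)" "\<And>i z. ((\<lambda>n. \<phi> n i z) \<longlongrightarrow> \<theta> i z) F"
    and w: "\<And>i. ((\<lambda>n. w n $ i) \<longlongrightarrow> w0 $ i) F"
  shows "((\<lambda>n. dual_sol (\<phi> n) a (w n)) \<longlongrightarrow> (\<Sum>k\<in>UNIV. w0 $ k *s a k)) F"
proof -
  have "((\<lambda>n. dual_sol (\<phi> n) a (w n)) \<longlongrightarrow>
     (\<Sum>k\<in>UNIV. ((adj (mat 1) *v w0) $ k / det (mat 1 :: complex^3^3)) *s a k)) F"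
    unfolding dual_sol_def matrix_vector_mult_def vec_lambda_beta
    by (intro tendsto_sum tendsto_scale_vec tendsto_divide tendsto_mult tendsto_const w
        tendsto_adj[OF dual_mat_tendsto, OF assms(1,2)] tendsto_det[OF dual_mat_tendsto, OF assms(1,2)]) simp
  then show ?thesis by simp
qed

section \<open>Points where the pairing has rank three\<close>

lemma span3_explicit: "x \<in> vec.span {a, b, c} \<longleftrightarrow> (\<exists>r s t. x = r *s a + s *s b + t *s c)"
proof
  assume "x \<in> vec.span {a, b, c}"
  then obtain r y where y: "y \<in> vec.span {b, c}" "x = r *s a + y" by (auto simp: in_span_insert[of x])
  then obtain s z where z: "z \<in> vec.span {c}" "y = s *s b + z" by (auto simp: in_span_insert[of y])
  then obtain t where "z = t *s c" by (auto simp: vec.span_singleton)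
  then show "\<exists>r s t. x = r *s a + s *s b + t *s c" using y z by (metis add.assoc)
next
  assume "\<exists>r s t. x = r *s a + s *s b + t *s c"
  then obtain r s t where "x = r *s a + s *s b + t *s c" by blast
  moreover have "r *s a + s *s b + t *s c \<in> vec.span {a, b, c}"
    by (intro vec.span_add vec.span_scale vec.span_base; simp)
  ultimately show "x \<in> vec.span {a, b, c}" by simp
qed

lemma span3_dim:
  fixes a b c :: "complex^'n"
  assumes "\<And>r s t. r *s a + s *s b + t *s c = 0 \<Longrightarrow> r = 0 \<and> s = 0 \<and> t = 0"
  shows "vec.dim (vec.span {a, b, c}) = 3"
proof -
  have c: "c \<noteq> 0" using assms[of 0 0 1] by auto
  have b: "b \<notin> vec.span {c}"
  proof
    assume "b \<in> vec.span {c}"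
    then obtain t where "b = t *s c" by (auto simp: vec.span_singleton)
    then show False using assms[of 0 1 "- t"] by simp
  qed
  have a: "a \<notin> vec.span {b, c}"
  proof
    assume "a \<in> vec.span {b, c}"
    then obtain s t where "a = s *s b + t *s c" by (auto simp: in_span_insert vec.span_singleton)
    then show False using assms[of 1 "- s" "- t"] by simp
  qed
  show ?thesis using a b c by (simp add: vec.dim_insert)
qed

context general_trivector
begin

definition Vb :: "3 \<Rightarrow> V10" where "Vb = (SOME v. V = vec.span (range v) \<and> (\<forall>i. v i \<in> V))"

lemma Vb: "V = vec.span (range Vb)" "Vb i \<in> V"
proof -
  have "\<exists>v :: 3 \<Rightarrow> V10. V = vec.span (range v) \<and> (\<forall>i. v i \<in> V)"
  proof -
    obtain c where c: "c \<in> V" "c \<noteq> 0" using subspace_nontrivial[of V] V(2) by auto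
    obtain c' where c': "c' \<in> V" "c' \<notin> vec.span {c}" using V_second[OF c(1)] by blast
    obtain d where d: "d \<in> V" "V = vec.span {c, c', d}" using V_basis[OF c(1) c'(1) c(2) c'(2)] by blast
    define v :: "3 \<Rightarrow> V10" where "v i = (if i = 1 then c else if i = 2 then c' else d)" for i
    have "range v = {c, c', d}"
      unfolding UNIV_3 by (auto simp: v_def)
    then show ?thesis using d c c' by (intro exI[of _ v]) (auto simp: v_def)
  qed
  from someI_ex[OF this] show "V = vec.span (range Vb)" "Vb i \<in> V" unfolding Vb_def by blast+
qed

lemma K_Vb: "K x = {z. \<forall>i. \<sigma> (Vb i) x z = 0}"
proof (intro subset_antisym subsetI)
  fix z assume z: "z \<in> {z. \<forall>i. \<sigma> (Vb i) x z = 0}"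
  have "\<sigma> v x z = 0" if "v \<in> V" for v
    by (rule functional_span[OF functional_first, of v "range Vb"]) (use that Vb z in auto)
  then show "z \<in> K x" by (simp add: K_def)
qed (use Vb(2) in \<open>auto simp: K_def\<close>)

lemma V_expand: "v \<in> V \<Longrightarrow> \<exists>c. v = (\<Sum>i\<in>UNIV. c i *s Vb i)"
proof -
  assume "v \<in> V"
  then have "v \<in> vec.span (range Vb)" using Vb(1) by blast
  then show ?thesis
  proof (induction rule: vec.span_induct_alt)
    case base
    show ?case by (intro exI[of _ "\<lambda>_. 0"]) simp
  next
    case (step c x y)
    then obtain d j where "y = (\<Sum>i\<in>UNIV. d i *s Vb i)" "x = Vb j" by auto
    then have "c *s x + y = (\<Sum>i\<in>UNIV. (if i = j then c else 0) *s Vb i) + (\<Sum>i\<in>UNIV. d i *s Vb i)"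
      by (simp add: if_distrib[of "\<lambda>a. a *s _"] cong: if_cong)
    also have "\<dots> = (\<Sum>i\<in>UNIV. ((if i = j then c else 0) + d i) *s Vb i)"
      by (simp add: vec.scale_left_distrib sum.distrib)
    finally show ?case by (intro exI[of _ "\<lambda>i. (if i = j then c else 0) + d i"])
  qed
qed

lemma dual_Vb:
  assumes "vec.dim (K x) = 7"
  obtains a where "\<And>i k. \<sigma> (Vb i) x (a k) = (if i = k then 1 else 0)"
  using dual_basis3[of "\<lambda>i. \<sigma> (Vb i) x", OF functional_third] assms unfolding K_Vb by blast

text \<open>Double annihilator: functionals vanishing on \<open>K x\<close> are combinations of the
  three that define it, with coefficients read off on a dual basis.\<close>

lemma functional_on_K:
  assumes "vec.dim (K x) = 7" "functional f" "\<And>z. z \<in> K x \<Longrightarrow> f z = 0"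
  shows "\<exists>b\<in>V. \<forall>z. f z = \<sigma> b x z"
proof -
  obtain a where a: "\<And>i k. \<sigma> (Vb i) x (a k) = (if i = k then 1 else 0)" using dual_Vb[OF assms(1)] by blast
  define b where "b = (\<Sum>i\<in>UNIV. f (a i) *s Vb i)"
  have "b \<in> V" unfolding b_def using Vb(2) V(1) by (intro vec.subspace_sum vec.subspace_scale) auto
  moreover have "f z = \<sigma> b x z" for z
  proof -
    define z' where "z' = (\<Sum>k\<in>UNIV. \<sigma> (Vb k) x z *s a k)"
    have "z - z' \<in> K x"
      unfolding K_Vb by (simp add: diff3 z'_def sum3 scale3 a if_distrib[of "\<lambda>t. _ * t"] cong: if_cong)
    then have "f (z - z') = 0" by (rule assms(3))
    then have "f z = f z'" by (simp add: functional_simps[OF assms(2)])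
    also have "\<dots> = \<sigma> b x z" unfolding z'_def b_def functional_sum[OF assms(2)]
      by (simp add: sum1 scale1 mult.commute)
    finally show ?thesis .
  qed
  ultimately show ?thesis by blast
qed

lemma rad_V_dependent:
  assumes v: "v \<in> V" "v \<noteq> 0" and xy: "x \<in> rad v" "y \<in> rad v"
  shows "\<exists>a b. (a, b) \<noteq> (0, 0) \<and> a *s x + b *s y \<in> V"
proof (cases "x \<in> V")
  case True
  then show ?thesis by (intro exI[of _ 1] exI[of _ 0]) simp
next
  case False
  have "rad v = vec.span (insert x V)"
    using dim_rad_V[OF v] V(2) False xy
    by (intro subspace_eq_span_insert V(1) rad_subspace V_rad v) auto
  then obtain k u where "u \<in> V" "y = k *s x + u" using xy(2) in_span_insert_subspace[OF V(1)] by blast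
  then show ?thesis by (intro exI[of _ "- k"] exI[of _ 1]) simp
qed

text \<open>Every bivector of a three-dimensional space is decomposable: with \<open>c3\<close>
  nonzero, the bivector with coefficients \<open>c1\<close>, \<open>c2\<close>, \<open>c3\<close> is
  \<open>c3\<close> times the product of \<open>?z1\<close> and \<open>?z2\<close>.\<close>

lemma isotropic_pair_aux:
  assumes ind: "\<And>a b c. a *s y1 + b *s y2 + c *s y3 \<in> S \<Longrightarrow> a = 0 \<and> b = 0 \<and> c = 0"
    and c3: "c3 \<noteq> 0"
    and iso: "\<And>v. v \<in> V \<Longrightarrow> c1 * \<sigma> v y2 y3 + c2 * \<sigma> v y3 y1 + c3 * \<sigma> v y1 y2 = 0"
  shows "\<exists>z1 z2. z1 \<in> vec.span {y1, y2, y3} \<and> z2 \<in> vec.span {y1, y2, y3} \<and>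
    (\<forall>v\<in>V. \<sigma> v z1 z2 = 0) \<and> (\<forall>a b. a *s z1 + b *s z2 \<in> S \<longrightarrow> a = 0 \<and> b = 0)"
proof -
  let ?z1 = "y1 - (c1 / c3) *s y3" and ?z2 = "y2 - (c2 / c3) *s y3"
  have "?z1 \<in> vec.span {y1, y2, y3}" "?z2 \<in> vec.span {y1, y2, y3}"
    by (intro vec.span_diff vec.span_scale vec.span_base; simp)+
  moreover have "\<sigma> v ?z1 ?z2 = 0" if "v \<in> V" for v
  proof -
    have "c3 * \<sigma> v ?z1 ?z2 = 0"
      using iso[OF that] c3 swap23[of v y1 y3] swap23[of v y2 y3] by (simp add: linear algebra_simps)
    then show "\<sigma> v ?z1 ?z2 = 0" using c3 by simp
  qed
  moreover have "a = 0 \<and> b = 0" if ab: "a *s ?z1 + b *s ?z2 \<in> S" for a b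
  proof -
    have "a *s ?z1 + b *s ?z2 = a *s y1 + b *s y2 + (- (a * (c1 / c3) + b * (c2 / c3))) *s y3"
      by (simp add: vec_eq_iff algebra_simps)
    with ab show ?thesis using ind by metis
  qed
  ultimately show ?thesis by blast
qed

lemma isotropic_pair:
  assumes ind: "\<And>a b c. a *s y1 + b *s y2 + c *s y3 \<in> S \<Longrightarrow> a = 0 \<and> b = 0 \<and> c = 0"
    and c: "(c1, c2, c3) \<noteq> (0, 0, 0)"
    and iso: "\<And>v. v \<in> V \<Longrightarrow> c1 * \<sigma> v y2 y3 + c2 * \<sigma> v y3 y1 + c3 * \<sigma> v y1 y2 = 0"
  shows "\<exists>z1 z2. z1 \<in> vec.span {y1, y2, y3} \<and> z2 \<in> vec.span {y1, y2, y3} \<and>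
    (\<forall>v\<in>V. \<sigma> v z1 z2 = 0) \<and> (\<forall>a b. a *s z1 + b *s z2 \<in> S \<longrightarrow> a = 0 \<and> b = 0)"
proof -
  have eq: "{y2, y3, y1} = {y1, y2, y3}" "{y3, y1, y2} = {y1, y2, y3}" by auto
  consider "c3 \<noteq> 0" | "c1 \<noteq> 0" | "c2 \<noteq> 0" using c by auto
  then show ?thesis
  proof cases
    case 1
    show ?thesis by (rule isotropic_pair_aux[OF ind 1 iso])
  next
    case 2
    have i: "a = 0 \<and> b = 0 \<and> c = 0" if "a *s y2 + b *s y3 + c *s y1 \<in> S" for a b c
    proof -
      have "c *s y1 + a *s y2 + b *s y3 \<in> S" using that by (simp only: ac_simps)
      then show ?thesis using ind by blast
    qed
    have "c2 * \<sigma> v y3 y1 + c3 * \<sigma> v y1 y2 + c1 * \<sigma> v y2 y3 = 0" if "v \<in> V" for v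
      using iso[OF that] by (simp add: algebra_simps)
    from isotropic_pair_aux[OF i 2 this] show ?thesis unfolding eq by blast
  next
    case 3
    have i: "a = 0 \<and> b = 0 \<and> c = 0" if "a *s y3 + b *s y1 + c *s y2 \<in> S" for a b c
    proof -
      have "b *s y1 + c *s y2 + a *s y3 \<in> S" using that by (simp only: ac_simps)
      then show ?thesis using ind by blast
    qed
    have "c3 * \<sigma> v y1 y2 + c1 * \<sigma> v y2 y3 + c2 * \<sigma> v y3 y1 = 0" if "v \<in> V" for v
      using iso[OF that] by (simp add: algebra_simps)
    from isotropic_pair_aux[OF i 3 this] show ?thesis unfolding eq by blast
  qed
qed

text \<open>Both \<open>V\<close> and the space of bivectors of \<open>rad p\<close> modulo
  \<open>p\<close> have dimension three, and \<open>k\<close> makes the pairing between them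
  degenerate. So a nonzero bivector is killed by all of \<open>V\<close>, and it is decomposable.
  Independence modulo \<open>V\<close> holds because the radical meets \<open>V\<close>
  trivially.\<close>

lemma rank3_isotropic_pair:
  assumes p: "inX p" "p \<notin> V" "vec.dim (K p) = 7"
    and k: "k \<in> V" "k \<noteq> 0" "\<And>x y. x \<in> K p \<Longrightarrow> y \<in> K p \<Longrightarrow> \<sigma> k x y = 0"
  shows "\<exists>z1\<in>rad p. \<exists>z2\<in>rad p. (\<forall>v\<in>V. \<sigma> v z1 z2 = 0) \<and>
    (\<forall>a b c. a *s p + b *s z1 + c *s z2 \<in> V \<longrightarrow> a = 0 \<and> b = 0 \<and> c = 0)"
proof -
  note r = rank3_point[OF p]
  have p0: "p \<noteq> 0" using p(1) by (simp add: inX_def)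
  have d1: "vec.dim (vec.span {p}) = 1" using p0 by simp
  have sub: "vec.span {p} \<subseteq> rad p" using rad_self rad_subspace by (intro vec.span_minimal) auto
  have "vec.dim (vec.span {p}) < vec.dim (rad p)" using d1 r(2) by simp
  from extend_by_one[OF vec.subspace_span rad_subspace sub this] obtain y1 where
    y1: "y1 \<in> rad p" "y1 \<notin> vec.span {p}" "vec.span (insert y1 (vec.span {p})) \<subseteq> rad p"
    "vec.dim (vec.span (insert y1 (vec.span {p}))) = vec.dim (vec.span {p}) + 1" by blast
  obtain y2 y3 where y: "y2 \<in> rad p" "y3 \<in> rad p"
    "\<And>a b. a *s y2 + b *s y3 \<in> vec.span (insert y1 (vec.span {p})) \<Longrightarrow> a = 0 \<and> b = 0"
    using extend_by_two[OF vec.subspace_span rad_subspace y1(3)] y1(4) d1 r(2) by auto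
  have ind: "a = 0 \<and> b = 0 \<and> c = 0" if abc: "a *s y1 + b *s y2 + c *s y3 \<in> vec.span {p}" for a b c
  proof -
    have "(a *s y1 + b *s y2 + c *s y3) - a *s y1 \<in> vec.span (insert y1 (vec.span {p}))"
    proof (rule vec.span_diff)
      show "a *s y1 + b *s y2 + c *s y3 \<in> vec.span (insert y1 (vec.span {p}))"
        using abc by (intro vec.span_base) simp
      show "a *s y1 \<in> vec.span (insert y1 (vec.span {p}))" by (intro vec.span_scale vec.span_base) simp
    qed
    then have bc: "b = 0 \<and> c = 0" by (intro y(3)) (simp add: algebra_simps)
    have "a = 0"
    proof (rule ccontr)
      assume "a \<noteq> 0"
      have "a *s y1 \<in> vec.span {p}" using abc bc by simp
      then have "(1 / a) *s (a *s y1) \<in> vec.span {p}" by (rule vec.span_scale)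
      then show False using y1(2) \<open>a \<noteq> 0\<close> by simp
    qed
    with bc show ?thesis by simp
  qed
  have yK: "y1 \<in> K p" "y2 \<in> K p" "y3 \<in> K p" using y1(1) y(1,2) by (simp_all add: subsetD[OF rad_K])
  define \<beta> where "\<beta> v c = c $ 1 * \<sigma> v y2 y3 + c $ 2 * \<sigma> v y3 y1 + c $ 3 * \<sigma> v y1 y2" for v and c :: "complex^3"
  have "bilinear_form \<beta>"
    by (auto simp: bilinear_form_def functional_def \<beta>_def linear algebra_simps)
  from pairing[OF this V(1) vec.subspace_UNIV]
  have "vec.dim {c. \<forall>v\<in>V. \<beta> v c = 0} + 3 = 3 + vec.dim {v \<in> V. \<forall>c. \<beta> v c = 0}"
    by (simp add: V(2) card_cart_basis)
  moreover have "0 < vec.dim {v \<in> V. \<forall>c. \<beta> v c = 0}"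
  proof (rule ccontr)
    assume "\<not> ?thesis"
    then have "{v \<in> V. \<forall>c. \<beta> v c = 0} \<subseteq> {0}" by (simp only: vec.dim_eq_0 not_gr_zero)
    moreover have "k \<in> {v \<in> V. \<forall>c. \<beta> v c = 0}" using k yK by (simp add: \<beta>_def)
    ultimately show False using k(2) by blast
  qed
  ultimately have "0 < vec.dim {c. \<forall>v\<in>V. \<beta> v c = 0}" by simp
  from subspace_nontrivial[OF this] obtain c where c: "\<forall>v\<in>V. \<beta> v c = 0" "c \<noteq> 0" by blast
  have c0: "(c $ 1, c $ 2, c $ 3) \<noteq> (0, 0, 0)" using c(2) by (auto simp: vec_eq_iff forall_3)
  obtain z1 z2 where z: "z1 \<in> vec.span {y1, y2, y3}" "z2 \<in> vec.span {y1, y2, y3}" "\<forall>v\<in>V. \<sigma> v z1 z2 = 0"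
    "\<forall>a b. a *s z1 + b *s z2 \<in> vec.span {p} \<longrightarrow> a = 0 \<and> b = 0"
    using isotropic_pair[OF ind c0] c(1) unfolding \<beta>_def by blast
  have "vec.span {y1, y2, y3} \<subseteq> rad p" using y1 y rad_subspace by (intro vec.span_minimal) auto
  then have zr: "z1 \<in> rad p" "z2 \<in> rad p" using z by auto
  have "a = 0 \<and> b = 0 \<and> c = 0" if abc: "a *s p + b *s z1 + c *s z2 \<in> V" for a b c
  proof -
    have "a *s p + b *s z1 + c *s z2 \<in> rad p"
      using zr rad_self rad_subspace by (intro vec.subspace_add vec.subspace_scale) auto
    then have e0: "a *s p + b *s z1 + c *s z2 = 0" using abc r(1) by blast
    then have "b *s z1 + c *s z2 = (- a) *s p" by (simp add: eq_neg_iff_add_eq_0 algebra_simps)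
    then have "b *s z1 + c *s z2 \<in> vec.span {p}"
      using vec.span_scale[OF vec.span_base[of p "{p}"], of "- a"] by (simp only: insertI1)
    then have "b = 0 \<and> c = 0" using z(4) by blast
    then show ?thesis using e0 p0 by simp
  qed
  then show ?thesis using zr z(3) by blast
qed

text \<open>The vector \<open>y\<close> is the direction in which \<open>rank3_limit\<close> moves
  \<open>p\<close>. If there were none, the second functional of \<open>y\<close> would be a
  multiple of the first; a nonzero factor produces a second isotropic plane, a zero factor an
  infinitesimal deformation of \<open>V\<close> or too large a radical.\<close>

lemma rank3_independent:
  assumes z: "\<And>w. \<sigma> p z1 w = 0" "\<And>w. \<sigma> p z2 w = 0"
    and ind: "\<And>a b c. a *s p + b *s z1 + c *s z2 \<in> V \<Longrightarrow> a = 0 \<and> b = 0 \<and> c = 0"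
    and k: "k \<in> V" "k \<noteq> 0" and b: "b1 \<in> V" "b2 \<in> V" "\<And>w. \<sigma> k z1 w = \<sigma> b1 p w" "\<And>w. \<sigma> k z2 w = \<sigma> b2 p w"
  shows "\<exists>y. \<sigma> y z1 z2 = 0 \<and> \<sigma> b2 y z1 - \<sigma> b1 y z2 \<noteq> 0"
proof (rule ccontr)
  assume "\<not> ?thesis"
  then have imp: "\<sigma> b2 y z1 - \<sigma> b1 y z2 = 0" if "\<sigma> y z1 z2 = 0" for y using that by blast
  have "functional (\<lambda>y. \<sigma> y z1 z2)" "functional (\<lambda>y. \<sigma> b2 y z1 - \<sigma> b1 y z2)"
    by (auto simp: functional_def linear algebra_simps)
  from functional_multiple[OF this imp] obtain \<alpha>' where \<alpha>': "\<And>y. \<sigma> b2 y z1 - \<sigma> b1 y z2 = \<alpha>' * \<sigma> y z1 z2" by blast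
  define \<alpha> where "\<alpha> = - \<alpha>'"
  have rel: "\<alpha> * \<sigma> y z1 z2 + \<sigma> b2 y z1 - \<sigma> b1 y z2 = 0" for y
    using \<alpha>'[of y] by (simp add: \<alpha>_def algebra_simps)
  show False
  proof (cases "\<alpha> = 0")
    case False
    \<comment> \<open>The relation \<open>rel\<close> says exactly that the product of
      \<open>?Z1\<close> and \<open>?Z2\<close> is killed; these three vectors span a plane
      isotropic in the same sense as \<open>V\<close> and independent of it.\<close>
    let ?P = "\<alpha> *s p + k" and ?Z1 = "\<alpha> *s z1 + b1" and ?Z2 = "\<alpha> *s z2 + b2"
    have ind': "r = 0 \<and> s = 0 \<and> t = 0" if "r *s ?P + s *s ?Z1 + t *s ?Z2 \<in> V" for r s t
    proof -
      have m: "r *s ?P + s *s ?Z1 + t *s ?Z2 - (r *s k + s *s b1 + t *s b2) \<in> V"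
        using that by (rule V_diff) (intro V_add V_scale k b)
      have "r *s ?P + s *s ?Z1 + t *s ?Z2 - (r *s k + s *s b1 + t *s b2)
         = (r * \<alpha>) *s p + (s * \<alpha>) *s z1 + (t * \<alpha>) *s z2"
        by (simp add: vec_eq_iff algebra_simps)
      from m[unfolded this] show ?thesis using ind False by (metis mult_eq_0_iff)
    qed
    have PZ: "\<sigma> ?P ?Z1 w = 0" "\<sigma> ?P ?Z2 w = 0" for w
      using z b(3,4) swap12[of p b1 w] swap12[of p b2 w] V_iso k b by (simp_all add: linear)
    have ZZ: "\<sigma> ?Z1 ?Z2 w = 0" for w
    proof -
      have "\<sigma> ?Z1 ?Z2 w = \<alpha> * (\<alpha> * \<sigma> z1 z2 w + \<sigma> z1 b2 w + \<sigma> b1 z2 w)"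
        using V_iso[OF b(1,2)] by (simp add: linear algebra_simps)
      moreover have "\<sigma> z1 z2 w = \<sigma> w z1 z2" by (rule rotate)
      moreover have "\<sigma> z1 b2 w = \<sigma> b2 w z1" by (rule rotate[symmetric])
      moreover have "\<sigma> b1 z2 w = - \<sigma> b1 w z2" by (rule swap23)
      ultimately show ?thesis using rel[of w] by simp
    qed
    show False
    proof (rule no_second_plane)
      show "vec.subspace (vec.span {?P, ?Z1, ?Z2})" by simp
      show "vec.dim (vec.span {?P, ?Z1, ?Z2}) = 3"
        by (rule span3_dim) (rule ind', simp add: V_zero)
      show "vec.span {?P, ?Z1, ?Z2} \<inter> V = {0}"
      proof (intro subset_antisym subsetI)
        fix x assume x: "x \<in> vec.span {?P, ?Z1, ?Z2} \<inter> V"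
        then obtain r s t where e: "x = r *s ?P + s *s ?Z1 + t *s ?Z2"
          using span3_explicit[of x ?P ?Z1 ?Z2] by auto
        then have "r = 0 \<and> s = 0 \<and> t = 0" using x by (intro ind') simp
        then show "x \<in> {0}" using e by simp
      qed (auto simp: V_zero vec.span_zero)
      fix x y w assume xy: "x \<in> vec.span {?P, ?Z1, ?Z2}" "y \<in> vec.span {?P, ?Z1, ?Z2}"
      have "\<sigma> w x y = 0"
      proof (rule span_isotropic[OF _ xy])
        fix a b assume "a \<in> {?P, ?Z1, ?Z2}" "b \<in> {?P, ?Z1, ?Z2}"
        then have "\<sigma> a b w = 0"
          using PZ ZZ swap12[of ?Z1 ?P w] swap12[of ?Z2 ?P w] swap12[of ?Z2 ?Z1 w] by auto
        then show "\<sigma> w a b = 0" using rotate[of a b w] by simp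
      qed
      then show "\<sigma> x y w = 0" using rotate[of x y w] by simp
    qed
  next
    case True
    have e3: "\<sigma> b1 z2 w = \<sigma> b2 z1 w" for w
      using rel[of w] True swap23[of b1 w z2] swap23[of b2 w z1] by simp
    \<comment> \<open>Otherwise \<open>k\<close>, \<open>b1\<close>, \<open>b2\<close> span
      \<open>V\<close>, and sending them to \<open>p\<close>, \<open>z1\<close>, \<open>z2\<close>
      is a first order deformation.\<close>
    have dep: "\<exists>x y t. (x, y, t) \<noteq> (0, 0, 0) \<and> x *s k + y *s b1 + t *s b2 = 0"
    proof (rule ccontr)
      assume "\<not> ?thesis"
      then have "vec.dim (vec.span {k, b1, b2}) = 3" by (intro span3_dim) auto
      moreover have "vec.span {k, b1, b2} \<subseteq> V" using k b V(1) by (intro vec.span_minimal) auto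
      ultimately have "V = vec.span {k, b1, b2}"
        using vec.subspace_dim_equal[OF vec.subspace_span V(1)] V(2) by (metis order_refl)
      from nondegenerate[OF this, of z1 p z2] b e3 have "p \<in> V" by simp
      then show False using ind[of 1 0 0] by simp
    qed
    then obtain x y t where xyt: "(x, y, t) \<noteq> (0, 0, 0)" "x *s k + y *s b1 + t *s b2 = 0" by blast
    \<comment> \<open>The relation among \<open>k\<close>, \<open>b1\<close>, \<open>b2\<close> is
      transferred to \<open>p\<close>, \<open>z1\<close>, \<open>z2\<close>. The result is killed by
      all three vectors and lies outside \<open>V\<close>, so these are proportional by
      \<open>common_kernel\<close>.\<close>
    define w where "w = x *s p + y *s z1 + t *s z2"
    have wV: "w \<notin> V" using ind[of x y t] xyt(1) by (auto simp: w_def)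
    have z0: "\<sigma> (x *s k + y *s b1 + t *s b2) u u' = 0" for u u' by (simp add: xyt)
    have kw: "\<sigma> k w u = 0" for u
      using z0[of p u] b(3,4)[of u] by (simp add: w_def linear)
    have b1w: "\<sigma> b1 w u = 0" for u
      using z0[of z1 u] b(3,4)[of u] e3[of u] by (simp add: w_def linear)
    have b2w: "\<sigma> b2 w u = 0" for u
      using z0[of z2 u] b(3,4)[of u] e3[of u] by (simp add: w_def linear)
    have "b1 \<in> vec.span {k}" using common_kernel[OF k(1) b(1) k(2)] kw b1w wV by blast
    moreover have "b2 \<in> vec.span {k}" using common_kernel[OF k(1) b(2) k(2)] kw b2w wV by blast
    ultimately obtain \<beta>1 \<beta>2 where \<beta>: "b1 = \<beta>1 *s k" "b2 = \<beta>2 *s k" by (auto simp: vec.span_singleton)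
    have "z1 - \<beta>1 *s p \<in> rad k" "z2 - \<beta>2 *s p \<in> rad k"
      using b(3,4) by (simp_all add: rad_def linear \<beta>)
    then obtain r s where rs: "(r, s) \<noteq> (0, 0)" "r *s (z1 - \<beta>1 *s p) + s *s (z2 - \<beta>2 *s p) \<in> V"
      using rad_V_dependent[OF k] by blast
    have "r *s (z1 - \<beta>1 *s p) + s *s (z2 - \<beta>2 *s p) = (- (r * \<beta>1 + s * \<beta>2)) *s p + r *s z1 + s *s z2"
      by (simp add: vec_eq_iff algebra_simps)
    with rs show False using ind by (metis (no_types, lifting))
  qed
qed

lemma span_isotropic_pair:
  assumes "\<And>a b. a \<in> G \<Longrightarrow> b \<in> G \<Longrightarrow> \<sigma> a b z = 0" "x \<in> vec.span G" "y \<in> vec.span G"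
  shows "\<sigma> x y z = 0"
proof -
  have "\<sigma> z x y = 0"
    by (rule span_isotropic[OF _ assms(2,3)]) (metis assms(1) rotate)
  then show ?thesis by (metis rotate)
qed

text \<open>With two independent solutions in \<open>V\<close>, a single form
  \<open>\<sigma> d\<close> governs the action of \<open>V\<close> on \<open>K p\<close>. Its
  radical there contains the four-dimensional \<open>W4 p\<close>, and by parity inside a space of
  dimension 7 it is larger. An additional element \<open>e\<close> gives a flag of dimensions 5 and
  7 that is excluded.\<close>

lemma rank3_unique:
  assumes p: "p \<notin> V" "vec.dim (K p) = 7" "\<And>x y. x \<in> K p \<Longrightarrow> y \<in> K p \<Longrightarrow> \<sigma> p x y = 0"
    and k: "k \<in> V" "k \<noteq> 0" "\<And>x y. x \<in> K p \<Longrightarrow> y \<in> K p \<Longrightarrow> \<sigma> k x y = 0"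
    and v: "v \<in> V" "\<And>x y. x \<in> K p \<Longrightarrow> y \<in> K p \<Longrightarrow> \<sigma> v x y = 0"
  shows "v \<in> vec.span {k}"
proof (rule ccontr)
  assume "v \<notin> vec.span {k}"
  then obtain d where d: "d \<in> V" "V = vec.span {k, v, d}" using V_basis[OF k(1) v(1) k(2)] by blast
  let ?E = "{s \<in> K p. \<forall>t\<in>K p. \<sigma> d s t = 0}"
  have E: "even (7 + vec.dim ?E)"
    using alternating_parity[OF bilinear_form_first[of d] same(2) K_subspace[of p]] p(2) by simp
  have W: "W4 p \<subseteq> ?E" using W4_K W4_iso[OF subsetD[OF W4_V d(1)]] by blast
  have "4 \<le> vec.dim ?E" using vec.dim_subset[OF W] W4_dim[OF p(1)] by simp
  moreover have "vec.dim ?E \<noteq> 4" using E by auto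
  ultimately have "vec.dim (W4 p) < vec.dim ?E" using W4_dim[OF p(1)] by simp
  from subspace_exists_outside[OF W4_subspace this] obtain e where e: "e \<in> ?E" "e \<notin> W4 p" by blast
  have Ve: "\<sigma> u e z = 0" if "u \<in> V" "z \<in> K p" for u z
  proof (rule functional_span[OF functional_first])
    show "u \<in> vec.span {k, v, d}" using that(1) d(2) by simp
    show "\<sigma> s e z = 0" if "s \<in> {k, v, d}" for s using that e(1) k(3) v(2) \<open>z \<in> K p\<close> by auto
  qed
  have We: "\<sigma> w e z = 0" if w: "w \<in> W4 p" and z: "z \<in> K p" for w z
  proof -
    obtain s u where "u \<in> V" "w = s *s p + u" using w by (auto simp: W4_iff)
    then show ?thesis using Ve[OF _ z] p(3)[of e z] e(1) z by (simp add: linear)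
  qed
  show False
  proof (rule no_flag[of "vec.span (insert e (W4 p))" "K p"])
    show "V \<subseteq> vec.span (insert e (W4 p))" using W4_V[of p] vec.span_superset[of "insert e (W4 p)"] by blast
    show "vec.span (insert e (W4 p)) \<subseteq> K p" using e(1) W4_K K_subspace by (intro vec.span_minimal) auto
    show "vec.dim (vec.span (insert e (W4 p))) = 5"
      using e(2) W4_dim[OF p(1)] W4_subspace by (simp add: vec.dim_insert vec.span_eq_iff[THEN iffD2])
    fix x y z assume xy: "x \<in> vec.span (insert e (W4 p))" "y \<in> vec.span (insert e (W4 p))" and z: "z \<in> K p"
    show "\<sigma> x y z = 0"
    proof (rule span_isotropic_pair[OF _ xy])
      fix a b assume "a \<in> insert e (W4 p)" "b \<in> insert e (W4 p)"
      then show "\<sigma> a b z = 0" using We[OF _ z] W4_iso[OF _ _ z] swap12[of e b z] by auto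
    qed
  qed (use p K_subspace in auto)
qed

lemma small_sequence:
  obtains t :: "nat \<Rightarrow> complex" where "t \<longlonglongrightarrow> 0" "\<And>n. t n \<noteq> 0"
proof
  show "(\<lambda>n. complex_of_real (1 / real (Suc n))) \<longlonglongrightarrow> 0"
    using tendsto_of_real[OF LIMSEQ_Suc[OF lim_1_over_n], where 'a = complex] by simp
  show "complex_of_real (1 / real (Suc n)) \<noteq> 0" for n by (simp del: of_nat_Suc)
qed

lemma K_of_V: "x \<in> V \<Longrightarrow> K x = UNIV"
  using V_iso by (auto simp: K_def)

text \<open>Goodness can fail only through a vector \<open>k\<close> of \<open>V\<close> whose form
  vanishes on \<open>K p\<close>; it is unique up to a factor. Along \<open>p + t *s y\<close> a
  limit of solutions has a component \<open>\<beta> *s k\<close> in \<open>V\<close>, and the first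
  order term of the equation on \<open>z1\<close> and \<open>z2\<close> is \<open>\<beta>\<close>
  times the nonzero number from \<open>rank3_independent\<close>.\<close>

lemma rank3_limit:
  assumes p: "inX p" "p \<notin> V" "vec.dim (K p) = 7"
  shows "p \<in> closure (Collect good)"
proof (cases "\<exists>k\<in>V. k \<noteq> 0 \<and> (\<forall>x\<in>K p. \<forall>y\<in>K p. \<sigma> k x y = 0)")
  case False
  then have "good p" using p rank3_point(4)[OF p] unfolding good_def by blast
  then show ?thesis using closure_subset by blast
next
  case True
  then obtain k where k: "k \<in> V" "k \<noteq> 0" "\<And>x y. x \<in> K p \<Longrightarrow> y \<in> K p \<Longrightarrow> \<sigma> k x y = 0" by blast
  note piso = rank3_point(4)[OF p]
  obtain z1 z2 where z: "z1 \<in> rad p" "z2 \<in> rad p" "\<And>v. v \<in> V \<Longrightarrow> \<sigma> v z1 z2 = 0"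
    and ind: "\<And>a b c. a *s p + b *s z1 + c *s z2 \<in> V \<Longrightarrow> a = 0 \<and> b = 0 \<and> c = 0"
    using rank3_isotropic_pair[OF p k] by blast
  have zp: "\<sigma> p z1 w = 0" "\<sigma> p z2 w = 0" for w using z(1,2) by (simp_all add: rad_def)
  have zK: "z1 \<in> K p" "z2 \<in> K p" using z(1,2) rad_K by auto
  obtain b1 where b1: "b1 \<in> V" "\<And>w. \<sigma> k z1 w = \<sigma> b1 p w"
    using functional_on_K[OF p(3) functional_third, of k z1] k(3)[OF zK(1)] by blast
  obtain b2 where b2: "b2 \<in> V" "\<And>w. \<sigma> k z2 w = \<sigma> b2 p w"
    using functional_on_K[OF p(3) functional_third, of k z2] k(3)[OF zK(2)] by blast
  obtain y where y: "\<sigma> y z1 z2 = 0" "\<sigma> b2 y z1 - \<sigma> b1 y z2 \<noteq> 0"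
    using rank3_independent[OF zp ind k(1,2) b1(1) b2(1) b1(2) b2(2)] by blast
  obtain a where a: "\<And>i j. \<sigma> (Vb i) p (a j) = (if i = j then 1 else 0)" using dual_Vb[OF p(3)] by blast
  obtain s where s: "s \<longlonglongrightarrow> 0" "\<And>n. s n \<noteq> (0 :: complex)" using small_sequence by blast
  have lim: "(\<lambda>n. p + s n *s y) \<longlonglongrightarrow> p + 0 *s y"
    by (intro tendsto_add tendsto_scale_vec tendsto_const s(1))
  have conv0: "(\<lambda>n. \<sigma> (Vb i) (p + s n *s y) w) \<longlonglongrightarrow> \<sigma> (Vb i) p w" for i w
    using tendsto_form[OF tendsto_const lim tendsto_const, of "Vb i" w] by simp
  have "\<forall>\<^sub>F n in sequentially. det (dual_mat (\<lambda>i. \<sigma> (Vb i) (p + s n *s y)) a) \<noteq> 0"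
    by (rule dual_mat_eventually[where \<theta> = "\<lambda>i. \<sigma> (Vb i) p", OF a conv0])
  then obtain N where N: "\<And>n. N \<le> n \<Longrightarrow> det (dual_mat (\<lambda>i. \<sigma> (Vb i) (p + s n *s y)) a) \<noteq> 0"
    unfolding eventually_sequentially by blast
  define t where "t n = s (n + N)" for n
  have t: "t \<longlonglongrightarrow> 0" "\<And>n. t n \<noteq> 0" using LIMSEQ_ignore_initial_segment[OF s(1), of N] s(2) by (simp_all add: t_def[abs_def])
  define X where "X n = p + t n *s y" for n
  have X: "X \<longlonglongrightarrow> p" using LIMSEQ_ignore_initial_segment[OF lim, of N] by (simp add: X_def[abs_def] t_def)
  define \<phi> where "\<phi> n i = \<sigma> (Vb i) (X n)" for n i
  have \<phi>f: "functional (\<phi> n i)" for n i unfolding \<phi>_def by (rule functional_third)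
  have det: "det (dual_mat (\<phi> n) a) \<noteq> 0" for n
    using N[of "n + N"] by (simp add: \<phi>_def[abs_def] X_def t_def)
  have conv: "(\<lambda>n. \<phi> n i w) \<longlonglongrightarrow> \<sigma> (Vb i) p w" for i w
    unfolding \<phi>_def by (rule tendsto_form[OF tendsto_const X tendsto_const])
  have KX: "K (X n) = {z. \<forall>i. \<phi> n i z = 0}" for n unfolding K_Vb \<phi>_def ..
  have dX: "vec.dim (K (X n)) = 7" for n unfolding KX by (rule dual_mat_dim[OF \<phi>f det])
  have XV: "X n \<notin> V" for n
  proof
    assume "X n \<in> V"
    then have "K (X n) = UNIV" by (rule K_of_V)
    then have "vec.dim (K (X n)) = 10" by (simp add: card_cart_basis)
    then show False using dX by simp
  qed
  define \<psi> :: "V10 \<Rightarrow> complex^3" where "\<psi> z = (\<chi> i. \<sigma> (Vb i) y z)" for z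
  \<comment> \<open>The correction that carries \<open>z\<close> from \<open>K p\<close> into
    \<open>K (X n)\<close>; it is multiplied by \<open>t n\<close>.\<close>
  define \<zeta> where "\<zeta> z n = dual_sol (\<phi> n) a (\<psi> z)" for z n
  define \<zeta>0 where "\<zeta>0 z = (\<Sum>j\<in>UNIV. \<psi> z $ j *s a j)" for z
  have \<zeta>: "\<zeta> z \<longlonglongrightarrow> \<zeta>0 z" for z
    unfolding \<zeta>_def[abs_def] \<zeta>0_def
    by (rule dual_sol_tendsto[where \<theta> = "\<lambda>i. \<sigma> (Vb i) p", OF a conv]) (rule tendsto_const)
  have zz: "z - t n *s \<zeta> z n \<in> K (X n)" if "z \<in> K p" for z n
  proof -
    have "\<phi> n i (z - t n *s \<zeta> z n) = 0" for i
    proof -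
      have "\<phi> n i z = t n * \<sigma> (Vb i) y z"
        using that Vb(2)[of i] by (simp add: \<phi>_def X_def linear K_def)
      moreover have "\<phi> n i (\<zeta> z n) = \<sigma> (Vb i) y z"
        unfolding \<zeta>_def by (subst dual_sol_works[OF \<phi>f det]) (simp add: \<psi>_def)
      ultimately show ?thesis by (simp add: functional_simps[OF \<phi>f])
    qed
    then show ?thesis by (simp add: KX)
  qed
  have b\<zeta>: "\<sigma> b p (\<zeta>0 z) = \<sigma> b y z" if bV: "b \<in> V" for b z
  proof -
    obtain c where c: "b = (\<Sum>i\<in>UNIV. c i *s Vb i)" using V_expand[OF bV] by blast
    have "\<sigma> (Vb i) p (\<zeta>0 z) = \<sigma> (Vb i) y z" for i
      by (simp add: \<zeta>0_def sum3 scale3 a \<psi>_def if_distrib[of "\<lambda>t. _ * t"] cong: if_cong)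
    then show ?thesis by (simp add: c sum1 scale1)
  qed
  show ?thesis
  proof (rule limit_core[OF p(2) X XV dX])
    fix r u v u0 v0
    assume r: "strict_mono (r :: nat \<Rightarrow> nat)" and vV: "\<And>n. v n \<in> V"
      and iso: "\<And>n a b. a \<in> K (X (r n)) \<Longrightarrow> b \<in> K (X (r n)) \<Longrightarrow> \<sigma> (u n *s X (r n) + v n) a b = 0"
      and u: "u \<longlonglongrightarrow> u0" and v: "v \<longlonglongrightarrow> v0"
    have tr: "(\<lambda>n. t (r n)) \<longlonglongrightarrow> 0" using LIMSEQ_subseq_LIMSEQ[OF t(1) r] by (simp add: o_def)
    have Xr: "(\<lambda>n. X (r n)) \<longlonglongrightarrow> p" using LIMSEQ_subseq_LIMSEQ[OF X r] by (simp add: o_def)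
    have \<zeta>r: "(\<lambda>n. \<zeta> z (r n)) \<longlonglongrightarrow> \<zeta>0 z" for z using LIMSEQ_subseq_LIMSEQ[OF \<zeta> r] by (simp add: o_def)
    have v0V: "v0 \<in> V" by (rule closed_sequentially[OF V_closed _ v]) (rule vV)
    have P: "(\<lambda>n. u n *s X (r n) + v n) \<longlonglongrightarrow> u0 *s p + v0"
      by (intro tendsto_add tendsto_scale_vec u v Xr)
    have zr: "(\<lambda>n. z - t (r n) *s \<zeta> z (r n)) \<longlonglongrightarrow> z" for z
    proof -
      have "(\<lambda>n. z - t (r n) *s \<zeta> z (r n)) \<longlonglongrightarrow> z - 0 *s \<zeta>0 z"
        by (intro tendsto_diff tendsto_scale_vec tendsto_const tr \<zeta>r)
      then show ?thesis by simp
    qed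
    have iso0: "\<sigma> (u0 *s p + v0) x x' = 0" if "x \<in> K p" "x' \<in> K p" for x x'
    proof -
      have "(\<lambda>n. \<sigma> (u n *s X (r n) + v n) (x - t (r n) *s \<zeta> x (r n)) (x' - t (r n) *s \<zeta> x' (r n)))
          \<longlonglongrightarrow> \<sigma> (u0 *s p + v0) x x'"
        by (rule tendsto_form[OF P zr zr])
      then show ?thesis using iso[OF zz zz] that by (simp add: LIMSEQ_const_iff)
    qed
    have "v0 \<in> vec.span {k}"
      by (rule rank3_unique[OF p(2,3) piso k v0V]) (use iso0 piso in \<open>auto simp: linear\<close>)
    then obtain \<beta> where \<beta>: "v0 = \<beta> *s k" by (auto simp: vec.span_singleton)
    let ?P = "\<lambda>n. u n *s X (r n) + v n"
    \<comment> \<open>The equation on the corrected \<open>z1\<close> and \<open>z2\<close>, divided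
      by \<open>t\<close>. This is possible because \<open>p\<close> and \<open>V\<close> both kill
      the uncorrected pair.\<close>
    let ?Z = "\<lambda>n. u n * \<sigma> y z1 z2 - \<sigma> (?P n) (\<zeta> z1 (r n)) z2 - \<sigma> (?P n) z1 (\<zeta> z2 (r n))
        + t (r n) * \<sigma> (?P n) (\<zeta> z1 (r n)) (\<zeta> z2 (r n))"
    have Z0: "?Z n = 0" for n
    proof -
      have "\<sigma> (?P n) z1 z2 = t (r n) * (u n * \<sigma> y z1 z2)"
        using zp(1)[of z2] z(3)[OF vV[of n]] by (simp add: X_def linear algebra_simps)
      then have "t (r n) * ?Z n = \<sigma> (?P n) (z1 - t (r n) *s \<zeta> z1 (r n)) (z2 - t (r n) *s \<zeta> z2 (r n))"
        by (simp add: diff2 diff3 scale2 scale3 algebra_simps)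
      also have "\<dots> = 0" using iso[OF zz zz] zK by blast
      finally show ?thesis using t(2) by simp
    qed
    have "?Z \<longlonglongrightarrow> u0 * \<sigma> y z1 z2 - \<sigma> (u0 *s p + v0) (\<zeta>0 z1) z2 - \<sigma> (u0 *s p + v0) z1 (\<zeta>0 z2)
        + 0 * \<sigma> (u0 *s p + v0) (\<zeta>0 z1) (\<zeta>0 z2)"
      by (intro tendsto_add tendsto_diff tendsto_mult tendsto_const u tr tendsto_form[OF P] \<zeta>r)
    then have "u0 * \<sigma> y z1 z2 - \<sigma> (u0 *s p + v0) (\<zeta>0 z1) z2 - \<sigma> (u0 *s p + v0) z1 (\<zeta>0 z2) = 0"
      unfolding Z0 by (simp add: LIMSEQ_const_iff)
    moreover have "\<sigma> p (\<zeta>0 z1) z2 = 0" "\<sigma> p z1 (\<zeta>0 z2) = 0" using zp swap23[of p z2 "\<zeta>0 z1"] by simp_all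
    moreover have "\<sigma> k (\<zeta>0 z1) z2 = - \<sigma> b2 y z1"
      using swap23[of k z2 "\<zeta>0 z1"] b2(2)[of "\<zeta>0 z1"] b\<zeta>[OF b2(1), of z1] by simp
    moreover have "\<sigma> k z1 (\<zeta>0 z2) = \<sigma> b1 y z2"
      using b1(2)[of "\<zeta>0 z2"] b\<zeta>[OF b1(1), of z2] by simp
    ultimately have "\<beta> * (\<sigma> b2 y z1 - \<sigma> b1 y z2) = 0" using y(1) by (simp add: \<beta> linear algebra_simps)
    then show "v0 = 0" using y(2) \<beta> by simp
  qed
qed

end

section \<open>Points where the pairing has rank two\<close>

lemma proportional_rows:
  fixes a1 a2 b1 b2 :: complex
  assumes "a1 * b2 = a2 * b1"
  shows "\<exists>a b u1 u2. (u1, u2) \<noteq> (0, 0) \<and> a1 = a * u1 \<and> a2 = a * u2 \<and> b1 = b * u1 \<and> b2 = b * u2"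
proof -
  consider "a1 \<noteq> 0" | "a1 = 0" "a2 \<noteq> 0" | "a1 = 0" "a2 = 0" "(b1, b2) \<noteq> (0, 0)" | "a1 = 0" "a2 = 0" "b1 = 0" "b2 = 0"
    by auto
  then show ?thesis
  proof cases
    case 1
    then show ?thesis using assms
      by (intro exI[of _ 1] exI[of _ "b1 / a1"] exI[of _ a1] exI[of _ a2]) (auto simp: field_simps)
  next
    case 2
    then show ?thesis using assms
      by (intro exI[of _ 1] exI[of _ "b2 / a2"] exI[of _ a1] exI[of _ a2]) (auto simp: field_simps)
  next
    case 3
    then show ?thesis by (intro exI[of _ 0] exI[of _ 1] exI[of _ b1] exI[of _ b2]) auto
  next
    case 4
    then show ?thesis by (intro exI[of _ 0] exI[of _ 0] exI[of _ 1] exI[of _ 1]) auto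
  qed
qed

text \<open>The hypotheses are the coefficients of the determinant of a pencil of 2 by 2 matrices. A
  linear space of singular 2 by 2 matrices has a common left kernel or a common right kernel, which
  are the two alternatives.\<close>

lemma degenerate_pencil:
  fixes x11 x12 x21 x22 y11 y12 y21 y22 :: complex
  assumes 1: "x11 * y12 = x12 * y11" and 2: "x21 * y22 = x22 * y21"
    and 3: "x11 * y22 + x21 * y12 = x12 * y21 + x22 * y11"
  obtains a b where "(a, b) \<noteq> (0, 0)" "a * x11 + b * y11 = 0" "a * x12 + b * y12 = 0"
      "a * x21 + b * y21 = 0" "a * x22 + b * y22 = 0"
  | k1 k2 where "(k1, k2) \<noteq> (0, 0)" "x11 * k1 + x12 * k2 = 0" "x21 * k1 + x22 * k2 = 0"
      "y11 * k1 + y12 * k2 = 0" "y21 * k1 + y22 * k2 = 0"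
proof -
  obtain a b u1 u2 where u: "(u1, u2) \<noteq> (0, 0)" "x11 = a * u1" "x12 = a * u2" "y11 = b * u1" "y12 = b * u2"
    using proportional_rows[OF 1] by blast
  obtain c d w1 w2 where w: "(w1, w2) \<noteq> (0, 0)" "x21 = c * w1" "x22 = c * w2" "y21 = d * w1" "y22 = d * w2"
    using proportional_rows[OF 2] by blast
  have "(a * d - c * b) * (u1 * w2 - u2 * w1) = 0"
    using 3 by (simp add: u w algebra_simps)
  then consider "u1 * w2 = u2 * w1" | "a * d = c * b" by auto
  then show ?thesis
  proof cases
    case 1
    show ?thesis
    proof (rule that(2)[of "u2" "- u1"])
      show "(u2, - u1) \<noteq> (0, 0)" using u(1) by auto
      have "c * w1 * u2 - c * w2 * u1 = c * (u2 * w1 - u1 * w2)" by (simp add: algebra_simps)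
      then show "x21 * u2 + x22 * - u1 = 0" using 1 by (simp add: w)
      have "d * w1 * u2 - d * w2 * u1 = d * (u2 * w1 - u1 * w2)" by (simp add: algebra_simps)
      then show "y21 * u2 + y22 * - u1 = 0" using 1 by (simp add: w)
    qed (simp_all add: u)
  next
    case 2
    show ?thesis
    proof (cases "(a, b) = (0, 0)")
      case False
      show ?thesis
      proof (rule that(1)[of b "- a"])
        have "b * c * w1 - a * d * w1 = 0" "b * c * w2 - a * d * w2 = 0" using 2 by (simp_all add: mult.commute)
        then show "b * x21 + - a * y21 = 0" "b * x22 + - a * y22 = 0" by (simp_all add: w mult.assoc)
      qed (use False in \<open>auto simp: u\<close>)
    next
      case True
      show ?thesis
      proof (cases "(c, d) = (0, 0)")
        case False
        show ?thesis by (rule that(1)[of d "- c"]) (use True False in \<open>auto simp: u w\<close>)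
      next
        case cd: True
        show ?thesis by (rule that(1)[of 1 1]) (use True cd in \<open>auto simp: u w\<close>)
      qed
    qed
  qed
qed

lemma binary_quadratic_root:
  fixes A B C :: complex
  shows "\<exists>a b. (a, b) \<noteq> (0, 0) \<and> A * a\<^sup>2 + B * (a * b) + C * b\<^sup>2 = 0"
proof (cases "A = 0")
  case True
  then show ?thesis by (intro exI[of _ 1] exI[of _ 0]) simp
next
  case False
  define s where "s = csqrt (B\<^sup>2 - 4 * A * C)"
  have s: "s\<^sup>2 = B\<^sup>2 - 4 * A * C" by (simp add: s_def)
  define a where "a = (- B + s) / (2 * A)"
  have "2 * A * a + B = s" using False by (simp add: a_def)
  then have "(2 * A * a + B)\<^sup>2 = B\<^sup>2 - 4 * A * C" using s by simp
  then have "4 * A * (A * a\<^sup>2 + B * a + C) = 0" by (simp add: power2_eq_square algebra_simps)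
  then have "A * a\<^sup>2 + B * a + C = 0" using False by simp
  then show ?thesis by (intro exI[of _ a] exI[of _ 1]) simp
qed

lemma singular_2x2:
  fixes x11 x12 x21 x22 :: complex
  assumes "x11 * x22 = x12 * x21"
  shows "\<exists>k1 k2. (k1, k2) \<noteq> (0, 0) \<and> x11 * k1 + x12 * k2 = 0 \<and> x21 * k1 + x22 * k2 = 0"
proof -
  obtain a b u1 u2 where u: "(u1, u2) \<noteq> (0, 0)" "x11 = a * u1" "x12 = a * u2" "x21 = b * u1" "x22 = b * u2"
    using proportional_rows[OF assms] by blast
  then show ?thesis by (intro exI[of _ u2] exI[of _ "- u1"]) auto
qed

section \<open>The quadric of a point where the pairing has rank two\<close>

locale rank2_point = general_trivector +
  fixes x c
  assumes x: "x \<notin> V" and c: "c \<in> V" "c \<noteq> 0" and cx: "\<And>z. \<sigma> c x z = 0"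
begin

lemma dK: "vec.dim (K x) = 8"
  by (rule dim_K_eight[OF x c cx])

text \<open>Here \<open>K x\<close> has dimension 8 and its quotient by \<open>W4 x\<close> has dimension 4. The skew forms
  \<open>\<sigma> w\<close> for \<open>w\<close> in \<open>W4 x\<close> live on this quotient; the degenerate ones form a quadric, the zero set of
  the Pfaffian \<open>pf\<close>.\<close>

definition R :: "V10 \<Rightarrow> V10 set" where "R w = {z \<in> K x. \<forall>t\<in>K x. \<sigma> w z t = 0}"

lemma R_subspace: "vec.subspace (R w)"
  using K_subspace[of x] by (auto simp: vec.subspace_def R_def linear)

lemma R_K: "R w \<subseteq> K x"
  by (auto simp: R_def)

lemma W_R: "w \<in> W4 x \<Longrightarrow> W4 x \<subseteq> R w"
  using W4_K W4_iso by (auto simp: R_def)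

lemma R_even: "even (vec.dim (R w))"
  using alternating_parity[OF bilinear_form_first[of w] same(2) K_subspace[of x]] dK by (simp add: R_def)

text \<open>Outside \<open>V\<close> such a \<open>w\<close> would be the excluded rank four point,
  since \<open>c\<close> kills it too. Inside \<open>V\<close>, isotropy of the eight-dimensional
  \<open>K x\<close> would force a radical of dimension at least 6 instead of 4.\<close>

lemma R_not_all:
  assumes w: "w \<in> W4 x" "w \<noteq> 0"
  shows "\<exists>a\<in>K x. \<exists>b\<in>K x. \<sigma> w a b \<noteq> 0"
proof (rule ccontr)
  assume "\<not> ?thesis"
  then have iso: "\<And>a b. a \<in> K x \<Longrightarrow> b \<in> K x \<Longrightarrow> \<sigma> w a b = 0" by blast
  show False
  proof (cases "w \<in> V")
    case False
    obtain s v where sv: "v \<in> V" "w = s *s x + v" using w(1) by (auto simp: W4_iff)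
    have "\<sigma> w c z = 0" for z
      using cx[of z] swap12[of x c z] V_iso[OF sv(1) c(1)] by (simp add: sv linear)
    then show False
      using no_rank4_point[OF c False K_subspace V_K _ dK] iso w(1) W4_K by blast
  next
    case True
    have "vec.dim {t. \<forall>s\<in>K x. \<sigma> w s t = 0} + 8 = 10 + vec.dim {s \<in> K x. \<forall>t. \<sigma> w s t = 0}"
      using pairing[OF bilinear_form_first[of w] K_subspace[of x] vec.subspace_UNIV] dK by (simp add: card_cart_basis)
    moreover have "vec.dim (K x) \<le> vec.dim {t. \<forall>s\<in>K x. \<sigma> w s t = 0}"
      using iso by (intro vec.dim_subset) auto
    moreover have "vec.dim {s \<in> K x. \<forall>t. \<sigma> w s t = 0} \<le> vec.dim (rad w)"
      by (intro vec.dim_subset) (auto simp: rad_def)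
    ultimately show False using dim_rad_V[OF True w(2)] dK by linarith
  qed
qed

text \<open>On the four-dimensional quotient \<open>K x / W4 x\<close> the form of \<open>w\<close>
  then has rank two, so \<open>w\<close> is a point of the Pfaffian quadric.\<close>

definition cone :: "V10 \<Rightarrow> bool" where "cone w \<longleftrightarrow> w \<in> W4 x \<and> w \<noteq> 0 \<and> vec.dim (R w) = 6"

lemma coneI:
  assumes w: "w \<in> W4 x" "w \<noteq> 0" and z: "z \<in> R w" "z \<notin> W4 x"
  shows "cone w"
proof -
  have "vec.dim (W4 x) < vec.dim (R w)"
  proof -
    have "W4 x \<subset> R w" using W_R[OF w(1)] z by blast
    then show ?thesis by (intro vec.dim_psubset) (simp add: W4_subspace R_subspace vec.span_eq_iff[THEN iffD2])
  qed
  moreover have "vec.dim (R w) \<noteq> 8"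
  proof
    assume "vec.dim (R w) = 8"
    then have "R w = K x" using dK by (intro vec.subspace_dim_equal R_subspace K_subspace R_K) simp
    then show False using R_not_all[OF w] by (auto simp: R_def)
  qed
  moreover have "vec.dim (R w) \<le> 8" using vec.dim_subset[OF R_K] dK by metis
  ultimately have "vec.dim (R w) = 5 \<or> vec.dim (R w) = 6 \<or> vec.dim (R w) = 7" using W4_dim[OF x] by linarith
  then have "vec.dim (R w) = 6" using R_even[of w] by auto
  then show ?thesis using w by (simp add: cone_def)
qed

definition frame :: "V10 \<Rightarrow> V10 \<Rightarrow> V10 \<Rightarrow> V10 \<Rightarrow> bool" where
  "frame h1 h2 h3 h4 \<longleftrightarrow> {h1, h2, h3, h4} \<subseteq> K x \<and> K x = vec.span ({h1, h2, h3, h4} \<union> W4 x) \<and>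
     (\<forall>a b c d. a *s h1 + b *s h2 + c *s h3 + d *s h4 \<in> W4 x \<longrightarrow> a = 0 \<and> b = 0 \<and> c = 0 \<and> d = 0)"

lemma frame_functional:
  assumes "frame h1 h2 h3 h4" "functional f" "\<And>w. w \<in> W4 x \<Longrightarrow> f w = 0" "f h1 = 0" "f h2 = 0" "f h3 = 0" "f h4 = 0"
    and "z \<in> K x"
  shows "f z = 0"
proof (rule functional_span[OF assms(2)])
  show "z \<in> vec.span ({h1, h2, h3, h4} \<union> W4 x)" using assms(1,8) by (simp add: frame_def)
qed (use assms in auto)

lemma frame_through:
  assumes S: "vec.subspace S" "W4 x \<subseteq> S" "S \<subseteq> K x" "vec.dim S = 6"
  obtains r1 r2 g1 g2 where "frame r1 r2 g1 g2" "r1 \<in> S" "r2 \<in> S" "S = vec.span ({r1, r2} \<union> W4 x)"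
    "\<And>a b. a *s g1 + b *s g2 \<in> S \<Longrightarrow> a = 0 \<and> b = 0"
proof -
  have "vec.dim S = vec.dim (W4 x) + 2" using S(4) W4_dim[OF x] by simp
  then obtain r1 r2 where r: "r1 \<in> S" "r2 \<in> S" "S = vec.span (insert r2 (insert r1 (W4 x)))"
    "\<And>a b. a *s r1 + b *s r2 \<in> W4 x \<Longrightarrow> a = 0 \<and> b = 0"
    using extend_by_two[OF W4_subspace S(1,2)] by blast
  have "vec.dim (K x) = vec.dim S + 2" using S(4) dK by simp
  then obtain g1 g2 where g: "g1 \<in> K x" "g2 \<in> K x" "K x = vec.span (insert g2 (insert g1 S))"
    "\<And>a b. a *s g1 + b *s g2 \<in> S \<Longrightarrow> a = 0 \<and> b = 0"
    using extend_by_two[OF S(1) K_subspace S(3)] by blast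
  have sub: "vec.span ({r1, r2, g1, g2} \<union> W4 x) = K x"
  proof
    show "vec.span ({r1, r2, g1, g2} \<union> W4 x) \<subseteq> K x"
      using r(1,2) g(1,2) S W4_K K_subspace by (intro vec.span_minimal) auto
    have "S \<subseteq> vec.span ({r1, r2, g1, g2} \<union> W4 x)" unfolding r(3) by (intro vec.span_mono) auto
    moreover have "{g1, g2} \<subseteq> vec.span ({r1, r2, g1, g2} \<union> W4 x)" by (auto intro: vec.span_base)
    ultimately have "insert g2 (insert g1 S) \<subseteq> vec.span ({r1, r2, g1, g2} \<union> W4 x)" by blast
    then show "K x \<subseteq> vec.span ({r1, r2, g1, g2} \<union> W4 x)" unfolding g(3) by (intro vec.span_minimal) auto
  qed
  have ind: "a = 0 \<and> b = 0 \<and> c = 0 \<and> d = 0" if abcd: "a *s r1 + b *s r2 + c *s g1 + d *s g2 \<in> W4 x" for a b c d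
  proof -
    have "a *s r1 + b *s r2 + c *s g1 + d *s g2 \<in> S" using abcd S(2) by blast
    moreover have "a *s r1 + b *s r2 \<in> S" using r(1,2) by (intro vec.subspace_add vec.subspace_scale S(1))
    ultimately have "(a *s r1 + b *s r2 + c *s g1 + d *s g2) - (a *s r1 + b *s r2) \<in> S"
      by (rule vec.subspace_diff[OF S(1)])
    then have cd: "c = 0 \<and> d = 0" by (intro g(4)) (simp add: algebra_simps)
    then have "a *s r1 + b *s r2 \<in> W4 x" using abcd by simp
    with cd r(4) show ?thesis by blast
  qed
  have "frame r1 r2 g1 g2" unfolding frame_def using r(1,2) g(1,2) S(3) sub ind by auto
  moreover have "S = vec.span ({r1, r2} \<union> W4 x)" using r(3) by (simp add: insert_commute)
  ultimately show ?thesis using that r(1,2) g(4) by blast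
qed

definition pf :: "V10 \<Rightarrow> V10 \<Rightarrow> V10 \<Rightarrow> V10 \<Rightarrow> V10 \<Rightarrow> complex" where
  "pf h1 h2 h3 h4 w = \<sigma> w h1 h2 * \<sigma> w h3 h4 - \<sigma> w h1 h3 * \<sigma> w h2 h4 + \<sigma> w h1 h4 * \<sigma> w h2 h3"

lemma frame_isotropic:
  assumes F: "frame h1 h2 h3 h4" and w: "w \<in> W4 x"
    and 0: "\<sigma> w h1 h2 = 0" "\<sigma> w h1 h3 = 0" "\<sigma> w h1 h4 = 0" "\<sigma> w h2 h3 = 0" "\<sigma> w h2 h4 = 0" "\<sigma> w h3 h4 = 0"
    and ab: "a \<in> K x" "b \<in> K x"
  shows "\<sigma> w a b = 0"
proof (rule frame_functional[OF F functional_second _ _ _ _ _ ab(1)])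
  have hK: "h1 \<in> K x" "h2 \<in> K x" "h3 \<in> K x" "h4 \<in> K x" using F by (auto simp: frame_def)
  have sw: "\<sigma> w h2 h1 = - \<sigma> w h1 h2" "\<sigma> w h3 h1 = - \<sigma> w h1 h3" "\<sigma> w h4 h1 = - \<sigma> w h1 h4"
    "\<sigma> w h3 h2 = - \<sigma> w h2 h3" "\<sigma> w h4 h2 = - \<sigma> w h2 h4" "\<sigma> w h4 h3 = - \<sigma> w h3 h4"
    by (rule swap23)+
  have "\<sigma> w h b = 0" if h: "h \<in> {h1, h2, h3, h4}" for h
  proof (rule frame_functional[OF F functional_third _ _ _ _ _ ab(2)])
    show "\<sigma> w h u = 0" if "u \<in> W4 x" for u
      using W4_iso[OF w that, of h] swap23[of w u h] h hK by auto
  qed (use h 0 sw in auto)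
  then show "\<sigma> w h1 b = 0" "\<sigma> w h2 b = 0" "\<sigma> w h3 b = 0" "\<sigma> w h4 b = 0" by auto
  show "\<sigma> w u b = 0" if "u \<in> W4 x" for u by (rule W4_iso[OF w that ab(2)])
qed

text \<open>When the Pfaffian vanishes, the rows of the complementary skew matrix lie in the kernel
  of the form. Three of its rows already show all six entries, so if they were zero the form would
  be zero, against \<open>R_not_all\<close>.\<close>

lemma pf_cone:
  assumes F: "frame h1 h2 h3 h4" and w: "w \<in> W4 x" "w \<noteq> 0" and pf: "pf h1 h2 h3 h4 w = 0"
  shows "cone w"
proof -
  have hK: "h1 \<in> K x" "h2 \<in> K x" "h3 \<in> K x" "h4 \<in> K x" using F by (auto simp: frame_def)
  have W0: "\<sigma> w z u = 0" "\<sigma> w u z = 0" if "z \<in> K x" "u \<in> W4 x" for z u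
    using W4_iso[OF w(1) that(2,1)] swap23[of w u z] by simp_all
  have key: "cone w" if n: "(n1, n2, n3, n4) \<noteq> (0, 0, 0, 0)"
    "n2 * \<sigma> w h2 h1 + n3 * \<sigma> w h3 h1 + n4 * \<sigma> w h4 h1 = 0"
    "n1 * \<sigma> w h1 h2 + n3 * \<sigma> w h3 h2 + n4 * \<sigma> w h4 h2 = 0"
    "n1 * \<sigma> w h1 h3 + n2 * \<sigma> w h2 h3 + n4 * \<sigma> w h4 h3 = 0"
    "n1 * \<sigma> w h1 h4 + n2 * \<sigma> w h2 h4 + n3 * \<sigma> w h3 h4 = 0" for n1 n2 n3 n4
  proof (rule coneI[OF w])
    let ?z = "n1 *s h1 + n2 *s h2 + n3 *s h3 + n4 *s h4"
    have zK: "?z \<in> K x" using hK K_subspace by (intro vec.subspace_add vec.subspace_scale) auto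
    have "\<sigma> w ?z t = 0" if "t \<in> K x" for t
      by (rule frame_functional[OF F functional_third _ _ _ _ _ that])
        (use W0(1)[OF zK] n in \<open>simp_all add: linear\<close>)
    then show "?z \<in> R w" using zK by (simp add: R_def)
    show "?z \<notin> W4 x" using F n(1) unfolding frame_def by blast
  qed
  have sw: "\<sigma> w h2 h1 = - \<sigma> w h1 h2" "\<sigma> w h3 h1 = - \<sigma> w h1 h3" "\<sigma> w h4 h1 = - \<sigma> w h1 h4"
    "\<sigma> w h3 h2 = - \<sigma> w h2 h3" "\<sigma> w h4 h2 = - \<sigma> w h2 h4" "\<sigma> w h4 h3 = - \<sigma> w h3 h4"
    by (rule swap23)+
  let ?a12 = "\<sigma> w h1 h2" and ?a13 = "\<sigma> w h1 h3" and ?a14 = "\<sigma> w h1 h4"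
    and ?a23 = "\<sigma> w h2 h3" and ?a24 = "\<sigma> w h2 h4" and ?a34 = "\<sigma> w h3 h4"
  have p: "?a12 * ?a34 + ?a14 * ?a23 = ?a13 * ?a24" using pf by (simp add: pf_def algebra_simps)
  consider "(0 :: complex, ?a34, - ?a24, ?a23) \<noteq> (0, 0, 0, 0)" | "(- ?a34, 0 :: complex, ?a14, - ?a13) \<noteq> (0, 0, 0, 0)"
    | "(?a24, - ?a14, 0 :: complex, ?a12) \<noteq> (0, 0, 0, 0)"
    | "?a12 = 0" "?a13 = 0" "?a14 = 0" "?a23 = 0" "?a24 = 0" "?a34 = 0" by auto
  then show ?thesis
  proof cases
    case 1
    show ?thesis by (rule key[OF 1]) (use p in \<open>simp_all add: sw algebra_simps\<close>)
  next
    case 2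
    show ?thesis by (rule key[OF 2]) (use p in \<open>simp_all add: sw algebra_simps\<close>)
  next
    case 3
    show ?thesis by (rule key[OF 3]) (use p in \<open>simp_all add: sw algebra_simps\<close>)
  next
    case 4
    then show ?thesis using frame_isotropic[OF F w(1)] R_not_all[OF w] by blast
  qed
qed

lemma flag_contradiction:
  assumes e: "e \<in> K x" "e \<notin> W4 x" and T: "vec.subspace T" "insert e (W4 x) \<subseteq> T" "vec.dim T = 7" "T \<subseteq> K x"
    and iso: "\<And>w z. w \<in> W4 x \<Longrightarrow> z \<in> T \<Longrightarrow> \<sigma> w e z = 0"
  shows False
proof (rule no_flag[of "vec.span (insert e (W4 x))" T])
  show "V \<subseteq> vec.span (insert e (W4 x))" using W4_V[of x] vec.span_superset[of "insert e (W4 x)"] by blast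
  show "vec.span (insert e (W4 x)) \<subseteq> T" using T by (intro vec.span_minimal) auto
  show "vec.dim (vec.span (insert e (W4 x))) = 5"
    using e(2) W4_dim[OF x] W4_subspace by (simp add: vec.dim_insert vec.span_eq_iff[THEN iffD2])
  fix a b z assume ab: "a \<in> vec.span (insert e (W4 x))" "b \<in> vec.span (insert e (W4 x))" and z: "z \<in> T"
  show "\<sigma> a b z = 0"
  proof (rule span_isotropic_pair[OF _ ab])
    fix a b assume "a \<in> insert e (W4 x)" "b \<in> insert e (W4 x)"
    then show "\<sigma> a b z = 0" using iso[OF _ z] W4_iso[OF _ _ subsetD[OF T(4) z]] swap12[of e b z] by auto
  qed
qed (use T in auto)

text \<open>A fourth vector \<open>w4\<close> of \<open>W4 x\<close> imposes only one linear
  condition on \<open>K x\<close>, which leaves a seven-dimensional space on which all of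
  \<open>W4 x\<close> kills \<open>e\<close>.\<close>

lemma hyperplane_contradiction:
  assumes e: "e \<in> K x" "e \<notin> W4 x" and U: "vec.subspace U" "U \<subseteq> W4 x" "vec.dim U = 3"
    and iso: "\<And>w z. w \<in> U \<Longrightarrow> z \<in> K x \<Longrightarrow> \<sigma> w e z = 0"
  shows False
proof -
  have "vec.dim U < vec.dim (W4 x)" using U(3) W4_dim[OF x] by simp
  from subspace_exists_outside[OF U(1) this] obtain w4 where w4: "w4 \<in> W4 x" "w4 \<notin> U" by blast
  have W: "W4 x = vec.span (insert w4 U)"
    using U w4 W4_dim[OF x] by (intro subspace_eq_span_insert W4_subspace) auto
  let ?K' = "{z \<in> K x. \<sigma> w4 e z = 0}"
  have sK': "vec.subspace ?K'" by (rule subspace_kernel[OF K_subspace functional_third])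
  have "8 \<le> vec.dim ?K' + 1" using dim_kernel[OF K_subspace functional_third, of x w4 e] dK by simp
  then have dK': "7 \<le> vec.dim ?K'" by simp
  let ?S = "vec.span (insert e (W4 x))"
  have dS: "vec.dim ?S = 5"
    using e(2) W4_dim[OF x] W4_subspace by (simp add: vec.dim_insert vec.span_eq_iff[THEN iffD2])
  have "insert e (W4 x) \<subseteq> ?K'"
    using e(1) W4_K W4_iso[OF w4(1) _ e(1)] swap23[of w4 e] by auto
  then have "?S \<subseteq> ?K'" using sK' by (rule vec.span_minimal)
  from subspace_between[OF vec.subspace_span sK' this, of 7] dS dK'
  obtain T where T: "vec.subspace T" "?S \<subseteq> T" "T \<subseteq> ?K'" "vec.dim T = 7" by auto
  show False
  proof (rule flag_contradiction[OF e T(1) _ T(4)])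
    show "insert e (W4 x) \<subseteq> T" using T(2) vec.span_superset[of "insert e (W4 x)"] by blast
    show "T \<subseteq> K x" using T(3) by blast
    fix w z assume w: "w \<in> W4 x" and z: "z \<in> T"
    obtain k u where "u \<in> U" "w = k *s w4 + u" using w W in_span_insert_subspace[OF U(1)] by blast
    moreover have "\<sigma> w4 e z = 0" "z \<in> K x" using T(3) z by auto
    ultimately show "\<sigma> w e z = 0" using iso by (simp add: linear)
  qed
qed

text \<open>In a frame adapted to \<open>P\<close>, the derivative of the Pfaffian at
  \<open>P\<close> in direction \<open>w\<close> is the nonzero \<open>\<sigma> P g1 g2\<close>
  times \<open>\<sigma> w r1 r2\<close>. So this says that \<open>P\<close> is a smooth point of the
  quadric.\<close>

definition nonvertex :: "V10 \<Rightarrow> bool" where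
  "nonvertex P \<longleftrightarrow> (\<exists>w\<in>W4 x. \<exists>r\<in>R P. \<exists>r'\<in>R P. \<sigma> w r r' \<noteq> 0)"

lemma cone_frame:
  assumes "cone P"
  obtains r1 r2 g1 g2 where "frame r1 r2 g1 g2" "r1 \<in> R P" "r2 \<in> R P" "R P = vec.span ({r1, r2} \<union> W4 x)"
    "\<And>a b. a *s g1 + b *s g2 \<in> R P \<Longrightarrow> a = 0 \<and> b = 0" "\<sigma> P g1 g2 \<noteq> 0"
    "nonvertex P \<Longrightarrow> \<exists>w\<in>W4 x. \<sigma> w r1 r2 \<noteq> 0"
proof -
  have P: "P \<in> W4 x" "P \<noteq> 0" "vec.dim (R P) = 6" using assms by (auto simp: cone_def)
  obtain r1 r2 g1 g2 where f: "frame r1 r2 g1 g2" "r1 \<in> R P" "r2 \<in> R P" "R P = vec.span ({r1, r2} \<union> W4 x)"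
    "\<And>a b. a *s g1 + b *s g2 \<in> R P \<Longrightarrow> a = 0 \<and> b = 0"
    using frame_through[OF R_subspace W_R[OF P(1)] R_K P(3)] by blast
  have gK: "g1 \<in> K x" "g2 \<in> K x" using f(1) by (auto simp: frame_def)
  have "\<sigma> P g1 g2 \<noteq> 0"
  proof
    assume 0: "\<sigma> P g1 g2 = 0"
    have "\<sigma> P g1 t = 0" if "t \<in> K x" for t
    proof (rule frame_functional[OF f(1) functional_third _ _ _ _ _ that])
      show "\<sigma> P g1 w = 0" if "w \<in> W4 x" for w using W4_iso[OF P(1) that gK(1)] swap23[of P g1 w] by simp
      show "\<sigma> P g1 r1 = 0" "\<sigma> P g1 r2 = 0"
        using f(2,3) gK swap23[of P g1 r1] swap23[of P g1 r2] by (auto simp: R_def)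
    qed (use 0 in auto)
    then have "1 *s g1 + 0 *s g2 \<in> R P" using gK by (simp add: R_def)
    then show False using f(5) by fastforce
  qed
  moreover have "\<exists>w\<in>W4 x. \<sigma> w r1 r2 \<noteq> 0" if nv: "nonvertex P"
  proof (rule ccontr)
    assume "\<not> ?thesis"
    then have 0: "\<And>w. w \<in> W4 x \<Longrightarrow> \<sigma> w r1 r2 = 0" by blast
    have "\<sigma> w r r' = 0" if "w \<in> W4 x" "r \<in> R P" "r' \<in> R P" for w r r'
    proof (rule span_isotropic[where G = "{r1, r2} \<union> W4 x"])
      fix a b assume ab: "a \<in> {r1, r2} \<union> W4 x" "b \<in> {r1, r2} \<union> W4 x"
      have K: "a \<in> K x" "b \<in> K x" using ab f(2,3) R_K W4_K by blast+
      show "\<sigma> w a b = 0"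
      proof (cases "a \<in> W4 x \<or> b \<in> W4 x")
        case True
        then show ?thesis using W4_iso[OF \<open>w \<in> W4 x\<close>] K swap23[of w a b] by auto
      next
        case False
        then show ?thesis using ab 0[OF \<open>w \<in> W4 x\<close>] swap23[of w r1 r2] by auto
      qed
    qed (use that f(4) in auto)
    then show False using nv by (auto simp: nonvertex_def)
  qed
  ultimately show ?thesis using that f by blast
qed

lemma rad_c: "rad c = W4 x"
proof -
  have "W4 x \<subseteq> rad c"
    using V_rad[OF c(1)] cx rad_subspace unfolding W4_def by (intro vec.span_minimal) (auto simp: rad_def)
  then show ?thesis
    using vec.subspace_dim_equal[OF W4_subspace rad_subspace] dim_rad_V[OF c] W4_dim[OF x] by (metis order_refl)
qed

text \<open>The radical of \<open>\<sigma> c\<close> is exactly \<open>W4 x\<close>, so this form is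
  nondegenerate modulo \<open>W4 x\<close>, and the orthogonal of \<open>S\<close> is strictly
  larger than that of \<open>K x\<close>. The vector \<open>y\<close> found there is the direction
  in which \<open>cone_limit_core\<close> moves the point.\<close>

lemma hyperplane_as_kernel:
  assumes S: "vec.subspace S" "W4 x \<subseteq> S" "S \<subseteq> K x" "vec.dim S = 7"
  obtains y where "S = {z \<in> K x. \<sigma> c y z = 0}"
proof -
  have d: "vec.dim {t. \<forall>s\<in>T. \<sigma> c s t = 0} + vec.dim T = 14" if T: "vec.subspace T" "W4 x \<subseteq> T" for T
  proof -
    have "{s \<in> T. \<forall>t. \<sigma> c s t = 0} = W4 x" using rad_c T(2) by (auto simp: rad_def)
    then show ?thesis
      using pairing[OF bilinear_form_first[of c] T(1) vec.subspace_UNIV] W4_dim[OF x] by (simp add: card_cart_basis)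
  qed
  have "vec.dim {t. \<forall>s\<in>K x. \<sigma> c s t = 0} < vec.dim {t. \<forall>s\<in>S. \<sigma> c s t = 0}"
    using d[OF S(1,2)] d[OF K_subspace W4_K] S(4) dK by linarith
  moreover have "vec.subspace {t. \<forall>s\<in>K x. \<sigma> c s t = 0}" by (auto simp: vec.subspace_def linear)
  ultimately obtain y where y: "\<forall>s\<in>S. \<sigma> c s y = 0" "\<not> (\<forall>s\<in>K x. \<sigma> c s y = 0)"
    using subspace_exists_outside by blast
  have sk: "vec.subspace {z \<in> K x. \<sigma> c y z = 0}" by (rule subspace_kernel[OF K_subspace functional_third])
  have sub: "S \<subseteq> {z \<in> K x. \<sigma> c y z = 0}" using y(1) S(3) swap23[of c y] by auto
  have "{z \<in> K x. \<sigma> c y z = 0} \<subset> K x" using y(2) swap23[of c y] by auto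
  then have "vec.dim {z \<in> K x. \<sigma> c y z = 0} < vec.dim (K x)"
    by (intro vec.dim_psubset) (simp add: sk K_subspace vec.span_eq_iff[THEN iffD2])
  then have "S = {z \<in> K x. \<sigma> c y z = 0}" using S(4) dK by (intro vec.subspace_dim_equal[OF S(1) sk sub]) simp
  then show ?thesis by (rule that)
qed

text \<open>Since \<open>c\<close> kills \<open>P\<close>, at \<open>P + s *s y\<close> its equation
  is \<open>s\<close> times \<open>\<sigma> c y\<close>. For small nonzero \<open>s\<close> the
  spaces \<open>K\<close> therefore have dimension 7 and tend to \<open>S\<close> rather than to
  \<open>K x\<close>. Hence it is enough that no nonzero vector of \<open>V\<close> vanishes on
  \<open>S\<close>.\<close>

lemma cone_limit_core:
  assumes P: "P \<in> W4 x" "P \<notin> V" and S: "vec.subspace S" "W4 x \<subseteq> S" "S \<subseteq> K x" "vec.dim S = 7"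
    and Piso: "\<And>a b. a \<in> S \<Longrightarrow> b \<in> S \<Longrightarrow> \<sigma> P a b = 0"
    and Vinj: "\<And>v. v \<in> V \<Longrightarrow> (\<And>a b. a \<in> S \<Longrightarrow> b \<in> S \<Longrightarrow> \<sigma> v a b = 0) \<Longrightarrow> v = 0"
  shows "P \<in> closure (Collect good)"
proof -
  obtain y where y: "S = {z \<in> K x. \<sigma> c y z = 0}" using hyperplane_as_kernel[OF S] by blast
  obtain s v where sv: "v \<in> V" "P = s *s x + v" using P(1) by (auto simp: W4_iff)
  have "s \<noteq> 0" using P(2) sv by auto
  then have KP: "K P = K x" using K_shift[OF sv(1)] sv(2) by simp
  have cP: "\<sigma> c P z = 0" for z using cx[of z] V_iso[OF c(1) sv(1)] by (simp add: sv linear)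
  obtain v1 where v1: "v1 \<in> V" "v1 \<notin> vec.span {c}" using V_second[OF c(1)] by blast
  obtain v2 where v2: "v2 \<in> V" "V = vec.span {c, v1, v2}" using V_basis[OF c(1) v1(1) c(2) v1(2)] by blast
  have K3: "K p = {z. \<sigma> c p z = 0 \<and> \<sigma> v1 p z = 0 \<and> \<sigma> v2 p z = 0}" for p
  proof (intro subset_antisym subsetI)
    fix z assume z: "z \<in> {z. \<sigma> c p z = 0 \<and> \<sigma> v1 p z = 0 \<and> \<sigma> v2 p z = 0}"
    have "\<sigma> u p z = 0" if "u \<in> V" for u
      by (rule functional_span[OF functional_first, of u "{c, v1, v2}"]) (use that v2 z in auto)
    then show "z \<in> K p" by (simp add: K_def)
  qed (use c(1) v1(1) v2(1) in \<open>auto simp: K_def\<close>)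
  \<comment> \<open>The equation belonging to \<open>c\<close> is divided by the small parameter
    beforehand, so that the three functionals stay independent in the limit.\<close>
  define \<Phi> where "\<Phi> p i = (if i = 1 then \<sigma> c y else if i = 2 then \<sigma> v1 p else \<sigma> v2 p)" for p and i :: 3
  have \<Phi>f: "functional (\<Phi> p i)" for p i by (auto simp: \<Phi>_def functional_third)
  have ker\<Phi>: "{z. \<forall>i. \<Phi> p i z = 0} = {z. \<sigma> c y z = 0 \<and> \<sigma> v1 p z = 0 \<and> \<sigma> v2 p z = 0}" for p
    unfolding forall_3 by (auto simp: \<Phi>_def)
  have ker0: "{z. \<forall>i. \<Phi> P i z = 0} = S"
    unfolding ker\<Phi> y KP[symmetric] unfolding K3[of P] using cP by auto
  obtain a where a: "\<And>i j. \<Phi> P i (a j) = (if i = j then 1 else 0)"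
    using dual_basis3[of "\<Phi> P", OF \<Phi>f] S(4) ker0 by auto
  obtain s where s: "s \<longlonglongrightarrow> 0" "\<And>n. s n \<noteq> (0 :: complex)" using small_sequence by blast
  have "(\<lambda>n. P + s n *s y) \<longlonglongrightarrow> P + 0 *s y" by (intro tendsto_add tendsto_scale_vec tendsto_const s(1))
  then have lim: "(\<lambda>n. P + s n *s y) \<longlonglongrightarrow> P" by simp
  have convq: "(\<lambda>n. \<Phi> (q n) i w) \<longlonglongrightarrow> \<Phi> P i w" if "q \<longlonglongrightarrow> P" for q i w
    unfolding \<Phi>_def using tendsto_form[OF tendsto_const that tendsto_const] by auto
  have "\<forall>\<^sub>F n in sequentially. det (dual_mat (\<Phi> (P + s n *s y)) a) \<noteq> 0"
    by (rule dual_mat_eventually[where \<theta> = "\<Phi> P", OF a convq[OF lim]])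
  then obtain N where N: "\<And>n. N \<le> n \<Longrightarrow> det (dual_mat (\<Phi> (P + s n *s y)) a) \<noteq> 0"
    unfolding eventually_sequentially by blast
  define X where "X n = P + s (n + N) *s y" for n
  have X: "X \<longlonglongrightarrow> P" using LIMSEQ_ignore_initial_segment[OF lim, of N] by (simp add: X_def[abs_def])
  have det: "det (dual_mat (\<Phi> (X n)) a) \<noteq> 0" for n using N[of "n + N"] by (simp add: X_def)
  have KX: "K (X n) = {z. \<forall>i. \<Phi> (X n) i z = 0}" for n
    unfolding ker\<Phi> K3[of "X n"] using s(2)[of "n + N"] cP by (auto simp: X_def linear)
  have dX: "vec.dim (K (X n)) = 7" for n unfolding KX by (rule dual_mat_dim[OF \<Phi>f det])
  have XV: "X n \<notin> V" for n
  proof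
    assume "X n \<in> V"
    then have "K (X n) = UNIV" by (rule K_of_V)
    then have "vec.dim (K (X n)) = 10" by (simp add: card_cart_basis)
    then show False using dX by simp
  qed
  define zz where "zz z n = z - dual_sol (\<Phi> (X n)) a (\<chi> i. \<Phi> (X n) i z)" for z n
  have zzK: "zz z n \<in> K (X n)" for z n
    unfolding KX zz_def using dual_sol_works[OF \<Phi>f det] by (simp add: functional_simps[OF \<Phi>f])
  have zz: "zz z \<longlonglongrightarrow> z" if z: "z \<in> S" for z
  proof -
    have z0: "\<Phi> P i z = 0" for i using z ker0 by blast
    have "(\<lambda>n. dual_sol (\<Phi> (X n)) a (\<chi> i. \<Phi> (X n) i z)) \<longlonglongrightarrow> (\<Sum>k\<in>UNIV. (\<chi> i. \<Phi> P i z) $ k *s a k)"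
      by (rule dual_sol_tendsto[where \<theta> = "\<Phi> P", OF a convq[OF X]]) (simp add: convq[OF X])
    then have "(\<lambda>n. dual_sol (\<Phi> (X n)) a (\<chi> i. \<Phi> (X n) i z)) \<longlonglongrightarrow> 0" by (simp add: z0)
    from tendsto_diff[OF tendsto_const this, of z] show ?thesis by (simp add: zz_def[abs_def])
  qed
  show ?thesis
  proof (rule limit_core[OF P(2) X XV dX])
    fix r u v u0 v0
    assume r: "strict_mono (r :: nat \<Rightarrow> nat)" and vV: "\<And>n. v n \<in> V"
      and iso: "\<And>n a b. a \<in> K (X (r n)) \<Longrightarrow> b \<in> K (X (r n)) \<Longrightarrow> \<sigma> (u n *s X (r n) + v n) a b = 0"
      and u: "u \<longlonglongrightarrow> u0" and v: "v \<longlonglongrightarrow> v0"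
    have Xr: "(\<lambda>n. X (r n)) \<longlonglongrightarrow> P" using LIMSEQ_subseq_LIMSEQ[OF X r] by (simp add: o_def)
    have zr: "(\<lambda>n. zz z (r n)) \<longlonglongrightarrow> z" if "z \<in> S" for z
      using LIMSEQ_subseq_LIMSEQ[OF zz[OF that] r] by (simp add: o_def)
    have v0V: "v0 \<in> V" by (rule closed_sequentially[OF V_closed _ v]) (rule vV)
    have "\<sigma> v0 a b = 0" if ab: "a \<in> S" "b \<in> S" for a b
    proof -
      have "(\<lambda>n. \<sigma> (u n *s X (r n) + v n) (zz a (r n)) (zz b (r n))) \<longlonglongrightarrow> \<sigma> (u0 *s P + v0) a b"
        by (intro tendsto_form tendsto_add tendsto_scale_vec u v Xr zr ab)
      then have "\<sigma> (u0 *s P + v0) a b = 0" using iso[OF zzK zzK] by (simp add: LIMSEQ_const_iff)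
      then show ?thesis using Piso[OF ab] by (simp add: linear)
    qed
    then show "v0 = 0" by (rule Vinj[OF v0V])
  qed
qed

end

lemma kernel_2x2:
  fixes a b :: complex
  assumes "(a, b) \<noteq> (0, 0)" "a * x1 + b * y1 = 0" "a * x2 + b * y2 = 0"
  shows "x1 * y2 = x2 * y1"
proof -
  have "a * (x1 * y2 - x2 * y1) = (a * x1 + b * y1) * y2 - (a * x2 + b * y2) * y1" by (simp add: algebra_simps)
  moreover have "b * (x1 * y2 - x2 * y1) = (a * x2 + b * y2) * x1 - (a * x1 + b * y1) * x2" by (simp add: algebra_simps)
  ultimately have "a * (x1 * y2 - x2 * y1) = 0" "b * (x1 * y2 - x2 * y1) = 0" using assms(2,3) by simp_all
  then show ?thesis using assms(1) by auto
qed

context rank2_point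
begin

lemma W4_expand:
  assumes P: "P \<in> W4 x" "P \<notin> V" and w: "w \<in> W4 x"
  shows "\<exists>k. \<exists>v\<in>V. w = k *s P + v"
proof -
  have "vec.dim (vec.span (insert P V)) = 4" using W4_dim[OF P(2)] by (simp add: W4_def)
  then have "W4 x = vec.span (insert P V)"
    using subspace_eq_span_insert[OF V(1) W4_subspace W4_V P] W4_dim[OF x] V(2) by simp
  then show ?thesis using w in_span_insert_subspace[OF V(1)] by blast
qed

lemma limit_of_perturbations:
  fixes P u :: V10
  assumes "\<And>\<epsilon>. \<epsilon> \<noteq> 0 \<Longrightarrow> P + \<epsilon> *s u \<in> closure A"
  shows "P \<in> closure A"
proof -
  obtain s where s: "s \<longlonglongrightarrow> 0" "\<And>n. s n \<noteq> (0 :: complex)" using small_sequence by blast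
  have "(\<lambda>n. P + s n *s u) \<longlonglongrightarrow> P + 0 *s u" by (intro tendsto_add tendsto_scale_vec tendsto_const s(1))
  then have "(\<lambda>n. P + s n *s u) \<longlonglongrightarrow> P" by simp
  then show ?thesis using assms s(2) by (intro closed_sequentially[OF closed_closure, of "\<lambda>n. P + s n *s u" A P]) auto
qed

lemma frame_kernel:
  assumes F: "frame r1 r2 g1 g2" and w: "w \<in> W4 x"
    and r: "\<sigma> w r1 r2 = 0"
    and k: "\<sigma> w g1 r1 * k1 + \<sigma> w g1 r2 * k2 = 0" "\<sigma> w g2 r1 * k1 + \<sigma> w g2 r2 * k2 = 0"
    and z: "z \<in> K x"
  shows "\<sigma> w (k1 *s r1 + k2 *s r2) z = 0"
proof (rule frame_functional[OF F functional_third _ _ _ _ _ z])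
  have K: "r1 \<in> K x" "r2 \<in> K x" using F by (auto simp: frame_def)
  then have e: "k1 *s r1 + k2 *s r2 \<in> K x" using K_subspace by (intro vec.subspace_add vec.subspace_scale) auto
  show "\<sigma> w (k1 *s r1 + k2 *s r2) u = 0" if "u \<in> W4 x" for u
    using W4_iso[OF w that e] swap23[of w u] by simp
  show "\<sigma> w (k1 *s r1 + k2 *s r2) r1 = 0" "\<sigma> w (k1 *s r1 + k2 *s r2) r2 = 0"
    using r swap23[of w r2 r1] same by (simp_all add: linear)
  have "\<sigma> w (k1 *s r1 + k2 *s r2) g = - (\<sigma> w g r1 * k1 + \<sigma> w g r2 * k2)" for g
    using swap23[of w g r1] swap23[of w g r2] by (simp add: linear)
  then show "\<sigma> w (k1 *s r1 + k2 *s r2) g1 = 0" "\<sigma> w (k1 *s r1 + k2 *s r2) g2 = 0" by (simp_all only: k minus_zero)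
qed

lemma frame_nonzero:
  assumes "frame r1 r2 g1 g2" "(k1, k2) \<noteq> (0, 0)"
  shows "k1 *s r1 + k2 *s r2 \<in> K x" "k1 *s r1 + k2 *s r2 \<notin> W4 x"
proof -
  have K: "r1 \<in> K x" "r2 \<in> K x" using assms(1) by (auto simp: frame_def)
  then show "k1 *s r1 + k2 *s r2 \<in> K x" using K_subspace by (intro vec.subspace_add vec.subspace_scale) auto
  have "k1 *s r1 + k2 *s r2 + 0 *s g1 + 0 *s g2 \<notin> W4 x" using assms unfolding frame_def by blast
  then show "k1 *s r1 + k2 *s r2 \<notin> W4 x" by simp
qed

text \<open>One vector of \<open>K x\<close> outside \<open>W4 x\<close> would be killed by the
  three-dimensional span of \<open>P\<close>, \<open>t1\<close>, \<open>t2\<close>.\<close>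

lemma kernel_contradiction:
  assumes F: "frame r1 r2 g1 g2" and P: "P \<in> W4 x" "r1 \<in> R P" "r2 \<in> R P"
    and t: "t1 \<in> W4 x" "t2 \<in> W4 x" "\<sigma> t1 r1 r2 = 0" "\<sigma> t2 r1 r2 = 0"
    and d: "vec.dim (vec.span {P, t1, t2}) = 3" and k: "(k1, k2) \<noteq> (0, 0)"
    "\<sigma> t1 g1 r1 * k1 + \<sigma> t1 g1 r2 * k2 = 0" "\<sigma> t1 g2 r1 * k1 + \<sigma> t1 g2 r2 * k2 = 0"
    "\<sigma> t2 g1 r1 * k1 + \<sigma> t2 g1 r2 * k2 = 0" "\<sigma> t2 g2 r1 * k1 + \<sigma> t2 g2 r2 * k2 = 0"
  shows False
proof (rule hyperplane_contradiction[OF frame_nonzero[OF F k(1)] vec.subspace_span _ d])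
  show "vec.span {P, t1, t2} \<subseteq> W4 x" using P t W4_subspace by (intro vec.span_minimal) auto
  fix w z assume w: "w \<in> vec.span {P, t1, t2}" and z: "z \<in> K x"
  show "\<sigma> w (k1 *s r1 + k2 *s r2) z = 0"
  proof (rule functional_span[OF functional_first w])
    fix s assume "s \<in> {P, t1, t2}"
    moreover have "\<sigma> P (k1 *s r1 + k2 *s r2) z = 0" using P(2,3) z by (simp add: R_def linear)
    moreover have "\<sigma> t1 (k1 *s r1 + k2 *s r2) z = 0" by (rule frame_kernel[OF F t(1,3) k(2,3) z])
    moreover have "\<sigma> t2 (k1 *s r1 + k2 *s r2) z = 0" by (rule frame_kernel[OF F t(2,4) k(4,5) z])
    ultimately show "\<sigma> s (k1 *s r1 + k2 *s r2) z = 0" by auto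
  qed
qed

lemma hyperplane_over_R:
  assumes P: "cone P" and e: "e \<in> K x" "e \<notin> R P"
  shows "vec.subspace (vec.span (insert e (R P)))" "W4 x \<subseteq> vec.span (insert e (R P))"
    "vec.span (insert e (R P)) \<subseteq> K x" "vec.dim (vec.span (insert e (R P))) = 7"
proof -
  show "vec.subspace (vec.span (insert e (R P)))" by simp
  have "R P \<subseteq> vec.span (insert e (R P))" using vec.span_superset[of "insert e (R P)"] by blast
  then show "W4 x \<subseteq> vec.span (insert e (R P))" using W_R P unfolding cone_def by blast
  show "vec.span (insert e (R P)) \<subseteq> K x" using e(1) R_K K_subspace by (intro vec.span_minimal) auto
  show "vec.dim (vec.span (insert e (R P))) = 7"
    using e(2) P R_subspace by (simp add: cone_def vec.dim_insert vec.span_eq_iff[THEN iffD2])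
qed

text \<open>For every \<open>g\<close> in the pencil of \<open>g1\<close> and \<open>g2\<close>,
  \<open>P\<close> vanishes on the hyperplane \<open>S\<close> spanned by \<open>g\<close> and
  \<open>R P\<close>. If none of these choices gives a limit, each \<open>S\<close> is killed by
  some vector of \<open>V\<close>, and this makes a pencil of 2 by 2 matrices singular. Either kind
  of common kernel is excluded.\<close>

lemma nonvertex_limit:
  assumes P: "cone P" "P \<notin> V" "nonvertex P"
  shows "P \<in> closure (Collect good)"
proof (rule ccontr)
  assume bad: "P \<notin> closure (Collect good)"
  have PW: "P \<in> W4 x" using P(1) by (simp add: cone_def)
  obtain r1 r2 g1 g2 where F: "frame r1 r2 g1 g2" "r1 \<in> R P" "r2 \<in> R P" "R P = vec.span ({r1, r2} \<union> W4 x)"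
    and gi: "\<And>a b. a *s g1 + b *s g2 \<in> R P \<Longrightarrow> a = 0 \<and> b = 0" and \<delta>: "\<sigma> P g1 g2 \<noteq> 0"
    and nv: "nonvertex P \<Longrightarrow> \<exists>w\<in>W4 x. \<sigma> w r1 r2 \<noteq> 0"
    using cone_frame[OF P(1)] by metis
  have K: "r1 \<in> K x" "r2 \<in> K x" "g1 \<in> K x" "g2 \<in> K x" using F(1) by (auto simp: frame_def)
  have Pr: "\<sigma> P r1 z = 0" "\<sigma> P r2 z = 0" if "z \<in> K x" for z using F(2,3) that by (auto simp: R_def)
  obtain w where w: "w \<in> W4 x" "\<sigma> w r1 r2 \<noteq> 0" using nv P(3) by blast
  obtain k v0 where v0: "v0 \<in> V" "w = k *s P + v0" using W4_expand[OF PW P(2) w(1)] by blast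
  have v0r: "\<sigma> v0 r1 r2 \<noteq> 0" using w(2) Pr(1)[OF K(2)] by (simp add: v0 linear)
  \<comment> \<open>A vector of \<open>V\<close> that vanishes on a space containing
    \<open>r1\<close> and \<open>r2\<close> lies in \<open>?T\<close>, which has dimension 2 because
    \<open>P\<close> is not a vertex.\<close>
  let ?T = "{v \<in> V. \<sigma> v r1 r2 = 0}"
  have sT: "vec.subspace ?T" by (rule subspace_kernel[OF V(1) functional_first])
  have "3 \<le> vec.dim ?T + 1" using dim_kernel[OF V(1) functional_first, of r1 r2] V(2) by simp
  moreover have "vec.dim ?T < vec.dim V"
    using v0 v0r by (intro vec.dim_psubset) (auto simp: sT V(1) vec.span_eq_iff[THEN iffD2])
  ultimately have dT: "vec.dim ?T = 2" using V(2) by simp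
  have s0: "vec.subspace {0 :: V10}" by (simp add: vec.subspace_def)
  obtain t1 t2 where t: "t1 \<in> ?T" "t2 \<in> ?T" "?T = vec.span (insert t2 (insert t1 {0}))"
    and ti: "\<And>a b. a *s t1 + b *s t2 \<in> {0} \<Longrightarrow> a = 0 \<and> b = 0"
    using extend_by_two[OF s0 sT] dT vec.subspace_0[OF sT] by auto
  have tV: "t1 \<in> V" "t2 \<in> V" "\<sigma> t1 r1 r2 = 0" "\<sigma> t2 r1 r2 = 0" using t(1,2) by auto
  have tW: "t1 \<in> W4 x" "t2 \<in> W4 x" using tV W4_V by auto
  \<comment> \<open>Some nonzero combination of \<open>t1\<close> and \<open>t2\<close> kills both
    pairs formed by \<open>?g\<close> with \<open>r1\<close> and with \<open>r2\<close>, so the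
    matrix of these four values is singular.\<close>
  have det: "(\<alpha> * \<sigma> t1 g1 r1 + \<beta> * \<sigma> t1 g2 r1) * (\<alpha> * \<sigma> t2 g1 r2 + \<beta> * \<sigma> t2 g2 r2) =
      (\<alpha> * \<sigma> t1 g1 r2 + \<beta> * \<sigma> t1 g2 r2) * (\<alpha> * \<sigma> t2 g1 r1 + \<beta> * \<sigma> t2 g2 r1)" if \<alpha>: "(\<alpha>, \<beta>) \<noteq> (0, 0)" for \<alpha> \<beta>
  proof -
    let ?g = "\<alpha> *s g1 + \<beta> *s g2"
    let ?S = "vec.span (insert ?g (R P))"
    have gK: "?g \<in> K x" using K K_subspace by (intro vec.subspace_add vec.subspace_scale) auto
    have gR: "?g \<notin> R P" using gi \<alpha> by blast
    have Piso: "\<sigma> P a b = 0" if ab: "a \<in> ?S" "b \<in> ?S" for a b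
    proof (rule span_isotropic[OF _ ab])
      fix a b assume "a \<in> insert ?g (R P)" "b \<in> insert ?g (R P)"
      then show "\<sigma> P a b = 0" using gK R_K swap23[of P b a] same by (auto simp: R_def)
    qed
    obtain v where v: "v \<in> V" "\<And>a b. a \<in> ?S \<Longrightarrow> b \<in> ?S \<Longrightarrow> \<sigma> v a b = 0" "v \<noteq> 0"
      using cone_limit_core[OF PW P(2) hyperplane_over_R[OF P(1) gK gR] Piso] bad by blast
    have inS: "?g \<in> ?S" "r1 \<in> ?S" "r2 \<in> ?S" using F(2,3) by (auto intro: vec.span_base)
    have "v \<in> ?T" using v(1) v(2)[OF inS(2,3)] by simp
    then obtain a b where ab: "v = b *s t2 + a *s t1"
      unfolding t(3) by (auto simp: in_span_insert)
    have ab0: "(a, b) \<noteq> (0, 0)" using v(3) ab by auto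
    show ?thesis
      by (rule kernel_2x2[OF ab0]) (use v(2)[OF inS(1,2)] v(2)[OF inS(1,3)] in \<open>simp_all add: ab linear algebra_simps\<close>)
  qed
  let ?x = "\<lambda>g r. \<sigma> t1 g r" and ?y = "\<lambda>g r. \<sigma> t2 g r"
  have p1: "?x g1 r1 * ?y g1 r2 = ?x g1 r2 * ?y g1 r1" using det[of 1 0] by simp
  have p2: "?x g2 r1 * ?y g2 r2 = ?x g2 r2 * ?y g2 r1" using det[of 0 1] by simp
  have p3: "?x g1 r1 * ?y g2 r2 + ?x g2 r1 * ?y g1 r2 = ?x g1 r2 * ?y g2 r1 + ?x g2 r2 * ?y g1 r1"
    using det[of 1 1] p1 p2 by (simp add: algebra_simps)
  from p1 p2 p3 show False
  proof (rule degenerate_pencil)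
    fix a b assume ab: "(a, b) \<noteq> (0, 0)" and 0: "a * ?x g1 r1 + b * ?y g1 r1 = 0" "a * ?x g1 r2 + b * ?y g1 r2 = 0"
      "a * ?x g2 r1 + b * ?y g2 r1 = 0" "a * ?x g2 r2 + b * ?y g2 r2 = 0"
    define u where "u = a *s t1 + b *s t2"
    have u0: "u \<noteq> 0" using ti ab by (auto simp: u_def)
    have uV: "u \<in> V" unfolding u_def using tV by (intro V_add V_scale)
    \<comment> \<open>All entries of \<open>\<sigma> u\<close> in the frame vanish except the one at
      \<open>g1\<close>, \<open>g2\<close>; subtracting this multiple of \<open>P\<close> removes it
      as well.\<close>
    define \<gamma> where "\<gamma> = \<sigma> u g1 g2 / \<sigma> P g1 g2"
    have u'W: "u - \<gamma> *s P \<in> W4 x" using uV W4_V PW by (intro vec.subspace_diff vec.subspace_scale W4_subspace) auto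
    have u'0: "u - \<gamma> *s P \<noteq> 0"
    proof
      assume e: "u - \<gamma> *s P = 0"
      then have "\<gamma> \<noteq> 0" using u0 by auto
      moreover have "\<gamma> *s P \<in> V" using e uV by simp
      ultimately show False using V_scale_iff P(2) by blast
    qed
    have "\<sigma> (u - \<gamma> *s P) y z = 0" if "y \<in> K x" "z \<in> K x" for y z
    proof (rule frame_isotropic[OF F(1) u'W _ _ _ _ _ _ that])
      have sw: "\<sigma> t g r = - \<sigma> t r g" for t g r by (rule swap23)
      have ur: "\<sigma> u r1 g1 = 0" "\<sigma> u r1 g2 = 0" "\<sigma> u r2 g1 = 0" "\<sigma> u r2 g2 = 0"
        using 0 unfolding sw[of u r1] sw[of u r2] by (simp_all add: u_def linear)
      then show "\<sigma> (u - \<gamma> *s P) r1 g1 = 0" "\<sigma> (u - \<gamma> *s P) r1 g2 = 0" "\<sigma> (u - \<gamma> *s P) r2 g1 = 0"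
        "\<sigma> (u - \<gamma> *s P) r2 g2 = 0" using Pr K by (simp_all add: linear)
      show "\<sigma> (u - \<gamma> *s P) r1 r2 = 0" using Pr K tV by (simp add: u_def linear)
      show "\<sigma> (u - \<gamma> *s P) g1 g2 = 0" using \<delta> by (simp add: linear \<gamma>_def)
    qed
    then show False using R_not_all[OF u'W u'0] by blast
  next
    fix k1 k2 assume k: "(k1, k2) \<noteq> (0, 0)" and 0: "?x g1 r1 * k1 + ?x g1 r2 * k2 = 0" "?x g2 r1 * k1 + ?x g2 r2 * k2 = 0"
      "?y g1 r1 * k1 + ?y g1 r2 * k2 = 0" "?y g2 r1 * k1 + ?y g2 r2 * k2 = 0"
    have "vec.dim (vec.span {P, t1, t2}) = 3"
    proof (rule span3_dim)
      fix a b c assume e: "a *s P + b *s t1 + c *s t2 = 0"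
      have "a *s P = (a *s P + b *s t1 + c *s t2) - (b *s t1 + c *s t2)" by simp
      then have "a *s P = - (b *s t1 + c *s t2)" unfolding e by simp
      also have "\<dots> = (- b) *s t1 + (- c) *s t2" by (simp add: vec.scale_minus_left)
      also have "\<dots> \<in> V" using tV by (intro V_add V_scale)
      finally have "a = 0" using V_scale_iff P(2) by blast
      then show "a = 0 \<and> b = 0 \<and> c = 0" using e ti by auto
    qed
    then show False by (rule kernel_contradiction[OF F(1) PW F(2,3) tW tV(3,4) _ k 0])
  qed
qed

text \<open>At a vertex all forms from \<open>W4 x\<close> vanish on \<open>R P\<close>. A
  \<open>u\<close> is chosen for which some \<open>e\<close> in \<open>R P\<close> is killed by
  \<open>u\<close> too; then \<open>e\<close> lies in \<open>R (P + \<epsilon> *s u)\<close> and the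
  whole line stays on the quadric. A second vertex on it would either make a combination of
  \<open>u\<close> and \<open>P\<close> vanish on \<open>K x\<close>, or enlarge \<open>R P\<close>
  to a forbidden flag through \<open>e\<close>.\<close>

lemma vertex_perturbation:
  assumes P: "cone P" "\<not> nonvertex P"
  shows "\<exists>u\<in>V. \<forall>\<epsilon>. \<epsilon> \<noteq> 0 \<longrightarrow> cone (P + \<epsilon> *s u) \<and> nonvertex (P + \<epsilon> *s u)"
proof -
  have PW: "P \<in> W4 x" "P \<noteq> 0" and dP: "vec.dim (R P) = 6" using P(1) by (auto simp: cone_def)
  obtain r1 r2 g1 g2 where F: "frame r1 r2 g1 g2" "r1 \<in> R P" "r2 \<in> R P" "R P = vec.span ({r1, r2} \<union> W4 x)"
    and \<delta>: "\<sigma> P g1 g2 \<noteq> 0"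
    using cone_frame[OF P(1)] by metis
  have K: "r1 \<in> K x" "r2 \<in> K x" "g1 \<in> K x" "g2 \<in> K x" using F(1) by (auto simp: frame_def)
  have Pr: "\<sigma> P r z = 0" if "r \<in> R P" "z \<in> K x" for r z using that by (auto simp: R_def)
  have nvP: "\<sigma> w r r' = 0" if "w \<in> W4 x" "r \<in> R P" "r' \<in> R P" for w r r'
    using P(2) that unfolding nonvertex_def by blast
  obtain u1 u2 where u12: "u1 \<in> V" "u2 \<in> V" "\<And>a b. a *s u1 + b *s u2 \<in> vec.span {P} \<Longrightarrow> a = 0 \<and> b = 0"
  proof (cases "P \<in> V")
    case True
    have "vec.dim V = vec.dim (vec.span {P}) + 2" using V(2) PW(2) by simp
    from extend_by_two[OF vec.subspace_span V(1) span_singleton_V[OF True] this] show ?thesis using that by blast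
  next
    case False
    have "vec.dim V = vec.dim (vec.span {c}) + 2" using V(2) c(2) by simp
    from extend_by_two[OF vec.subspace_span V(1) span_singleton_V[OF c(1)] this]
    obtain u1 u2 where u: "u1 \<in> V" "u2 \<in> V" "\<And>a b. a *s u1 + b *s u2 \<in> vec.span {c} \<Longrightarrow> a = 0 \<and> b = 0" by blast
    show ?thesis
    proof (rule that[OF u(1,2)])
      fix a b assume "a *s u1 + b *s u2 \<in> vec.span {P}"
      then obtain k where k: "a *s u1 + b *s u2 = k *s P" by (auto simp: vec.span_singleton)
      have "k *s P \<in> V" unfolding k[symmetric] using u by (intro V_add V_scale)
      then have "k = 0" using V_scale_iff False by blast
      then show "a = 0 \<and> b = 0" using k by (intro u(3)) (simp add: vec.span_zero)
    qed
  qed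
  \<comment> \<open>The determinant of \<open>\<sigma> u\<close> between \<open>g1\<close>,
    \<open>g2\<close> and \<open>r1\<close>, \<open>r2\<close> is quadratic in \<open>u\<close>, so
    it has a zero in any pencil.\<close>
  let ?d = "\<lambda>u w. \<sigma> u g1 r1 * \<sigma> w g2 r2 - \<sigma> u g1 r2 * \<sigma> w g2 r1"
  obtain a b where ab: "(a, b) \<noteq> (0, 0)" "?d u1 u1 * a\<^sup>2 + (?d u1 u2 + ?d u2 u1) * (a * b) + ?d u2 u2 * b\<^sup>2 = 0"
    using binary_quadratic_root by blast
  define u where "u = a *s u1 + b *s u2"
  have uV: "u \<in> V" unfolding u_def using u12 by (intro V_add V_scale)
  have uW: "u \<in> W4 x" using uV W4_V by blast
  have uP: "u \<notin> vec.span {P}" using u12(3) ab(1) by (auto simp: u_def)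
  have "?d u u = 0" using ab(2) by (simp add: u_def linear power2_eq_square algebra_simps)
  then have "\<sigma> u g1 r1 * \<sigma> u g2 r2 = \<sigma> u g1 r2 * \<sigma> u g2 r1" by simp
  then obtain k1 k2 where k: "(k1, k2) \<noteq> (0, 0)" "\<sigma> u g1 r1 * k1 + \<sigma> u g1 r2 * k2 = 0" "\<sigma> u g2 r1 * k1 + \<sigma> u g2 r2 * k2 = 0"
    using singular_2x2 by blast
  define e where "e = k1 *s r1 + k2 *s r2"
  have eK: "e \<in> K x" "e \<notin> W4 x" using frame_nonzero[OF F(1) k(1)] by (simp_all add: e_def)
  have eR: "e \<in> R P" unfolding e_def using F(2,3) R_subspace by (intro vec.subspace_add vec.subspace_scale) auto
  have ue: "\<sigma> u e z = 0" if "z \<in> K x" for z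
    unfolding e_def by (rule frame_kernel[OF F(1) uW nvP[OF uW F(2,3)] k(2,3) that])
  have "cone (P + \<epsilon> *s u) \<and> nonvertex (P + \<epsilon> *s u)" if \<epsilon>: "\<epsilon> \<noteq> 0" for \<epsilon>
  proof -
    let ?Q = "P + \<epsilon> *s u"
    have QW: "?Q \<in> W4 x" using PW uW W4_subspace by (intro vec.subspace_add vec.subspace_scale) auto
    have Q0: "?Q \<noteq> 0"
    proof
      assume "?Q = 0"
      then have "\<epsilon> *s u \<in> vec.span {P}"
        by (metis add.commute add_eq_0_iff vec.span_neg vec.span_base singletonI)
      then have "(1 / \<epsilon>) *s (\<epsilon> *s u) \<in> vec.span {P}" by (rule vec.span_scale)
      then show False using uP \<epsilon> by simp
    qed
    have eQ: "e \<in> R ?Q" using eK(1) Pr[OF eR] ue by (auto simp: R_def linear)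
    have cQ: "cone ?Q" by (rule coneI[OF QW Q0 eQ eK(2)])
    have "nonvertex ?Q"
    proof (rule ccontr)
      assume "\<not> ?thesis"
      then have nvQ: "\<sigma> w r r' = 0" if "w \<in> W4 x" "r \<in> R ?Q" "r' \<in> R ?Q" for w r r'
        using that unfolding nonvertex_def by blast
      show False
      proof (cases "R ?Q \<subseteq> R P")
        case True
        then have "R ?Q = R P" using cQ dP by (intro vec.subspace_dim_equal R_subspace) (simp_all add: cone_def)
        then have Q0': "\<sigma> ?Q r z = 0" if "r \<in> R P" "z \<in> K x" for r z using that by (auto simp: R_def)
        then have ur: "\<sigma> u r z = 0" if "r \<in> R P" "z \<in> K x" for r z
        proof -
          have "\<sigma> P r z + \<epsilon> * \<sigma> u r z = 0" using Q0'[OF that] by (simp add: linear)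
          then show ?thesis using Pr[OF that] \<epsilon> by simp
        qed
        define \<gamma> where "\<gamma> = \<sigma> u g1 g2 / \<sigma> P g1 g2"
        have W: "u - \<gamma> *s P \<in> W4 x" using uW PW by (intro vec.subspace_diff vec.subspace_scale W4_subspace) auto
        have "u - \<gamma> *s P \<noteq> 0" using uP by (auto simp: vec.span_singleton)
        then obtain y z where yz: "y \<in> K x" "z \<in> K x" "\<sigma> (u - \<gamma> *s P) y z \<noteq> 0" using R_not_all[OF W] by blast
        have "\<sigma> (u - \<gamma> *s P) y z = 0"
          by (rule frame_isotropic[OF F(1) W _ _ _ _ _ _ yz(1,2)])
            (use Pr F(2,3) K ur \<delta> in \<open>simp_all add: linear \<gamma>_def\<close>)
        then show False using yz by blast
      next
        case False
        then obtain n where n: "n \<in> R ?Q" "n \<notin> R P" by blast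
        have nK: "n \<in> K x" using n(1) R_K by blast
        note T = hyperplane_over_R[OF P(1) nK n(2)]
        show False
        proof (rule flag_contradiction[OF eK T(1) _ T(4,3)])
          show "insert e (W4 x) \<subseteq> vec.span (insert n (R P))" using T(2) eR by (auto intro: vec.span_base)
          fix w z assume w: "w \<in> W4 x" and "z \<in> vec.span (insert n (R P))"
          then obtain k r where "r \<in> R P" "z = k *s n + r" using in_span_insert_subspace[OF R_subspace] by blast
          then show "\<sigma> w e z = 0" using nvP[OF w eR] nvQ[OF w eQ n(1)] by (simp add: linear)
        qed
      qed
    qed
    with cQ show ?thesis by blast
  qed
  then show ?thesis using uV by blast
qed

lemma cone_limit:
  assumes P: "cone P" "P \<notin> V"
  shows "P \<in> closure (Collect good)"
proof (cases "nonvertex P")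
  case True
  then show ?thesis using nonvertex_limit P by blast
next
  case False
  obtain u where u: "u \<in> V" "\<And>\<epsilon>. \<epsilon> \<noteq> 0 \<Longrightarrow> cone (P + \<epsilon> *s u) \<and> nonvertex (P + \<epsilon> *s u)"
    using vertex_perturbation[OF P(1) False] by blast
  have "P + \<epsilon> *s u \<notin> V" for \<epsilon>
  proof
    assume "P + \<epsilon> *s u \<in> V"
    then have "P + \<epsilon> *s u - \<epsilon> *s u \<in> V" using V_scale[OF u(1)] by (rule vec.subspace_diff[OF V(1)])
    then show False using P(2) by simp
  qed
  then show ?thesis using limit_of_perturbations[of P u] nonvertex_limit u(2) by blast
qed

lemma outside_W4:
  assumes "w \<in> W4 x" "functional \<phi>" "\<phi> w \<noteq> 0"
  shows "\<exists>w'\<in>W4 x. w' \<notin> V \<and> \<phi> w' \<noteq> 0"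
proof (cases "w \<in> V")
  case False
  then show ?thesis using assms by blast
next
  case w: True
  show ?thesis
  proof (cases "\<phi> x = 0")
    case False
    then show ?thesis using x W4_self by blast
  next
    case True
    have "w + x \<notin> V"
    proof
      assume "w + x \<in> V"
      then have "(w + x) - w \<in> V" using w by (rule vec.subspace_diff[OF V(1)])
      then show False using x by simp
    qed
    moreover have "w + x \<in> W4 x" by (rule vec.subspace_add[OF W4_subspace assms(1) W4_self])
    moreover have "\<phi> (w + x) \<noteq> 0" using True assms(3) by (simp add: functional_simps[OF assms(2)])
    ultimately show ?thesis by blast
  qed
qed

text \<open>The tangent plane of the quadric at \<open>v\<close>, given by
  \<open>\<sigma> \<rho> r1 r2 = 0\<close>, does not lie inside the quadric. Otherwise the 2 by 2
  matrices of its elements are all singular; with fixed rows and columns exchanged, the pencil lemma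
  yields a vector \<open>g\<close> or a combination of \<open>r1\<close> and \<open>r2\<close> that
  is killed too often.\<close>

lemma nonvertex_V_regular:
  assumes v: "cone v" "v \<in> V" and F: "frame r1 r2 g1 g2" "r1 \<in> R v" "r2 \<in> R v" "R v = vec.span ({r1, r2} \<union> W4 x)"
    and gi: "\<And>a b. a *s g1 + b *s g2 \<in> R v \<Longrightarrow> a = 0 \<and> b = 0"
    and w4: "w4 \<in> W4 x" "\<sigma> w4 r1 r2 \<noteq> 0"
  shows "\<exists>\<rho>\<in>W4 x. \<sigma> \<rho> r1 r2 = 0 \<and> \<sigma> \<rho> g1 r1 * \<sigma> \<rho> g2 r2 \<noteq> \<sigma> \<rho> g1 r2 * \<sigma> \<rho> g2 r1"
proof (rule ccontr)
  assume "\<not> ?thesis"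
  then have sing: "\<sigma> t g1 r1 * \<sigma> t g2 r2 = \<sigma> t g1 r2 * \<sigma> t g2 r1" if "t \<in> W4 x" "\<sigma> t r1 r2 = 0" for t
    using that by blast
  have vW: "v \<in> W4 x" "v \<noteq> 0" using v(1) by (auto simp: cone_def)
  have K: "r1 \<in> K x" "r2 \<in> K x" "g1 \<in> K x" "g2 \<in> K x" using F(1) by (auto simp: frame_def)
  have vr: "\<sigma> v r1 z = 0" "\<sigma> v r2 z = 0" if "z \<in> K x" for z using F(2,3) that by (auto simp: R_def)
  let ?T = "{w \<in> W4 x. \<sigma> w r1 r2 = 0}"
  have sT: "vec.subspace ?T" by (rule subspace_kernel[OF W4_subspace functional_first])
  have "4 \<le> vec.dim ?T + 1" using dim_kernel[OF W4_subspace functional_first, of x r1 r2] W4_dim[OF x] by simp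
  moreover have "vec.dim ?T < vec.dim (W4 x)"
    using w4 by (intro vec.dim_psubset) (auto simp: sT W4_subspace vec.span_eq_iff[THEN iffD2])
  ultimately have dT: "vec.dim ?T = 3" using W4_dim[OF x] by simp
  have vT: "v \<in> ?T" using vW vr(1)[OF K(2)] by simp
  have "vec.span {v} \<subseteq> ?T" using vT sT by (intro vec.span_minimal) auto
  moreover have "vec.dim ?T = vec.dim (vec.span {v}) + 2" using dT vW(2) by simp
  ultimately obtain t1 t2 where t: "t1 \<in> ?T" "t2 \<in> ?T" "?T = vec.span (insert t2 (insert t1 (vec.span {v})))"
    and ti: "\<And>a b. a *s t1 + b *s t2 \<in> vec.span {v} \<Longrightarrow> a = 0 \<and> b = 0"
    using extend_by_two[OF vec.subspace_span sT] by blast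
  have tW: "t1 \<in> W4 x" "t2 \<in> W4 x" "\<sigma> t1 r1 r2 = 0" "\<sigma> t2 r1 r2 = 0" using t by auto
  have T: "?T = vec.span {v, t1, t2}"
  proof
    have "vec.span {v} \<subseteq> vec.span {v, t1, t2}" by (intro vec.span_mono) auto
    then show "?T \<subseteq> vec.span {v, t1, t2}" unfolding t(3) by (intro vec.span_minimal) (auto intro: vec.span_base)
    show "vec.span {v, t1, t2} \<subseteq> ?T" using vT t(1,2) sT by (intro vec.span_minimal) auto
  qed
  let ?x = "\<lambda>g r. \<sigma> t1 g r" and ?y = "\<lambda>g r. \<sigma> t2 g r"
  have p1: "?x g1 r1 * ?x g2 r2 = ?x g1 r2 * ?x g2 r1" by (rule sing[OF tW(1,3)])
  have p2: "?y g1 r1 * ?y g2 r2 = ?y g1 r2 * ?y g2 r1" by (rule sing[OF tW(2,4)])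
  have "t1 + t2 \<in> W4 x" using tW W4_subspace by (intro vec.subspace_add) auto
  then have p3: "?x g1 r1 * ?y g2 r2 + ?y g1 r1 * ?x g2 r2 = ?x g1 r2 * ?y g2 r1 + ?y g1 r2 * ?x g2 r1"
    using sing[of "t1 + t2"] tW p1 p2 by (simp add: linear algebra_simps)
  from p1 p2 p3 show False
  proof (rule degenerate_pencil)
    fix a b assume ab: "(a, b) \<noteq> (0, 0)" and 0: "a * ?x g1 r1 + b * ?x g2 r1 = 0" "a * ?x g1 r2 + b * ?x g2 r2 = 0"
      "a * ?y g1 r1 + b * ?y g2 r1 = 0" "a * ?y g1 r2 + b * ?y g2 r2 = 0"
    define g where "g = a *s g1 + b *s g2"
    have gK: "g \<in> K x" unfolding g_def using K K_subspace by (intro vec.subspace_add vec.subspace_scale) auto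
    have gR: "g \<notin> R v" using gi ab by (auto simp: g_def)
    have vg: "\<sigma> v g r1 = 0" "\<sigma> v g r2 = 0" using vr[OF gK] swap23[of v r1 g] swap23[of v r2 g] by simp_all
    have gT: "\<sigma> w g r1 = 0" "\<sigma> w g r2 = 0" if "w \<in> ?T" for w
    proof -
      have "\<sigma> s g r1 = 0 \<and> \<sigma> s g r2 = 0" if "s \<in> {v, t1, t2}" for s
        using that 0 vg by (auto simp: g_def linear)
      then show "\<sigma> w g r1 = 0" "\<sigma> w g r2 = 0"
        using functional_span[OF functional_first, of w "{v, t1, t2}" g r1]
          functional_span[OF functional_first, of w "{v, t1, t2}" g r2] \<open>w \<in> ?T\<close> unfolding T by auto
    qed
    \<comment> \<open>The multiples of \<open>r1\<close> and \<open>r2\<close> are chosen to cancel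
      \<open>\<sigma> w4 g r1\<close> and \<open>\<sigma> w4 g r2\<close>; on \<open>?T\<close> they
      change nothing, because there \<open>r1\<close> and \<open>r2\<close> are orthogonal.\<close>
    define e where "e = g + (- \<sigma> w4 g r2 / \<sigma> w4 r1 r2) *s r1 + (\<sigma> w4 g r1 / \<sigma> w4 r1 r2) *s r2"
    have eK: "e \<in> K x" unfolding e_def using gK K K_subspace by (intro vec.subspace_add vec.subspace_scale) auto
    have eR: "e \<notin> R v"
    proof
      assume "e \<in> R v"
      then have "e - (\<sigma> w4 g r1 / \<sigma> w4 r1 r2) *s r2 - (- \<sigma> w4 g r2 / \<sigma> w4 r1 r2) *s r1 \<in> R v"
        using F(2,3) by (intro vec.subspace_diff vec.subspace_scale R_subspace)
      then show False using gR by (simp add: e_def)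
    qed
    have eW: "e \<notin> W4 x" using eR W_R[OF vW(1)] by blast
    have w4e: "\<sigma> w4 e r1 = 0" "\<sigma> w4 e r2 = 0"
      using w4(2) swap23[of w4 r2 r1] same by (simp_all add: e_def linear)
    have W: "W4 x = vec.span (insert w4 ?T)"
      using w4 dT W4_dim[OF x] by (intro subspace_eq_span_insert[OF sT W4_subspace]) auto
    have er: "\<sigma> w e r1 = 0" "\<sigma> w e r2 = 0" if w: "w \<in> W4 x" for w
    proof -
      obtain k s where s: "s \<in> ?T" "w = k *s w4 + s" using w W in_span_insert_subspace[OF sT] by blast
      have "\<sigma> s e r1 = 0" "\<sigma> s e r2 = 0" using gT[OF s(1)] s(1) swap23[of s r2 r1] same by (simp_all add: e_def linear)
      then show "\<sigma> w e r1 = 0" "\<sigma> w e r2 = 0" using w4e by (simp_all add: s linear)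
    qed
    note S = hyperplane_over_R[OF v(1) eK eR]
    show False
    proof (rule flag_contradiction[OF eK eW S(1) _ S(4,3)])
      show "insert e (W4 x) \<subseteq> vec.span (insert e (R v))" using S(2) by (auto intro: vec.span_base)
      fix w z assume w: "w \<in> W4 x" and "z \<in> vec.span (insert e (R v))"
      then obtain k r where r: "r \<in> R v" "z = k *s e + r" using in_span_insert_subspace[OF R_subspace] by blast
      have "\<sigma> w e r = 0"
      proof (rule functional_span[OF functional_third])
        show "r \<in> vec.span ({r1, r2} \<union> W4 x)" using r(1) F(4) by simp
        fix s assume "s \<in> {r1, r2} \<union> W4 x"
        then show "\<sigma> w e s = 0" using er[OF w] W4_iso[OF w _ eK] swap23[of w e s] by auto
      qed
      then show "\<sigma> w e z = 0" using r same by (simp add: linear)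
    qed
  next
    fix k1 k2 assume k: "(k1, k2) \<noteq> (0, 0)" and 0: "?x g1 r1 * k1 + ?x g1 r2 * k2 = 0"
      "?y g1 r1 * k1 + ?y g1 r2 * k2 = 0" "?x g2 r1 * k1 + ?x g2 r2 * k2 = 0" "?y g2 r1 * k1 + ?y g2 r2 * k2 = 0"
    have "vec.dim (vec.span {v, t1, t2}) = 3" using dT T by simp
    then show False by (rule kernel_contradiction[OF F(1) vW(1) F(2,3) tW(1,2,3,4) _ k 0(1,3,2,4)])
  qed
qed

text \<open>\<open>cone_limit\<close> handles points of the quadric outside \<open>V\<close>, so
  \<open>v\<close> is approached by such points. A line through \<open>v\<close> meets the quadric
  once more, and this second point tends to \<open>v\<close> when the direction tends to a tangent
  direction that is not on the quadric. Admixing \<open>\<rho>1\<close> keeps the directions away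
  from the tangent plane and from \<open>V\<close>.\<close>

lemma nonvertex_V_limit:
  assumes v: "cone v" "v \<in> V" "nonvertex v"
  shows "v \<in> closure (Collect good)"
proof -
  have vW: "v \<in> W4 x" "v \<noteq> 0" using v(1) by (auto simp: cone_def)
  obtain r1 r2 g1 g2 where F: "frame r1 r2 g1 g2" "r1 \<in> R v" "r2 \<in> R v" "R v = vec.span ({r1, r2} \<union> W4 x)"
    and gi: "\<And>a b. a *s g1 + b *s g2 \<in> R v \<Longrightarrow> a = 0 \<and> b = 0" and \<delta>: "\<sigma> v g1 g2 \<noteq> 0"
    and nv: "nonvertex v \<Longrightarrow> \<exists>w\<in>W4 x. \<sigma> w r1 r2 \<noteq> 0"
    using cone_frame[OF v(1)] by metis
  have K: "r1 \<in> K x" "r2 \<in> K x" "g1 \<in> K x" "g2 \<in> K x" using F(1) by (auto simp: frame_def)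
  have vr: "\<sigma> v r1 z = 0" "\<sigma> v r2 z = 0" if "z \<in> K x" for z using F(2,3) that by (auto simp: R_def)
  obtain w where w: "w \<in> W4 x" "\<sigma> w r1 r2 \<noteq> 0" using nv v(3) by blast
  obtain \<rho>1 where \<rho>1: "\<rho>1 \<in> W4 x" "\<rho>1 \<notin> V" "\<sigma> \<rho>1 r1 r2 \<noteq> 0" using outside_W4[OF w(1) functional_first w(2)] by blast
  obtain \<rho>' where \<rho>': "\<rho>' \<in> W4 x" "\<sigma> \<rho>' r1 r2 = 0" "\<sigma> \<rho>' g1 r1 * \<sigma> \<rho>' g2 r2 \<noteq> \<sigma> \<rho>' g1 r2 * \<sigma> \<rho>' g2 r1"
    using nonvertex_V_regular[OF v(1,2) F gi w] by blast
  let ?pf = "pf r1 r2 g1 g2"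
  have pf': "?pf w = \<sigma> w r1 r2 * \<sigma> w g1 g2 - (\<sigma> w g1 r1 * \<sigma> w g2 r2 - \<sigma> w g1 r2 * \<sigma> w g2 r1)" for w
    using swap23[of w g1 r1] swap23[of w g2 r2] swap23[of w g1 r2] swap23[of w g2 r1] by (simp add: pf_def)
  obtain s where s: "s \<longlonglongrightarrow> 0" "\<And>n. s n \<noteq> (0 :: complex)" using small_sequence by blast
  define \<rho> where "\<rho> n = \<rho>' + s n *s \<rho>1" for n
  have "\<rho> \<longlonglongrightarrow> \<rho>' + 0 *s \<rho>1" unfolding \<rho>_def[abs_def] by (intro tendsto_add tendsto_scale_vec tendsto_const s(1))
  then have \<rho>: "\<rho> \<longlonglongrightarrow> \<rho>'" by simp
  have "(\<lambda>n. ?pf (\<rho> n)) \<longlonglongrightarrow> ?pf \<rho>'"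
    unfolding pf_def by (intro tendsto_add tendsto_diff tendsto_mult tendsto_form \<rho> tendsto_const)
  moreover have pf0: "?pf \<rho>' \<noteq> 0" using \<rho>' by (simp add: pf')
  ultimately have evpf: "\<forall>\<^sub>F n in sequentially. ?pf (\<rho> n) \<noteq> 0" and pfl: "(\<lambda>n. ?pf (\<rho> n)) \<longlonglongrightarrow> ?pf \<rho>'"
    using tendsto_imp_eventually_ne by blast+
  have evV: "\<forall>\<^sub>F n in sequentially. \<rho> n \<notin> V"
  proof (cases "\<rho>' \<in> V")
    case True
    have "\<rho> n \<notin> V" for n
    proof
      assume "\<rho> n \<in> V"
      then have "\<rho> n - \<rho>' \<in> V" using True by (rule vec.subspace_diff[OF V(1)])
      then show False using V_scale_iff[OF s(2)] \<rho>1(2) by (simp add: \<rho>_def)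
    qed
    then show ?thesis by simp
  next
    case False
    then have "\<forall>\<^sub>F n in sequentially. \<rho> n \<in> - V"
      using V_closed by (intro topological_tendstoD[OF \<rho>]) auto
    then show ?thesis by simp
  qed
  \<comment> \<open>The second root: the Pfaffian of \<open>v - q *s \<rho>\<close> is
    \<open>q\<close> times \<open>q * pf \<rho>\<close> minus
    \<open>\<sigma> \<rho> r1 r2 * \<sigma> v g1 g2\<close>.\<close>
  define q where "q n = s n * \<sigma> \<rho>1 r1 r2 * \<sigma> v g1 g2 / ?pf (\<rho> n)" for n
  have "q \<longlonglongrightarrow> 0 * \<sigma> \<rho>1 r1 r2 * \<sigma> v g1 g2 / ?pf \<rho>'"
    unfolding q_def[abs_def] by (intro tendsto_divide tendsto_mult s(1) tendsto_const pfl pf0)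
  then have "(\<lambda>n. v - q n *s \<rho> n) \<longlonglongrightarrow> v - 0 *s \<rho>'"
    by (intro tendsto_diff tendsto_scale_vec tendsto_const \<rho>) simp
  then have lim: "(\<lambda>n. v - q n *s \<rho> n) \<longlonglongrightarrow> v" by simp
  have "\<forall>\<^sub>F n in sequentially. v - q n *s \<rho> n \<in> closure (Collect good)"
    using evpf evV
  proof eventually_elim
    case (elim n)
    let ?p = "v - q n *s \<rho> n"
    have \<rho>W: "\<rho> n \<in> W4 x" unfolding \<rho>_def using \<rho>' \<rho>1 W4_subspace by (intro vec.subspace_add vec.subspace_scale) auto
    have q0: "q n \<noteq> 0" using s(2) \<rho>1(3) \<delta> elim(1) by (simp add: q_def)
    have pV: "?p \<notin> V"
    proof
      assume "?p \<in> V"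
      then have "v - ?p \<in> V" by (rule vec.subspace_diff[OF V(1) v(2)])
      then show False using V_scale_iff[OF q0] elim(2) by simp
    qed
    have pW: "?p \<in> W4 x" using vW \<rho>W W4_subspace by (intro vec.subspace_diff vec.subspace_scale) auto
    have vr': "\<sigma> v g r1 = 0" "\<sigma> v g r2 = 0" if "g \<in> K x" for g
      using vr[OF that] swap23[of v r1 g] swap23[of v r2 g] by simp_all
    have "\<sigma> (\<rho> n) r1 r2 = s n * \<sigma> \<rho>1 r1 r2" using \<rho>'(2) by (simp add: \<rho>_def linear)
    then have key: "q n * ?pf (\<rho> n) = \<sigma> (\<rho> n) r1 r2 * \<sigma> v g1 g2" using elim(1) by (simp add: q_def)
    have "?pf ?p = q n * (q n * ?pf (\<rho> n) - \<sigma> (\<rho> n) r1 r2 * \<sigma> v g1 g2)"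
      using vr(1)[OF K(2)] vr'[OF K(3)] vr'[OF K(4)] by (simp add: pf' linear algebra_simps)
    then have "?pf ?p = 0" by (simp add: key)
    moreover have "?p \<noteq> 0" using pV V_zero by auto
    ultimately have "cone ?p" using pf_cone[OF F(1) pW] by blast
    then show ?case using cone_limit pV by blast
  qed
  then show ?thesis by (rule Lim_in_closed_set[OF closed_closure _ _ lim]) simp
qed

lemma cone_V_limit:
  assumes v: "cone v" "v \<in> V"
  shows "v \<in> closure (Collect good)"
proof (cases "nonvertex v")
  case True
  then show ?thesis using nonvertex_V_limit v by blast
next
  case False
  obtain u where u: "u \<in> V" "\<And>\<epsilon>. \<epsilon> \<noteq> 0 \<Longrightarrow> cone (v + \<epsilon> *s u) \<and> nonvertex (v + \<epsilon> *s u)"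
    using vertex_perturbation[OF v(1) False] by blast
  have "v + \<epsilon> *s u \<in> V" for \<epsilon> using v(2) u(1) by (intro V_add V_scale)
  then show ?thesis using limit_of_perturbations[of v u] nonvertex_V_limit u(2) by blast
qed

end

section \<open>Density of the good points in the Peskine variety\<close>

context general_trivector
begin

text \<open>The point lies on its own quadric. Its radical cannot be contained in
  \<open>W4 p\<close>: it would equal it, and then all of \<open>V\<close> would kill
  \<open>p\<close>, whereas only one dimension of \<open>V\<close> can.\<close>

lemma rank2_limit:
  assumes p: "inX p" "p \<notin> V" "vec.dim (K p) = 8"
  shows "p \<in> closure (Collect good)"
proof -
  have "0 < vec.dim {v \<in> V. \<forall>z. \<sigma> v p z = 0}" using p(3) dim_K[of p] by simp
  then obtain c where c: "c \<in> V" "c \<noteq> 0" "\<And>z. \<sigma> c p z = 0" using subspace_nontrivial by blast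
  interpret rank2_point \<sigma> V p c by unfold_locales (use p c in auto)
  have "\<not> rad p \<subseteq> W4 p"
  proof
    assume sub: "rad p \<subseteq> W4 p"
    then have "rad p = W4 p"
      using p(1) W4_dim[OF p(2)] by (intro vec.subspace_dim_equal rad_subspace W4_subspace) (auto simp: inX_def)
    then have "V \<subseteq> {v \<in> V. \<forall>z. \<sigma> v p z = 0}" using W4_V[of p] swap12[of p] by (auto simp: rad_def)
    then have "vec.dim V \<le> 1" using vec.dim_subset dim_N[OF p(2)] le_trans by blast
    then show False using V(2) by simp
  qed
  then obtain z where z: "z \<in> rad p" "z \<notin> W4 p" by blast
  have "z \<in> R p" using z(1) rad_K by (auto simp: R_def rad_def)
  then have "cone p" using coneI[OF W4_self _ _ z(2)] p(1) by (simp add: inX_def)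
  then show ?thesis using cone_limit p(2) by blast
qed

text \<open>Every \<open>v\<close> lies on the quadric of a suitable point \<open>y\<close> outside
  \<open>V\<close>. To find \<open>y\<close>, one starts from some \<open>k\<close> in the radical
  of \<open>v\<close>, takes a vector \<open>c\<close> of \<open>V\<close> on the quadric of
  \<open>k\<close> but not proportional to \<open>v\<close>, and chooses \<open>y\<close> in the
  radical of \<open>c\<close> inside \<open>A.R c\<close>. Then \<open>k\<close> lies in
  \<open>B.R v\<close> and witnesses that \<open>v\<close> is on the quadric of
  \<open>y\<close>.\<close>

lemma V_limit:
  assumes v: "v \<in> V" "v \<noteq> 0"
  shows "v \<in> closure (Collect good)"
proof -
  obtain k where k: "k \<in> rad v" "k \<notin> V"
    using subspace_exists_outside[OF V(1), of "rad v"] V(2) dim_rad_V[OF v] by auto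
  have vk: "\<sigma> v k z = 0" for z using k(1) by (simp add: rad_def)
  interpret A: rank2_point \<sigma> V k v by unfold_locales (use k v vk in auto)
  have "vec.dim V = vec.dim (vec.span {v}) + 2" using V(2) v(2) by simp
  from extend_by_two[OF vec.subspace_span V(1) span_singleton_V[OF v(1)] this]
  obtain d d' where d: "d \<in> V" "d' \<in> V" "\<And>a b. a *s d + b *s d' \<in> vec.span {v} \<Longrightarrow> a = 0 \<and> b = 0" by blast
  obtain S where S: "vec.subspace S" "W4 k \<subseteq> S" "S \<subseteq> K k" "vec.dim S = 6"
    using subspace_between[OF W4_subspace K_subspace W4_K, of k 6] W4_dim[OF k(2)] A.dK by auto
  obtain h1 h2 h3 h4 where F: "A.frame h1 h2 h3 h4" using A.frame_through[OF S] by metis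
  define B where "B u w = \<sigma> u h1 h2 * \<sigma> w h3 h4 - \<sigma> u h1 h3 * \<sigma> w h2 h4 + \<sigma> u h1 h4 * \<sigma> w h2 h3" for u w
  \<comment> \<open>The pencil of \<open>d\<close> and \<open>d'\<close> is complementary to
    \<open>v\<close> in \<open>V\<close>, and the Pfaffian restricted to it is a binary quadratic
    form.\<close>
  obtain a b where ab: "(a, b) \<noteq> (0, 0)" "B d d * a\<^sup>2 + (B d d' + B d' d) * (a * b) + B d' d' * b\<^sup>2 = 0"
    using binary_quadratic_root by blast
  define c where "c = a *s d + b *s d'"
  have cV: "c \<in> V" unfolding c_def using d by (intro V_add V_scale)
  have cv: "c \<notin> vec.span {v}" using d(3) ab(1) by (auto simp: c_def)
  then have c0: "c \<noteq> 0" using vec.span_zero by auto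
  have "A.pf h1 h2 h3 h4 c = 0"
    using ab(2) by (simp add: A.pf_def B_def c_def linear power2_eq_square algebra_simps)
  then have "A.cone c" using A.pf_cone[OF F _ c0] cV W4_V by blast
  then have dR: "vec.dim (A.R c) = 6" by (simp add: A.cone_def)
  have "vec.dim {t \<in> UNIV. \<forall>s\<in>A.R c. \<sigma> c s t = 0} + vec.dim (A.R c) =
      vec.dim (UNIV :: V10 set) + vec.dim {s \<in> A.R c. \<forall>t\<in>UNIV. \<sigma> c s t = 0}"
    by (rule pairing[OF bilinear_form_first A.R_subspace vec.subspace_UNIV])
  moreover have "vec.dim (K k) \<le> vec.dim {t \<in> UNIV. \<forall>s\<in>A.R c. \<sigma> c s t = 0}"
    by (intro vec.dim_subset) (auto simp: A.R_def)
  \<comment> \<open>The orthogonal of \<open>A.R c\<close> contains the eight-dimensional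
    \<open>K k\<close>, so the left kernel has dimension at least 8 + 6 - 10 = 4.\<close>
  ultimately have "vec.dim V < vec.dim {s \<in> A.R c. \<forall>t\<in>UNIV. \<sigma> c s t = 0}"
    using A.dK dR V(2) by (simp add: card_cart_basis)
  then obtain y where y: "y \<in> A.R c" "\<And>t. \<sigma> c y t = 0" "y \<notin> V"
    using subspace_exists_outside[OF V(1)] by blast
  interpret B: rank2_point \<sigma> V y c by unfold_locales (use y cV c0 in auto)
  have yk: "y \<in> K k" using y(1) A.R_K by blast
  have kK: "k \<in> K y" using yk swap23[of _ k y] by (auto simp: K_def)
  have "k \<in> B.R v" using kK vk by (simp add: B.R_def)
  moreover have "k \<notin> W4 y"
  proof
    assume "k \<in> W4 y"
    then obtain s u where su: "u \<in> V" "k = s *s y + u" by (auto simp: W4_iff)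
    have "\<sigma> c k z = 0" for z using y(2) V_iso[OF cV su(1)] by (simp add: su linear)
    then show False using common_kernel[OF v(1) cV v(2) cv vk] k(2) by blast
  qed
  ultimately have "B.cone v" using B.coneI v W4_V by blast
  then show ?thesis by (rule B.cone_V_limit[OF _ v(1)])
qed

lemma inX_limit:
  assumes "inX p"
  shows "p \<in> closure (Collect good)"
proof (cases "p \<in> V")
  case True
  then show ?thesis using V_limit assms by (simp add: inX_def)
next
  case False
  then show ?thesis using dim_K_cases[OF False] rank2_limit rank3_limit assms by blast
qed

end

section \<open>The Zariski topology\<close>

lemma generated_basis:
  assumes int: "\<And>A B. A \<in> S \<Longrightarrow> B \<in> S \<Longrightarrow> A \<inter> B \<in> S"
    and "openin (topology_generated_by S) U" "x \<in> U"
  shows "\<exists>B\<in>S. x \<in> B \<and> B \<subseteq> U"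
proof -
  have "generate_topology_on S U" using assms(2) by (simp add: openin_topology_generated_by_iff)
  then show ?thesis using assms(3)
  proof (induction U)
    case (Int a b)
    have "x \<in> a" "x \<in> b" using Int.prems by auto
    then obtain A B where AB: "A \<in> S" "x \<in> A" "A \<subseteq> a" "B \<in> S" "x \<in> B" "B \<subseteq> b"
      using Int.IH by meson
    have "A \<inter> B \<in> S" by (rule int[OF AB(1,4)])
    then show ?case using AB by (intro bexI[of _ "A \<inter> B"]) auto
  next
    case (UN K)
    then obtain k where k: "k \<in> K" "x \<in> k" by auto
    obtain B where "B \<in> S" "x \<in> B" "B \<subseteq> k" using UN.IH[OF k] by auto
    then show ?case using k by (intro bexI[of _ B]) auto
  next
    case (Basis s)
    then show ?case by (intro bexI[of _ s]) auto
  qed simp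
qed

lemma homogeneous_form_scale: "homogeneous_form d f \<Longrightarrow> f (c *s x) = c ^ d * f x"
  by (simp add: homogeneous_form_def)

lemma homogeneous_form_mult:
  "homogeneous_form d f \<Longrightarrow> homogeneous_form e g \<Longrightarrow> homogeneous_form (d + e) (\<lambda>x. f x * g x)"
  by (auto simp: homogeneous_form_def power_add intro: poly_functions.mult)

lemma homogeneous_form_compose:
  fixes F :: "complex^'n \<Rightarrow> complex^'m"
  assumes "homogeneous_form d f" "\<And>j. homogeneous_form e (\<lambda>x. F x $ j)"
  shows "homogeneous_form (e * d) (\<lambda>x. f (F x))"
  unfolding homogeneous_form_def
proof
  show "(\<lambda>x. f (F x)) \<in> poly_functions (range (\<lambda>i x. x $ i))"
    using assms by (intro poly_functions_compose[where f = f and \<phi> = F]) (auto simp: homogeneous_form_def)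
  have "F (c *s x) = c ^ e *s F x" for c x
    using assms(2) by (simp add: homogeneous_form_def vec_eq_iff)
  then show "\<forall>c x. f (F (c *s x)) = c ^ (e * d) * f (F x)"
    using assms(1) by (simp add: homogeneous_form_def power_mult)
qed

lemma homogeneous_form_functional:
  assumes "functional f"
  shows "homogeneous_form 1 f"
proof -
  have "f = (\<lambda>x. \<Sum>i\<in>UNIV. x $ i * f (ee i))" using functional_expand[OF assms] by blast
  moreover have "(\<lambda>x. \<Sum>i\<in>UNIV. x $ i * f (ee i)) \<in> poly_functions (range (\<lambda>i x. x $ i))"
    by (intro poly_functions_intros poly_functions.gen) auto
  ultimately show ?thesis by (simp add: homogeneous_form_def functional_simps[OF assms])
qed

lemma poly_functions_continuous:
  fixes f :: "complex^'n \<Rightarrow> complex"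
  assumes "f \<in> poly_functions (range (\<lambda>i x. x $ i))"
  shows "continuous_on UNIV f"
  using assms by (induction f) (auto intro!: continuous_intros)

definition nonzero_set :: "(complex^'n \<Rightarrow> complex) \<Rightarrow> (complex^'n) set set" where
  "nonzero_set f = {L \<in> projective_space. \<exists>x\<in>L. f x \<noteq> 0}"

lemma projective_space_span: "L \<in> projective_space \<longleftrightarrow> (\<exists>u. u \<noteq> 0 \<and> L = vec.span {u})"
proof
  assume L: "L \<in> projective_space"
  then have "0 < vec.dim L" by (simp add: projective_space_def)
  then obtain u where u: "u \<in> L" "u \<noteq> 0" using subspace_nontrivial by blast
  have "vec.span {u} = L"
    using L u by (intro vec.subspace_dim_equal vec.span_minimal) (auto simp: projective_space_def)
  then show "\<exists>u. u \<noteq> 0 \<and> L = vec.span {u}" using u by blast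
qed (auto simp: projective_space_def)

lemma span_projective [simp]: "u \<noteq> 0 \<Longrightarrow> vec.span {u} \<in> projective_space"
  using projective_space_span by blast

lemma nonzero_set_span:
  assumes "homogeneous_form d f" "u \<noteq> 0"
  shows "vec.span {u} \<in> nonzero_set f \<longleftrightarrow> f u \<noteq> 0"
proof -
  have "f x \<noteq> 0 \<longleftrightarrow> f u \<noteq> 0" if "x = k *s u" "f x \<noteq> 0" for x k
    using that homogeneous_form_scale[OF assms(1), of k u] by auto
  then have "(\<exists>x\<in>vec.span {u}. f x \<noteq> 0) \<longleftrightarrow> f u \<noteq> 0"
    using vec.span_base[of u "{u}"] unfolding vec.span_singleton by blast
  then show ?thesis using span_projective[OF assms(2)] by (simp only: nonzero_set_def mem_Collect_eq simp_thms)
qed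

lemma nonzero_set_mult:
  assumes "homogeneous_form d f" "homogeneous_form e g"
  shows "nonzero_set f \<inter> nonzero_set g = nonzero_set (\<lambda>x. f x * g x)"
proof -
  have "L \<in> nonzero_set f \<inter> nonzero_set g \<longleftrightarrow> L \<in> nonzero_set (\<lambda>x. f x * g x)" if L: "L \<in> projective_space" for L
  proof -
    obtain u where u: "u \<noteq> 0" "L = vec.span {u}" using L projective_space_span by blast
    show ?thesis
      unfolding u(2) Int_iff nonzero_set_span[OF assms(1) u(1)] nonzero_set_span[OF assms(2) u(1)]
        nonzero_set_span[OF homogeneous_form_mult[OF assms] u(1)] by simp
  qed
  then show ?thesis by (auto simp: nonzero_set_def)
qed

lemma openin_zariski_nonzero_set: "homogeneous_form d f \<Longrightarrow> openin zariski (nonzero_set f)"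
  unfolding zariski_def nonzero_set_def by (intro topology_generated_by_Basis) blast

lemma topspace_zariski: "topspace zariski = projective_space"
proof
  show "topspace zariski \<subseteq> (projective_space :: (complex^'n) set set)"
    unfolding zariski_def topology_generated_by_topspace by auto
  have "homogeneous_form 0 (\<lambda>_ :: complex^'n. 1)" by (simp add: homogeneous_form_def poly_functions.const)
  then have "openin zariski (nonzero_set (\<lambda>_ :: complex^'n. 1))" by (rule openin_zariski_nonzero_set)
  moreover have "nonzero_set (\<lambda>_ :: complex^'n. 1) = projective_space"
    using vec.subspace_0 by (auto simp: nonzero_set_def projective_space_def)
  ultimately show "projective_space \<subseteq> topspace (zariski :: (complex^'n) set topology)" using openin_subset by metis
qed

lemma zariski_basis:
  assumes "openin zariski U" "L \<in> U"
  shows "\<exists>d f. homogeneous_form d f \<and> L \<in> nonzero_set f \<and> nonzero_set f \<subseteq> U"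
proof -
  let ?S = "{nonzero_set f | f :: complex^'n \<Rightarrow> complex. \<exists>d. homogeneous_form d f}"
  have "A \<inter> B \<in> ?S" if A: "A \<in> ?S" "B \<in> ?S" for A B
  proof -
    obtain f g d e where f: "A = nonzero_set f" "homogeneous_form d f" "B = nonzero_set g" "homogeneous_form e g"
      using A by blast
    have "A \<inter> B = nonzero_set (\<lambda>x. f x * g x)" using nonzero_set_mult f by blast
    then show ?thesis using homogeneous_form_mult[OF f(2,4)] by blast
  qed
  moreover have "openin (topology_generated_by ?S) U" using assms(1) by (simp add: zariski_def nonzero_set_def)
  ultimately obtain B where "B \<in> ?S" "L \<in> B" "B \<subseteq> U" using generated_basis[of ?S U L] assms(2) by blast
  then show ?thesis by blast
qed

lemma openin_zariskiI:
  assumes "U \<subseteq> projective_space"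
    and "\<And>u. u \<noteq> 0 \<Longrightarrow> vec.span {u} \<in> U \<Longrightarrow> \<exists>d f. homogeneous_form d f \<and> f u \<noteq> 0 \<and> nonzero_set f \<subseteq> U"
  shows "openin zariski U"
proof (subst openin_subopen, intro ballI)
  fix L assume L: "L \<in> U"
  then obtain u where u: "u \<noteq> 0" "L = vec.span {u}" using assms(1) projective_space_span by blast
  obtain d f where f: "homogeneous_form d f" "f u \<noteq> 0" "nonzero_set f \<subseteq> U" using assms(2) u L by blast
  have "openin zariski (nonzero_set f)" "L \<in> nonzero_set f"
    using openin_zariski_nonzero_set[OF f(1)] nonzero_set_span[OF f(1) u(1)] f(2) u(2) by simp_all
  then show "\<exists>T. openin zariski T \<and> L \<in> T \<and> T \<subseteq> U" using f(3) by blast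
qed

lemma zariski_forms_basis:
  assumes "openin zariski_forms W" "\<sigma> \<in> W"
  shows "\<exists>f\<in>form_polys. \<sigma> \<in> alternating_forms \<and> f \<sigma> \<noteq> 0 \<and> {\<sigma> \<in> alternating_forms. f \<sigma> \<noteq> 0} \<subseteq> W"
proof -
  let ?S = "{{\<sigma> \<in> alternating_forms. f \<sigma> \<noteq> 0} | f. f \<in> form_polys}"
  have "A \<inter> B \<in> ?S" if A: "A \<in> ?S" "B \<in> ?S" for A B
  proof -
    obtain f g where f: "A = {\<sigma> \<in> alternating_forms. f \<sigma> \<noteq> 0}" "f \<in> form_polys"
      "B = {\<sigma> \<in> alternating_forms. g \<sigma> \<noteq> 0}" "g \<in> form_polys" using A by blast
    have "A \<inter> B = {\<sigma> \<in> alternating_forms. f \<sigma> * g \<sigma> \<noteq> 0}" by (auto simp: f)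
    moreover have "(\<lambda>\<sigma>. f \<sigma> * g \<sigma>) \<in> form_polys" by (rule poly_functions.mult[OF f(2,4)])
    ultimately show ?thesis unfolding mem_Collect_eq by (intro exI[of _ "\<lambda>\<sigma>. f \<sigma> * g \<sigma>"] conjI)
  qed
  moreover have "openin (topology_generated_by ?S) W" using assms(1) by (simp add: zariski_forms_def)
  ultimately obtain B where "B \<in> ?S" "\<sigma> \<in> B" "B \<subseteq> W" using generated_basis[of ?S W \<sigma>] assms(2) by blast
  then show ?thesis by blast
qed

lemma topspace_zariski_forms: "topspace zariski_forms = alternating_forms"
proof
  show "topspace zariski_forms \<subseteq> alternating_forms"
    unfolding zariski_forms_def topology_generated_by_topspace by auto
  have "openin zariski_forms {\<sigma> \<in> alternating_forms. (\<lambda>_. 1 :: complex) \<sigma> \<noteq> 0}"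
    unfolding zariski_forms_def
    by (rule topology_generated_by_Basis) (unfold mem_Collect_eq, intro exI[of _ "\<lambda>_. 1"] conjI refl poly_functions.const)
  then show "alternating_forms \<subseteq> topspace zariski_forms" using openin_subset by fastforce
qed

lemma rank_nullity:
  fixes M :: "complex^'n^'m"
  shows "rank M + vec.dim {c. M *v c = 0} = CARD('n)"
proof -
  let ?\<beta> = "\<lambda>x y :: complex^'n. \<Sum>j\<in>UNIV. x $ j * y $ j"
  have \<beta>: "bilinear_form ?\<beta>"
    by (auto simp: bilinear_form_def functional_def sum.distrib[symmetric] sum_distrib_left algebra_simps intro!: sum.cong)
  let ?S = "vec.span (rows M)"
  have ker: "{c. M *v c = 0} = {t \<in> UNIV. \<forall>s\<in>?S. ?\<beta> s t = 0}"
  proof (intro subset_antisym subsetI)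
    fix c assume c: "c \<in> {c. M *v c = 0}"
    have "?\<beta> s c = 0" if s: "s \<in> ?S" for s
    proof (rule functional_span[of "\<lambda>s. ?\<beta> s c", OF _ s])
      show "functional (\<lambda>s. ?\<beta> s c)" using \<beta> by (simp add: bilinear_form_def)
      fix r assume "r \<in> rows M"
      then obtain i where "r = M $ i" by (auto simp: rows_def row_def)
      then show "?\<beta> r c = 0" using c by (auto simp: matrix_vector_mult_def vec_eq_iff)
    qed
    then show "c \<in> {t \<in> UNIV. \<forall>s\<in>?S. ?\<beta> s t = 0}" by blast
  next
    fix c assume c: "c \<in> {t \<in> UNIV. \<forall>s\<in>?S. ?\<beta> s t = 0}"
    have "M $ i \<in> ?S" for i by (rule vec.span_base) (auto simp: rows_def row_def)
    then show "c \<in> {c. M *v c = 0}" using c by (auto simp: matrix_vector_mult_def vec_eq_iff)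
  qed
  have "s = 0" if "\<forall>t. ?\<beta> s t = 0" for s
  proof -
    have "s $ i = 0" for i
      using that[rule_format, of "ee i"] by (simp add: axis_def if_distrib[of "(*) _"] cong: if_cong)
    then show ?thesis by (simp add: vec_eq_iff)
  qed
  then have "{s \<in> ?S. \<forall>t\<in>UNIV. ?\<beta> s t = 0} = {0}" using vec.span_zero by auto
  then show ?thesis
    using pairing[OF \<beta> vec.subspace_span vec.subspace_UNIV, of "rows M"]
    unfolding ker by (simp add: row_rank_def_gen card_cart_basis)
qed

section \<open>Rank, radical, and equations of the Peskine variety\<close>

context trivector
begin

text \<open>Coefficient vectors of length 9 are paired with \<open>V10\<close> through
  \<open>\<sigma> u\<close>. The left kernel is the kernel of the matrix and the right kernel is the
  radical; \<open>u\<close> itself lies in the radical, which accounts for the step from 9 to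
  10.\<close>

lemma rank_rad:
  fixes w :: "9 \<Rightarrow> V10"
  assumes span: "vec.span (insert u (range w)) = UNIV"
  shows "rank ((\<chi> i j. \<sigma> u (w i) (w j)) :: complex^9^9) + vec.dim (rad u) = 10"
proof -
  let ?M = "(\<chi> i j. \<sigma> u (w i) (w j)) :: complex^9^9"
  let ?\<beta> = "\<lambda>(c :: complex^9) z. \<Sum>i\<in>UNIV. c $ i * \<sigma> u (w i) z"
  have \<beta>: "bilinear_form ?\<beta>"
    by (auto simp: bilinear_form_def functional_def linear sum.distrib[symmetric] sum_distrib_left algebra_simps intro!: sum.cong)
  have rad: "{z \<in> UNIV. \<forall>c\<in>UNIV. ?\<beta> c z = 0} = rad u"
  proof (intro subset_antisym subsetI)
    fix z assume z: "z \<in> {z \<in> UNIV. \<forall>c\<in>UNIV. ?\<beta> c z = 0}"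
    have 0: "\<sigma> u (w i) z = 0" for i
    proof -
      have "?\<beta> (ee i) z = 0" using z by blast
      then show ?thesis by (simp add: axis_def if_distrib[of "\<lambda>t. t * _"] cong: if_cong)
    qed
    have "\<sigma> u z y = 0" for y
      by (rule functional_span[OF functional_third, of y "insert u (range w)"])
        (use span 0 swap23[of u z] in auto)
    then show "z \<in> rad u" by (simp add: rad_def)
  next
    fix z assume "z \<in> rad u"
    then show "z \<in> {z \<in> UNIV. \<forall>c\<in>UNIV. ?\<beta> c z = 0}" using swap23[of u _ z] by (auto simp: rad_def)
  qed
  have ker: "{c \<in> UNIV. \<forall>z\<in>UNIV. ?\<beta> c z = 0} = {c. ?M *v c = 0}"
  proof (intro subset_antisym subsetI)
    fix c assume c: "c \<in> {c \<in> UNIV. \<forall>z\<in>UNIV. ?\<beta> c z = 0}"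
    have "(?M *v c) $ i = - ?\<beta> c (w i)" for i
      unfolding sum_negf[symmetric]
      by (auto simp: matrix_vector_mult_def swap23[of u _ "w i"] mult.commute intro!: sum.cong)
    then show "c \<in> {c. ?M *v c = 0}" using c by (simp add: vec_eq_iff)
  next
    fix c assume c: "c \<in> {c. ?M *v c = 0}"
    have b: "?\<beta> c (w i) = - (?M *v c) $ i" for i
      unfolding matrix_vector_mult_def vec_lambda_beta sum_negf[symmetric]
      by (auto simp: swap23[of u _ "w i"] mult.commute intro!: sum.cong)
    have "?\<beta> c z = 0" for z
    proof (rule functional_span[of "?\<beta> c" z "insert u (range w)"])
      show "functional (?\<beta> c)" using \<beta> by (simp add: bilinear_form_def)
      fix s assume "s \<in> insert u (range w)"
      then show "?\<beta> c s = 0"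
      proof
        assume "s \<in> range w"
        then obtain i where "s = w i" by blast
        then show ?thesis using b[of i] c by simp
      qed simp
    qed (use span in simp)
    then show "c \<in> {c \<in> UNIV. \<forall>z\<in>UNIV. ?\<beta> c z = 0}" by blast
  qed
  show ?thesis
    using pairing[OF \<beta> vec.subspace_UNIV vec.subspace_UNIV] rank_nullity[of ?M]
    unfolding rad ker by (simp add: card_cart_basis)
qed

lemma peskine_iff:
  assumes u: "u \<noteq> 0"
  shows "vec.span {u} \<in> peskine \<sigma> \<longleftrightarrow> 4 \<le> vec.dim (rad u)"
proof
  assume "vec.span {u} \<in> peskine \<sigma>"
  then obtain u' and w :: "9 \<Rightarrow> V10" where u': "vec.span {u'} = vec.span {u}" "vec.span (insert u' (range w)) = UNIV"
    "rank ((\<chi> i j. \<sigma> u' (w i) (w j)) :: complex^9^9) \<le> 6"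
    by (auto simp: peskine_def)
  have "u \<in> vec.span {u'}" using u'(1) by (simp add: vec.span_base)
  then obtain c where c: "u = c *s u'" by (auto simp: vec.span_singleton)
  then have "c \<noteq> 0" using u by auto
  then have "rad u = rad u'" by (simp add: rad_def c linear)
  then show "4 \<le> vec.dim (rad u)" using rank_rad[OF u'(2)] u'(3) by simp
next
  assume 4: "4 \<le> vec.dim (rad u)"
  have ind: "vec.independent {u}" using u by simp
  obtain B where B: "{u} \<subseteq> B" "vec.independent B" "vec.span B = UNIV"
    using vec.maximal_independent_subset_extend[OF subset_UNIV ind] by (metis UNIV_I subsetI subset_antisym)
  have "card B = 10" using B vec.dim_eq_card_independent[OF B(2)] vec.dim_span[of B] by (simp add: card_cart_basis)
  then have "card (B - {u}) = 9" "finite B" using B(1) by (auto simp: card_Diff_singleton intro: card_ge_0_finite)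
  then obtain w :: "9 \<Rightarrow> V10" where w: "bij_betw w UNIV (B - {u})"
    using finite_same_card_bij[of "UNIV :: 9 set" "B - {u}"] by auto
  have "insert u (range w) = B" using w B(1) by (auto simp: bij_betw_def)
  then have "vec.span (insert u (range w)) = UNIV" using B(3) by simp
  moreover from rank_rad[OF this] 4 have "rank ((\<chi> i j. \<sigma> u (w i) (w j)) :: complex^9^9) \<le> 6" by simp
  ultimately show "vec.span {u} \<in> peskine \<sigma>" using u by (auto simp: peskine_def)
qed

text \<open>At a point with a two-dimensional radical the form is nondegenerate on the span of eight
  of the ten vectors of an adapted basis; the determinant of the corresponding Gram matrix, padded
  to size ten, is an equation of the Peskine variety.\<close>

lemma peskine_equation:
  assumes p: "p \<noteq> 0" "\<not> 4 \<le> vec.dim (rad p)"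
  shows "\<exists>d F. homogeneous_form d F \<and> F p \<noteq> 0 \<and> (\<forall>q. 4 \<le> vec.dim (rad q) \<longrightarrow> F q = 0)"
proof -
  have "vec.dim (rad p) \<noteq> 0" using p(1) rad_self[of p] vec.dim_eq_0[of "rad p"] by blast
  moreover obtain k where "vec.dim (rad p) = 2 * k" using rad_even by (rule evenE)
  ultimately have d2: "vec.dim (rad p) = 2" using p(2) by arith
  obtain w :: "nat \<Rightarrow> V10" where w: "\<forall>k<2. w k \<in> rad p" "inj_on w {..<2}" "vec.independent (w ` {..<2})"
    using extend_independent[of "\<lambda>_. 0" 0 2 "rad p"] d2 vec.independent_empty by auto
  obtain f :: "complex^10^10" where f: "det f \<noteq> 0" "\<And>i. nt i < 2 \<Longrightarrow> f *v ee i = w (nt i)"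
    using independent_to_matrix[OF w(2,3)] by blast
  have wr: "w ` {..<2} \<subseteq> rad p" using w(1) by auto
  have "vec.span (w ` {..<2}) = rad p"
    using wr w(2,3) d2 vec.dim_eq_card_independent[OF w(3)] card_image[OF w(2)]
    by (intro vec.subspace_dim_equal rad_subspace vec.span_minimal vec.subspace_span) auto
  define N where "N q = ((\<chi> i j. if nt i < 2 \<or> nt j < 2 then (if i = j then 1 else 0)
      else \<sigma> q (f *v ee i) (f *v ee j)) :: complex^10^10)" for q
  define F where "F q = det (N q)" for q
  have fx: "f *v c = (\<Sum>j\<in>UNIV. c $ j *s (f *v ee j))" for c
    using matrix_vector_columns[of f c] by (simp add: matrix_vector_axis)
  have N_low: "(N q *v c) $ i = c $ i" if "nt i < 2" for q c i
    using that by (simp add: N_def matrix_vector_mult_def if_distrib[of "\<lambda>t. t * _"] cong: if_cong)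
  have N_high: "(N q *v c) $ i = \<sigma> q (f *v ee i) (f *v c)" if "\<not> nt i < 2" "\<And>j. nt j < 2 \<Longrightarrow> c $ j = 0" for q c i
  proof -
    have "\<sigma> q (f *v ee i) (f *v c) = (\<Sum>j\<in>UNIV. c $ j * \<sigma> q (f *v ee i) (f *v ee j))"
      by (subst fx) (simp add: sum3 scale3)
    also have "\<dots> = (\<Sum>j\<in>UNIV. N q $ i $ j * c $ j)"
      by (intro sum.cong refl) (use that in \<open>auto simp: N_def mult.commute\<close>)
    finally show ?thesis by (simp add: matrix_vector_mult_def)
  qed
  have "homogeneous_form (card {i :: 10. \<not> nt i < 2}) F"
    unfolding homogeneous_form_def
  proof (intro conjI allI)
    have "(\<lambda>q. \<sigma> q y z) \<in> poly_functions (range (\<lambda>i x. x $ i))" for y z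
      using homogeneous_form_functional[OF functional_first] by (simp add: homogeneous_form_def)
    then have "(\<lambda>q. N q $ i $ j) \<in> poly_functions (range (\<lambda>i x. x $ i))" for i j
      by (cases "nt i < 2 \<or> nt j < 2") (simp_all add: N_def poly_functions.const)
    then show "F \<in> poly_functions (range (\<lambda>i x. x $ i))" unfolding F_def[abs_def] by (rule poly_functions_det)
    fix c q
    have "N (c *s q) = (\<chi> i. (if nt i < 2 then 1 else c) *s N q $ i)"
      by (auto simp: N_def vec_eq_iff linear)
    then have "F (c *s q) = (\<Prod>i\<in>UNIV. if nt i < 2 then 1 else c) * F q"
      unfolding F_def by (simp only: det_rows_mul) (simp add: vec_lambda_eta)
    also have "(\<Prod>i\<in>(UNIV :: 10 set). if nt i < 2 then 1 else c) = c ^ card {i :: 10. \<not> nt i < 2}"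
      by (simp add: prod.If_cases Collect_neg_eq)
    finally show "F (c *s q) = c ^ card {i :: 10. \<not> nt i < 2} * F q" .
  qed
  moreover have "F p \<noteq> 0"
    unfolding F_def
  proof (rule det_nonzeroI)
    fix c assume c: "N p *v c = 0"
    have low: "c $ i = 0" if "nt i < 2" for i using N_low[OF that, of p c] c by simp
    have "\<sigma> p (f *v ee i) (f *v c) = 0" for i
    proof (cases "nt i < 2")
      case True
      then show ?thesis using f(2)[OF True] w(1) by (simp add: rad_def)
    next
      case False
      then show ?thesis using N_high[OF False low, of p] c by simp
    qed
    then have 0: "\<sigma> p (f *v y) (f *v c) = 0" for y unfolding fx[of y] by (simp add: sum2 scale2)
    have "\<sigma> p (f *v c) z = 0" for z
    proof -
      have "z = f *v ((1 / det f) *s (adj f *v z))" using f(1) by (simp add: vec.scale adj_right_vec)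
      then have "\<sigma> p z (f *v c) = 0" using 0 by metis
      then show ?thesis using swap23[of p z "f *v c"] by simp
    qed
    then have "f *v c \<in> vec.span (w ` {..<2})" using \<open>vec.span (w ` {..<2}) = rad p\<close> by (simp add: rad_def)
    then obtain b where "f *v c = (\<Sum>v\<in>w ` {..<2}. b v *s v)" by (auto simp: vec.span_finite)
    then have e: "f *v c = (\<Sum>k<2. b (w k) *s w k)" by (simp add: sum.reindex[OF w(2)])
    define c' where "c' = (\<chi> i :: 10. if nt i < 2 then b (w (nt i)) else 0)"
    have "f *v c' = (\<Sum>k<10. c' $ ix k *s (f *v ee (ix k)))" unfolding fx[of c'] by (rule sum_UNIV_ix)
    also have "\<dots> = (\<Sum>k<2. b (w k) *s w k)"
      by (rule sum.mono_neutral_cong_right) (auto simp: c'_def f(2))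
    finally have "c = c'" using det_nonzero_injD[OF f(1)] e by metis
    then show "c = 0" using low by (auto simp: c'_def vec_eq_iff)
  qed
  moreover have "F q = 0" if q: "4 \<le> vec.dim (rad q)" for q
  proof (rule ccontr)
    assume "F q \<noteq> 0"
    let ?\<phi> = "\<lambda>i z. (adj f *v z) $ i"
    have \<phi>: "functional (?\<phi> i)" for i by (simp add: functional_def matrix_vector_right_distrib vec.scale)
    have "{i :: 10. nt i < 2} = {ix 0, ix 1}"
      by (auto simp: less_2_cases_iff) (metis ix_nt One_nat_def)+
    then have c2: "card {i :: 10. nt i < 2} \<le> 2" by (simp add: card_insert_if)
    \<comment> \<open>Two linear conditions cannot annihilate a four-dimensional radical, so it
      meets the span of the eight chosen vectors, and the Gram matrix is singular.\<close>
    have "vec.dim (rad q) \<le> vec.dim {z \<in> rad q. \<forall>i\<in>{i. nt i < 2}. ?\<phi> i z = 0} + card {i :: 10. nt i < 2}"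
      by (rule dim_kernels[OF _ rad_subspace \<phi>]) simp
    then have "0 < vec.dim {z \<in> rad q. \<forall>i\<in>{i. nt i < 2}. ?\<phi> i z = 0}" using q c2 by linarith
    then obtain z where z: "z \<in> rad q" "\<And>i. nt i < 2 \<Longrightarrow> ?\<phi> i z = 0" "z \<noteq> 0" using subspace_nontrivial by blast
    let ?c = "adj f *v z"
    have fc: "f *v ?c = det f *s z" using f(1) by (rule adj_right_vec)
    have "(N q *v ?c) $ i = 0" for i
    proof (cases "nt i < 2")
      case True
      then show ?thesis using N_low z(2) by simp
    next
      case False
      then show ?thesis using N_high[OF False z(2), of q] z(1) swap23[of q z "f *v ee i"] by (simp add: fc linear rad_def)
    qed
    then have "N q *v ?c = N q *v 0" by (simp add: vec_eq_iff)
    then have "?c = 0" using det_nonzero_injD \<open>F q \<noteq> 0\<close> unfolding F_def by blast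
    then show False using fc f(1) z(3) by simp
  qed
  ultimately show ?thesis by blast
qed

lemma peskine_closed: "closedin zariski (peskine \<sigma>)"
proof -
  have "peskine \<sigma> \<subseteq> projective_space" by (auto simp: peskine_def)
  moreover have "openin zariski (projective_space - peskine \<sigma>)"
  proof (rule openin_zariskiI)
    fix p assume p: "p \<noteq> 0" "vec.span {p} \<in> projective_space - peskine \<sigma>"
    then obtain d F where F: "homogeneous_form d F" "F p \<noteq> 0" "\<And>q. 4 \<le> vec.dim (rad q) \<Longrightarrow> F q = 0"
      using peskine_equation peskine_iff by blast
    have "nonzero_set F \<subseteq> projective_space - peskine \<sigma>"
    proof
      fix L assume L: "L \<in> nonzero_set F"
      then obtain q where q: "q \<noteq> 0" "L = vec.span {q}" using projective_space_span by (auto simp: nonzero_set_def)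
      then have "F q \<noteq> 0" using L nonzero_set_span[OF F(1)] by blast
      then show "L \<in> projective_space - peskine \<sigma>" using peskine_iff q F(3) by auto
    qed
    then show "\<exists>d f. homogeneous_form d f \<and> f p \<noteq> 0 \<and> nonzero_set f \<subseteq> projective_space - peskine \<sigma>"
      using F by blast
  qed auto
  ultimately show ?thesis by (simp add: closedin_def topspace_zariski)
qed

end

section \<open>Projection from the plane\<close>

lemma det_scale3: "det ((\<chi> i j. c * A $ i $ j) :: complex^3^3) = c ^ 3 * det (A :: complex^3^3)"
  by (simp add: det_3 power3_eq_cube algebra_simps)

lemma adj_scale3: "adj ((\<chi> i j. c * A $ i $ j) :: complex^3^3) = (\<chi> i j. c\<^sup>2 * adj A $ i $ j)"
proof -
  have "adj ((\<chi> i j. c * A $ i $ j) :: complex^3^3) $ k $ l = c\<^sup>2 * adj A $ k $ l" for k l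
    using exhaust_3[of k] exhaust_3[of l]
    by (elim disjE) (simp_all add: adj_def det_3 power2_eq_square algebra_simps)
  then show ?thesis by (simp add: vec_eq_iff)
qed

lemma span_singleton_eqD:
  assumes "vec.span {p} = vec.span {q :: complex^'n}" "p \<noteq> 0"
  shows "\<exists>c. c \<noteq> 0 \<and> p = c *s q"
proof -
  have "p \<in> vec.span {q}" using assms(1) by (metis vec.span_base singletonI)
  then obtain c where "p = c *s q" by (auto simp: vec.span_singleton)
  then show ?thesis using assms(2) by auto
qed

lemma span_singleton_scale:
  assumes "c \<noteq> 0"
  shows "vec.span {c *s (q :: complex^'n)} = vec.span {q}"
proof (intro subset_antisym vec.span_minimal vec.subspace_span)
  show "{c *s q} \<subseteq> vec.span {q}" by (auto simp: vec.span_singleton)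
  have "q = (1 / c) *s (c *s q)" using assms by simp
  then have "q \<in> vec.span {c *s q}" unfolding vec.span_singleton by blast
  then show "{q} \<subseteq> vec.span {c *s q}" by simp
qed

text \<open>\<open>cyc1 l\<close> and \<open>cyc2 l\<close> are the indices other than
  \<open>l\<close> in cyclic order. Pairs out of three vectors are thereby indexed by a single
  \<open>l\<close>, which makes \<open>Mm\<close> a square matrix.\<close>

definition cyc1 :: "3 \<Rightarrow> 3" where "cyc1 l = (if l = 1 then 2 else if l = 2 then 3 else 1)"
definition cyc2 :: "3 \<Rightarrow> 3" where "cyc2 l = (if l = 1 then 3 else if l = 2 then 1 else 2)"

context general_trivector
begin

text \<open>The part of \<open>good\<close> that depends only on the class modulo \<open>V\<close>;
  it describes the open set of P^6 over which the inverse of the projection is defined.\<close>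

definition reg :: "V10 \<Rightarrow> bool" where
  "reg q \<longleftrightarrow> q \<notin> V \<and> vec.dim (K q) = 7 \<and> (\<forall>v\<in>V. (\<forall>x\<in>K q. \<forall>y\<in>K q. \<sigma> v x y = 0) \<longrightarrow> v = 0)"

text \<open>At a point of the Peskine variety where \<open>K p\<close> has dimension 7, the
  vanishing of \<open>\<sigma> p\<close> on \<open>K p\<close> is automatic by
  \<open>rank3_point\<close>.\<close>

lemma good_iff_reg: "good p \<longleftrightarrow> reg p \<and> inX p"
  using good_inX rank3_point(4) unfolding good_def reg_def by blast

lemma reg_shift:
  assumes "v \<in> V" "c \<noteq> 0"
  shows "reg (c *s q + v) \<longleftrightarrow> reg q"
proof -
  have "c *s q + v \<in> V \<longleftrightarrow> q \<in> V"
  proof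
    assume "c *s q + v \<in> V"
    then have "(c *s q + v) - v \<in> V" using assms(1) by (rule vec.subspace_diff[OF V(1)])
    then show "q \<in> V" using V_scale_iff[OF assms(2)] by simp
  qed (use assms in \<open>blast intro: V_add V_scale\<close>)
  then show ?thesis by (simp add: reg_def K_shift[OF assms])
qed

lemma inX_scale: "c \<noteq> 0 \<Longrightarrow> inX (c *s p) \<longleftrightarrow> inX p"
  by (simp add: inX_def rad_def linear)

lemma good_scale: "c \<noteq> 0 \<Longrightarrow> good (c *s p) \<longleftrightarrow> good p"
  using reg_shift[OF V_zero, of c p] by (simp add: good_iff_reg inX_scale)

lemma good_unique:
  assumes p: "good p" "good (c *s p + v)" and v: "v \<in> V" and c: "c \<noteq> 0"
  shows "v = 0"
proof -
  have "\<sigma> v x y = 0" if "x \<in> K p" "y \<in> K p" for x y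
    using p that unfolding good_def K_shift[OF v c] by (simp add: linear)
  then show ?thesis using p(1) v unfolding good_def by blast
qed

lemma cyclic_pairs_zero:
  assumes "\<And>l. \<sigma> u (z (cyc1 l)) (z (cyc2 l)) = 0"
  shows "\<sigma> u (z i) (z j) = 0"
proof -
  have "\<sigma> u (z 2) (z 3) = 0" "\<sigma> u (z 3) (z 1) = 0" "\<sigma> u (z 1) (z 2) = 0"
    using assms[of 1] assms[of 2] assms[of 3] by (simp_all add: cyc1_def cyc2_def)
  then show ?thesis
    using exhaust_3[of i] exhaust_3[of j] swap23[of u "z 2" "z 3"] swap23[of u "z 3" "z 1"] swap23[of u "z 1" "z 2"]
    by (elim disjE) simp_all
qed

text \<open>\<open>proj a q\<close> projects onto \<open>K q\<close> along the \<open>a k\<close>, up to the factor \<open>det (Dm a q)\<close>, and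
  \<open>chart_map\<close> solves the equations of the good point congruent to \<open>q\<close> modulo \<open>V\<close> by Cramer's rule;
  denominators are cleared so that both maps are given by forms.\<close>

definition Dm :: "(3 \<Rightarrow> V10) \<Rightarrow> V10 \<Rightarrow> complex^3^3" where "Dm a q = (\<chi> i k. \<sigma> (Vb i) q (a k))"

definition proj :: "(3 \<Rightarrow> V10) \<Rightarrow> V10 \<Rightarrow> V10 \<Rightarrow> V10" where
  "proj a q z = det (Dm a q) *s z - (\<Sum>k\<in>UNIV. (adj (Dm a q) *v (\<chi> i. \<sigma> (Vb i) q z)) $ k *s a k)"

definition Mm :: "(3 \<Rightarrow> V10) \<Rightarrow> (3 \<Rightarrow> V10) \<Rightarrow> V10 \<Rightarrow> complex^3^3" where
  "Mm a z q = (\<chi> l i. \<sigma> (Vb i) (proj a q (z (cyc1 l))) (proj a q (z (cyc2 l))))"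

definition Tv :: "(3 \<Rightarrow> V10) \<Rightarrow> (3 \<Rightarrow> V10) \<Rightarrow> V10 \<Rightarrow> complex^3" where
  "Tv a z q = (\<chi> l. \<sigma> q (proj a q (z (cyc1 l))) (proj a q (z (cyc2 l))))"

definition chart_det :: "(3 \<Rightarrow> V10) \<Rightarrow> (3 \<Rightarrow> V10) \<Rightarrow> V10 \<Rightarrow> complex" where
  "chart_det a z q = det (Dm a q) * det (Mm a z q)"

definition chart_map :: "(3 \<Rightarrow> V10) \<Rightarrow> (3 \<Rightarrow> V10) \<Rightarrow> V10 \<Rightarrow> V10" where
  "chart_map a z q = det (Mm a z q) *s q - (\<Sum>i\<in>UNIV. (adj (Mm a z q) *v Tv a z q) $ i *s Vb i)"

lemma proj_K:
  assumes "det (Dm a q) \<noteq> 0"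
  shows "proj a q z \<in> K q"
proof -
  let ?w = "\<chi> i. \<sigma> (Vb i) q z"
  have "\<sigma> (Vb i) q (proj a q z) = 0" for i
  proof -
    have "(\<Sum>k\<in>UNIV. (adj (Dm a q) *v ?w) $ k * \<sigma> (Vb i) q (a k)) = (Dm a q *v (adj (Dm a q) *v ?w)) $ i"
      unfolding matrix_vector_mult_def[of "Dm a q"] by (simp add: Dm_def mult.commute)
    also have "\<dots> = det (Dm a q) * \<sigma> (Vb i) q z" by (simp add: adj_right_vec[OF assms])
    finally show ?thesis by (simp add: proj_def linear sum3)
  qed
  then show ?thesis by (simp add: K_Vb)
qed

lemma dim_K_Dm:
  assumes "det (Dm a q) \<noteq> 0"
  shows "vec.dim (K q) = 7" "q \<notin> V"
proof -
  show d: "vec.dim (K q) = 7"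
    unfolding K_Vb using assms by (intro det_dual3[where a = a] functional_third) (simp add: Dm_def)
  show "q \<notin> V"
  proof
    assume "q \<in> V"
    then have "vec.dim (K q) = 10" by (simp add: K_of_V card_cart_basis)
    then show False using d by simp
  qed
qed

text \<open>Invertibility of \<open>Mm\<close> says that an element of \<open>V\<close> is
  determined by its values on three pairs of vectors of \<open>K q\<close>.\<close>

lemma chart_reg:
  assumes "chart_det a z q \<noteq> 0"
  shows "reg q"
proof -
  have D: "det (Dm a q) \<noteq> 0" and M: "det (Mm a z q) \<noteq> 0" using assms by (auto simp: chart_det_def)
  have "v = 0" if v: "v \<in> V" and 0: "\<And>x y. x \<in> K q \<Longrightarrow> y \<in> K q \<Longrightarrow> \<sigma> v x y = 0" for v
  proof -
    obtain c where c: "v = (\<Sum>i\<in>UNIV. c i *s Vb i)" using V_expand[OF v] by blast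
    have "(Mm a z q *v (\<chi> i. c i)) $ l = \<sigma> v (proj a q (z (cyc1 l))) (proj a q (z (cyc2 l)))" for l
      by (simp add: c sum1 scale1 matrix_vector_mult_def Mm_def mult.commute)
    then have "Mm a z q *v (\<chi> i. c i) = Mm a z q *v 0" using 0 proj_K[OF D] by (simp add: vec_eq_iff)
    then have "(\<chi> i. c i) = (0 :: complex^3)" by (rule det_nonzero_injD[OF M])
    then show ?thesis by (simp add: c vec_eq_iff)
  qed
  then show ?thesis using dim_K_Dm[OF D] by (auto simp: reg_def)
qed

lemma reg_good:
  assumes "reg q"
  shows "\<exists>s v. s \<noteq> 0 \<and> v \<in> V \<and> good (s *s q + v)"
proof -
  have q: "q \<notin> V" "vec.dim (K q) = 7" using assms by (auto simp: reg_def)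
  obtain s v where sv: "v \<in> V" "(s, v) \<noteq> (0, 0)" "\<And>x y. x \<in> K q \<Longrightarrow> y \<in> K q \<Longrightarrow> \<sigma> (s *s q + v) x y = 0"
    using kernel_exists[OF q] by auto
  have s: "s \<noteq> 0"
  proof
    assume s: "s = 0"
    have "\<sigma> v x y = 0" if "x \<in> K q" "y \<in> K q" for x y using sv(3)[OF that] by (simp add: s)
    then have "v = 0" using assms sv(1) unfolding reg_def by blast
    then show False using sv(2) s by simp
  qed
  have "reg (s *s q + v)" using reg_shift[OF sv(1) s] assms by blast
  then have "good (s *s q + v)"
    using sv(3) K_shift[OF sv(1) s] unfolding good_def reg_def by auto
  then show ?thesis using s sv(1) by blast
qed

text \<open>A good point \<open>s *s q + v\<close> in the class of \<open>q\<close> exists by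
  \<open>reg_good\<close>. Its coordinates in \<open>V\<close> solve the linear system with matrix
  \<open>Mm\<close>, so the solution by Cramer's rule must be proportional to it.\<close>

lemma chart_good:
  assumes "chart_det a z q \<noteq> 0"
  shows "good (chart_map a z q) \<and> (\<exists>s v. s \<noteq> 0 \<and> v \<in> V \<and> chart_map a z q = s *s q + v)"
proof -
  have D: "det (Dm a q) \<noteq> 0" and M: "det (Mm a z q) \<noteq> 0" using assms by (auto simp: chart_det_def)
  obtain s v where sv: "s \<noteq> 0" "v \<in> V" "good (s *s q + v)" using reg_good[OF chart_reg[OF assms]] by blast
  obtain c where c: "v = (\<Sum>i\<in>UNIV. c i *s Vb i)" using V_expand[OF sv(2)] by blast
  let ?c = "\<chi> i. c i" and ?m = "det (Mm a z q)"
  have MT: "Mm a z q *v ?c = (- s) *s Tv a z q"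
  proof -
    have "(Mm a z q *v ?c) $ l = - s * Tv a z q $ l" for l
    proof -
      have "\<sigma> (s *s q + v) (proj a q (z (cyc1 l))) (proj a q (z (cyc2 l))) = 0"
        using sv(3) proj_K[OF D] K_shift[OF sv(2,1)] unfolding good_def by auto
      then have "s * Tv a z q $ l + (Mm a z q *v ?c) $ l = 0"
        by (simp add: c sum1 scale1 linear matrix_vector_mult_def Mm_def Tv_def mult.commute)
      then show ?thesis by (simp add: eq_neg_iff_add_eq_0 add.commute)
    qed
    then show ?thesis by (simp add: vec_eq_iff)
  qed
  have "(- s) *s (adj (Mm a z q) *v Tv a z q) = ?m *s ?c"
    using adj_left_vec[OF M, of ?c] unfolding MT by (simp only: vec.scale)
  then have "- s * (adj (Mm a z q) *v Tv a z q) $ i = ?m * c i" for i by (simp add: vec_eq_iff)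
  then have e: "(adj (Mm a z q) *v Tv a z q) $ i = - (?m / s) * c i" for i
    using sv(1) by (simp add: field_simps) (metis minus_mult_minus mult_minus_left minus_minus)
  have "chart_map a z q = (?m / s) *s (s *s q + v)"
    unfolding chart_map_def e c
    using sv(1) by (simp add: vec.scale_right_distrib vec.scale_sum_right sum_negf[symmetric])
  moreover from this have "chart_map a z q = ?m *s q + (?m / s) *s v" using sv(1) by (simp add: vec.scale_right_distrib)
  ultimately show ?thesis
    using good_scale[of "?m / s" "s *s q + v"] sv M V_scale[OF sv(2)] by (metis divide_eq_0_iff)
qed

lemma chart_poly:
  "(\<lambda>q. det (Dm a q)) \<in> poly_functions (range (\<lambda>i x. x $ i))"
  "(\<lambda>q. proj a q y $ j) \<in> poly_functions (range (\<lambda>i x. x $ i))"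
  "(\<lambda>q. Mm a z q $ l $ i) \<in> poly_functions (range (\<lambda>i x. x $ i))"
  "(\<lambda>q. chart_det a z q) \<in> poly_functions (range (\<lambda>i x. x $ i))"
  "(\<lambda>q. chart_map a z q $ j) \<in> poly_functions (range (\<lambda>i x. x $ i))"
proof -
  let ?G = "range (\<lambda>i (x :: V10). x $ i)"
  have crd: "(\<lambda>q. q $ i) \<in> poly_functions ?G" for i by (rule poly_functions.gen) blast
  have f: "(\<lambda>q. \<sigma> y q y') \<in> poly_functions ?G" for y y'
    using homogeneous_form_functional[OF functional_second] by (simp add: homogeneous_form_def)
  have D: "(\<lambda>q. Dm a q $ i $ k) \<in> poly_functions ?G" for i k by (simp add: Dm_def f)
  show dD: "(\<lambda>q. det (Dm a q)) \<in> poly_functions ?G" by (rule poly_functions_det[OF D])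
  have prj: "(\<lambda>q. proj a q y $ j) \<in> poly_functions ?G" for y j
    unfolding proj_def matrix_vector_mult_def vector_minus_component vector_smult_component sum_component vec_lambda_beta
    by (intro poly_functions_diff poly_functions_sum poly_functions.mult poly_functions_adj D dD f poly_functions.const)
  then show "(\<lambda>q. proj a q y $ j) \<in> poly_functions ?G" .
  have 3: "(\<lambda>q. \<sigma> (x q) (proj a q y) (proj a q y')) \<in> poly_functions ?G"
    if "\<And>i. (\<lambda>q. x q $ i) \<in> poly_functions ?G" for x y y'
    by (rule poly_functions_form[where L = "\<lambda>_. \<sigma>" and x = x and y = "\<lambda>q. proj a q y" and z = "\<lambda>q. proj a q y'"])
      (use that alternating poly_functions.const prj in auto)
  have M: "(\<lambda>q. Mm a z q $ l $ i) \<in> poly_functions ?G" for l i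
    using 3[of "\<lambda>_. Vb i"] by (simp add: Mm_def poly_functions.const)
  then show "(\<lambda>q. Mm a z q $ l $ i) \<in> poly_functions ?G" .
  have dM: "(\<lambda>q. det (Mm a z q)) \<in> poly_functions ?G" by (rule poly_functions_det[OF M])
  show "(\<lambda>q. chart_det a z q) \<in> poly_functions ?G"
    unfolding chart_det_def by (rule poly_functions.mult[OF dD dM])
  have T: "(\<lambda>q. Tv a z q $ l) \<in> poly_functions ?G" for l using 3[of "\<lambda>q. q"] crd by (simp add: Tv_def)
  show "(\<lambda>q. chart_map a z q $ j) \<in> poly_functions ?G"
    unfolding chart_map_def matrix_vector_mult_def vector_minus_component vector_smult_component sum_component vec_lambda_beta
    by (intro poly_functions_diff poly_functions_sum poly_functions.mult poly_functions_adj M dM T crd poly_functions.const)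
qed

text \<open>The degrees in \<open>q\<close>: 1 for \<open>Dm\<close>, 3 for its determinant and for
  \<open>proj\<close>, 6 for \<open>Mm\<close>, 18 for its determinant, 7 for \<open>Tv\<close> and
  12 for the adjugate of \<open>Mm\<close>. Hence 18 + 3 = 21 and 18 + 1 = 12 + 7 = 19.\<close>

lemma chart_scaling:
  "chart_det a z (c *s q) = c ^ 21 * chart_det a z q" "chart_map a z (c *s q) = c ^ 19 *s chart_map a z q"
proof -
  have D: "Dm a (c *s q) = (\<chi> i j. c * Dm a q $ i $ j)" by (simp add: Dm_def vec_eq_iff scale2)
  have P: "proj a (c *s q) y = c ^ 3 *s proj a q y" for y
    unfolding proj_def D det_scale3 adj_scale3
    by (simp add: vec_eq_iff matrix_vector_mult_def sum_distrib_left sum_distrib_right scale2 algebra_simps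
        power2_eq_square power3_eq_cube)
  have M: "Mm a z (c *s q) = (\<chi> l i. c ^ 6 * Mm a z q $ l $ i)"
    by (simp add: Mm_def vec_eq_iff P scale2 scale3 eval_nat_numeral)
  have T: "Tv a z (c *s q) = c ^ 7 *s Tv a z q"
    by (simp add: Tv_def vec_eq_iff P scale1 scale2 scale3 eval_nat_numeral)
  have cM: "det (Mm a z (c *s q)) = c ^ 18 * det (Mm a z q)"
    unfolding M det_scale3 by (simp add: power_mult[symmetric])
  show "chart_det a z (c *s q) = c ^ 21 * chart_det a z q"
    unfolding chart_det_def cM D det_scale3 by (simp add: eval_nat_numeral)
  have "adj (Mm a z (c *s q)) *v Tv a z (c *s q) = c ^ 19 *s (adj (Mm a z q) *v Tv a z q)"
    unfolding M adj_scale3 T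
    by (simp add: vec_eq_iff matrix_vector_mult_def sum_distrib_left mult.assoc mult.left_commute power_mult[symmetric]
        power_add[symmetric] flip: mult.assoc)
  then show "chart_map a z (c *s q) = c ^ 19 *s chart_map a z q"
    unfolding chart_map_def cM
    by (simp add: vec_eq_iff sum_distrib_left right_diff_distrib mult.assoc eval_nat_numeral)
qed

lemma chart_forms:
  "homogeneous_form 21 (chart_det a z)" "homogeneous_form 19 (\<lambda>q. chart_map a z q $ j)"
  using chart_poly(4,5) chart_scaling by (auto simp: homogeneous_form_def)

text \<open>With \<open>a\<close> dual to the functionals of \<open>q\<close>, \<open>proj\<close>
  is the identity on \<open>K q\<close>; for the \<open>z i\<close> one takes a basis of
  \<open>K q\<close> modulo \<open>W4 q\<close>. A kernel vector of \<open>Mm\<close> is then an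
  element of \<open>V\<close> that vanishes on \<open>K q\<close>.\<close>

lemma chart_exists:
  assumes "reg q"
  shows "\<exists>a z. chart_det a z q \<noteq> 0"
proof -
  have q: "q \<notin> V" "vec.dim (K q) = 7" using assms by (auto simp: reg_def)
  obtain a where a: "\<And>i k. \<sigma> (Vb i) q (a k) = (if i = k then 1 else 0)" using dual_Vb[OF q(2)] by blast
  have D: "Dm a q = mat 1" by (simp add: Dm_def a mat_def vec_eq_iff)
  obtain z1 where z1: "z1 \<in> K q" "vec.span (insert z1 (W4 q)) \<subseteq> K q" "vec.dim (vec.span (insert z1 (W4 q))) = 5"
    using extend_by_one[OF W4_subspace K_subspace W4_K, of q] W4_dim[OF q(1)] q(2) by auto
  obtain z2 z3 where z23: "z2 \<in> K q" "z3 \<in> K q" "K q = vec.span (insert z3 (insert z2 (vec.span (insert z1 (W4 q)))))"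
    using extend_by_two[OF vec.subspace_span K_subspace z1(2)] z1(3) q(2) by auto
  define z where "z i = (if i = 1 then z1 else if i = 2 then z2 else z3)" for i :: 3
  have z: "z 1 = z1" "z 2 = z2" "z 3 = z3" by (simp_all add: z_def)
  let ?G = "{z1, z2, z3} \<union> W4 q"
  have zK: "z i \<in> K q" for i using z1 z23 by (auto simp: z_def)
  have "K q \<subseteq> vec.span ?G"
    unfolding z23(3)
  proof (intro vec.span_minimal vec.subspace_span)
    have "vec.span (insert z1 (W4 q)) \<subseteq> vec.span ?G" by (intro vec.span_mono) auto
    then show "insert z3 (insert z2 (vec.span (insert z1 (W4 q)))) \<subseteq> vec.span ?G" by (auto intro: vec.span_base)
  qed
  have P: "proj a q y = y" if "y \<in> K q" for y
    using that Vb(2) by (simp add: proj_def D K_def zero_vec_def[symmetric])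
  have "det (Mm a z q) \<noteq> 0"
  proof (rule det_nonzeroI)
    fix c assume c: "Mm a z q *v c = 0"
    define v where "v = (\<Sum>i\<in>UNIV. c $ i *s Vb i)"
    have vV: "v \<in> V" unfolding v_def using Vb(2) V(1) by (intro vec.subspace_sum vec.subspace_scale)
    have "\<sigma> v (z (cyc1 l)) (z (cyc2 l)) = 0" for l
    proof -
      have "(Mm a z q *v c) $ l = \<sigma> v (z (cyc1 l)) (z (cyc2 l))"
        unfolding v_def sum1 scale1 matrix_vector_mult_def Mm_def vec_lambda_beta P[OF zK]
        by (simp only: mult.commute)
      then show ?thesis unfolding c by simp
    qed
    then have z0: "\<sigma> v (z i) (z j) = 0" for i j by (rule cyclic_pairs_zero)
    have zz: "\<sigma> v y y' = 0" if yy: "y \<in> {z1, z2, z3}" "y' \<in> {z1, z2, z3}" for y y'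
    proof -
      have "{z1, z2, z3} \<subseteq> range z"
        using rangeI[of z 1] rangeI[of z 2] rangeI[of z 3] by (auto simp: z)
      then obtain i j where "y = z i" "y' = z j" using yy by blast
      then show ?thesis using z0 by simp
    qed
    have "\<sigma> v x y = 0" if xy: "x \<in> K q" "y \<in> K q" for x y
    proof (rule span_isotropic[where G = ?G])
      fix s t assume s: "s \<in> ?G" "t \<in> ?G"
      have sK: "s \<in> K q" "t \<in> K q" using s z1 z23 W4_K by blast+
      have vW: "v \<in> W4 q" using vV W4_V by blast
      show "\<sigma> v s t = 0"
      proof (cases "s \<in> W4 q \<or> t \<in> W4 q")
        case True
        then show ?thesis using W4_iso[OF vW] sK swap23[of v s t] by auto
      next
        case False
        then show ?thesis using s zz by blast
      qed
    qed (use xy \<open>K q \<subseteq> vec.span ?G\<close> in auto)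
    then have "v = 0" using assms vV unfolding reg_def by blast
    moreover have "\<sigma> v q (a k) = c $ k" for k
      by (simp add: v_def sum1 scale1 a if_distrib[of "\<lambda>t. _ * t"] cong: if_cong)
    ultimately have "c $ k = 0" for k using zero(1) by metis
    then show "c = 0" by (simp add: vec_eq_iff)
  qed
  then show ?thesis by (intro exI[of _ a] exI[of _ z]) (simp add: chart_det_def D)
qed

lemma chart_at_good:
  assumes "good p" "chart_det a z p \<noteq> 0"
  shows "\<exists>s. s \<noteq> 0 \<and> chart_map a z p = s *s p"
proof -
  obtain s v where sv: "s \<noteq> 0" "v \<in> V" "chart_map a z p = s *s p + v" "good (s *s p + v)"
    using chart_good[OF assms(2)] by metis
  have "v = 0" by (rule good_unique[OF assms(1) sv(4,2,1)])
  then show ?thesis using sv by auto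
qed

section \<open>Irreducibility\<close>

text \<open>A form is continuous, so where it is nonzero at a limit of good points it is nonzero at
  some good point.\<close>

lemma good_dense:
  assumes f: "homogeneous_form d f" and p: "inX p" "f p \<noteq> 0"
  shows "\<exists>p. good p \<and> f p \<noteq> 0"
proof -
  have "continuous_on UNIV f" using f by (intro poly_functions_continuous) (simp add: homogeneous_form_def)
  then have "open (f -` (- {0}))" by (intro open_vimage) auto
  then have "f -` (- {0}) \<inter> Collect good \<noteq> {}"
    using inX_limit[OF p(1)] p(2) open_Int_closure_eq_empty[of "f -` (- {0})" "Collect good"] by auto
  then show ?thesis by auto
qed

lemma homogeneous_form_line:
  assumes "homogeneous_form d f"
  shows "(\<lambda>t. f ((1 - t) *s p + t *s q)) \<in> upoly"
  by (rule poly_functions_compose[where f = f and \<phi> = "\<lambda>t. (1 - t) *s p + t *s q"])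
    (use assms in \<open>auto simp: homogeneous_form_def intro!: poly_functions_intros upoly_id\<close>)

text \<open>Both forms are moved to good points, where they can be pulled back along chart maps to
  forms on the whole of \<open>V10\<close>. There the two good points are joined by a line. At a
  common parameter the two charts produce good points of the same class modulo \<open>V\<close>, and
  these are proportional by uniqueness.\<close>

lemma inX_irreducible:
  assumes f: "homogeneous_form d f" "inX p" "f p \<noteq> 0" and g: "homogeneous_form e g" "inX q" "g q \<noteq> 0"
  shows "\<exists>x. inX x \<and> f x \<noteq> 0 \<and> g x \<noteq> 0"
proof -
  obtain p0 where p0: "good p0" "f p0 \<noteq> 0" using good_dense[OF f] by blast
  obtain p1 where p1: "good p1" "g p1 \<noteq> 0" using good_dense[OF g] by blast
  obtain a z where az: "chart_det a z p0 \<noteq> 0" using chart_exists p0(1) good_iff_reg by blast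
  obtain b y where b_y: "chart_det b y p1 \<noteq> 0" using chart_exists p1(1) good_iff_reg by blast
  let ?F0 = "\<lambda>q. f (chart_map a z q)" and ?F1 = "\<lambda>q. g (chart_map b y q)"
  let ?x = "\<lambda>t. (1 - t) *s p0 + t *s p1"
  have F0: "homogeneous_form (19 * d) ?F0" and F1: "homogeneous_form (19 * e) ?F1"
    by (rule homogeneous_form_compose[OF f(1) chart_forms(2)], rule homogeneous_form_compose[OF g(1) chart_forms(2)])
  obtain s where "s \<noteq> 0" "chart_map a z p0 = s *s p0" using chart_at_good[OF p0(1) az] by blast
  then have n0: "?F0 p0 \<noteq> 0" using p0(2) homogeneous_form_scale[OF f(1)] by simp
  obtain s' where "s' \<noteq> 0" "chart_map b y p1 = s' *s p1" using chart_at_good[OF p1(1) b_y] by blast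
  then have n1: "?F1 p1 \<noteq> 0" using p1(2) homogeneous_form_scale[OF g(1)] by simp
  define h1 h2 h3 h4 where h: "h1 = (\<lambda>t. chart_det a z (?x t))" "h2 = (\<lambda>t. chart_det b y (?x t))"
    "h3 = (\<lambda>t. ?F0 (?x t))" "h4 = (\<lambda>t. ?F1 (?x t))"
  have up: "h1 \<in> upoly" "h2 \<in> upoly" "h3 \<in> upoly" "h4 \<in> upoly"
    unfolding h by (rule homogeneous_form_line chart_forms F0 F1)+
  have nz: "h1 0 \<noteq> 0" "h2 1 \<noteq> 0" "h3 0 \<noteq> 0" "h4 1 \<noteq> 0" unfolding h using az b_y n0 n1 by simp_all
  have "\<exists>t. \<forall>h\<in>{h1, h2, h3, h4}. h t \<noteq> 0"
    by (rule upoly_common_nonzero) (use up nz in auto)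
  then obtain t where t: "chart_det a z (?x t) \<noteq> 0" "chart_det b y (?x t) \<noteq> 0" "?F0 (?x t) \<noteq> 0" "?F1 (?x t) \<noteq> 0"
    unfolding h by auto
  let ?y0 = "chart_map a z (?x t)" and ?y1 = "chart_map b y (?x t)"
  obtain s v where s: "good ?y0" "s \<noteq> 0" "v \<in> V" "?y0 = s *s ?x t + v" using chart_good[OF t(1)] by blast
  obtain s' v' where s': "good ?y1" "s' \<noteq> 0" "v' \<in> V" "?y1 = s' *s ?x t + v'" using chart_good[OF t(2)] by blast
  \<comment> \<open>The part of \<open>?y1\<close> in \<open>V\<close> that is left after
    subtracting the multiple of \<open>?y0\<close> with the same component along
    \<open>?x t\<close>.\<close>
  let ?u = "v' - (s' / s) *s v"
  have "?y1 = (s' / s) *s ?y0 + ?u" using s(2) unfolding s(4) s'(4) by (simp add: vec.scale_right_distrib)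
  moreover have "?u \<in> V" using s s' V(1) by (intro vec.subspace_diff V_scale)
  moreover have "s' / s \<noteq> 0" using s s' by simp
  ultimately have "?y1 = (s' / s) *s ?y0" using good_unique[OF s(1), of "s' / s" ?u] s'(1) by simp
  then have "g ?y0 \<noteq> 0" using t(4) homogeneous_form_scale[OF g(1), of "s' / s" ?y0] by auto
  then show ?thesis using t(3) s(1) good_inX by blast
qed

lemma peskine_inX: "u \<noteq> 0 \<Longrightarrow> vec.span {u} \<in> peskine \<sigma> \<longleftrightarrow> inX u"
  using peskine_iff by (simp add: inX_def)

lemma peskine_projective: "peskine \<sigma> \<subseteq> projective_space"
  by (auto simp: peskine_def)

lemma good_exists: "\<exists>p. good p"
proof -
  obtain v where "v \<in> V" "v \<noteq> 0" using subspace_nontrivial[of V] V(2) by auto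
  then show ?thesis using V_limit[of v] by (metis Collect_empty_eq closure_empty empty_iff)
qed

lemma good_nonzero: "good p \<Longrightarrow> p \<noteq> 0"
  using V_zero by (auto simp: good_def)

lemma peskine_irreducible: "irreducible_topology (subtopology zariski (peskine \<sigma>))"
proof -
  have top: "topspace (subtopology zariski (peskine \<sigma>)) = peskine \<sigma>"
    using peskine_projective by (auto simp: topspace_zariski)
  have sep: "\<exists>d f u. homogeneous_form d f \<and> inX u \<and> f u \<noteq> 0 \<and> (\<forall>x. inX x \<longrightarrow> f x \<noteq> 0 \<longrightarrow> vec.span {x} \<notin> A)"
    if A: "closedin (subtopology zariski (peskine \<sigma>)) A" "A \<noteq> peskine \<sigma>" for A
  proof -
    have "A \<subseteq> peskine \<sigma>" "openin (subtopology zariski (peskine \<sigma>)) (peskine \<sigma> - A)"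
      using A(1) top by (auto simp: closedin_def)
    then obtain T where T: "openin zariski T" "peskine \<sigma> - A = T \<inter> peskine \<sigma>" by (auto simp: openin_subtopology)
    obtain L where L: "L \<in> peskine \<sigma>" "L \<notin> A" using A(2) \<open>A \<subseteq> peskine \<sigma>\<close> by blast
    obtain u where u: "u \<noteq> 0" "L = vec.span {u}" using L peskine_projective projective_space_span by blast
    have "L \<in> T" using L T(2) by blast
    then obtain d f where f: "homogeneous_form d f" "L \<in> nonzero_set f" "nonzero_set f \<subseteq> T"
      using zariski_basis[OF T(1)] by blast
    have "f u \<noteq> 0" using f(2) nonzero_set_span[OF f(1) u(1)] u(2) by simp
    moreover have "inX u" using L u peskine_inX by blast
    moreover have "vec.span {x} \<notin> A" if x: "inX x" "f x \<noteq> 0" for x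
    proof -
      have x0: "x \<noteq> 0" using x(1) by (simp add: inX_def)
      then have "vec.span {x} \<in> T \<inter> peskine \<sigma>" using x f(3) nonzero_set_span[OF f(1) x0] peskine_inX by blast
      then show ?thesis using T(2) by blast
    qed
    ultimately show ?thesis using f(1) by blast
  qed
  show ?thesis
    unfolding irreducible_topology_def top
  proof (intro conjI allI impI)
    show "peskine \<sigma> \<noteq> {}" using good_exists good_nonzero good_inX peskine_inX by blast
    fix A B assume AB: "closedin (subtopology zariski (peskine \<sigma>)) A \<and> closedin (subtopology zariski (peskine \<sigma>)) B \<and>
      A \<union> B = peskine \<sigma>"
    show "A = peskine \<sigma> \<or> B = peskine \<sigma>"
    proof (rule ccontr)
      assume n: "\<not> ?thesis"
      obtain d f u where f: "homogeneous_form d f" "inX u" "f u \<noteq> 0" "\<And>x. inX x \<Longrightarrow> f x \<noteq> 0 \<Longrightarrow> vec.span {x} \<notin> A"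
        using sep[of A] AB n by blast
      obtain e g w where g: "homogeneous_form e g" "inX w" "g w \<noteq> 0" "\<And>x. inX x \<Longrightarrow> g x \<noteq> 0 \<Longrightarrow> vec.span {x} \<notin> B"
        using sep[of B] AB n by blast
      obtain x where x: "inX x" "f x \<noteq> 0" "g x \<noteq> 0" using inX_irreducible[OF f(1-3) g(1-3)] by blast
      have "vec.span {x} \<in> peskine \<sigma>" using x(1) peskine_inX[of x] by (simp add: inX_def)
      then show False using f(4)[OF x(1,2)] g(4)[OF x(1,3)] AB by blast
    qed
  qed
qed

end

context general_trivector
begin

section \<open>Rationality\<close>

text \<open>A coordinate model of the quotient by \<open>V\<close> together with a linear section
  \<open>\<iota>\<close>, through which the chart maps are read on P^6.\<close>

lemma plane_projection:
  "\<exists>(\<rho> :: V10 \<Rightarrow> complex^7) \<iota>. (\<forall>j. functional (\<lambda>x. \<rho> x $ j)) \<and> (\<forall>i. functional (\<lambda>y. \<iota> y $ i)) \<and>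
     (\<forall>y. \<rho> (\<iota> y) = y) \<and> (\<forall>x. \<rho> x = 0 \<longleftrightarrow> x \<in> V)"
proof -
  obtain w :: "nat \<Rightarrow> V10" where w: "\<forall>k<3. w k \<in> V" "inj_on w {..<3}" "vec.independent (w ` {..<3})"
    using extend_independent[of "\<lambda>_. 0" 0 3 V] V(2) vec.independent_empty by auto
  obtain f :: "complex^10^10" where f: "det f \<noteq> 0" "\<And>i. nt i < 3 \<Longrightarrow> f *v ee i = w (nt i)"
    using independent_to_matrix[OF w(2,3)] by blast
  have wV: "w ` {..<3} \<subseteq> V" using w(1) by auto
  have spw: "vec.span (w ` {..<3}) = V"
    using wV w(2,3) V vec.dim_eq_card_independent[OF w(3)] card_image[OF w(2)]
    by (intro vec.subspace_dim_equal vec.span_minimal vec.subspace_span) auto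
  have "{i :: 10. \<not> nt i < 3} = ix ` {3..<10}"
    using ix_nt nt_less by (auto simp: image_iff not_less) (metis atLeastLessThan_iff ix_nt nt_less)
  moreover have "inj_on ix {3..<10}" by (auto simp: inj_on_def)
  ultimately have "card {i :: 10. \<not> nt i < 3} = 7" by (simp add: card_image)
  then obtain \<kappa> :: "7 \<Rightarrow> 10" where \<kappa>: "bij_betw \<kappa> UNIV {i. \<not> nt i < 3}"
    using finite_same_card_bij[of "UNIV :: 7 set" "{i :: 10. \<not> nt i < 3}"] by auto
  have \<kappa>3: "\<not> nt (\<kappa> j) < 3" for j using \<kappa> by (auto simp: bij_betw_def)
  have \<kappa>inv: "inv \<kappa> (\<kappa> j) = j" for j using \<kappa> by (auto simp: bij_betw_def)
  have \<kappa>ex: "\<exists>j. i = \<kappa> j" if "\<not> nt i < 3" for i using \<kappa> that by (auto simp: bij_betw_def)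
  define g where "g x = (1 / det f) *s (adj f *v x)" for x
  define \<rho> :: "V10 \<Rightarrow> complex^7" where "\<rho> x = (\<chi> j. g x $ \<kappa> j)" for x
  define ext :: "complex^7 \<Rightarrow> V10" where "ext y = (\<chi> i. if nt i < 3 then 0 else y $ inv \<kappa> i)" for y
  have fg: "f *v g x = x" for x using f(1) by (simp add: g_def vec.scale adj_right_vec)
  have gf: "g (f *v x) = x" for x using f(1) by (simp add: g_def adj_left_vec)
  have gl: "functional (\<lambda>x. g x $ i)" for i by (simp add: functional_def g_def matrix_vector_right_distrib vec.scale add_divide_distrib)
  have 1: "functional (\<lambda>x. \<rho> x $ j)" for j using gl by (simp add: \<rho>_def)
  have "ext (x + y) = ext x + ext y" "ext (c *s x) = c *s ext x" for x y c by (simp_all add: ext_def vec_eq_iff)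
  then have 2: "functional (\<lambda>y. (f *v ext y) $ i)" for i
    by (simp add: functional_def matrix_vector_right_distrib vec.scale)
  have 3: "\<rho> (f *v ext y) = y" for y
    unfolding \<rho>_def gf by (simp add: ext_def \<kappa>3 \<kappa>inv)
  have 4: "\<rho> x = 0 \<longleftrightarrow> x \<in> V" for x
  proof
    assume x: "\<rho> x = 0"
    have 0: "g x $ i = 0" if i: "\<not> nt i < 3" for i
    proof -
      obtain j where "i = \<kappa> j" using \<kappa>ex[OF i] by blast
      then show ?thesis using arg_cong[OF x, of "\<lambda>v. v $ j"] by (simp add: \<rho>_def)
    qed
    have "x = (\<Sum>i\<in>UNIV. g x $ i *s (f *v ee i))"
      using matrix_vector_columns[of f "g x"] fg[of x] by (simp add: matrix_vector_axis)
    moreover have "g x $ i *s (f *v ee i) \<in> V" for i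
      using 0[of i] f(2)[of i] w(1) V_zero V_scale by (cases "nt i < 3") auto
    then have "(\<Sum>i\<in>UNIV. g x $ i *s (f *v ee i)) \<in> V" by (intro vec.subspace_sum V(1))
    ultimately show "x \<in> V" by simp
  next
    assume x: "x \<in> V"
    have "\<rho> x $ j = 0" for j
    proof (rule functional_span[OF 1])
      show "x \<in> vec.span (w ` {..<3})" using x spw by simp
      fix s assume "s \<in> w ` {..<3}"
      then obtain k where k: "k < 3" "s = w k" by blast
      then have "s = f *v ee (ix k)" using f(2)[of "ix k"] by simp
      then have "\<rho> s $ j = ee (ix k) $ \<kappa> j" by (simp add: \<rho>_def gf)
      moreover have "nt (ix k) = k" using k(1) by (intro nt_ix) simp
      then have "ix k \<noteq> \<kappa> j" using \<kappa>3[of j] k(1) by metis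
      ultimately show "\<rho> s $ j = 0" by (simp add: axis_nth)
    qed
    then show "\<rho> x = 0" by (simp add: vec_eq_iff)
  qed
  show ?thesis
    by (intro exI[of _ \<rho>] exI[of _ "\<lambda>y. f *v ext y"] conjI allI 1 2 3 4)
qed

text \<open>The two open sets are the lines of good points and the lines of regular classes. One
  direction is the linear projection \<open>\<rho>\<close>, a single form of degree 1; the other is
  given locally by \<open>chart_map\<close> of degree 19. Injectivity is uniqueness of the good
  point in a class, surjectivity its existence.\<close>

lemma peskine_rational: "rational_sixfold (peskine \<sigma>)"
proof -
  obtain \<rho> :: "V10 \<Rightarrow> complex^7" and \<iota> where \<rho>: "\<And>j. functional (\<lambda>x. \<rho> x $ j)" and \<iota>: "\<And>i. functional (\<lambda>y. \<iota> y $ i)"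
    and \<rho>\<iota>: "\<And>y. \<rho> (\<iota> y) = y" and ker: "\<And>x. \<rho> x = 0 \<longleftrightarrow> x \<in> V"
    using plane_projection by blast
  have \<rho>l: "\<rho> (x + y) = \<rho> x + \<rho> y" "\<rho> (c *s x) = c *s \<rho> x" "\<rho> (x - y) = \<rho> x - \<rho> y" for x y c
    by (simp_all add: vec_eq_iff functional_simps[OF \<rho>])
  have \<iota>l: "\<iota> (c *s y) = c *s \<iota> y" "\<iota> 0 = 0" for y c
    by (simp_all add: vec_eq_iff functional_simps[OF \<iota>])
  have lift: "\<exists>v\<in>V. x = c *s \<iota> y + v" if "\<rho> x = c *s y" for x c y
  proof -
    have "x - c *s \<iota> y \<in> V" using that by (simp add: ker[symmetric] \<rho>l \<rho>\<iota>)
    then show ?thesis by (intro bexI[of _ "x - c *s \<iota> y"]) auto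
  qed
  define X where "X = {vec.span {p} | p. good p}"
  define U where "U = {vec.span {y} | y. y \<noteq> 0 \<and> reg (\<iota> y)}"
  define \<phi> where "\<phi> = (\<lambda>L. \<rho> ` L)"
  have XI: "vec.span {p} \<in> X" if "good p" for p using that by (auto simp: X_def)
  have XE: "\<exists>p. L = vec.span {p} \<and> good p" if "L \<in> X" for L using that by (auto simp: X_def)
  have UI: "vec.span {y} \<in> U" if "y \<noteq> 0" "reg (\<iota> y)" for y using that by (auto simp: U_def)
  have UE: "\<exists>y. M = vec.span {y} \<and> y \<noteq> 0 \<and> reg (\<iota> y)" if "M \<in> U" for M using that by (auto simp: U_def)
  have \<phi>_span: "\<phi> (vec.span {p}) = vec.span {\<rho> p}" for p
    unfolding vec.span_singleton \<phi>_def by (auto simp: \<rho>l image_iff)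
  have \<rho>0: "\<rho> p \<noteq> 0" if "good p" for p using that ker by (simp add: good_def)
  have \<rho>reg: "reg (\<iota> (\<rho> p))" if p: "good p" for p
  proof -
    obtain v where v: "v \<in> V" "p = 1 *s \<iota> (\<rho> p) + v" using lift[of p 1 "\<rho> p"] by auto
    then have "reg (1 *s \<iota> (\<rho> p) + v)" using p by (simp add: good_iff_reg)
    then show ?thesis using reg_shift[OF v(1), of 1] by simp
  qed
  have chart_line: "vec.span {chart_map a z (\<iota> y)} \<in> X \<and> \<phi> (vec.span {chart_map a z (\<iota> y)}) = vec.span {y}"
    if c: "chart_det a z (\<iota> y) \<noteq> 0" for a z y
  proof -
    obtain s v where s: "good (chart_map a z (\<iota> y))" "s \<noteq> 0" "v \<in> V" "chart_map a z (\<iota> y) = s *s \<iota> y + v"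
      using chart_good[OF c] by blast
    have "\<rho> (chart_map a z (\<iota> y)) = s *s y" using s(3) by (simp add: s(4) \<rho>l \<rho>\<iota> ker)
    then show ?thesis using XI[OF s(1)] s(2) by (simp add: \<phi>_span span_singleton_scale)
  qed
  have bij: "bij_betw \<phi> X U"
  proof (rule bij_betw_imageI)
    show "inj_on \<phi> X"
    proof (rule inj_onI)
      fix L L' assume "L \<in> X" "L' \<in> X" and eq: "\<phi> L = \<phi> L'"
      then obtain p p' where p: "L = vec.span {p}" "good p" "L' = vec.span {p'}" "good p'" using XE by metis
      have "vec.span {\<rho> p} = vec.span {\<rho> p'}" using eq \<phi>_span p by simp
      then obtain c where c: "c \<noteq> 0" "\<rho> p = c *s \<rho> p'" using span_singleton_eqD[OF _ \<rho>0[OF p(2)]] by metis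
      have v: "p - c *s p' \<in> V" using c(2) by (simp add: ker[symmetric] \<rho>l)
      have "p - c *s p' = 0" by (rule good_unique[OF p(4) _ v c(1)]) (simp add: p(2))
      then have "p = c *s p'" by simp
      then show "L = L'" using p(1,3) c(1) by (simp add: span_singleton_scale)
    qed
    show "\<phi> ` X = U"
    proof (intro subset_antisym subsetI)
      fix M assume "M \<in> \<phi> ` X"
      then obtain L where L: "L \<in> X" "M = \<phi> L" by blast
      obtain p where p: "L = vec.span {p}" "good p" using XE[OF L(1)] by blast
      show "M \<in> U" unfolding L(2) p(1) \<phi>_span by (rule UI[OF \<rho>0[OF p(2)] \<rho>reg[OF p(2)]])
    next
      fix M assume "M \<in> U"
      then obtain y where y: "M = vec.span {y}" "reg (\<iota> y)" using UE by blast
      obtain a z where "chart_det a z (\<iota> y) \<noteq> 0" using chart_exists[OF y(2)] by blast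
      from chart_line[OF this] show "M \<in> \<phi> ` X" unfolding y(1) by (metis imageI)
    qed
  qed
  define \<psi> where "\<psi> = inv_into X \<phi>"
  have \<psi>\<phi>: "\<psi> (\<phi> L) = L" if "L \<in> X" for L using bij that by (simp add: bij_betw_def \<psi>_def)
  have \<phi>\<psi>: "\<phi> (\<psi> M) = M" if "M \<in> U" for M unfolding \<psi>_def using bij that by (rule bij_betw_inv_into_right)
  have Xp: "X \<subseteq> peskine \<sigma>"
  proof
    fix L assume "L \<in> X"
    then obtain p where "L = vec.span {p}" "good p" using XE by blast
    then show "L \<in> peskine \<sigma>" using peskine_inX[OF good_nonzero] good_inX by simp
  qed
  have Up: "U \<subseteq> projective_space" by (auto simp: U_def)
  have openX: "openin (subtopology zariski (peskine \<sigma>)) X"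
  proof (subst openin_subopen, intro ballI)
    fix L assume "L \<in> X"
    then obtain p where p: "L = vec.span {p}" "good p" using XE by blast
    obtain a z where az: "chart_det a z p \<noteq> 0" using chart_exists p(2) good_iff_reg by blast
    let ?T = "nonzero_set (chart_det a z) \<inter> peskine \<sigma>"
    have "openin (subtopology zariski (peskine \<sigma>)) ?T"
      using openin_zariski_nonzero_set[OF chart_forms(1)] by (auto simp: openin_subtopology)
    moreover have "L \<in> ?T"
      using az nonzero_set_span[OF chart_forms(1) good_nonzero[OF p(2)]] Xp XI[OF p(2)] unfolding p(1) by blast
    moreover have "?T \<subseteq> X"
    proof
      fix L assume L: "L \<in> ?T"
      then have "L \<in> projective_space" using peskine_projective by blast
      then obtain u where u: "u \<noteq> 0" "L = vec.span {u}" unfolding projective_space_span by blast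
      have "chart_det a z u \<noteq> 0" using L nonzero_set_span[OF chart_forms(1) u(1)] unfolding u(2) by blast
      then have "reg u" by (rule chart_reg)
      moreover have "inX u" using L peskine_inX[OF u(1)] unfolding u(2) by blast
      ultimately show "L \<in> X" unfolding u(2) by (intro XI) (simp add: good_iff_reg)
    qed
    ultimately show "\<exists>T. openin (subtopology zariski (peskine \<sigma>)) T \<and> L \<in> T \<and> T \<subseteq> X" by (intro exI conjI)
  qed
  have pullback: "homogeneous_form (1 * 21) (\<lambda>y. chart_det a z (\<iota> y))" for a z
    by (intro homogeneous_form_compose[OF chart_forms(1)] homogeneous_form_functional \<iota>)
  have nonzeroU: "nonzero_set (\<lambda>y. chart_det a z (\<iota> y)) \<subseteq> U" for a z
  proof
    fix M assume M: "M \<in> nonzero_set (\<lambda>y. chart_det a z (\<iota> y))"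
    then have "M \<in> projective_space" by (simp add: nonzero_set_def)
    then obtain y where y: "y \<noteq> 0" "M = vec.span {y}" unfolding projective_space_span by blast
    have "chart_det a z (\<iota> y) \<noteq> 0" using M nonzero_set_span[OF pullback y(1)] unfolding y(2) by blast
    then show "M \<in> U" unfolding y(2) by (intro UI[OF y(1)] chart_reg)
  qed
  have openU: "openin zariski U"
  proof (rule openin_zariskiI[OF Up])
    fix y assume y: "y \<noteq> 0" "vec.span {y} \<in> U"
    obtain y' where y': "vec.span {y} = vec.span {y'}" "reg (\<iota> y')" using UE[OF y(2)] by blast
    obtain c where c: "c \<noteq> 0" "y = c *s y'" using span_singleton_eqD[OF y'(1) y(1)] by blast
    have "reg (\<iota> y)" using reg_shift[OF V_zero c(1), of "\<iota> y'"] y'(2) by (simp add: c(2) \<iota>l)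
    then obtain a z where "chart_det a z (\<iota> y) \<noteq> 0" using chart_exists by blast
    then show "\<exists>d f. homogeneous_form d f \<and> f y \<noteq> 0 \<and> nonzero_set f \<subseteq> U"
      using pullback nonzeroU by (intro exI[of _ "1 * 21"] exI[of _ "\<lambda>y. chart_det a z (\<iota> y)"] conjI)
  qed
  have "regular_map X \<phi>"
    unfolding regular_map_def
  proof (intro ballI exI conjI allI)
    fix L assume "L \<in> X"
    then show "L \<in> X" .
    have "X \<subseteq> topspace zariski" using Xp peskine_projective topspace_zariski by blast
    then show "openin (subtopology zariski X) X" by (metis openin_topspace topspace_subtopology_subset)
    show "homogeneous_form 1 (\<lambda>x. \<rho> x $ j)" for j by (rule homogeneous_form_functional[OF \<rho>])
  next
    fix L x assume L: "L \<in> X" and x: "x \<in> L - {0}"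
    obtain p where p: "L = vec.span {p}" "good p" using XE[OF L] by blast
    obtain c where c: "x = c *s p" using x p(1) by (auto simp: vec.span_singleton)
    then have c0: "c \<noteq> 0" using x by auto
    show "\<rho> x \<noteq> 0" using c0 \<rho>0[OF p(2)] by (simp add: c \<rho>l)
    show "\<phi> L = vec.span {\<rho> x}" using c0 by (simp add: p(1) \<phi>_span c \<rho>l span_singleton_scale)
  qed
  moreover have "regular_map U \<psi>"
    unfolding regular_map_def
  proof
    fix M assume M: "M \<in> U"
    then obtain y where y: "M = vec.span {y}" "y \<noteq> 0" "reg (\<iota> y)" using UE by blast
    obtain a z where az: "chart_det a z (\<iota> y) \<noteq> 0" using chart_exists[OF y(3)] by blast
    let ?N = "nonzero_set (\<lambda>y. chart_det a z (\<iota> y))"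
    show "\<exists>N d (F :: complex^7 \<Rightarrow> complex^10). openin (subtopology zariski U) N \<and> M \<in> N \<and>
        (\<forall>j. homogeneous_form d (\<lambda>x. F x $ j)) \<and> (\<forall>L\<in>N. \<forall>x\<in>L - {0}. F x \<noteq> 0 \<and> \<psi> L = vec.span {F x})"
    proof (intro exI[of _ ?N] exI[of _ "1 * 19"] exI[of _ "\<lambda>x. chart_map a z (\<iota> x)"] conjI allI ballI)
      have "?N \<inter> U = ?N" using nonzeroU[of a z] by blast
      then show "openin (subtopology zariski U) ?N"
        using openin_subtopology_Int[OF openin_zariski_nonzero_set[OF pullback[of a z]], of U] by simp
      show "M \<in> ?N" using nonzero_set_span[OF pullback y(2)] az y(1) by simp
      show "homogeneous_form (1 * 19) (\<lambda>x. chart_map a z (\<iota> x) $ j)" for j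
        by (rule homogeneous_form_compose[OF chart_forms(2) homogeneous_form_functional[OF \<iota>]])
    next
      fix L x assume L: "L \<in> ?N" and x: "x \<in> L - {0}"
      have "L \<in> projective_space" using L by (simp add: nonzero_set_def)
      then obtain u where u: "u \<noteq> 0" "L = vec.span {u}" unfolding projective_space_span by blast
      obtain c where "x = c *s u" using x u by (auto simp: vec.span_singleton)
      then have Lx: "L = vec.span {x}" using x u by (auto simp: span_singleton_scale)
      have cx: "chart_det a z (\<iota> x) \<noteq> 0" using L x nonzero_set_span[OF pullback, of x a z] unfolding Lx by simp
      show "chart_map a z (\<iota> x) \<noteq> 0" using chart_good[OF cx] by (intro good_nonzero) simp
      show "\<psi> L = vec.span {chart_map a z (\<iota> x)}"
        using \<psi>\<phi>[of "vec.span {chart_map a z (\<iota> x)}"] chart_line[OF cx] Lx by simp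
    qed
  qed
  moreover have "\<phi> \<in> X \<rightarrow> U" "\<psi> \<in> U \<rightarrow> X"
    using bij bij_betw_inv_into[OF bij] by (auto simp: bij_betw_def \<psi>_def)
  ultimately have "biregular X U"
    unfolding biregular_def using \<psi>\<phi> \<phi>\<psi> by (intro exI[of _ \<phi>] exI[of _ \<psi>] conjI ballI)
  moreover have "X \<noteq> {}" using good_exists XI by blast
  moreover have "U \<noteq> {}" using good_exists UI \<rho>0 \<rho>reg by blast
  moreover have "openin (subtopology zariski projective_space) U"
    using openU by (metis subtopology_topspace topspace_zariski)
  ultimately have "birational (peskine \<sigma>) (projective_space :: (complex^7) set set)"
    unfolding birational_def using openX by (intro exI[of _ X] exI[of _ U] conjI)
  then show ?thesis
    using peskine_closed peskine_irreducible by (simp add: rational_sixfold_def projective_variety_def)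
qed

end

theorem theorem2p1:
  "for_general (subtopology zariski_forms D_3_3_10) (\<lambda>\<sigma>. rational_sixfold (peskine \<sigma>))"
proof -
  obtain h where h: "h \<in> form_polys" "\<exists>\<sigma>\<in>D_3_3_10. h \<sigma> \<noteq> 0" "\<forall>\<sigma>\<in>D_3_3_10. h \<sigma> \<noteq> 0 \<longrightarrow> (\<forall>f. det f \<noteq> 0 \<longrightarrow>
     pull \<sigma> f \<notin> vanishing (\<lambda>a b c. plane3 a b c \<or> a = 0 \<and> b < 6) \<and>
     pull \<sigma> f \<notin> vanishing (\<lambda>a b c. plane3 a b c \<or> 3 \<le> a \<and> a < 6 \<and> 3 \<le> b \<and> b < 6) \<and>
     pull \<sigma> f \<notin> vanishing (\<lambda>a b c. plane3 a b c \<or> a < 5 \<and> b < 5 \<and> c < 7) \<and>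
     pull \<sigma> f \<notin> vanishing (\<lambda>a b c. plane3 a b c \<or> a = 3 \<and> b = 0 \<or> a = 3 \<and> b < 8 \<and> c < 8) \<and>
     (pull \<sigma> f \<in> vanishing plane3 \<longrightarrow> \<not> degenerate (pull \<sigma> f)))"
    using generic_polynomial by blast
  let ?T = "subtopology zariski_forms D_3_3_10" and ?G = "{\<sigma> \<in> D_3_3_10. h \<sigma> \<noteq> 0}"
  have sub: "D_3_3_10 \<subseteq> alternating_forms" by (auto simp: D_3_3_10_def)
  then have top: "topspace ?T = D_3_3_10" by (auto simp: topspace_zariski_forms)
  have "openin zariski_forms {\<sigma> \<in> alternating_forms. h \<sigma> \<noteq> 0}"
    unfolding zariski_forms_def
    by (rule topology_generated_by_Basis) (unfold mem_Collect_eq, intro exI[of _ h] conjI refl h(1))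
  moreover have "?G = {\<sigma> \<in> alternating_forms. h \<sigma> \<noteq> 0} \<inter> D_3_3_10" using sub by auto
  ultimately have "openin ?T ?G" unfolding openin_subtopology by auto
  \<comment> \<open>A nonempty open set of the divisor contains the locus of some \<open>f\<close>
    that does not vanish identically there, and by irreducibility \<open>f\<close> and
    \<open>h\<close> are nonzero at a common point.\<close>
  moreover have "?T closure_of ?G = topspace ?T"
  proof (intro subset_antisym closure_of_subset_topspace subsetI)
    fix \<sigma> assume \<sigma>: "\<sigma> \<in> topspace ?T"
    have "\<exists>\<tau>. \<tau> \<in> ?G \<and> \<tau> \<in> W" if W: "\<sigma> \<in> W" "openin ?T W" for W
    proof -
      obtain W' where W': "openin zariski_forms W'" "W = W' \<inter> D_3_3_10" using W(2) by (auto simp: openin_subtopology)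
      have "\<sigma> \<in> W'" using W(1) W'(2) by simp
      then obtain f where f: "f \<in> form_polys" "f \<sigma> \<noteq> 0" "{\<sigma> \<in> alternating_forms. f \<sigma> \<noteq> 0} \<subseteq> W'"
        using zariski_forms_basis[OF W'(1)] by blast
      obtain \<tau> where \<tau>: "\<tau> \<in> D_3_3_10" "f \<tau> \<noteq> 0" "h \<tau> \<noteq> 0"
        using D_3_3_10_irreducible[OF f(1) h(1), of \<sigma>] h(2) f(2) \<sigma> top by blast
      have "\<tau> \<in> W" using \<tau> f(3) sub W'(2) by auto
      then show ?thesis using \<tau> by blast
    qed
    then show "\<sigma> \<in> ?T closure_of ?G" using \<sigma> by (simp only: in_closure_of) blast
  qed
  moreover have "rational_sixfold (peskine \<sigma>)" if "\<sigma> \<in> ?G" for \<sigma>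
  proof -
    have \<sigma>: "\<sigma> \<in> D_3_3_10" "h \<sigma> \<noteq> 0" using that by auto
    obtain V where "general_trivector \<sigma> V" using general_trivectorI[OF \<sigma>(1)] h(3) \<sigma> by blast
    then show ?thesis by (rule general_trivector.peskine_rational)
  qed
  ultimately show ?thesis unfolding for_general_def by blast
qed

end
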